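(* Let $\Omega\subset\mathbb{R}^2$ be an open bounded domain and let $p\in\Omega$ be a fixed point. For every $\varepsilon>0$ such that the ball $\mathbb{B}_\varepsilon$ with center $p$ and radius $\varepsilon$ is contained in $\Omega$, let $K_\varepsilon\subset\mathbb{B}_\varepsilon$ be a compact set with zero Lebesgue measure such that $\Omega_{K_\varepsilon}:=\Omega\setminus K_\varepsilon$ satisfies property$^*$. Let $-\Delta_\Omega^N$ and $-\Delta_{\Omega_{K_\varepsilon}}^N$ be the Neumann Laplacians on $\Omega$ and $\Omega_{K_\varepsilon}$, respectively. Then for small enough $\varepsilon$ the pairs $(L^2(\Omega),-\Delta_\Omega^N)$ and $(L^2(\Omega_{K_\varepsilon}),-\Delta_{\Omega_{K_\varepsilon}}^N)$ are $\mathcal{O}(\varepsilon^{1/6})$-close of order $2$; that is, there exist constants $C>0$ and $\varepsilon_0>0$ such that for every $\varepsilon\in(0,\varepsilon_0)$ they are $\delta$-close of order $2$ with $\delta=C\varepsilon^{1/6}$.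
   Context: Property$^*$: for a bounded domain $\Omega\subset\mathbb{R}^2$ and a compact set $K\subset\Omega$ of zero Lebesgue measure, $\Omega_K=\Omega\setminus K$ satisfies property$^*$ if for every $(x_0,y_0)\in\Omega_K$ at least one of the following holds: (i) the line $l(x_0)=\{(x,y)\in\Omega: x=x_0\}$ has no intersection with $K$; (ii) the line $h(y_0)=\{(x,y)\in\Omega: y=y_0\}$ has no intersection with $K$. Neumann Laplacian: for an open set $U$ (here $U=\Omega$ or $U=\Omega_K$), the Neumann Laplacian $-\Delta_U^N$ is the non-negative self-adjoint operator in $L^2(U)$ associated with the closed quadratic form $u\mapsto\int_U|\nabla u|^2\,dx\,dy$ with form domain the Sobolev space $\mathcal{H}^1(U)$. Since $K$ has measure zero, $L^2(\Omega_K)$ is identified with $L^2(\Omega)$. Scale of spaces: for a Hilbert space $H$ with norm $\|\cdot\|$ and a non-negative unbounded self-adjoint operator $A$ in $H$, set $H_k:=\mathrm{Dom}((A+I)^{k/2})$ and $\|u\|_k:=\|(A+I)^{k/2}u\|$ for $k\ge0$ (so $H_0=H$). For $(H',A')$ the spaces $H'_k$ and their norms (also denoted $\|\cdot\|_k$) are defined in the same way. Let $a$, $a'$ be the sesquilinear forms associated with $A$, $A'$. $\delta$-closeness: let $\delta>0$ and $k\ge1$. $(H,A)$ and $(H',A')$ are $\delta$-close of order $k$ if there are linear operators $J:H\to H'$, $J_1:H_1\to H_1'$, $J':H'\to H$, $J_1':H_1'\to H_1$ such that - $\|Jf-J_1f\|_0\le\delta\|f\|_1$ for all $f\in H_1$;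 - $|(Jf,u)-(f,J'u)|\le\delta\|f\|_0\|u\|_0$ for all $f\in H$, $u\in H'$; - $\|u-JJ'u\|_0\le\delta\|u\|_1$ for all $u\in H_1'$; - $\|Jf\|_0\le2\|f\|_0$ and $\|J'u\|_0\le2\|u\|_0$ for all $f\in H$, $u\in H'$; - $\|f-J'Jf\|_0\le\delta\|f\|_1$ for all $f\in H_1$; - $\|J'u-J_1'u\|_0\le\delta\|u\|_1$ for all $u\in H_1'$; - $|a(f,J_1'u)-a'(J_1f,u)|\le\delta\|f\|_k\|u\|_1$ for all $f\in H_k$, $u\in H_1'$. *)

theory Defs
  imports "HOL-Analysis.Analysis"
begin

section \<open>Complex Hilbert spaces given by a carrier\<close>

text \<open>
  The spaces \<open>L\<^sup>2(U)\<close> depend on the set \<open>U\<close>, so Hilbert spaces are records with an explicit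
  carrier. The record holds the operations only; every space used below is some \<open>L2_space M\<close>.
  Inner products are linear in the first and conjugate-linear in the second argument.
\<close>

record 'a hspace =
  hcarrier :: "'a set"
  hadd :: "'a \<Rightarrow> 'a \<Rightarrow> 'a"
  hscale :: "complex \<Rightarrow> 'a \<Rightarrow> 'a"
  hinner :: "'a \<Rightarrow> 'a \<Rightarrow> complex"

definition hdiff :: "'a hspace \<Rightarrow> 'a \<Rightarrow> 'a \<Rightarrow> 'a" where
  "hdiff H x y = hadd H x (hscale H (-1) y)"

definition hnorm :: "'a hspace \<Rightarrow> 'a \<Rightarrow> real" where
  "hnorm H x = sqrt (Re (hinner H x x))"

definition lin_subspace :: "'a hspace \<Rightarrow> 'a set \<Rightarrow> bool" where
  "lin_subspace H D \<longleftrightarrow> D \<subseteq> hcarrier H \<and> D \<noteq> {} \<and>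
     (\<forall>x\<in>D. \<forall>y\<in>D. hadd H x y \<in> D) \<and> (\<forall>c. \<forall>x\<in>D. hscale H c x \<in> D)"

definition dense_in :: "'a hspace \<Rightarrow> 'a set \<Rightarrow> bool" where
  "dense_in H D \<longleftrightarrow> D \<subseteq> hcarrier H \<and>
     (\<forall>x\<in>hcarrier H. \<forall>e>0. \<exists>y\<in>D. hnorm H (hdiff H x y) < e)"

definition linear_between ::
  "'a hspace \<Rightarrow> 'a set \<Rightarrow> 'b hspace \<Rightarrow> 'b set \<Rightarrow> ('a \<Rightarrow> 'b) \<Rightarrow> bool" where
  "linear_between H D H' D' T \<longleftrightarrow>
     (\<forall>x\<in>D. T x \<in> D') \<and>
     (\<forall>x\<in>D. \<forall>y\<in>D. T (hadd H x y) = hadd H' (T x) (T y)) \<and>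
     (\<forall>c. \<forall>x\<in>D. T (hscale H c x) = hscale H' c (T x))"


section \<open>Unbounded operators as graphs\<close>

text \<open>
  An unbounded operator is identified with its graph, so that \<open>Domain A\<close> is its domain,
  relational composition is composition with the natural domain, and equality of operators
  includes equality of the domains.
\<close>

definition op_adjoint :: "'a hspace \<Rightarrow> ('a \<times> 'a) set \<Rightarrow> ('a \<times> 'a) set" where
  "op_adjoint H A = {(v, w). v \<in> hcarrier H \<and> w \<in> hcarrier H \<and>
     (\<forall>(u, Au)\<in>A. hinner H Au v = hinner H u w)}"

text \<open>Linearity of \<open>A\<close> is implied, since adjoints are linear relations.\<close>

definition nonneg_selfadjoint :: "'a hspace \<Rightarrow> ('a \<times> 'a) set \<Rightarrow> bool" where
  "nonneg_selfadjoint H A \<longleftrightarrow>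
     single_valued A \<and> dense_in H (Domain A) \<and> op_adjoint H A = A \<and>
     (\<forall>(u, Au)\<in>A. 0 \<le> Re (hinner H Au u))"

definition plus_identity :: "'a hspace \<Rightarrow> ('a \<times> 'a) set \<Rightarrow> ('a \<times> 'a) set" where
  "plus_identity H A = {(u, hadd H Au u) | u Au. (u, Au) \<in> A}"

definition op_sqrt :: "'a hspace \<Rightarrow> ('a \<times> 'a) set \<Rightarrow> ('a \<times> 'a) set" where
  "op_sqrt H A = (THE B. nonneg_selfadjoint H B \<and> B O B = A)"

primrec op_power :: "'a hspace \<Rightarrow> ('a \<times> 'a) set \<Rightarrow> nat \<Rightarrow> ('a \<times> 'a) set" where
  "op_power H B 0 = Id_on (hcarrier H)"
| "op_power H B (Suc k) = op_power H B k O B"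

text \<open>\<open>(A + I)\<^bsup>k/2\<^esup>\<close> denotes the \<open>k\<close>-th power of the non-negative square root of \<open>A + I\<close>.\<close>

definition half_power :: "'a hspace \<Rightarrow> ('a \<times> 'a) set \<Rightarrow> nat \<Rightarrow> ('a \<times> 'a) set" where
  "half_power H A k = op_power H (op_sqrt H (plus_identity H A)) k"

definition scale_space :: "'a hspace \<Rightarrow> ('a \<times> 'a) set \<Rightarrow> nat \<Rightarrow> 'a set" where
  "scale_space H A k = Domain (half_power H A k)"

definition scale_norm :: "'a hspace \<Rightarrow> ('a \<times> 'a) set \<Rightarrow> nat \<Rightarrow> 'a \<Rightarrow> real" where
  "scale_norm H A k u = hnorm H (THE w. (u, w) \<in> half_power H A k)"

lemma scale_space_0: "scale_space H A 0 = hcarrier H"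
  by (auto simp: scale_space_def half_power_def)

lemma scale_norm_0: "u \<in> hcarrier H \<Longrightarrow> scale_norm H A 0 u = hnorm H u"
proof -
  assume "u \<in> hcarrier H"
  then have "(THE w. (u, w) \<in> half_power H A 0) = u"
    by (intro the_equality) (auto simp: half_power_def)
  then show ?thesis by (simp add: scale_norm_def)
qed


section \<open>Closed forms and their operators\<close>

text \<open>Closedness: if \<open>x\<^sub>n \<in> D\<close>, \<open>x\<^sub>n \<rightarrow> x\<close> in \<open>H\<close> and \<open>q[x\<^sub>m - x\<^sub>n] \<rightarrow> 0\<close>, then \<open>x \<in> D\<close> and
  \<open>q[x\<^sub>n - x] \<rightarrow> 0\<close>.\<close>

definition closed_nonneg_form :: "'a hspace \<Rightarrow> 'a set \<Rightarrow> ('a \<Rightarrow> 'a \<Rightarrow> complex) \<Rightarrow> bool" where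
  "closed_nonneg_form H D q \<longleftrightarrow>
     lin_subspace H D \<and> dense_in H D \<and>
     (\<forall>x\<in>D. \<forall>y\<in>D. \<forall>z\<in>D. q (hadd H x y) z = q x z + q y z) \<and>
     (\<forall>c. \<forall>x\<in>D. \<forall>y\<in>D. q (hscale H c x) y = c * q x y) \<and>
     (\<forall>x\<in>D. \<forall>y\<in>D. q y x = cnj (q x y)) \<and>
     (\<forall>x\<in>D. 0 \<le> Re (q x x)) \<and>
     (\<forall>X. \<forall>x\<in>hcarrier H.
        (\<forall>n. X n \<in> D) \<and> (\<lambda>n. hnorm H (hdiff H (X n) x)) \<longlonglongrightarrow> 0 \<and>
        (\<forall>e>0. \<exists>N. \<forall>m\<ge>N. \<forall>n\<ge>N. Re (q (hdiff H (X m) (X n)) (hdiff H (X m) (X n))) < e)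
        \<longrightarrow> x \<in> D \<and> (\<lambda>n. Re (q (hdiff H (X n) x) (hdiff H (X n) x))) \<longlonglongrightarrow> 0)"

text \<open>The operator of a form in the sense of the first representation theorem.\<close>

definition form_operator :: "'a hspace \<Rightarrow> 'a set \<Rightarrow> ('a \<Rightarrow> 'a \<Rightarrow> complex) \<Rightarrow> ('a \<times> 'a) set" where
  "form_operator H D q = {(u, w). u \<in> D \<and> w \<in> hcarrier H \<and> (\<forall>v\<in>D. q u v = hinner H w v)}"

text \<open>The value at \<open>(f, u)\<close> of the closed form whose operator is \<open>A\<close>.\<close>

definition operator_form :: "'a hspace \<Rightarrow> ('a \<times> 'a) set \<Rightarrow> 'a \<Rightarrow> 'a \<Rightarrow> complex" where
  "operator_form H A f u = (THE z. \<exists>D q. closed_nonneg_form H D q \<and> form_operator H D q = A \<and>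
     f \<in> D \<and> u \<in> D \<and> z = q f u)"


section \<open>Closeness of operators in different Hilbert spaces\<close>

definition delta_close ::
  "real \<Rightarrow> nat \<Rightarrow> 'a hspace \<Rightarrow> ('a \<times> 'a) set \<Rightarrow> 'b hspace \<Rightarrow> ('b \<times> 'b) set \<Rightarrow> bool" where
  "delta_close \<delta> k H A H' A' \<longleftrightarrow> 0 < \<delta> \<and> 1 \<le> k \<and>
    (\<exists>J J1 J' J1'.
      linear_between H (hcarrier H) H' (hcarrier H') J \<and>
      linear_between H (scale_space H A 1) H' (scale_space H' A' 1) J1 \<and>
      linear_between H' (hcarrier H') H (hcarrier H) J' \<and>
      linear_between H' (scale_space H' A' 1) H (scale_space H A 1) J1' \<and>
      (\<forall>f\<in>scale_space H A 1. hnorm H' (hdiff H' (J f) (J1 f)) \<le> \<delta> * scale_norm H A 1 f) \<and>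
      (\<forall>f\<in>hcarrier H. \<forall>u\<in>hcarrier H'.
         cmod (hinner H' (J f) u - hinner H f (J' u)) \<le> \<delta> * hnorm H f * hnorm H' u) \<and>
      (\<forall>u\<in>scale_space H' A' 1. hnorm H' (hdiff H' u (J (J' u))) \<le> \<delta> * scale_norm H' A' 1 u) \<and>
      (\<forall>f\<in>hcarrier H. hnorm H' (J f) \<le> 2 * hnorm H f) \<and>
      (\<forall>u\<in>hcarrier H'. hnorm H (J' u) \<le> 2 * hnorm H' u) \<and>
      (\<forall>f\<in>scale_space H A 1. hnorm H (hdiff H f (J' (J f))) \<le> \<delta> * scale_norm H A 1 f) \<and>
      (\<forall>u\<in>scale_space H' A' 1. hnorm H (hdiff H (J' u) (J1' u)) \<le> \<delta> * scale_norm H' A' 1 u) \<and>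
      (\<forall>f\<in>scale_space H A k. \<forall>u\<in>scale_space H' A' 1.
         cmod (operator_form H A f (J1' u) - operator_form H' A' (J1 f) u)
           \<le> \<delta> * scale_norm H A k f * scale_norm H' A' 1 u))"


section \<open>The space \<open>L\<^sup>2\<close>\<close>

text \<open>Elements are equivalence classes of measurable functions modulo equality almost everywhere.\<close>

definition ae_class :: "'x measure \<Rightarrow> ('x \<Rightarrow> complex) \<Rightarrow> ('x \<Rightarrow> complex) set" where
  "ae_class M f = {g \<in> borel_measurable M. AE x in M. g x = f x}"

definition rep :: "('x \<Rightarrow> complex) set \<Rightarrow> 'x \<Rightarrow> complex" where
  "rep F = (SOME f. f \<in> F)"

definition L2_space :: "'x measure \<Rightarrow> ('x \<Rightarrow> complex) set hspace" where
  "L2_space M = \<lparr>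
     hcarrier = {ae_class M f | f. f \<in> borel_measurable M \<and> integrable M (\<lambda>x. (cmod (f x))\<^sup>2)},
     hadd = (\<lambda>F G. ae_class M (\<lambda>x. rep F x + rep G x)),
     hscale = (\<lambda>c F. ae_class M (\<lambda>x. c * rep F x)),
     hinner = (\<lambda>F G. LINT x|M. rep F x * cnj (rep G x)) \<rparr>"


section \<open>Sobolev space and Neumann Laplacian on open subsets of the plane\<close>

abbreviation L2_on :: "(real \<times> real) set \<Rightarrow> (real \<times> real \<Rightarrow> complex) set hspace" where
  "L2_on U \<equiv> L2_space (lebesgue_on U)"

text \<open>\<open>\<phi>\<close> is \<open>C\<^sup>\<infinity>\<close> iff it is differentiable and its first partial derivatives are again \<open>C\<^sup>\<infinity>\<close>
  (greatest fixed point).\<close>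

coinductive smooth :: "(real \<times> real \<Rightarrow> real) \<Rightarrow> bool" where
  "\<lbrakk>\<And>z. (\<phi> has_derivative (\<lambda>h. fst h * \<phi>x z + snd h * \<phi>y z)) (at z); smooth \<phi>x; smooth \<phi>y\<rbrakk>
    \<Longrightarrow> smooth \<phi>"

definition test_function :: "(real \<times> real) set \<Rightarrow> (real \<times> real \<Rightarrow> real) \<Rightarrow> bool" where
  "test_function U \<phi> \<longleftrightarrow>
     smooth \<phi> \<and> compact (closure {z. \<phi> z \<noteq> 0}) \<and> closure {z. \<phi> z \<noteq> 0} \<subseteq> U"

definition directional_deriv ::
  "real \<times> real \<Rightarrow> (real \<times> real \<Rightarrow> real) \<Rightarrow> real \<times> real \<Rightarrow> real" where
  "directional_deriv b \<phi> z = frechet_derivative \<phi> (at z) b"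

text \<open>\<open>G\<close> is the weak derivative of \<open>F\<close> in direction \<open>b\<close>; the directions used are \<open>(1, 0)\<close> and
  \<open>(0, 1)\<close>.\<close>

definition is_weak_deriv ::
  "(real \<times> real) set \<Rightarrow> real \<times> real \<Rightarrow> (real \<times> real \<Rightarrow> complex) set
     \<Rightarrow> (real \<times> real \<Rightarrow> complex) set \<Rightarrow> bool" where
  "is_weak_deriv U b F G \<longleftrightarrow> F \<in> hcarrier (L2_on U) \<and> G \<in> hcarrier (L2_on U) \<and>
     (\<forall>\<phi>. test_function U \<phi> \<longrightarrow>
        (LINT z|lebesgue_on U. directional_deriv b \<phi> z *\<^sub>R rep F z)
          = - (LINT z|lebesgue_on U. \<phi> z *\<^sub>R rep G z))"

definition weak_deriv ::
  "(real \<times> real) set \<Rightarrow> real \<times> real \<Rightarrow> (real \<times> real \<Rightarrow> complex) set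
     \<Rightarrow> (real \<times> real \<Rightarrow> complex) set" where
  "weak_deriv U b F = (THE G. is_weak_deriv U b F G)"

definition sobolev_H1 :: "(real \<times> real) set \<Rightarrow> (real \<times> real \<Rightarrow> complex) set set" where
  "sobolev_H1 U = {F \<in> hcarrier (L2_on U).
     (\<exists>G. is_weak_deriv U (1, 0) F G) \<and> (\<exists>G. is_weak_deriv U (0, 1) F G)}"

text \<open>The sesquilinear form obtained by polarisation from \<open>u \<mapsto> \<integral>\<^sub>U |\<nabla>u|\<^sup>2\<close>.\<close>

definition dirichlet_form ::
  "(real \<times> real) set \<Rightarrow> (real \<times> real \<Rightarrow> complex) set \<Rightarrow> (real \<times> real \<Rightarrow> complex) set
     \<Rightarrow> complex" where
  "dirichlet_form U F G =
     (LINT z|lebesgue_on U.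
        rep (weak_deriv U (1, 0) F) z * cnj (rep (weak_deriv U (1, 0) G) z)
      + rep (weak_deriv U (0, 1) F) z * cnj (rep (weak_deriv U (0, 1) G) z))"

definition neumann_laplacian ::
  "(real \<times> real) set
     \<Rightarrow> ((real \<times> real \<Rightarrow> complex) set \<times> (real \<times> real \<Rightarrow> complex) set) set" where
  "neumann_laplacian U = form_operator (L2_on U) (sobolev_H1 U) (dirichlet_form U)"


section \<open>The geometric condition on the removed set\<close>

definition property_star :: "(real \<times> real) set \<Rightarrow> (real \<times> real) set \<Rightarrow> bool" where
  "property_star \<Omega> K \<longleftrightarrow>
     (\<forall>(x0, y0)\<in>\<Omega> - K.
        {(x, y). (x, y) \<in> \<Omega> \<and> x = x0} \<inter> K = {} \<or> {(x, y). (x, y) \<in> \<Omega> \<and> y = y0} \<inter> K = {})"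

end

(*
  Take for J and J' the identifications of L^2(Omega) with L^2(Omega_K), J_1 = J, and J_1' u = (1 - eta) u,
  where eta is a cutoff function that is 1 near K and supported in the square Q of half side 2 epsilon about p,
  with gradient O(1/epsilon). Only two quantities have to be small: the L^2 norm of eta u, and
  the sum over i of (d_i f, eta d_i u + (d_i eta) u), which involves only the restrictions of u and grad f to Q.
  By property*, almost every point of Q lies on a horizontal or a vertical line that misses K. Comparing u
  with its translates along such lines gives |u|_Q = O(epsilon^(1/2)) |u|_1.
  For f in the domain of the Neumann Laplacian of Omega, difference quotients show that eta_0 f, with
  a fixed cutoff eta_0, is in H^2, and comparing grad f with its translates, first in one direction and
  then in the other, gives |grad f|_Q = O(epsilon^(3/4)) |f|_2. The second quantity is therefore
  O(epsilon^(3/4 + 1/2 - 1)) = O(epsilon^(1/4)), which is better than required.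
*)
theory Submission
  imports Defs "HOL-Computational_Algebra.Polynomial"
begin

section \<open>Closed forms and positive contractions on real Hilbert spaces\<close>

text \<open>The norms of order 1 and 2 are defined through a square root of A + I selected by
  \<open>THE\<close>, and the form is recovered from the operator by \<open>THE\<close> as well.
  Existence and uniqueness of that root therefore have to be proved, and this is done without a
  spectral theorem: the resolvent T = (A + I)^(-1) is a positive contraction, an iteration yields
  its bounded root S, and (A + I)^(1/2) is the inverse of S. All spaces L^2(U) are realised inside
  one Hilbert space of functions on the plane. As K is null, \<Omega> and \<Omega> - K give the same
  subspace, and J, J' act on it as the identity. The geometric obstacle is that u may jump across K.
  Near K it can be compared with translates in one direction only, the direction depending on the
  point. Nothing obstructs grad f, so there both directions can be used in succession and more
  smallness is gained. The parameter r with r^4 = 2 \<epsilon> replaces fractional powers of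
  \<epsilon> by integer powers: u contributes r^2, grad f contributes r^3, the cutoff gradient
  r^(-4), and a defect of order r remains.\<close>

lemma quadratic_nonneg_imp:
  fixes a c d :: real
  assumes nn: "\<And>t. 0 \<le> a * t\<^sup>2 + 2 * c * t + d" and a: "0 \<le> a"
  shows "c\<^sup>2 \<le> a * d"
proof (cases "a = 0")
  case True
  have "c = 0"
  proof (rule ccontr)
    assume c: "c \<noteq> 0"
    \<comment> \<open>At this point the affine function \<open>2 * c * t + d\<close> takes the value
      -1.\<close>
    have "0 \<le> a * (-(d+1)/(2*c))\<^sup>2 + 2 * c * (-(d+1)/(2*c)) + d" by (rule nn)
    then show False using True c by (simp add: field_simps)
  qed
  then show ?thesis using True by simp
next
  case False
  then have a0: "a > 0" using a by simp
  have "0 \<le> a * (-c/a)\<^sup>2 + 2 * c * (-c/a) + d" by (rule nn)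
  also have "\<dots> = d - c\<^sup>2 / a" using a0 by (simp add: power2_eq_square)
  finally show ?thesis using a0 by (simp add: field_simps)
qed

text \<open>The form lives on a set \<open>D\<close> and may be degenerate, because three different
  forms are used: the inner product on a closed subspace, the energy form of A + I on its domain,
  and (x, y) |-> <Z x, y> for a positive map Z.\<close>

locale form_space =
  fixes D :: "'h::real_vector set" and b :: "'h \<Rightarrow> 'h \<Rightarrow> real"
  assumes sub: "subspace D"
    and add_left: "\<lbrakk>x \<in> D; y \<in> D; z \<in> D\<rbrakk> \<Longrightarrow> b (x + y) z = b x z + b y z"
    and scale_left: "\<lbrakk>x \<in> D; y \<in> D\<rbrakk> \<Longrightarrow> b (c *\<^sub>R x) y = c * b x y"
    and sym: "\<lbrakk>x \<in> D; y \<in> D\<rbrakk> \<Longrightarrow> b x y = b y x"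
    and nonneg: "x \<in> D \<Longrightarrow> 0 \<le> b x x"
begin

lemma add_right: "\<lbrakk>x \<in> D; y \<in> D; z \<in> D\<rbrakk> \<Longrightarrow> b z (x + y) = b z x + b z y"
  using add_left sym subspace_add[OF sub] by metis

lemma scale_right: "\<lbrakk>x \<in> D; y \<in> D\<rbrakk> \<Longrightarrow> b x (c *\<^sub>R y) = c * b x y"
  using scale_left sym subspace_scale[OF sub] by metis

lemma minus_left: "\<lbrakk>x \<in> D; y \<in> D\<rbrakk> \<Longrightarrow> b (- x) y = - b x y"
  using scale_left[of x y "-1"] by simp

lemma diff_left: "\<lbrakk>x \<in> D; y \<in> D; z \<in> D\<rbrakk> \<Longrightarrow> b (x - y) z = b x z - b y z"
  using add_left[of x "-y" z] minus_left subspace_neg[OF sub] by simp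

lemma diff_right: "\<lbrakk>x \<in> D; y \<in> D; z \<in> D\<rbrakk> \<Longrightarrow> b z (x - y) = b z x - b z y"
  using diff_left sym subspace_diff[OF sub] by metis

lemmas closedD = subspace_add[OF sub] subspace_scale[OF sub] subspace_diff[OF sub]
  subspace_neg[OF sub] subspace_0[OF sub]

lemma expand:
  assumes "x \<in> D" "y \<in> D"
  shows "b (x + t *\<^sub>R y) (x + t *\<^sub>R y) = b x x + 2 * t * b x y + t\<^sup>2 * b y y"
proof -
  have m: "t *\<^sub>R y \<in> D" "x + t *\<^sub>R y \<in> D" using assms closedD by auto
  show ?thesis using assms m sym[of x y]
    by (simp add: add_left add_right scale_left scale_right power2_eq_square algebra_simps)
qed

lemma cauchy_schwarz:
  assumes "x \<in> D" "y \<in> D"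
  shows "(b x y)\<^sup>2 \<le> b x x * b y y"
proof -
  have "0 \<le> b y y * t\<^sup>2 + 2 * b x y * t + b x x" for t
    using nonneg[of "x + t *\<^sub>R y"] expand[OF assms, of t] closedD assms by (simp add: algebra_simps)
  from quadratic_nonneg_imp[OF this nonneg[OF assms(2)]] show ?thesis by (simp add: mult.commute)
qed

lemma parallelogram:
  assumes "x \<in> D" "y \<in> D"
  shows "b (x - y) (x - y) + b (x + y) (x + y) = 2 * b x x + 2 * b y y"
  using expand[OF assms, of 1] expand[OF assms, of "-1"] by simp

text \<open>The representing vector is the minimiser of \<open>F v = b v v - 2 * l v\<close>.
  Completeness is required with respect to \<open>b\<close>, so that closed subspaces and form
  domains are both covered.\<close>

theorem riesz:
  assumes complete: "\<And>X. \<lbrakk>\<And>n. X n \<in> D;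
      \<And>e. e > 0 \<Longrightarrow> \<exists>N. \<forall>m\<ge>N. \<forall>n\<ge>N. b (X m - X n) (X m - X n) < e\<rbrakk>
      \<Longrightarrow> \<exists>x\<in>D. (\<lambda>n. b (X n - x) (X n - x)) \<longlonglongrightarrow> 0"
    and ladd: "\<And>x y. \<lbrakk>x \<in> D; y \<in> D\<rbrakk> \<Longrightarrow> l (x + y) = l x + l y"
    and lscale: "\<And>c x. x \<in> D \<Longrightarrow> l (c *\<^sub>R x) = c * l x"
    and lbound: "\<And>x. x \<in> D \<Longrightarrow> (l x)\<^sup>2 \<le> C * b x x"
  and C: "0 \<le> C"
  shows "\<exists>u\<in>D. \<forall>v\<in>D. b u v = l v"
proof -
  define F where "F v = b v v - 2 * l v" for v
  \<comment> \<open>The chain (2 l v)^2 <= 4 C b v v <= (C + b v v)^2 bounds \<open>F\<close> from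
    below.\<close>
  have lower: "- C \<le> F v" if "v \<in> D" for v
  proof -
    have "(l v)\<^sup>2 \<le> C * b v v" "0 \<le> b v v" using lbound nonneg that by auto
    then have "(2 * l v)\<^sup>2 \<le> 4 * C * b v v" by (simp add: power_mult_distrib)
    also have "\<dots> \<le> (C + b v v)\<^sup>2" using sum_squares_bound[of C "b v v"]
      by (simp add: power2_eq_square algebra_simps)
    finally have "2 * l v \<le> C + b v v"
      by (rule power2_le_imp_le) (use C \<open>0 \<le> b v v\<close> in simp)
    then show ?thesis unfolding F_def by simp
  qed
  define I where "I = Inf (F ` D)"
  have ne: "F ` D \<noteq> {}" using closedD(5) by auto
  have bb: "bdd_below (F ` D)" using lower by (auto intro!: bdd_belowI)
  have I_le: "I \<le> F v" if "v \<in> D" for v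
    unfolding I_def using that bb by (simp add: cINF_lower)
  have "\<exists>v\<in>D. F v < I + 1 / Suc n" for n
    using cInf_lessD[OF ne, of "I + 1 / Suc n"] unfolding I_def by auto
  then obtain X where X: "\<And>n. X n \<in> D" "\<And>n. F (X n) < I + 1 / Suc n" by metis
  have lmid: "l (x + y) = l x + l y" "l (c *\<^sub>R x) = c * l x" if "x \<in> D" "y \<in> D" for x y c
    using ladd lscale that by auto
  \<comment> \<open>With the midpoint \<open>m\<close> the parallelogram law reads b (x - y) (x - y)
    = 2 F x + 2 F y - 4 F m, and F m >= I. Hence minimising sequences are Cauchy.\<close>
  have close: "b (x - y) (x - y) \<le> 2 * (F x - I) + 2 * (F y - I)" if "x \<in> D" "y \<in> D" for x y
  proof -
    define m where "m = (1/2) *\<^sub>R (x + y)"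
    have xy: "x + y \<in> D" and m: "m \<in> D" unfolding m_def using that closedD by auto
    have "b m m = b (x + y) (x + y) / 4" unfolding m_def using xy closedD
      by (simp add: scale_left scale_right)
    moreover have "l m = (l x + l y) / 2" unfolding m_def using lmid that lscale[OF xy, of "1/2"] by simp
    ultimately have "b (x - y) (x - y) = 2 * F x + 2 * F y - 4 * F m"
      using parallelogram[OF that] unfolding F_def by simp
    then show ?thesis using I_le[OF m] by simp
  qed
  have "\<exists>x\<in>D. (\<lambda>n. b (X n - x) (X n - x)) \<longlonglongrightarrow> 0"
  proof (rule complete[OF X(1)])
    fix e :: real assume e: "e > 0"
    then obtain N where N: "1 / Suc N < e / 4" using nat_approx_posE[of "e/4"] by auto
    have "b (X m - X n) (X m - X n) < e" if "m \<ge> N" "n \<ge> N" for m n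
    proof -
      have "1 / Suc m \<le> 1 / Suc N" "1 / Suc n \<le> 1 / Suc N" using that by (auto simp: field_simps)
      then have d: "F (X m) - I < e / 4" "F (X n) - I < e / 4" using X(2)[of m] X(2)[of n] N by simp_all
      have "2 * (F (X m) - I) + 2 * (F (X n) - I) < e" using d by simp
      then show ?thesis using close[OF X(1) X(1), of m n] by (rule le_less_trans[rotated])
    qed
    then show "\<exists>N. \<forall>m\<ge>N. \<forall>n\<ge>N. b (X m - X n) (X m - X n) < e" by blast
  qed
  then obtain x where x: "x \<in> D" and lim: "(\<lambda>n. b (X n - x) (X n - x)) \<longlonglongrightarrow> 0" by blast
  have "b x v = l v" if v: "v \<in> D" for v
  proof -
    have bl: "(\<lambda>n. b (X n) v) \<longlonglongrightarrow> b x v"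
    proof (rule LIM_zero_cancel, rule tendsto_rabs_zero_cancel)
      have "(\<lambda>n. sqrt (b (X n - x) (X n - x) * b v v)) \<longlonglongrightarrow> sqrt (0 * b v v)"
        by (intro tendsto_intros lim)
      then have s0: "(\<lambda>n. sqrt (b (X n - x) (X n - x) * b v v)) \<longlonglongrightarrow> 0" by simp
      have "\<bar>b (X n) v - b x v\<bar> \<le> sqrt (b (X n - x) (X n - x) * b v v)" for n
        using cauchy_schwarz[of "X n - x" v] X(1) x v closedD diff_left[OF X(1) x v]
        by (metis real_le_rsqrt power2_abs)
      then show "(\<lambda>n. \<bar>b (X n) v - b x v\<bar>) \<longlonglongrightarrow> 0"
        by (intro tendsto_sandwich[OF _ _ tendsto_const s0]) auto
    qed
    \<comment> \<open>First variation at the minimiser. It is read off at \<open>X n\<close>, which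
      is minimal up to \<open>1 / Suc n\<close>; only \<open>b (X n) v\<close> then has to converge,
      which is \<open>bl\<close>.\<close>
    have "0 \<le> b v v * t\<^sup>2 + 2 * (b x v - l v) * t + 0" for t
    proof -
      have "0 \<le> t\<^sup>2 * b v v + 2 * t * (b (X n) v - l v) + 1 / Suc n" for n
      proof -
        have "X n + t *\<^sub>R v \<in> D" "t *\<^sub>R v \<in> D" using X(1) v closedD by auto
        then have "I \<le> F (X n + t *\<^sub>R v)" "l (X n + t *\<^sub>R v) = l (X n) + t * l v"
          using I_le ladd X(1) lscale v by auto
        then show ?thesis using X(2)[of n] expand[OF X(1) v, of n t] unfolding F_def
          by (simp add: algebra_simps)
      qed
      moreover have "(\<lambda>n. t\<^sup>2 * b v v + 2 * t * (b (X n) v - l v) + 1 / Suc n)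
          \<longlonglongrightarrow> t\<^sup>2 * b v v + 2 * t * (b x v - l v) + 0"
        by (intro tendsto_intros bl LIMSEQ_Suc[OF lim_1_over_n])
      ultimately have "0 \<le> t\<^sup>2 * b v v + 2 * t * (b x v - l v) + 0"
        by (intro LIMSEQ_le_const) auto
      then show ?thesis by (simp add: algebra_simps)
    qed
    from quadratic_nonneg_imp[OF this nonneg[OF v]] show ?thesis by simp
  qed
  then show ?thesis using x by blast
qed

end

lemma closure_subspace_real:
  fixes D :: "'h::real_normed_vector set"
  assumes "subspace D" shows "subspace (closure D)"
proof (rule subspaceI)
  show "0 \<in> closure D" using subspace_0[OF assms] closure_subset by blast
  show "x + y \<in> closure D" if xy: "x \<in> closure D" "y \<in> closure D" for x y
  proof -
    obtain X Y where XY: "\<forall>n. X n \<in> D" "X \<longlonglongrightarrow> x" "\<forall>n. Y n \<in> D" "Y \<longlonglongrightarrow> y"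
      using xy unfolding closure_sequential by blast
    have "(\<lambda>n. X n + Y n) \<longlonglongrightarrow> x + y" using XY by (intro tendsto_add)
    moreover have "\<forall>n. X n + Y n \<in> D" using XY subspace_add[OF assms] by simp
    ultimately show ?thesis unfolding closure_sequential by (intro exI[of _ "\<lambda>n. X n + Y n"] conjI)
  qed
  show "c *\<^sub>R x \<in> closure D" if x: "x \<in> closure D" for x c
  proof -
    obtain X where X: "\<forall>n. X n \<in> D" "X \<longlonglongrightarrow> x"
      using x unfolding closure_sequential by blast
    have "(\<lambda>n. c *\<^sub>R X n) \<longlonglongrightarrow> c *\<^sub>R x" using X by (intro tendsto_intros)
    moreover have "\<forall>n. c *\<^sub>R X n \<in> D" using X subspace_scale[OF assms] by simp
    ultimately show ?thesis unfolding closure_sequential by (intro exI[of _ "\<lambda>n. c *\<^sub>R X n"] conjI)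
  qed
qed

lemma riesz_closed_subspace:
  fixes V :: "'h::{real_inner,complete_space} set"
  assumes V: "subspace V" "closed V"
    and l: "\<And>x y. \<lbrakk>x \<in> V; y \<in> V\<rbrakk> \<Longrightarrow> l (x + y) = l x + l y"
      "\<And>c x. x \<in> V \<Longrightarrow> l (c *\<^sub>R x) = c * l x"
      "\<And>x. x \<in> V \<Longrightarrow> (l x)\<^sup>2 \<le> C * inner x x"
    and C: "0 \<le> C"
  shows "\<exists>u\<in>V. \<forall>v\<in>V. inner u v = l v"
proof -
  interpret form_space V inner
    by unfold_locales (use V in \<open>auto simp: inner_add_left inner_add_right inner_commute\<close>)
  show ?thesis
  proof (rule riesz[OF _ l C])
    fix X :: "nat \<Rightarrow> 'h"
    assume XV: "\<And>n. X n \<in> V"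
      and C: "\<And>e. e > 0 \<Longrightarrow> \<exists>N. \<forall>m\<ge>N. \<forall>n\<ge>N. inner (X m - X n) (X m - X n) < e"
    have "Cauchy X"
    proof (rule CauchyI)
      fix e :: real assume "0 < e"
      then obtain N where N: "\<forall>m\<ge>N. \<forall>n\<ge>N. inner (X m - X n) (X m - X n) < e\<^sup>2"
        using C[of "e\<^sup>2"] by auto
      then show "\<exists>M. \<forall>m\<ge>M. \<forall>n\<ge>M. norm (X m - X n) < e"
        using \<open>0 < e\<close> by (metis dot_square_norm power2_less_imp_less less_imp_le)
    qed
    then obtain x where x: "X \<longlonglongrightarrow> x" using Cauchy_convergent convergent_def by blast
    have "x \<in> V" using closed_sequentially[OF V(2) _ x] XV by blast
    moreover have "(\<lambda>n. inner (X n - x) (X n - x)) \<longlonglongrightarrow> inner (x - x) (x - x)"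
      by (intro tendsto_intros x)
    ultimately show "\<exists>x\<in>V. (\<lambda>n. inner (X n - x) (X n - x)) \<longlonglongrightarrow> 0" by auto
  qed
qed

lemma closed_subspace_projection:
  fixes V :: "'h::{real_inner,complete_space} set"
  assumes V: "subspace V" "closed V"
  shows "\<exists>u\<in>V. \<forall>v\<in>V. inner (x - u) v = 0"
proof -
  obtain u where u: "u \<in> V" "\<And>v. v \<in> V \<Longrightarrow> inner u v = inner x v"
    using riesz_closed_subspace[OF V, of "inner x" "inner x x"]
    by (auto simp: inner_add_right Cauchy_Schwarz_ineq)
  have "inner (x - u) v = 0" if "v \<in> V" for v using u(2)[OF that] by (simp add: inner_diff_left)
  then show ?thesis using u(1) by blast
qed

text \<open>The residual of the projection onto \<open>closure D\<close> lies in \<open>V\<close>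
  and is orthogonal to \<open>D\<close>, so it vanishes.\<close>

lemma dense_subspace_if_orthogonal_trivial:
  fixes D V :: "'h::{real_inner,complete_space} set"
  assumes D: "subspace D" and DV: "D \<subseteq> V" and V: "subspace V" "closed V"
    and triv: "\<And>x. \<lbrakk>x \<in> V; \<forall>y\<in>D. inner x y = 0\<rbrakk> \<Longrightarrow> x = 0"
  shows "closure D = V"
proof
  show "closure D \<subseteq> V" using DV V(2) by (rule closure_minimal)
  show "V \<subseteq> closure D"
  proof
    fix x assume x: "x \<in> V"
    obtain u where u: "u \<in> closure D" "\<forall>v\<in>closure D. inner (x - u) v = 0"
      using closed_subspace_projection[OF closure_subspace_real[OF D] closed_closure] by blast
    have "x - u = 0"
      by (rule triv) (use u x V \<open>closure D \<subseteq> V\<close> closure_subset[of D] in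
          \<open>auto intro: subspace_diff\<close>)
    then show "x \<in> closure D" using u by simp
  qed
qed

section \<open>Square root of a positive contraction\<close>

locale positive_contraction =
  fixes T :: "'h::{real_inner,complete_space} \<Rightarrow> 'h"
  assumes lin: "linear T"
    and selfadj: "inner (T x) y = inner x (T y)"
    and norm_le: "(norm (T x))\<^sup>2 \<le> inner (T x) x"
begin

definition R where "R x = x - T x"

text \<open>If the root of T = I - R is written as I - Y, the equation (I - Y)^2 = I - R becomes Y =
  (R + Y^2) / 2, which is iterated from 0.\<close>

primrec Y :: "nat \<Rightarrow> 'h \<Rightarrow> 'h" where
  "Y 0 = (\<lambda>x. 0)"
| "Y (Suc n) = (\<lambda>x. (1/2) *\<^sub>R (R x + Y n (Y n x)))"

text \<open>The same recursion with R replaced by 1. It is increasing and bounded by 1, and it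
  majorises the operator iterates and their increments; this replaces monotone convergence of
  operators.\<close>

primrec y :: "nat \<Rightarrow> real" where
  "y 0 = 0"
| "y (Suc n) = (1 + (y n)\<^sup>2) / 2"

lemma linR: "linear R"
  unfolding R_def by (intro linear_compose_sub lin linear_ident)

text \<open>For self-adjoint T the hypothesis \<open>norm_le\<close> says T^2 <= T, that is 0 <= T
  <= I; expanding |x - T x|^2 turns it into this bound.\<close>

lemma normR: "norm (R x) \<le> norm x"
proof (rule power2_le_imp_le)
  have "0 \<le> inner (T x) x" using norm_le[of x] by (meson order_trans zero_le_power2)
  have "(norm (R x))\<^sup>2 = (norm x)\<^sup>2 - 2 * inner (T x) x + (norm (T x))\<^sup>2"
    unfolding R_def power2_norm_eq_inner by (simp add: inner_diff_left inner_diff_right inner_commute)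
  then show "(norm (R x))\<^sup>2 \<le> (norm x)\<^sup>2" using norm_le[of x] \<open>0 \<le> inner (T x) x\<close> by simp
qed simp

lemma linY: "linear (Y n)"
proof (induction n)
  case 0 show ?case by (simp add: linear_zero)
next
  case (Suc n)
  have "linear (\<lambda>x. Y n (Y n x))" using linear_compose[OF Suc Suc] by (simp add: o_def)
  then show ?case by (auto intro!: linear_compose_scale_right linear_compose_add linR)
qed

lemma selfadjY: "inner (Y n x) z = inner x (Y n z)"
proof (induction n arbitrary: x z)
  case (Suc n)
  then show ?case
    by (simp add: R_def inner_add_left inner_add_right inner_diff_left inner_diff_right selfadj)
qed simp

text \<open>\<open>X\<close> has to be linear only on an invariant subspace \<open>V\<close>, since
  a competing square root of the resolvent will be known only there. Taking \<open>X\<close> as the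
  identity gives the invariance of \<open>V\<close>.\<close>

lemma commY:
  assumes "subspace V" "\<And>x. x \<in> V \<Longrightarrow> T x \<in> V" "\<And>x. x \<in> V \<Longrightarrow> X x \<in> V"
    and "\<And>x z. x \<in> V \<Longrightarrow> z \<in> V \<Longrightarrow> X (x + z) = X x + X z"
    and "\<And>c x. x \<in> V \<Longrightarrow> X (c *\<^sub>R x) = c *\<^sub>R X x"
    and "\<And>x. x \<in> V \<Longrightarrow> X (T x) = T (X x)"
    and "x \<in> V"
  shows "Y n x \<in> V \<and> X (Y n x) = Y n (X x)"
  using \<open>x \<in> V\<close>
proof (induction n arbitrary: x)
  case 0 then show ?case using assms(5)[of x 0] assms(1) by (simp add: subspace_0)
next
  case (Suc n)
  have V: "\<And>x. x \<in> V \<Longrightarrow> Y n x \<in> V" using Suc by blast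
  have RV: "R x \<in> V" "X (R x) = R (X x)"
    using Suc.prems assms(1,2,6) assms(4)[of x "- T x"] assms(5)[of "T x" "-1"]
    by (auto simp: R_def subspace_diff subspace_neg)
  have *: "Y n (Y n x) \<in> V" "X (Y n (Y n x)) = Y n (Y n (X x))"
    using V[OF V[OF Suc.prems]] Suc.IH[OF V[OF Suc.prems]] Suc.IH[OF Suc.prems] by auto
  show ?case using * RV assms(1,4,5)
    by (simp add: subspace_add subspace_scale)
qed

lemma commYY: "Y m (Y n x) = Y n (Y m x)"
proof -
  have c: "linear Z \<Longrightarrow> (\<And>x. Z (T x) = T (Z x)) \<Longrightarrow> Z (Y n x) = Y n (Z x)" for Z n x
    using commY[of UNIV Z] by (auto simp: linear_add linear_scale)
  \<comment> \<open>Used twice: T commutes with itself, hence with \<open>Y m\<close>, hence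
    \<open>Y m\<close> commutes with \<open>Y n\<close>.\<close>
  show ?thesis by (rule c[OF linY]) (rule c[OF lin, symmetric, OF refl])
qed

lemma normY: "norm (Y n x) \<le> y n * norm x"
proof (induction n arbitrary: x)
  case (Suc n)
  have y0: "0 \<le> y n" by (cases n) auto
  have "norm (Y n (Y n x)) \<le> y n * norm (Y n x)" by (rule Suc)
  also have "\<dots> \<le> y n * (y n * norm x)" by (intro mult_left_mono Suc y0)
  finally have "norm (Y n (Y n x)) \<le> (y n)\<^sup>2 * norm x" by (simp add: power2_eq_square)
  then have "norm (R x + Y n (Y n x)) \<le> norm x + (y n)\<^sup>2 * norm x"
    using norm_triangle_ineq[of "R x" "Y n (Y n x)"] normR[of x] by linarith
  then show ?case by (simp add: algebra_simps flip: scaleR_right_distrib)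
qed simp

lemma y_bounds: "0 \<le> y n \<and> y n \<le> 1"
proof (induction n)
  case (Suc n)
  then have "(y n)\<^sup>2 \<le> 1" by (simp add: power_le_one)
  then show ?case by simp
qed simp

text \<open>The iterates commute, so the difference of the squares of two consecutive ones factors
  as sum times difference. The numbers \<open>y n\<close> obey the same factorisation, which carries
  the induction.\<close>

lemma diffY: "norm (Y (Suc n) x - Y n x) \<le> (y (Suc n) - y n) * norm x"
proof (induction n arbitrary: x)
  case 0 then show ?case using normR[of x] by simp
next
  case (Suc n)
  let ?d = "\<lambda>x. Y (Suc n) x - Y n x"
  have "Y (Suc (Suc n)) x - Y (Suc n) x = (1/2) *\<^sub>R (Y (Suc n) (Y (Suc n) x) - Y n (Y n x))"
    by (simp add: algebra_simps)
  also have "Y (Suc n) (Y (Suc n) x) - Y n (Y n x) = Y (Suc n) (?d x) + Y n (?d x)"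
    using commYY[of "Suc n" n x] unfolding linear_diff[OF linY] by (simp del: Y.simps)
  finally have eq: "Y (Suc (Suc n)) x - Y (Suc n) x = (1/2) *\<^sub>R (Y (Suc n) (?d x) + Y n (?d x))" .
  have "norm (Y (Suc n) (?d x) + Y n (?d x)) \<le> (y (Suc n) + y n) * norm (?d x)"
    using norm_triangle_ineq[of "Y (Suc n) (?d x)" "Y n (?d x)"] normY[of "Suc n" "?d x"] normY[of n "?d x"]
    by (simp only: distrib_right)
  also have "\<dots> \<le> (y (Suc n) + y n) * ((y (Suc n) - y n) * norm x)"
    using y_bounds[of n] y_bounds[of "Suc n"] by (intro mult_left_mono Suc) linarith
  finally have "norm (Y (Suc n) (?d x) + Y n (?d x)) \<le> ((y (Suc n))\<^sup>2 - (y n)\<^sup>2) * norm x"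
    by (simp only: power2_eq_square) (simp only: algebra_simps)
  moreover have yd: "(y (Suc (Suc n)) - y (Suc n)) = ((y (Suc n))\<^sup>2 - (y n)\<^sup>2) / 2"
    by (simp add: field_simps)
  ultimately show ?case unfolding eq yd by (simp del: y.simps Y.simps)
qed

lemma y_mono: "m \<le> n \<Longrightarrow> y m \<le> y n"
proof (rule lift_Suc_mono_le)
  show "y n \<le> y (Suc n)" for n
    using sum_squares_bound[of 1 "y n"] by simp
qed

lemma diffY_le: "m \<le> n \<Longrightarrow> norm (Y n x - Y m x) \<le> (y n - y m) * norm x"
proof (induction n rule: nat_induct)
  case (Suc n)
  show ?case
  proof (cases "m = Suc n")
    case False
    then have "norm (Y n x - Y m x) \<le> (y n - y m) * norm x" using Suc by simp
    moreover have "norm (Y (Suc n) x - Y m x) \<le> norm (Y (Suc n) x - Y n x) + norm (Y n x - Y m x)"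
      using norm_triangle_ineq[of "Y (Suc n) x - Y n x" "Y n x - Y m x"] by simp
    ultimately show ?thesis using diffY[of n x] by (simp only: left_diff_distrib)
  qed simp
qed simp

definition Yl where "Yl x = lim (\<lambda>n. Y n x)"

lemma limY: "(\<lambda>n. Y n x) \<longlonglongrightarrow> Yl x"
proof -
  have "convergent y"
    using y_bounds y_mono by (intro Bseq_monoseq_convergent BseqI'[of _ 1]) (auto simp: monoseq_def)
  then have Cy: "Cauchy (\<lambda>n. y n * norm x)"
    by (intro convergent_Cauchy) (simp add: convergent_mult convergent_const)
  have "Cauchy (\<lambda>n. Y n x)"
  proof (rule metric_CauchyI)
    fix e :: real assume "0 < e"
    then obtain M where M: "\<And>m n. m \<ge> M \<Longrightarrow> n \<ge> M \<Longrightarrow> norm (y m * norm x - y n * norm x) < e"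
      using CauchyD[OF Cy] by blast
    have "dist (Y m x) (Y n x) < e" if "m \<ge> M" "n \<ge> M" for m n
      using diffY_le[of m n x] diffY_le[of n m x] M[of m n] that
      by (cases "m \<le> n") (auto simp: norm_minus_commute left_diff_distrib dist_norm)
    then show "\<exists>M. \<forall>m\<ge>M. \<forall>n\<ge>M. dist (Y m x) (Y n x) < e" by blast
  qed
  then show ?thesis unfolding Yl_def using Cauchy_convergent convergent_LIMSEQ_iff by (metis (no_types, lifting))
qed

definition S where "S x = x - Yl x"

lemma normYl: "norm (Yl x) \<le> norm x"
proof (rule LIMSEQ_le_const2[OF tendsto_norm[OF limY]])
  have "norm (Y n x) \<le> norm x" for n
    using normY[of n x] y_bounds[of n] mult_right_mono[of "y n" 1 "norm x"] by simp
  then show "\<exists>N. \<forall>n\<ge>N. norm (Y n x) \<le> norm x" by blast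
qed

lemma linYl: "linear Yl"
proof (rule linearI)
  show "Yl (x + z) = Yl x + Yl z" for x z
    using tendsto_add[OF limY[of x] limY[of z]] limY[of "x + z"] LIMSEQ_unique
    by (simp add: linear_add[OF linY])
  show "Yl (c *\<^sub>R x) = c *\<^sub>R Yl x" for c x
    using tendsto_scaleR[OF tendsto_const limY[of x], of c] limY[of "c *\<^sub>R x"] LIMSEQ_unique
    unfolding linear_scale[OF linY] by blast
qed

lemma selfadjYl: "inner (Yl x) z = inner x (Yl z)"
proof (rule LIMSEQ_unique)
  show "(\<lambda>n. inner (Y n x) z) \<longlonglongrightarrow> inner (Yl x) z" by (intro tendsto_intros limY)
  show "(\<lambda>n. inner (Y n x) z) \<longlonglongrightarrow> inner x (Yl z)"
    unfolding selfadjY by (intro tendsto_intros limY)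
qed

text \<open>The limit of \<open>Y n (Y n x)\<close> is taken in two stages, using that all
  \<open>Y n\<close> are contractions.\<close>

lemma Yl_eq: "Yl x = (1/2) *\<^sub>R (R x + Yl (Yl x))"
proof -
  have a: "(\<lambda>n. Y n (Y n x) - Y n (Yl x)) \<longlonglongrightarrow> 0"
  proof (rule Lim_null_comparison)
    show "(\<lambda>n. norm (Y n x - Yl x)) \<longlonglongrightarrow> 0"
      using limY LIM_zero tendsto_norm_zero by blast
    have "norm (Y n (Y n x - Yl x)) \<le> norm (Y n x - Yl x)" for n
      using normY[of n "Y n x - Yl x"] y_bounds[of n]
        mult_right_mono[of "y n" 1 "norm (Y n x - Yl x)"] by simp
    then show "\<forall>\<^sub>F n in sequentially. norm (Y n (Y n x) - Y n (Yl x)) \<le> norm (Y n x - Yl x)"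
      by (simp add: linear_diff[OF linY])
  qed
  have "(\<lambda>n. Y n (Y n x)) \<longlonglongrightarrow> Yl (Yl x)"
    using tendsto_add[OF a limY[of "Yl x"]] by simp
  then have "(\<lambda>n. Y (Suc n) x) \<longlonglongrightarrow> (1/2) *\<^sub>R (R x + Yl (Yl x))"
    by (auto intro!: tendsto_intros)
  then show ?thesis using LIMSEQ_Suc[OF limY[of x]] LIMSEQ_unique by blast
qed

lemma linS: "linear S"
  unfolding S_def by (intro linear_compose_sub linYl linear_ident)

text \<open>By the fixed point equation (I - Yl)^2 = I - (2 Yl - Yl^2) = I - R.\<close>

lemma S_square: "S (S x) = T x"
proof -
  have "S (S x) = x - 2 *\<^sub>R Yl x + Yl (Yl x)"
    unfolding S_def by (simp add: linear_diff[OF linYl] algebra_simps scaleR_2)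
  also have "2 *\<^sub>R Yl x = R x + Yl (Yl x)" using arg_cong[OF Yl_eq[of x], of "\<lambda>z. 2 *\<^sub>R z"] by simp
  finally show ?thesis by (simp add: R_def)
qed

lemma selfadjS: "inner (S x) z = inner x (S z)"
  by (simp add: S_def inner_diff_left inner_diff_right selfadjYl)

lemma S_nonneg: "0 \<le> inner (S x) x"
proof -
  have "inner (Yl x) x \<le> norm x * norm x"
    using norm_cauchy_schwarz[of "Yl x" x] normYl[of x] mult_right_mono[of "norm (Yl x)" "norm x" "norm x"]
    by simp
  then show ?thesis by (simp add: S_def inner_diff_left power2_norm_eq_inner[symmetric] power2_eq_square)
qed

text \<open>Commutation survives the limit because \<open>X\<close> is a contraction on
  \<open>V\<close>; membership in \<open>V\<close> survives because \<open>V\<close> is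
  closed.\<close>

lemma commS:
  assumes V: "subspace V" "closed V" "\<And>x. x \<in> V \<Longrightarrow> T x \<in> V" 
    and X: "\<And>x. x \<in> V \<Longrightarrow> X x \<in> V"
    "\<And>x z. x \<in> V \<Longrightarrow> z \<in> V \<Longrightarrow> X (x + z) = X x + X z"
    "\<And>c x. x \<in> V \<Longrightarrow> X (c *\<^sub>R x) = c *\<^sub>R X x"
    "\<And>x. x \<in> V \<Longrightarrow> norm (X x) \<le> norm x"
    "\<And>x. x \<in> V \<Longrightarrow> X (T x) = T (X x)"
    and x: "x \<in> V"
  shows "S x \<in> V \<and> X (S x) = S (X x)"
proof -
  have c: "Y n x \<in> V" "X (Y n x) = Y n (X x)" for n
    using commY[of V X x n] assms by blast+
  then have YV: "Yl x \<in> V" using closed_sequentially[OF V(2) _ limY] by blast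
  have diff: "X (z - w) = X z - X w" if "z \<in> V" "w \<in> V" for z w
    using X(2)[of z "-w"] X(3)[of w "-1"] that V(1) by (simp add: subspace_neg)
  have "(\<lambda>n. X (Y n x) - X (Yl x)) \<longlonglongrightarrow> 0"
  proof (rule Lim_null_comparison)
    show "(\<lambda>n. norm (Y n x - Yl x)) \<longlonglongrightarrow> 0"
      using limY LIM_zero tendsto_norm_zero by blast
    show "\<forall>\<^sub>F n in sequentially. norm (X (Y n x) - X (Yl x)) \<le> norm (Y n x - Yl x)"
      using X(4)[of "Y _ x - Yl x"] c(1) YV V(1) diff by (simp add: subspace_diff)
  qed
  then have "(\<lambda>n. X (Y n x)) \<longlonglongrightarrow> X (Yl x)" by (rule LIM_zero_cancel)
  then have "X (Yl x) = Yl (X x)" unfolding c(2) using limY LIMSEQ_unique by blast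
  then show ?thesis unfolding S_def using YV x V(1) diff by (simp add: subspace_diff)
qed

end

section \<open>The operator of a closed form and its scale of spaces\<close>

text \<open>A complex Hilbert space record is studied through a map \<open>\<iota>\<close> into a type that is a real Hilbert
  space, on which \<open>ii\<close> acts as multiplication by the imaginary unit.\<close>

locale hilbert_rep =
  fixes H :: "'a hspace" and \<iota> :: "'a \<Rightarrow> 'h::{real_inner,complete_space}" and ii :: "'h \<Rightarrow> 'h"
  assumes inj: "inj_on \<iota> (hcarrier H)"
    and closed_range: "closed (\<iota> ` hcarrier H)"
    and ne: "hcarrier H \<noteq> {}"
    and add_closed: "\<lbrakk>x \<in> hcarrier H; y \<in> hcarrier H\<rbrakk> \<Longrightarrow> hadd H x y \<in> hcarrier H"
    and scale_closed: "x \<in> hcarrier H \<Longrightarrow> hscale H c x \<in> hcarrier H"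
    and \<iota>_add: "\<lbrakk>x \<in> hcarrier H; y \<in> hcarrier H\<rbrakk> \<Longrightarrow> \<iota> (hadd H x y) = \<iota> x + \<iota> y"
    and \<iota>_scale: "x \<in> hcarrier H \<Longrightarrow> \<iota> (hscale H c x) = Re c *\<^sub>R \<iota> x + Im c *\<^sub>R ii (\<iota> x)"
    and hinner_eq: "\<lbrakk>x \<in> hcarrier H; y \<in> hcarrier H\<rbrakk>
        \<Longrightarrow> hinner H x y = Complex (inner (\<iota> x) (\<iota> y)) (inner (\<iota> x) (ii (\<iota> y)))"
    and ii_lin: "linear ii"
    and ii_inner: "inner (ii v) (ii w) = inner v w"
    and ii_ii: "ii (ii v) = - v"
begin

definition V where "V = \<iota> ` hcarrier H"
definition \<kappa> where "\<kappa> = inv_into (hcarrier H) \<iota>"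

lemma \<kappa>\<iota> [simp]: "x \<in> hcarrier H \<Longrightarrow> \<kappa> (\<iota> x) = x"
  unfolding \<kappa>_def using inj by simp

lemma \<iota>\<kappa> [simp]: "v \<in> V \<Longrightarrow> \<iota> (\<kappa> v) = v"
  unfolding \<kappa>_def V_def by (simp add: f_inv_into_f)

lemma \<kappa>_in [simp]: "v \<in> V \<Longrightarrow> \<kappa> v \<in> hcarrier H"
  unfolding \<kappa>_def V_def by (simp add: inv_into_into)

lemma \<iota>_in [simp]: "x \<in> hcarrier H \<Longrightarrow> \<iota> x \<in> V"
  unfolding V_def by simp

lemma \<iota>_eq_iff: "\<lbrakk>x \<in> hcarrier H; y \<in> hcarrier H\<rbrakk> \<Longrightarrow> \<iota> x = \<iota> y \<longleftrightarrow> x = y"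
  using inj by (auto dest: inj_onD)

lemma \<iota>_scaleR: "x \<in> hcarrier H \<Longrightarrow> \<iota> (hscale H (of_real c) x) = c *\<^sub>R \<iota> x"
  by (simp add: \<iota>_scale)

lemma \<iota>_scale_ii: "x \<in> hcarrier H \<Longrightarrow> \<iota> (hscale H \<i> x) = ii (\<iota> x)"
  by (simp add: \<iota>_scale)

lemma \<iota>_minus: "x \<in> hcarrier H \<Longrightarrow> \<iota> (hscale H (-1) x) = - \<iota> x"
  by (simp add: \<iota>_scale)

lemma V_subspace: "subspace V"
proof (rule subspaceI)
  obtain x where x: "x \<in> hcarrier H" using ne by blast
  then have "\<iota> (hscale H 0 x) = 0" by (simp add: \<iota>_scale)
  then show "0 \<in> V" using scale_closed[OF x] \<iota>_in by metis
  show "x + y \<in> V" if "x \<in> V" "y \<in> V" for x y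
    using \<iota>_in[OF add_closed[OF \<kappa>_in[OF that(1)] \<kappa>_in[OF that(2)]]] that by (simp add: \<iota>_add)
  show "c *\<^sub>R x \<in> V" if "x \<in> V" for c x
    using \<iota>_in[OF scale_closed[OF \<kappa>_in[OF that], of "of_real c"]] that by (simp add: \<iota>_scaleR)
qed

lemma V_closed: "closed V" unfolding V_def by (rule closed_range)

lemmas Vc = subspace_add[OF V_subspace] subspace_diff[OF V_subspace] subspace_scale[OF V_subspace]
  subspace_0[OF V_subspace] subspace_neg[OF V_subspace]

lemma hnorm_eq: "x \<in> hcarrier H \<Longrightarrow> hnorm H x = norm (\<iota> x)"
  by (simp add: hnorm_def hinner_eq norm_eq_sqrt_inner)

lemma hdiff_closed: "\<lbrakk>x \<in> hcarrier H; y \<in> hcarrier H\<rbrakk> \<Longrightarrow> hdiff H x y \<in> hcarrier H"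
  by (simp add: hdiff_def add_closed scale_closed)

lemma \<iota>_diff: "\<lbrakk>x \<in> hcarrier H; y \<in> hcarrier H\<rbrakk> \<Longrightarrow> \<iota> (hdiff H x y) = \<iota> x - \<iota> y"
  by (simp add: hdiff_def \<iota>_add \<iota>_minus scale_closed)

lemma ii_skew: "inner (ii x) y = - inner x (ii y)"
  using ii_inner[of x "ii y"] by (simp add: ii_ii)

lemma norm_ii: "norm (ii x) = norm x"
  by (simp add: norm_eq_sqrt_inner ii_inner)

lemma \<kappa>_add: "\<lbrakk>v \<in> V; w \<in> V\<rbrakk> \<Longrightarrow> \<kappa> (v + w) = hadd H (\<kappa> v) (\<kappa> w)"
  by (metis \<iota>\<kappa> \<iota>_add \<kappa>\<iota> \<kappa>_in add_closed)

lemma \<kappa>_diff: "\<lbrakk>v \<in> V; w \<in> V\<rbrakk> \<Longrightarrow> \<kappa> (v - w) = hdiff H (\<kappa> v) (\<kappa> w)"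
  by (metis \<iota>\<kappa> \<iota>_diff \<kappa>\<iota> \<kappa>_in hdiff_closed)

lemma \<kappa>_scaleR: "v \<in> V \<Longrightarrow> \<kappa> (c *\<^sub>R v) = hscale H (of_real c) (\<kappa> v)"
  by (metis \<iota>\<kappa> \<iota>_scaleR \<kappa>\<iota> \<kappa>_in scale_closed)

lemma \<kappa>_ii: "v \<in> V \<Longrightarrow> \<kappa> (ii v) = hscale H \<i> (\<kappa> v)"
  by (metis \<iota>\<kappa> \<iota>_scale_ii \<kappa>\<iota> \<kappa>_in scale_closed)

lemma dense_in_iff:
  assumes "D \<subseteq> hcarrier H"
  shows "dense_in H D \<longleftrightarrow> closure (\<iota> ` D) = V"
proof
  assume d: "dense_in H D"
  show "closure (\<iota> ` D) = V"
  proof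
    show "closure (\<iota> ` D) \<subseteq> V"
      using assms by (intro closure_minimal V_closed) (auto simp: V_def)
    show "V \<subseteq> closure (\<iota> ` D)"
    proof
      fix v assume v: "v \<in> V"
      show "v \<in> closure (\<iota> ` D)" unfolding closure_approachable
      proof (intro allI impI)
        fix e :: real assume "0 < e"
        then obtain y where y: "y \<in> D" "hnorm H (hdiff H (\<kappa> v) y) < e"
          using d \<kappa>_in[OF v] unfolding dense_in_def by blast
        then show "\<exists>y\<in>\<iota> ` D. dist y v < e"
          using assms v by (auto simp: dist_norm norm_minus_commute hnorm_eq \<iota>_diff hdiff_closed subset_eq)
      qed
    qed
  qed
next
  assume c: "closure (\<iota> ` D) = V"
  show "dense_in H D" unfolding dense_in_def
  proof (intro conjI assms ballI allI impI)
    fix x :: 'a and e :: real assume x: "x \<in> hcarrier H" and e: "0 < e"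
    then have "\<iota> x \<in> closure (\<iota> ` D)" using c by simp
    then obtain y where "y \<in> D" "dist (\<iota> y) (\<iota> x) < e"
      unfolding closure_approachable using e by blast
    then show "\<exists>y\<in>D. hnorm H (hdiff H x y) < e"
      using assms x by (auto simp: dist_norm norm_minus_commute hnorm_eq \<iota>_diff hdiff_closed subset_eq)
  qed
qed

end

section \<open>The resolvent of a closed form and its bounded square root\<close>

locale form_rep = hilbert_rep +
  fixes D :: "'a set" and q :: "'a \<Rightarrow> 'a \<Rightarrow> complex"
  assumes cnf: "closed_nonneg_form H D q"
begin

lemma D_sub: "D \<subseteq> hcarrier H" and D_ne: "D \<noteq> {}"
  and D_add: "\<lbrakk>x \<in> D; y \<in> D\<rbrakk> \<Longrightarrow> hadd H x y \<in> D"
  and D_scale: "x \<in> D \<Longrightarrow> hscale H c x \<in> D"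
  and D_dense: "dense_in H D"
  and q_add: "\<lbrakk>x \<in> D; y \<in> D; z \<in> D\<rbrakk> \<Longrightarrow> q (hadd H x y) z = q x z + q y z"
  and q_scale: "\<lbrakk>x \<in> D; y \<in> D\<rbrakk> \<Longrightarrow> q (hscale H c x) y = c * q x y"
  and q_sym: "\<lbrakk>x \<in> D; y \<in> D\<rbrakk> \<Longrightarrow> q y x = cnj (q x y)"
  and q_nonneg: "x \<in> D \<Longrightarrow> 0 \<le> Re (q x x)"
  using cnf unfolding closed_nonneg_form_def lin_subspace_def by blast+

lemma q_closed:
  assumes "x \<in> hcarrier H" "\<And>n. X n \<in> D" "(\<lambda>n. hnorm H (hdiff H (X n) x)) \<longlonglongrightarrow> 0"
    "\<And>e. e > 0 \<Longrightarrow> \<exists>N. \<forall>m\<ge>N. \<forall>n\<ge>N. Re (q (hdiff H (X m) (X n)) (hdiff H (X m) (X n))) < e"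
  shows "x \<in> D \<and> (\<lambda>n. Re (q (hdiff H (X n) x) (hdiff H (X n) x))) \<longlonglongrightarrow> 0"
  using cnf assms unfolding closed_nonneg_form_def by blast

lemma D_in: "x \<in> D \<Longrightarrow> x \<in> hcarrier H" using D_sub by blast

lemma q_ii: "\<lbrakk>x \<in> D; y \<in> D\<rbrakk> \<Longrightarrow> q x (hscale H \<i> y) = - \<i> * q x y"
  using q_sym[of "hscale H \<i> y" x] q_scale[of y x \<i>] q_sym[of x y] D_scale[of y \<i>] by simp

text \<open>Conjugate linearity in the second argument gives Re (q x (i y)) = Im (q x y). Real parts
  therefore carry all the information, and the theory can run in a real Hilbert space.\<close>

lemma q_Complex:
  assumes "x \<in> D" "y \<in> D"
  shows "q x y = Complex (Re (q x y)) (Re (q x (hscale H \<i> y)))"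
  using q_ii[OF assms] by (simp add: complex_eq_iff)

definition E where "E = \<iota> ` D"
text \<open>The real part of the form of A + I. Adding the inner product makes it dominate the
  squared norm, and its domain complete.\<close>

definition b where "b x y = Re (q (\<kappa> x) (\<kappa> y)) + inner x y" for x y

lemma E_V: "x \<in> E \<Longrightarrow> x \<in> V" unfolding E_def V_def using D_sub by blast

lemma \<kappa>_D: "x \<in> E \<Longrightarrow> \<kappa> x \<in> D" unfolding E_def using D_sub by force

lemma \<iota>_E: "x \<in> D \<Longrightarrow> \<iota> x \<in> E" unfolding E_def by simp

lemma E_dense: "closure E = V"
  unfolding E_def using dense_in_iff[OF D_sub] D_dense by simp

lemma E_subspace: "subspace E"
proof (rule subspaceI)
  obtain x where x: "x \<in> D" using D_ne by blast
  then have "\<iota> (hscale H 0 x) = 0" using D_in by (simp add: \<iota>_scale)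
  then show "0 \<in> E" using \<iota>_E[OF D_scale[OF x]] by metis
  show "x + y \<in> E" if "x \<in> E" "y \<in> E" for x y
    using \<iota>_E[OF D_add[OF \<kappa>_D[OF that(1)] \<kappa>_D[OF that(2)]]] that E_V by (simp add: \<iota>_add)
  show "c *\<^sub>R x \<in> E" if "x \<in> E" for c x
    using \<iota>_E[OF D_scale[OF \<kappa>_D[OF that], of "of_real c"]] that E_V by (simp add: \<iota>_scaleR)
qed

lemma E_ii: "v \<in> E \<Longrightarrow> ii v \<in> E"
  using \<iota>_E[OF D_scale[OF \<kappa>_D, of v \<i>]] E_V by (simp add: \<iota>_scale_ii)

sublocale fs: form_space E b
proof
  show "subspace E" by (rule E_subspace)
  show "b (x + y) z = b x z + b y z" if "x \<in> E" "y \<in> E" "z \<in> E" for x y z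
    using that E_V \<kappa>_D by (simp add: b_def \<kappa>_add q_add inner_add_left)
  show "b (c *\<^sub>R x) y = c * b x y" if "x \<in> E" "y \<in> E" for x y c
    using that E_V \<kappa>_D by (simp add: b_def \<kappa>_scaleR q_scale distrib_left)
  show "b x y = b y x" if "x \<in> E" "y \<in> E" for x y
    using that \<kappa>_D q_sym[of "\<kappa> x" "\<kappa> y"] by (simp add: b_def inner_commute)
  show "0 \<le> b x x" if "x \<in> E" for x
    using that \<kappa>_D q_nonneg[of "\<kappa> x"] by (simp add: b_def)
qed

lemma norm_le_b: "x \<in> E \<Longrightarrow> (norm x)\<^sup>2 \<le> b x x"
  using q_nonneg[OF \<kappa>_D] by (simp add: b_def power2_norm_eq_inner)

lemma b_ii: "\<lbrakk>x \<in> E; y \<in> E\<rbrakk> \<Longrightarrow> b (ii x) y = - b x (ii y)"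
  using E_V \<kappa>_D by (simp add: b_def \<kappa>_ii q_scale q_ii ii_skew)

lemma E_closed_form:
  assumes X: "\<And>n. X n \<in> E" and lim: "X \<longlonglongrightarrow> x"
    and C: "\<And>e. e > 0 \<Longrightarrow> \<exists>N. \<forall>m\<ge>N. \<forall>n\<ge>N. b (X m - X n) (X m - X n) < e"
  shows "x \<in> E \<and> (\<lambda>n. b (X n - x) (X n - x)) \<longlonglongrightarrow> 0"
proof -
  have xV: "x \<in> V" using closed_sequentially[OF V_closed _ lim] X E_V by blast
  have "\<kappa> x \<in> D \<and> (\<lambda>n. Re (q (hdiff H (\<kappa> (X n)) (\<kappa> x)) (hdiff H (\<kappa> (X n)) (\<kappa> x)))) \<longlonglongrightarrow> 0"
  proof (rule q_closed)
    show "\<kappa> x \<in> hcarrier H" using xV by simp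
    show "\<kappa> (X n) \<in> D" for n using X \<kappa>_D by blast
    have "(\<lambda>n. norm (X n - x)) \<longlonglongrightarrow> 0" using lim LIM_zero tendsto_norm_zero by blast
    then show "(\<lambda>n. hnorm H (hdiff H (\<kappa> (X n)) (\<kappa> x))) \<longlonglongrightarrow> 0"
      using X E_V xV by (simp add: hnorm_eq hdiff_closed \<iota>_diff)
    fix e :: real assume "0 < e"
    then obtain N where N: "\<forall>m\<ge>N. \<forall>n\<ge>N. b (X m - X n) (X m - X n) < e" using C by blast
    have "Re (q (hdiff H (\<kappa> (X m)) (\<kappa> (X n))) (hdiff H (\<kappa> (X m)) (\<kappa> (X n))))
        \<le> b (X m - X n) (X m - X n)" for m n
      using X E_V by (simp add: b_def \<kappa>_diff)
    then show "\<exists>N. \<forall>m\<ge>N. \<forall>n\<ge>N.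
        Re (q (hdiff H (\<kappa> (X m)) (\<kappa> (X n))) (hdiff H (\<kappa> (X m)) (\<kappa> (X n)))) < e"
      using N le_less_trans by blast
  qed
  then have xE: "x \<in> E" and l: "(\<lambda>n. Re (q (\<kappa> (X n - x)) (\<kappa> (X n - x)))) \<longlonglongrightarrow> 0"
    using xV X E_V \<iota>_E[of "\<kappa> x"] by (auto simp: \<kappa>_diff)
  have "(\<lambda>n. b (X n - x) (X n - x)) \<longlonglongrightarrow> 0 + inner (x - x) (x - x)"
    unfolding b_def by (intro tendsto_intros l lim)
  then show ?thesis using xE by simp
qed

text \<open>A \<open>b\<close>-Cauchy sequence is norm Cauchy because \<open>b\<close> dominates the
  squared norm; closedness of the form then turns the norm limit into a
  \<open>b\<close>-limit.\<close>

lemma E_complete: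
  assumes X: "\<And>n. X n \<in> E"
    and C: "\<And>e. e > 0 \<Longrightarrow> \<exists>N. \<forall>m\<ge>N. \<forall>n\<ge>N. b (X m - X n) (X m - X n) < e"
  shows "\<exists>x\<in>E. (\<lambda>n. b (X n - x) (X n - x)) \<longlonglongrightarrow> 0"
proof -
  have "Cauchy X"
  proof (rule CauchyI)
    fix e :: real assume e: "0 < e"
    then obtain N where N: "\<forall>m\<ge>N. \<forall>n\<ge>N. b (X m - X n) (X m - X n) < e\<^sup>2"
      using C[of "e\<^sup>2"] by auto
    have "norm (X m - X n) < e" if "m \<ge> N" "n \<ge> N" for m n
    proof (rule power2_less_imp_less)
      show "(norm (X m - X n))\<^sup>2 < e\<^sup>2"
        using norm_le_b[of "X m - X n"] N that X fs.closedD by (meson le_less_trans)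
    qed (use e in simp)
    then show "\<exists>M. \<forall>m\<ge>M. \<forall>n\<ge>M. norm (X m - X n) < e" by blast
  qed
  then obtain x where "X \<longlonglongrightarrow> x" using Cauchy_convergent convergent_def by blast
  then show ?thesis using E_closed_form[OF X _ C] by blast
qed

lemma ex_T: "\<exists>u\<in>E. \<forall>v\<in>E. b u v = inner w v"
proof (rule fs.riesz[OF E_complete])
  show "(inner w x)\<^sup>2 \<le> inner w w * b x x" if "x \<in> E" for x
    using Cauchy_Schwarz_ineq[of w x] mult_left_mono[OF norm_le_b[OF that], of "inner w w"]
    by (simp add: power2_norm_eq_inner)
qed (auto simp: inner_add_right)

text \<open>The resolvent (A + I)^(-1) in weak form, preceded by the projection onto
  \<open>V\<close>. Defining it on the whole type makes it an instance of
  \<open>positive_contraction\<close>.\<close>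

definition T where "T w = (SOME u. u \<in> E \<and> (\<forall>v\<in>E. b u v = inner w v))"

lemma T_E [simp]: "T w \<in> E" and b_T: "v \<in> E \<Longrightarrow> b (T w) v = inner w v"
proof -
  have "T w \<in> E \<and> (\<forall>v\<in>E. b (T w) v = inner w v)"
    unfolding T_def by (rule someI_ex) (use ex_T in blast)
  then show "T w \<in> E" "v \<in> E \<Longrightarrow> b (T w) v = inner w v" by auto
qed

lemma T_unique:
  assumes "u \<in> E" "\<And>v. v \<in> E \<Longrightarrow> b u v = inner w v"
  shows "u = T w"
proof -
  have d: "u - T w \<in> E" using assms fs.closedD by simp
  have "b (u - T w) (u - T w) = 0" using assms d b_T[OF d] by (simp add: fs.diff_left)
  then have "norm (u - T w) = 0" using norm_le_b[OF d] by simp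
  then show ?thesis by simp
qed

lemma T_V [simp]: "T w \<in> V" using E_V by simp

sublocale pc: positive_contraction T
proof (rule positive_contraction.intro)
  show "linear T"
  proof (rule linearI)
    show "T (x + y) = T x + T y" for x y
      by (rule T_unique[symmetric]) (auto simp: fs.closedD fs.add_left b_T inner_add_left)
    show "T (c *\<^sub>R x) = c *\<^sub>R T x" for c x
      by (rule T_unique[symmetric]) (auto simp: fs.closedD fs.scale_left b_T)
  qed
  show "inner (T x) y = inner x (T y)" for x y
    using b_T[of "T x" y] b_T[of "T y" x] fs.sym[of "T x" "T y"] by (simp add: inner_commute)
  show "(norm (T x))\<^sup>2 \<le> inner (T x) x" for x
    using norm_le_b[of "T x"] b_T[of "T x" x] by (simp add: inner_commute)
qed

lemma T_ii: "T (ii x) = ii (T x)"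
  by (rule T_unique[symmetric]) (auto simp: E_ii b_ii b_T ii_skew)

lemma orth_E:
  assumes "w \<in> V" "\<And>v. v \<in> E \<Longrightarrow> inner w v = 0"
  shows "w = 0"
proof -
  obtain X where X: "\<And>n. X n \<in> E" "X \<longlonglongrightarrow> w"
    using assms(1) E_dense closure_sequential[of w E] by auto
  have "(\<lambda>n. inner w (X n)) \<longlonglongrightarrow> inner w w" by (intro tendsto_intros X)
  moreover have "(\<lambda>n. inner w (X n)) = (\<lambda>n. 0)" using assms(2) X(1) by auto
  ultimately have "inner w w = 0" by (simp only: LIMSEQ_const_iff)
  then show ?thesis by simp
qed

text \<open>If T w = 0, then w is orthogonal to the form domain, which is dense.\<close>

lemma T_inj: "\<lbrakk>w \<in> V; T w = 0\<rbrakk> \<Longrightarrow> w = 0"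
  using orth_E[of w] b_T[of _ w] fs.scale_left[OF fs.closedD(5), of _ 0] by simp

abbreviation "S \<equiv> pc.S"

lemma S_V: "x \<in> V \<Longrightarrow> S x \<in> V"
  using pc.commS[of V "\<lambda>x. x" x] V_subspace V_closed by simp

text \<open>Complex linearity of the root supplies the imaginary part of the adjoint identity for
  \<open>B\<close> below.\<close>

lemma S_ii: "S (ii x) = ii (S x)"
  using pc.commS[of UNIV ii x] by (simp add: linear_add[OF ii_lin] linear_scale[OF ii_lin] norm_ii T_ii)

lemma S_inj: "\<lbrakk>w \<in> V; S w = 0\<rbrakk> \<Longrightarrow> w = 0"
  using T_inj[of w] pc.S_square[of w] linear_0[OF pc.linS] by simp

text \<open>A vector orthogonal to the range of the symmetric map S lies in its kernel, which is
  trivial.\<close>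

lemma S_dense: "closure (S ` V) = V"
proof (rule dense_subspace_if_orthogonal_trivial)
  show "subspace (S ` V)" using linear_subspace_image[OF pc.linS V_subspace] .
  show "S ` V \<subseteq> V" using S_V by blast
  fix x assume x: "x \<in> V" "\<forall>y\<in>S ` V. inner x y = 0"
  then have "inner (S x) (S x) = 0" using pc.selfadjS[of x "S x"] S_V by auto
  then show "x = 0" using S_inj x by simp
qed (rule V_subspace V_closed)+

text \<open>For x = S w the claim is the defining identity of \<open>T\<close>, since then S x = T
  w. General x is reached by density of the range of \<open>S\<close>, and closedness of the form
  puts the limit into \<open>E\<close>. Thus \<open>S\<close> carries the inner product
  isometrically to \<open>b\<close>.\<close>

lemma S_E_aux:
  assumes x: "x \<in> V"
  shows "S x \<in> E" "y \<in> V \<Longrightarrow> S y \<in> E \<Longrightarrow> b (S y) (S x) = inner y x"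
proof -
  obtain X' where X': "\<And>n. X' n \<in> S ` V" "X' \<longlonglongrightarrow> x"
    using x S_dense closure_sequential[of x "S ` V"] by auto
  have "\<forall>n. \<exists>w. w \<in> V \<and> X' n = S w" using X'(1) by blast
  then obtain w where w: "\<And>n. w n \<in> V" "\<And>n. X' n = S (w n)" by metis
  have lim: "(\<lambda>n. S (w n)) \<longlonglongrightarrow> x" unfolding w(2)[symmetric] by (rule X'(2))
  have bl: "bounded_linear S"
  proof (rule bounded_linear_intro[where K = 2])
    show "norm (S x) \<le> norm x * 2" for x
      unfolding pc.S_def using norm_triangle_ineq4[of x "pc.Yl x"] pc.normYl[of x] by simp
  qed (simp_all add: linear_add[OF pc.linS] linear_scale[OF pc.linS])
  have lim2: "(\<lambda>n. T (w n)) \<longlonglongrightarrow> S x"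
    using bounded_linear.tendsto[OF bl lim] by (simp add: pc.S_square)
  \<comment> \<open>Because T d = S (S d), the form norm of T d is the norm of S d; norm convergence
    of \<open>S (w n)\<close> becomes form convergence of \<open>T (w n)\<close>.\<close>
  have bT: "b (T (w m) - T (w n)) (T (w m) - T (w n)) = (norm (S (w m) - S (w n)))\<^sup>2" for m n
  proof -
    let ?d = "w m - w n"
    have "b (T ?d) (T ?d) = inner ?d (S (S ?d))" by (simp add: b_T pc.S_square)
    also have "\<dots> = inner (S ?d) (S ?d)" by (simp add: pc.selfadjS)
    finally show ?thesis
      by (simp add: linear_diff[OF pc.linS] linear_diff[OF pc.lin] power2_norm_eq_inner)
  qed
  have *: "S x \<in> E \<and> (\<lambda>n. b (T (w n) - S x) (T (w n) - S x)) \<longlonglongrightarrow> 0"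
  proof (rule E_closed_form[OF _ lim2])
    fix e :: real assume e: "0 < e"
    then obtain N where N: "\<forall>m\<ge>N. \<forall>n\<ge>N. norm (S (w m) - S (w n)) < sqrt e"
      using CauchyD[OF LIMSEQ_imp_Cauchy[OF lim], of "sqrt e"] by auto
    then have "\<forall>m\<ge>N. \<forall>n\<ge>N. (norm (S (w m) - S (w n)))\<^sup>2 < e"
      using e by (metis norm_ge_zero power_strict_mono pos2 real_sqrt_pow2 less_imp_le)
    then show "\<exists>N. \<forall>m\<ge>N. \<forall>n\<ge>N. b (T (w m) - T (w n)) (T (w m) - T (w n)) < e"
      unfolding bT by blast
  qed simp
  then show SE: "S x \<in> E" by blast
  show "b (S y) (S x) = inner y x" if y: "y \<in> V" "S y \<in> E"
  proof -
    have "(\<lambda>n. b (S y) (T (w n) - S x)) \<longlonglongrightarrow> 0"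
    proof (rule Lim_null_comparison)
      have "(\<lambda>n. sqrt (b (S y) (S y) * b (T (w n) - S x) (T (w n) - S x))) \<longlonglongrightarrow> sqrt (b (S y) (S y) * 0)"
        using * by (intro tendsto_intros) blast
      then show "(\<lambda>n. sqrt (b (S y) (S y) * b (T (w n) - S x) (T (w n) - S x))) \<longlonglongrightarrow> 0" by simp
      have "\<bar>b (S y) (T (w n) - S x)\<bar> \<le> sqrt (b (S y) (S y) * b (T (w n) - S x) (T (w n) - S x))" for n
        using fs.cauchy_schwarz[OF y(2), of "T (w n) - S x"] SE fs.closedD
        by (metis T_E power2_abs real_le_rsqrt)
      then show "\<forall>\<^sub>F n in sequentially. norm (b (S y) (T (w n) - S x))
          \<le> sqrt (b (S y) (S y) * b (T (w n) - S x) (T (w n) - S x))" by simp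
    qed
    moreover have "b (S y) (T (w n) - S x) = inner y (S (w n)) - b (S y) (S x)" for n
      using y SE b_T[OF y(2), of "w n"] fs.sym[OF y(2), of "T (w n)"] pc.selfadjS[of y "w n"]
      by (simp add: fs.diff_right inner_commute)
    ultimately have "(\<lambda>n. inner y (S (w n)) - b (S y) (S x)) \<longlonglongrightarrow> 0" by simp
    moreover have "(\<lambda>n. inner y (S (w n)) - b (S y) (S x)) \<longlonglongrightarrow> inner y x - b (S y) (S x)"
      by (intro tendsto_intros lim)
    ultimately show ?thesis using LIMSEQ_unique by fastforce
  qed
qed

lemma b_S: "\<lbrakk>x \<in> V; y \<in> V\<rbrakk> \<Longrightarrow> b (S x) (S y) = inner x y"
  using S_E_aux by blast

text \<open>The domain of (A + I)^(1/2) is the form domain. Riesz gives x with <x, v> = b u (S v);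
  then d = u - S x is \<open>b\<close>-orthogonal to T d = S (S d), and by definition of
  \<open>T\<close> this means <d, d> = 0.\<close>

lemma S_image: "S ` V = E"
proof
  show "S ` V \<subseteq> E" using S_E_aux by blast
  show "E \<subseteq> S ` V"
  proof
    fix u assume u: "u \<in> E"
    have "\<exists>x\<in>V. \<forall>v\<in>V. inner x v = b u (S v)"
    proof (rule riesz_closed_subspace[OF V_subspace V_closed])
      show "(b u (S x))\<^sup>2 \<le> b u u * inner x x" if "x \<in> V" for x
        using fs.cauchy_schwarz[OF u S_E_aux(1)[OF that]] b_S[OF that that] by simp
    qed (use u S_E_aux(1) fs.nonneg in \<open>auto simp: linear_add[OF pc.linS] linear_scale[OF pc.linS]
        fs.add_right fs.scale_right\<close>)
    then obtain x where x: "x \<in> V" "\<And>v. v \<in> V \<Longrightarrow> inner x v = b u (S v)" by blast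
    let ?d = "u - S x"
    have SxE: "S x \<in> E" using S_E_aux x by blast
    have d: "?d \<in> E" using u SxE fs.closedD by blast
    have dV: "?d \<in> V" "S ?d \<in> V" using E_V[OF d] S_V by auto
    have "b ?d (S (S ?d)) = 0"
      using x(2)[OF dV(2)] b_S[OF x(1) dV(2)] S_E_aux(1)[OF dV(2)] u SxE
      by (simp add: fs.diff_left)
    then have "inner ?d ?d = 0" using b_T[OF d, of ?d] fs.sym[OF d, of "T ?d"] by (simp add: pc.S_square)
    then show "u \<in> S ` V" using x by auto
  qed
qed

section \<open>The operator, the square root of A + I and its uniqueness\<close>

definition A where "A = form_operator H D q"

text \<open>A + I is the inverse of \<open>T\<close> on \<open>V\<close>. In the converse direction
  the real identity is tested with v and with i v to recover the complex one.\<close>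

lemma A_iff:
  "(u, w) \<in> A \<longleftrightarrow> u \<in> hcarrier H \<and> w \<in> hcarrier H \<and> \<iota> u = T (\<iota> w + \<iota> u)"
proof
  assume "(u, w) \<in> A"
  then have uw: "u \<in> D" "w \<in> hcarrier H" and eq: "\<And>v. v \<in> D \<Longrightarrow> q u v = hinner H w v"
    unfolding A_def form_operator_def by auto
  have "\<iota> u = T (\<iota> w + \<iota> u)"
  proof (rule T_unique)
    show "\<iota> u \<in> E" using uw \<iota>_E by blast
    fix v assume v: "v \<in> E"
    show "b (\<iota> u) v = inner (\<iota> w + \<iota> u) v"
      using eq[OF \<kappa>_D[OF v]] uw D_in E_V[OF v] by (simp add: b_def hinner_eq inner_add_left)
  qed
  then show "u \<in> hcarrier H \<and> w \<in> hcarrier H \<and> \<iota> u = T (\<iota> w + \<iota> u)" using uw D_in by blast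
next
  assume a: "u \<in> hcarrier H \<and> w \<in> hcarrier H \<and> \<iota> u = T (\<iota> w + \<iota> u)"
  have uE: "\<iota> u \<in> E" using a T_E by metis
  then have uD: "u \<in> D" using \<kappa>_D a \<kappa>\<iota> by metis
  have Re: "Re (q u v) = inner (\<iota> w) (\<iota> v)" if "v \<in> D" for v
    using b_T[OF \<iota>_E[OF that], of "\<iota> w + \<iota> u"] a that D_in by (simp add: b_def inner_add_left)
  have "q u v = hinner H w v" if v: "v \<in> D" for v
    using q_Complex[OF uD v] Re[OF v] Re[OF D_scale[OF v, of \<i>]] a v D_in
    by (simp add: hinner_eq \<iota>_scale_ii)
  then show "(u, w) \<in> A" unfolding A_def form_operator_def using uD a by blast
qed

lemma plus_identity_A:
  "plus_identity H A = {(u, w). u \<in> hcarrier H \<and> w \<in> hcarrier H \<and> \<iota> u = T (\<iota> w)}"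
proof (intro equalityI subsetI; clarify)
  fix u w assume "(u, w) \<in> plus_identity H A"
  then show "u \<in> hcarrier H \<and> w \<in> hcarrier H \<and> \<iota> u = T (\<iota> w)"
    unfolding plus_identity_def by (auto simp: A_iff \<iota>_add add_closed)
next
  fix u w assume uw: "u \<in> hcarrier H" "w \<in> hcarrier H" "\<iota> u = T (\<iota> w)"
  have "(u, hdiff H w u) \<in> A" using uw by (simp add: A_iff hdiff_closed \<iota>_diff)
  moreover have "hadd H (hdiff H w u) u = w"
    using uw \<iota>_eq_iff[of "hadd H (hdiff H w u) u" w] by (simp add: \<iota>_add \<iota>_diff hdiff_closed add_closed)
  ultimately show "(u, w) \<in> plus_identity H A" unfolding plus_identity_def by force
qed

text \<open>The inverse relation of \<open>S\<close> on the carrier, that is (A + I)^(1/2) with its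
  natural domain.\<close>

definition B where "B = {(x, y). x \<in> hcarrier H \<and> y \<in> hcarrier H \<and> \<iota> x = S (\<iota> y)}"

lemma B_comp: "B O B = plus_identity H A"
  unfolding plus_identity_A B_def
proof (intro equalityI subsetI; clarsimp)
  fix x z assume x: "x \<in> hcarrier H" and z: "z \<in> hcarrier H" and e: "\<iota> x = T (\<iota> z)"
  have "(x, \<kappa> (S (\<iota> z))) \<in> {(x, y). x \<in> hcarrier H \<and> y \<in> hcarrier H \<and> \<iota> x = S (\<iota> y)}"
    "(\<kappa> (S (\<iota> z)), z) \<in> {(x, y). x \<in> hcarrier H \<and> y \<in> hcarrier H \<and> \<iota> x = S (\<iota> y)}"
    using x z e S_V by (auto simp: pc.S_square)
  then show "(x, z) \<in> {(x, y). x \<in> hcarrier H \<and> y \<in> hcarrier H \<and> \<iota> x = S (\<iota> y)} O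
    {(x, y). x \<in> hcarrier H \<and> y \<in> hcarrier H \<and> \<iota> x = S (\<iota> y)}" by blast
qed (simp add: pc.S_square)

lemma Domain_B: "Domain B = D"
proof (intro equalityI subsetI)
  fix x assume "x \<in> Domain B"
  then obtain y where y: "x \<in> hcarrier H" "y \<in> hcarrier H" "\<iota> x = S (\<iota> y)"
    unfolding B_def by blast
  then have "\<iota> x \<in> E" using S_image \<iota>_in by blast
  then show "x \<in> D" using \<kappa>_D y \<kappa>\<iota> by metis
next
  fix x assume x: "x \<in> D"
  then obtain v where v: "v \<in> V" "\<iota> x = S v" using S_image \<iota>_E by blast
  then show "x \<in> Domain B" unfolding B_def using x D_in by (intro DomainI[of _ "\<kappa> v"]) auto
qed

lemma B_nonneg_selfadjoint: "nonneg_selfadjoint H B"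
  unfolding nonneg_selfadjoint_def
proof (intro conjI)
  show "single_valued B"
  proof (rule single_valuedI)
    fix x y z assume "(x, y) \<in> B" "(x, z) \<in> B"
    then have c: "y \<in> hcarrier H" "z \<in> hcarrier H" "S (\<iota> y - \<iota> z) = 0"
      unfolding B_def by (auto simp: linear_diff[OF pc.linS])
    from c have "\<iota> y - \<iota> z \<in> V" by (intro Vc(2)) auto
    then have "\<iota> y - \<iota> z = 0" using c(3) by (rule S_inj)
    then show "y = z" using c \<iota>_eq_iff by simp
  qed
  show "dense_in H (Domain B)" using Domain_B D_dense by simp
  show "\<forall>(u, Au)\<in>B. 0 \<le> Re (hinner H Au u)"
    unfolding B_def using pc.S_nonneg by (auto simp: hinner_eq inner_commute)
  show "op_adjoint H B = B"
  proof (intro equalityI subsetI; clarify)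
    fix v w assume a: "(v, w) \<in> op_adjoint H B"
    then have vw: "v \<in> hcarrier H" "w \<in> hcarrier H"
      and eq: "\<And>u Au. (u, Au) \<in> B \<Longrightarrow> hinner H Au v = hinner H u w"
      unfolding op_adjoint_def by auto
    \<comment> \<open>Testing the adjoint relation with the pair (S d, d) of \<open>B\<close> gives
      <d, d> = 0.\<close>
    let ?d = "\<iota> v - S (\<iota> w)"
    have d: "?d \<in> V" using vw S_V Vc by simp
    have "(\<kappa> (S ?d), \<kappa> ?d) \<in> B" unfolding B_def using d S_V by simp
    from eq[OF this] have "inner ?d (\<iota> v) = inner (S ?d) (\<iota> w)"
      using vw d S_V by (simp add: hinner_eq)
    then have "inner ?d ?d = 0" by (simp add: pc.selfadjS inner_diff_right)
    then show "(v, w) \<in> B" unfolding B_def using vw by simp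
  next
    fix v w assume "(v, w) \<in> B"
    then show "(v, w) \<in> op_adjoint H B"
      unfolding op_adjoint_def B_def
      by (auto simp: hinner_eq pc.selfadjS) (simp flip: S_ii add: pc.selfadjS)
  qed
qed

text \<open>The inverse X of a competitor is a positive symmetric map on \<open>V\<close> with X X =
  T, so it commutes with T and hence with S. For y = S v - X v this gives S y + X y = 0; positivity
  forces S y = X y = 0, and then <y, y> = <v, S y - X y> = 0.\<close>

lemma B_unique:
  assumes ns: "nonneg_selfadjoint H B'" and comp: "B' O B' = plus_identity H A"
  shows "B' = B"
proof -
  have adj: "op_adjoint H B' = B'" and pos: "\<And>u w. (u, w) \<in> B' \<Longrightarrow> 0 \<le> Re (hinner H w u)"
    using ns unfolding nonneg_selfadjoint_def by auto
  have inB: "v \<in> hcarrier H" "w \<in> hcarrier H" if "(v, w) \<in> B'" for v w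
    using that adj unfolding op_adjoint_def by blast+
  have symB: "hinner H w y' = hinner H y w'" if "(y, w) \<in> B'" "(y', w') \<in> B'" for y w y' w'
    using that adj unfolding op_adjoint_def by blast
  \<comment> \<open>Maximality of a self-adjoint relation: the adjoint identity alone ensures
    membership. Linearity of B' is deduced from it.\<close>
  have adjI: "(v, w) \<in> B'" if "v \<in> hcarrier H" "w \<in> hcarrier H"
    "\<And>u Au. (u, Au) \<in> B' \<Longrightarrow> hinner H Au v = hinner H u w" for v w
    using that adj unfolding op_adjoint_def by blast
  have addB: "(hadd H y y', hadd H w w') \<in> B'" if a: "(y, w) \<in> B'" "(y', w') \<in> B'" for y w y' w'
  proof (rule adjI)
    show "hadd H y y' \<in> hcarrier H" "hadd H w w' \<in> hcarrier H" using inB a add_closed by auto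
    fix u Au assume u: "(u, Au) \<in> B'"
    show "hinner H Au (hadd H y y') = hinner H u (hadd H w w')"
      using symB[OF u a(1)] symB[OF u a(2)] inB[OF u] inB[OF a(1)] inB[OF a(2)]
      by (simp add: hinner_eq add_closed \<iota>_add inner_add_right linear_add[OF ii_lin])
  qed
  have scaleB: "(hscale H (of_real c) y, hscale H (of_real c) w) \<in> B'" if a: "(y, w) \<in> B'" for y w c
  proof (rule adjI)
    show "hscale H (of_real c) y \<in> hcarrier H" "hscale H (of_real c) w \<in> hcarrier H"
      using inB a scale_closed by auto
    fix u Au assume u: "(u, Au) \<in> B'"
    show "hinner H Au (hscale H (of_real c) y) = hinner H u (hscale H (of_real c) w)"
      using symB[OF u a] inB[OF u] inB[OF a]
      by (simp add: hinner_eq scale_closed \<iota>_scaleR linear_scale[OF ii_lin])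
  qed
  have chain: "\<iota> y = T (\<iota> w)" if "(y, z) \<in> B'" "(z, w) \<in> B'" for y z w
  proof -
    have "(y, w) \<in> plus_identity H A" using comp that by blast
    then show ?thesis unfolding plus_identity_A by simp
  qed
  have ex2: "\<exists>y z. (y, z) \<in> B' \<and> (z, w) \<in> B'" if w: "w \<in> hcarrier H" for w
  proof -
    have "(\<kappa> (T (\<iota> w)), w) \<in> B' O B'" unfolding comp plus_identity_A using w by simp
    then show ?thesis by blast
  qed
  \<comment> \<open>If y1 and y2 have the same image, linearity puts (y1 - y2, 0) and (0, 0) into
    B'; chaining the two pairs gives y1 - y2 = T 0 = 0.\<close>
  have uniq: "\<iota> y1 = \<iota> y2" if a: "(y1, w) \<in> B'" "(y2, w) \<in> B'" for y1 y2 w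
  proof -
    let ?d = "hadd H y1 (hscale H (of_real (-1)) y2)" and ?z = "hadd H w (hscale H (of_real (-1)) w)"
    have dz: "(?d, ?z) \<in> B'" using addB[OF a(1) scaleB[OF a(2), of "-1"]] .
    have 0: "\<iota> ?z = 0" "\<iota> (hscale H (of_real 0) y1) = 0" "\<iota> (hscale H (of_real 0) w) = 0"
      using inB[OF a(1)] by (auto simp: \<iota>_add \<iota>_scaleR scale_closed \<iota>_scale simp del: of_real_0 of_real_minus)
    have zc: "?z \<in> hcarrier H" "hscale H (of_real 0) y1 \<in> hcarrier H" "hscale H (of_real 0) w \<in> hcarrier H"
      using inB a scale_closed add_closed by blast+
    have "(?z, ?z) \<in> B'"
      using scaleB[OF a(1), of 0] \<iota>_eq_iff[OF zc(1) zc(2)] \<iota>_eq_iff[OF zc(1) zc(3)] 0 by metis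
    from chain[OF dz this] have "\<iota> ?d = 0" using 0 linear_0[OF pc.lin] by simp
    then show ?thesis
      using inB[OF a(1)] inB[OF a(2)] by (simp add: \<iota>_add \<iota>_scaleR scale_closed \<iota>_minus)
  qed
  \<comment> \<open>The inverse of B', carried over to the representing space; \<open>uniq\<close>
    makes the choice irrelevant.\<close>
  define X where "X v = \<iota> (SOME y. (y, \<kappa> v) \<in> B')" for v
  have X: "X (\<iota> w) = \<iota> y" if "(y, w) \<in> B'" for y w
  proof -
    have "(SOME y. (y, w) \<in> B', w) \<in> B'" using that by (rule someI)
    from uniq[OF this that] show ?thesis unfolding X_def using inB[OF that] by simp
  qed
  have XB: "\<exists>y. (y, \<kappa> v) \<in> B' \<and> X v = \<iota> y" if "v \<in> V" for v
    using ex2[OF \<kappa>_in[OF that]] X[of _ "\<kappa> v"] that by fastforce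
  have XV: "X v \<in> V" if "v \<in> V" for v using XB[OF that] inB \<iota>_in by metis
  have Xadd: "X (v + w) = X v + X w" if vw: "v \<in> V" "w \<in> V" for v w
  proof -
    obtain y y' where y: "(y, \<kappa> v) \<in> B'" "X v = \<iota> y" "(y', \<kappa> w) \<in> B'" "X w = \<iota> y'"
      using XB vw by blast
    have "X (\<iota> (hadd H (\<kappa> v) (\<kappa> w))) = \<iota> (hadd H y y')" by (rule X[OF addB[OF y(1,3)]])
    then show ?thesis using y(2,4) vw inB[OF y(1)] inB[OF y(3)] by (simp add: \<iota>_add)
  qed
  have Xscale: "X (c *\<^sub>R v) = c *\<^sub>R X v" if v: "v \<in> V" for v c
  proof -
    obtain y where y: "(y, \<kappa> v) \<in> B'" "X v = \<iota> y" using XB v by blast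
    have "X (\<iota> (hscale H (of_real c) (\<kappa> v))) = \<iota> (hscale H (of_real c) y)" by (rule X[OF scaleB[OF y(1)]])
    then show ?thesis using y(2) v inB[OF y(1)] by (simp add: \<iota>_scaleR)
  qed
  have XX: "X (X v) = T v" if v: "v \<in> V" for v
  proof -
    obtain y z where yz: "(y, z) \<in> B'" "(z, \<kappa> v) \<in> B'" using ex2[OF \<kappa>_in[OF v]] by blast
    then show ?thesis using X[OF yz(1)] X[OF yz(2)] chain[OF yz] v by simp
  qed
  have Xsym: "inner (X v) w = inner v (X w)" if vw: "v \<in> V" "w \<in> V" for v w
  proof -
    obtain y y' where y: "(y, \<kappa> v) \<in> B'" "X v = \<iota> y" "(y', \<kappa> w) \<in> B'" "X w = \<iota> y'"
      using XB vw by blast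
    show ?thesis using symB[OF y(1,3)] y vw inB[OF y(1)] inB[OF y(3)] by (simp add: hinner_eq)
  qed
  have Xpos: "0 \<le> inner (X v) v" if v: "v \<in> V" for v
  proof -
    obtain y where y: "(y, \<kappa> v) \<in> B'" "X v = \<iota> y" using XB v by blast
    show ?thesis using pos[OF y(1)] inB[OF y(1)] y v by (simp add: hinner_eq inner_commute)
  qed
  \<comment> \<open>Since X X = T, |X v|^2 = <T v, v>, and T is a contraction. This is the
    contractivity that \<open>commS\<close> demands of X.\<close>
  have Xnorm: "norm (X v) \<le> norm v" if v: "v \<in> V" for v
  proof (rule power2_le_imp_le)
    have "(norm (X v))\<^sup>2 = inner (T v) v"
      using Xsym[OF v XV[OF v]] XX[OF v] by (simp add: power2_norm_eq_inner inner_commute)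
    also have "\<dots> \<le> norm (T v) * norm v" by (rule norm_cauchy_schwarz)
    also have "\<dots> \<le> norm v * norm v"
    proof (cases "norm (T v) = 0")
      case False
      have "(norm (T v))\<^sup>2 \<le> norm (T v) * norm v"
        using pc.norm_le[of v] norm_cauchy_schwarz[of "T v" v] by linarith
      then show ?thesis using False by (simp add: power2_eq_square mult_right_mono)
    qed simp
    also have "\<dots> = (norm v)\<^sup>2" by (simp add: power2_eq_square)
    finally show "(norm (X v))\<^sup>2 \<le> (norm v)\<^sup>2" .
  qed simp
  have XS: "X (S v) = S (X v)" if v: "v \<in> V" for v
    using pc.commS[OF V_subspace V_closed _ XV Xadd Xscale Xnorm _ v] XX XV by (metis T_V)
  \<comment> \<open>Cauchy-Schwarz for the possibly degenerate form <Z x, z>, applied to y and Z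
    y.\<close>
  have null: "Z y = 0" if Z: "\<And>x z. x \<in> V \<Longrightarrow> z \<in> V \<Longrightarrow> Z (x + z) = Z x + Z z"
    "\<And>c x. x \<in> V \<Longrightarrow> Z (c *\<^sub>R x) = c *\<^sub>R Z x" "\<And>x z. x \<in> V \<Longrightarrow> z \<in> V \<Longrightarrow> inner (Z x) z = inner x (Z z)"
    "\<And>x. x \<in> V \<Longrightarrow> 0 \<le> inner (Z x) x" "\<And>x. x \<in> V \<Longrightarrow> Z x \<in> V" "y \<in> V" "inner (Z y) y = 0" for Z y
  proof -
    interpret z: form_space V "\<lambda>x y. inner (Z x) y"
    proof
      show "inner (Z x) z = inner (Z z) x" if "x \<in> V" "z \<in> V" for x z
        using Z(3)[OF that] by (simp add: inner_commute)
    qed (simp_all add: Z(1,2,4) V_subspace inner_add_left)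
    have "(inner (Z y) (Z y))\<^sup>2 \<le> inner (Z y) y * inner (Z (Z y)) (Z y)"
      by (rule z.cauchy_schwarz[OF Z(6) Z(5)[OF Z(6)]])
    then have "(inner (Z y) (Z y))\<^sup>2 \<le> 0" by (simp only: Z(7) mult_zero_left)
    then show ?thesis by simp
  qed
  have SX: "S v = X v" if v: "v \<in> V" for v
  proof -
    define y where "y = S v - X v"
    have yV: "y \<in> V" unfolding y_def using S_V XV v by (intro Vc(2))
    have diffX: "X (a - b) = X a - X b" if "a \<in> V" "b \<in> V" for a b
      using Xadd[of a "-b"] Xscale[of b "-1"] that Vc(5) by simp
    have "S y + X y = 0"
      unfolding y_def using v S_V XV XS[OF v] XX[OF v] pc.S_square[of v]
      by (simp add: linear_diff[OF pc.linS] diffX)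
    then have "inner (S y) y + inner (X y) y = 0" by (metis inner_add_left inner_zero_left)
    then have z: "inner (S y) y = 0" "inner (X y) y = 0" using pc.S_nonneg[of y] Xpos[OF yV] by linarith+
    have "S y = 0"
      by (rule null[OF _ _ pc.selfadjS pc.S_nonneg S_V yV z(1)])
        (simp_all add: linear_add[OF pc.linS] linear_scale[OF pc.linS])
    moreover have "X y = 0" by (rule null[OF Xadd Xscale Xsym Xpos XV yV z(2)])
    ultimately have "inner y y = 0"
      using Xsym[OF v yV] pc.selfadjS[of v y] by (simp add: y_def inner_diff_left)
    then show ?thesis by (simp add: y_def)
  qed
  show ?thesis
  proof (intro equalityI subsetI; clarify)
    fix x y assume "(x, y) \<in> B'"
    then show "(x, y) \<in> B" unfolding B_def using X SX inB by simp
  next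
    fix x y assume "(x, y) \<in> B"
    then have xy: "x \<in> hcarrier H" "y \<in> hcarrier H" "\<iota> x = X (\<iota> y)" unfolding B_def using SX by auto
    then obtain x' where x': "(x', y) \<in> B'" using ex2 by blast
    then have "\<iota> x = \<iota> x'" using X xy by simp
    then show "(x, y) \<in> B'" using x' xy inB \<iota>_eq_iff by metis
  qed
qed

lemma op_sqrt_eq: "op_sqrt H (plus_identity H A) = B"
  unfolding op_sqrt_def using B_nonneg_selfadjoint B_comp B_unique by (intro the_equality) blast+

lemma half_power_1: "half_power H A 1 = B"
  unfolding half_power_def op_sqrt_eq by (auto simp: B_def)

lemma half_power_2: "half_power H A 2 = plus_identity H A"
proof -
  have "op_power H B (Suc (Suc 0)) = (Id_on (hcarrier H) O B) O B" by simp
  also have "Id_on (hcarrier H) O B = B" by (auto simp: B_def)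
  finally show ?thesis unfolding half_power_def op_sqrt_eq B_comp by (simp add: numeral_2_eq_2)
qed

lemma scale_space_1: "scale_space H A 1 = D"
  unfolding scale_space_def half_power_1 by (rule Domain_B)

text \<open>\<open>S\<close> maps the carrier isometrically onto the form domain equipped with
  \<open>b\<close>, so its inverse computes the \<open>b\<close>-norm.\<close>

lemma scale_norm_1:
  assumes u: "u \<in> D"
  shows "(scale_norm H A 1 u)\<^sup>2 = (hnorm H u)\<^sup>2 + Re (q u u)" "0 \<le> scale_norm H A 1 u"
proof -
  obtain w where w: "(u, w) \<in> B" using u Domain_B by blast
  have "single_valued B" using B_nonneg_selfadjoint unfolding nonneg_selfadjoint_def by blast
  then have "(THE w. (u, w) \<in> B) = w" using w by (auto dest: single_valuedD)
  then have sn: "scale_norm H A 1 u = hnorm H w" unfolding scale_norm_def half_power_1 by simp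
  have c: "u \<in> hcarrier H" "w \<in> hcarrier H" "\<iota> u = S (\<iota> w)" using w unfolding B_def by auto
  have "(norm (\<iota> w))\<^sup>2 = b (\<iota> u) (\<iota> u)" using b_S[of "\<iota> w" "\<iota> w"] c by (simp add: power2_norm_eq_inner)
  then show "(scale_norm H A 1 u)\<^sup>2 = (hnorm H u)\<^sup>2 + Re (q u u)" "0 \<le> scale_norm H A 1 u"
    using c(1,2) by (simp_all add: sn hnorm_eq b_def power2_norm_eq_inner del: One_nat_def)
qed

lemma A_single_valued: "(u, w) \<in> A \<Longrightarrow> (u, w') \<in> A \<Longrightarrow> w = w'"
proof -
  assume a: "(u, w) \<in> A" "(u, w') \<in> A"
  then have c: "u \<in> hcarrier H" "w \<in> hcarrier H" "w' \<in> hcarrier H"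
    and "T (\<iota> w + \<iota> u) = T (\<iota> w' + \<iota> u)" unfolding A_iff by metis+
  then have T0: "T (\<iota> w - \<iota> w') = 0"
    by (simp add: linear_diff[OF pc.lin] linear_add[OF pc.lin])
  from c have "\<iota> w - \<iota> w' \<in> V" by (intro Vc(2)) auto
  then have "\<iota> w - \<iota> w' = 0" using T0 by (rule T_inj)
  then show "w = w'" using c \<iota>_eq_iff by simp
qed

lemma scale_space_2: "scale_space H A 2 = Domain A"
  unfolding scale_space_def half_power_2 plus_identity_def by auto

lemma scale_norm_2:
  assumes "(u, w) \<in> A"
  shows "scale_norm H A 2 u = hnorm H (hadd H w u)"
proof -
  have "(THE w'. (u, w') \<in> plus_identity H A) = hadd H w u"
    unfolding plus_identity_def using assms A_single_valued by (intro the_equality) blast+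
  then show ?thesis unfolding scale_norm_def half_power_2 by simp
qed

section \<open>Recovering the form from its operator\<close>

lemma polarize:
  assumes "x \<in> D" "y \<in> D"
  shows "Re (q x y) = (Re (q (hadd H x y) (hadd H x y)) - Re (q x x) - Re (q y y)) / 2"
  using assms q_add[of x y "hadd H x y"] q_add[of x y x] q_add[of x y y] D_add[OF assms]
    q_sym[of x y] q_sym[of "hadd H x y" x] q_sym[of "hadd H x y" y]
  by simp

text \<open>For any closed form with operator \<open>A\<close> the domain is
  \<open>scale_space H A 1\<close>, and its diagonal is read off from
  \<open>scale_norm H A 1\<close>. Both depend on \<open>A\<close> alone; polarisation and
  \<open>q_Complex\<close> do the rest.\<close>

lemma operator_form_eq:
  assumes f: "f \<in> D" and u: "u \<in> D"
  shows "operator_form H A f u = q f u"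
  unfolding operator_form_def
proof (rule the_equality)
  show "\<exists>D q'. closed_nonneg_form H D q' \<and> form_operator H D q' = A \<and> f \<in> D \<and> u \<in> D \<and> q f u = q' f u"
    using cnf f u A_def by blast
  fix z assume "\<exists>D' q'. closed_nonneg_form H D' q' \<and> form_operator H D' q' = A \<and> f \<in> D' \<and> u \<in> D' \<and> z = q' f u"
  then obtain D' q' where c': "closed_nonneg_form H D' q'" "form_operator H D' q' = A" and z: "z = q' f u"
    by blast
  interpret o: form_rep H \<iota> ii D' q' by unfold_locales (rule c')
  have oA: "o.A = A" unfolding o.A_def by (rule c')
  have DD: "D' = D" using o.scale_space_1 scale_space_1 unfolding oA by simp
  have diag: "Re (q' x x) = Re (q x x)" if "x \<in> D" for x
    using o.scale_norm_1(1)[of x] scale_norm_1(1)[of x] that unfolding oA unfolding DD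
    by (simp del: One_nat_def)
  have Re: "Re (q' x y) = Re (q x y)" if "x \<in> D" "y \<in> D" for x y
    using o.polarize[of x y] polarize[of x y] that diag D_add[of x y] unfolding DD by simp
  show "z = q f u"
    using o.q_Complex[of f u] q_Complex[of f u] Re f u D_scale[of u \<i>] unfolding z DD by simp
qed

end

section \<open>The Hilbert space of square integrable functions on the plane\<close>

definition sqint :: "'x measure \<Rightarrow> ('x \<Rightarrow> complex) \<Rightarrow> bool" where
  "sqint M f \<longleftrightarrow> f \<in> borel_measurable M \<and> integrable M (\<lambda>x. (cmod (f x))\<^sup>2)"

lemma sqint_measurable: "sqint M f \<Longrightarrow> f \<in> borel_measurable M"
  by (simp add: sqint_def)

lemma sqint_bound:
  assumes f: "f \<in> borel_measurable M" and g: "integrable M g"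
    and le: "AE x in M. (cmod (f x))\<^sup>2 \<le> g x"
  shows "sqint M f"
  unfolding sqint_def
proof
  show "integrable M (\<lambda>x. (cmod (f x))\<^sup>2)"
    using g
  proof (rule Bochner_Integration.integrable_bound)
    show "(\<lambda>x. (cmod (f x))\<^sup>2) \<in> borel_measurable M" using f by measurable
    show "AE x in M. norm ((cmod (f x))\<^sup>2) \<le> norm (g x)" using le by eventually_elim auto
  qed
qed (rule f)

lemma sqint_add:
  assumes "sqint M f" "sqint M g"
  shows "sqint M (\<lambda>x. f x + g x)"
proof (rule sqint_bound)
  show "(\<lambda>x. f x + g x) \<in> borel_measurable M" using assms by (auto simp: sqint_def)
  show "integrable M (\<lambda>x. 2 * (cmod (f x))\<^sup>2 + 2 * (cmod (g x))\<^sup>2)"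
    using assms by (auto simp: sqint_def)
  have "(cmod (a + b))\<^sup>2 \<le> 2 * (cmod a)\<^sup>2 + 2 * (cmod b)\<^sup>2" for a b :: complex
  proof -
    have "(cmod (a + b))\<^sup>2 \<le> (cmod a + cmod b)\<^sup>2" by (intro power_mono norm_triangle_ineq) auto
    also have "\<dots> \<le> 2 * (cmod a)\<^sup>2 + 2 * (cmod b)\<^sup>2"
      using sum_squares_bound[of "cmod a" "cmod b"] by (simp add: power2_sum)
    finally show ?thesis .
  qed
  then show "AE x in M. (cmod (f x + g x))\<^sup>2 \<le> 2 * (cmod (f x))\<^sup>2 + 2 * (cmod (g x))\<^sup>2" by simp
qed

lemma sqint_mult:
  assumes f: "sqint M f" and m: "m \<in> borel_measurable M" "\<And>x. cmod (m x) \<le> B"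
  shows "sqint M (\<lambda>x. m x * f x)"
proof (rule sqint_bound)
  show "(\<lambda>x. m x * f x) \<in> borel_measurable M" using assms by (auto simp: sqint_def)
  show "integrable M (\<lambda>x. B\<^sup>2 * (cmod (f x))\<^sup>2)" using f by (auto simp: sqint_def)
  have "(cmod (m x * f x))\<^sup>2 \<le> B\<^sup>2 * (cmod (f x))\<^sup>2" for x
    unfolding norm_mult power_mult_distrib by (intro mult_right_mono power_mono m) auto
  then show "AE x in M. (cmod (m x * f x))\<^sup>2 \<le> B\<^sup>2 * (cmod (f x))\<^sup>2" by simp
qed

lemma sqint_scale: "sqint M f \<Longrightarrow> sqint M (\<lambda>x. c * f x)"
  by (rule sqint_mult[where B = "cmod c"]) auto

lemma sqint_zero: "sqint M (\<lambda>x. 0)"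
  by (simp add: sqint_def)

lemma borel_measurable_cnj [measurable (raw)]:
  "f \<in> borel_measurable M \<Longrightarrow> (\<lambda>x. cnj (f x)) \<in> borel_measurable M"
  by (rule borel_measurable_continuous_on[OF continuous_on_cnj[OF continuous_on_id]])

lemma sqint_product:
  assumes "sqint M f" "sqint M g"
  shows "integrable M (\<lambda>x. f x * cnj (g x))"
proof -
  have "integrable M (\<lambda>x. (cmod (f x))\<^sup>2 + (cmod (g x))\<^sup>2)" using assms by (auto simp: sqint_def)
  then show ?thesis
  proof (rule Bochner_Integration.integrable_bound)
    show "(\<lambda>x. f x * cnj (g x)) \<in> borel_measurable M"
      using assms by (auto simp: sqint_def intro!: borel_measurable_times borel_measurable_cnj)
    have "cmod (a * cnj b) \<le> \<bar>(cmod a)\<^sup>2 + (cmod b)\<^sup>2\<bar>" for a b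
    proof -
      have "0 \<le> cmod a * cmod b" by simp
      then have "cmod a * cmod b \<le> (cmod a)\<^sup>2 + (cmod b)\<^sup>2"
        using sum_squares_bound[of "cmod a" "cmod b"] by linarith
      then show ?thesis by (simp add: norm_mult)
    qed
    then show "AE x in M. norm (f x * cnj (g x)) \<le> norm ((cmod (f x))\<^sup>2 + (cmod (g x))\<^sup>2)" by simp
  qed
qed

lemma sqint_cong:
  assumes "sqint M f" "g \<in> borel_measurable M" "AE x in M. g x = f x"
  shows "sqint M g"
  by (rule sqint_bound[where g = "\<lambda>x. (cmod (f x))\<^sup>2"]) (use assms in \<open>auto simp: sqint_def\<close>)

section \<open>Equivalence classes of square integrable functions\<close>

lemma rep_ae_class:
  assumes "f \<in> borel_measurable M"
  shows "rep (ae_class M f) \<in> borel_measurable M" "AE x in M. rep (ae_class M f) x = f x"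
proof -
  have "f \<in> ae_class M f" using assms by (simp add: ae_class_def)
  then have "rep (ae_class M f) \<in> ae_class M f" unfolding rep_def by (rule someI[of "\<lambda>g. g \<in> ae_class M f"])
  then show "rep (ae_class M f) \<in> borel_measurable M" "AE x in M. rep (ae_class M f) x = f x"
    by (auto simp: ae_class_def)
qed

lemma ae_class_eq_iff:
  assumes "f \<in> borel_measurable M" "g \<in> borel_measurable M"
  shows "ae_class M f = ae_class M g \<longleftrightarrow> (AE x in M. f x = g x)"
proof
  assume "ae_class M f = ae_class M g"
  then have "f \<in> ae_class M g" using assms by (auto simp: ae_class_def)
  then show "AE x in M. f x = g x" by (simp add: ae_class_def)
next
  assume "AE x in M. f x = g x"
  then have "(AE x in M. h x = f x) \<longleftrightarrow> (AE x in M. h x = g x)" for h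
    by (intro iffI; elim AE_mp) (auto elim!: eventually_mono)
  then show "ae_class M f = ae_class M g" by (simp add: ae_class_def)
qed

lemma L2_carrier: "hcarrier (L2_space M) = {ae_class M f | f. sqint M f}"
  by (auto simp: L2_space_def sqint_def)

lemma ae_class_in: "sqint M f \<Longrightarrow> ae_class M f \<in> hcarrier (L2_space M)"
  by (auto simp: L2_carrier)

lemma rep_sqint:
  assumes "F \<in> hcarrier (L2_space M)"
  shows "sqint M (rep F)" "ae_class M (rep F) = F"
proof -
  obtain f where f: "F = ae_class M f" "sqint M f" using assms by (auto simp: L2_carrier)
  note r = rep_ae_class[OF sqint_measurable[OF f(2)]]
  show "sqint M (rep F)" unfolding f(1) by (rule sqint_cong[OF f(2) r])
  show "ae_class M (rep F) = F"
    using ae_class_eq_iff[OF r(1) sqint_measurable[OF f(2)]] r(2) unfolding f(1) by simp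
qed

lemma rep_AE: "sqint M f \<Longrightarrow> AE x in M. rep (ae_class M f) x = f x"
  using rep_ae_class(2) sqint_measurable by blast

lemma L2_eqI:
  assumes "F \<in> hcarrier (L2_space M)" "G \<in> hcarrier (L2_space M)" "AE x in M. rep F x = rep G x"
  shows "F = G"
  using assms rep_sqint ae_class_eq_iff sqint_measurable by metis

lemma L2_add:
  assumes "F \<in> hcarrier (L2_space M)" "G \<in> hcarrier (L2_space M)"
  shows "hadd (L2_space M) F G \<in> hcarrier (L2_space M)"
    "AE x in M. rep (hadd (L2_space M) F G) x = rep F x + rep G x"
proof -
  have e: "hadd (L2_space M) F G = ae_class M (\<lambda>x. rep F x + rep G x)" by (simp add: L2_space_def)
  have s: "sqint M (\<lambda>x. rep F x + rep G x)" using assms by (intro sqint_add rep_sqint)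
  show "hadd (L2_space M) F G \<in> hcarrier (L2_space M)"
    "AE x in M. rep (hadd (L2_space M) F G) x = rep F x + rep G x"
    unfolding e using ae_class_in[OF s] rep_AE[OF s] by auto
qed

lemma L2_scale:
  assumes "F \<in> hcarrier (L2_space M)"
  shows "hscale (L2_space M) c F \<in> hcarrier (L2_space M)"
    "AE x in M. rep (hscale (L2_space M) c F) x = c * rep F x"
proof -
  have e: "hscale (L2_space M) c F = ae_class M (\<lambda>x. c * rep F x)" by (simp add: L2_space_def)
  have s: "sqint M (\<lambda>x. c * rep F x)" using assms by (intro sqint_scale rep_sqint)
  show "hscale (L2_space M) c F \<in> hcarrier (L2_space M)"
    "AE x in M. rep (hscale (L2_space M) c F) x = c * rep F x"
    unfolding e using ae_class_in[OF s] rep_AE[OF s] by auto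
qed

lemma L2_inner: "hinner (L2_space M) F G = (LINT x|M. rep F x * cnj (rep G x))"
  by (simp add: L2_space_def)

text \<open>One type for the whole plane, since a type cannot depend on an open set. Each L^2(U)
  reappears as the closed subspace of elements vanishing off U, and functions on \<Omega> and on
  \<Omega> - K become elements of the same space.\<close>

typedef l2 = "hcarrier (L2_space (lebesgue :: (real \<times> real) measure))"
  using ae_class_in[OF sqint_zero] by blast

definition fn :: "l2 \<Rightarrow> real \<times> real \<Rightarrow> complex" where "fn x = rep (Rep_l2 x)"
definition mk :: "(real \<times> real \<Rightarrow> complex) \<Rightarrow> l2" where "mk f = Abs_l2 (ae_class lebesgue f)"

lemma sqint_fn [simp]: "sqint lebesgue (fn x)"
  unfolding fn_def using rep_sqint Rep_l2 by blast

lemma fn_measurable [measurable]: "fn x \<in> borel_measurable lebesgue"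
  by (rule sqint_measurable[OF sqint_fn])

lemma fn_mk: "sqint lebesgue f \<Longrightarrow> AE z in lebesgue. fn (mk f) z = f z"
  by (simp add: fn_def mk_def Abs_l2_inverse ae_class_in rep_AE)

lemma mk_fn [simp]: "mk (fn x) = x"
  unfolding fn_def mk_def using rep_sqint(2)[OF Rep_l2] Rep_l2_inverse by metis

lemma l2_eq_iff: "x = y \<longleftrightarrow> (AE z in lebesgue. fn x z = fn y z)"
proof
  assume "AE z in lebesgue. fn x z = fn y z"
  then have "ae_class lebesgue (fn x) = ae_class lebesgue (fn y)"
    using ae_class_eq_iff[of "fn x" lebesgue "fn y"] by simp
  then show "x = y" using mk_fn unfolding mk_def by metis
qed simp

lemma l2_eqI: "AE z in lebesgue. fn x z = fn y z \<Longrightarrow> x = y"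
  using l2_eq_iff by blast

text \<open>The type class knows only real inner products. Its instance takes the real part of this
  one, and \<open>l2_inner_c_eq\<close> recovers the imaginary part through
  \<open>ii\<close>.\<close>

definition l2_inner_c :: "l2 \<Rightarrow> l2 \<Rightarrow> complex" where
  "l2_inner_c x y = (LINT z|lebesgue. fn x z * cnj (fn y z))"

instantiation l2 :: real_inner
begin

definition zero_l2 :: l2 where "zero_l2 = mk (\<lambda>z. 0)"
definition plus_l2 :: "l2 \<Rightarrow> l2 \<Rightarrow> l2" where "plus_l2 x y = mk (\<lambda>z. fn x z + fn y z)"
definition scaleR_l2 :: "real \<Rightarrow> l2 \<Rightarrow> l2" where "scaleR_l2 c x = mk (\<lambda>z. of_real c * fn x z)"
definition uminus_l2 :: "l2 \<Rightarrow> l2" where "uminus_l2 x = mk (\<lambda>z. -1 * fn x z)"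
definition minus_l2 :: "l2 \<Rightarrow> l2 \<Rightarrow> l2" where "minus_l2 x y = x + - y"
definition inner_l2 :: "l2 \<Rightarrow> l2 \<Rightarrow> real" where "inner_l2 x y = Re (l2_inner_c x y)"
definition norm_l2 :: "l2 \<Rightarrow> real" where "norm_l2 x = sqrt (inner x x)"
definition dist_l2 :: "l2 \<Rightarrow> l2 \<Rightarrow> real" where "dist_l2 x y = norm (x - y)"
definition sgn_l2 :: "l2 \<Rightarrow> l2" where "sgn_l2 x = scaleR (inverse (norm x)) x"
definition uniformity_l2 :: "(l2 \<times> l2) filter" where
  "uniformity_l2 = (INF e\<in>{0<..}. principal {(x, y). dist x y < e})"
definition open_l2 :: "l2 set \<Rightarrow> bool" where
  "open_l2 U \<longleftrightarrow> (\<forall>x\<in>U. eventually (\<lambda>(x', y). x' = x \<longrightarrow> y \<in> U) uniformity)"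

lemma fn_zero: "AE z in lebesgue. fn 0 z = 0"
  unfolding zero_l2_def by (rule fn_mk[OF sqint_zero])

lemma fn_add: "AE z in lebesgue. fn (x + y) z = fn x z + fn y z"
  unfolding plus_l2_def by (intro fn_mk sqint_add) auto

lemma fn_scaleR: "AE z in lebesgue. fn (c *\<^sub>R x) z = of_real c * fn x z"
  unfolding scaleR_l2_def by (intro fn_mk sqint_scale) auto

lemma fn_uminus: "AE z in lebesgue. fn (- x) z = - fn x z"
  unfolding uminus_l2_def using fn_mk[OF sqint_scale[OF sqint_fn, of "-1" x]] by simp

lemma l2_inner_integrable: "integrable lebesgue (\<lambda>z. fn x z * cnj (fn y z))"
  by (intro sqint_product) auto

lemma inner_self: "inner x x = (LINT z|lebesgue. (cmod (fn x z))\<^sup>2)" for x :: l2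
proof -
  have "inner x x = (LINT z|lebesgue. Re (fn x z * cnj (fn x z)))"
    unfolding inner_l2_def l2_inner_c_def by (rule integral_Re[symmetric, OF l2_inner_integrable])
  also have "(\<lambda>z. Re (fn x z * cnj (fn x z))) = (\<lambda>z. (cmod (fn x z))\<^sup>2)"
    unfolding cmod_power2 by (simp add: power2_eq_square)
  finally show ?thesis .
qed

instance
proof
  fix x y z :: l2 and a b c :: real
  show "x + y + z = x + (y + z)"
    by (rule l2_eqI) (use fn_add[of "x+y" z] fn_add[of x y] fn_add[of x "y+z"] fn_add[of y z] in
        \<open>eventually_elim, simp\<close>)
  show "x + y = y + x"
    by (rule l2_eqI) (use fn_add[of x y] fn_add[of y x] in \<open>eventually_elim, simp\<close>)
  show "0 + x = x"
    by (rule l2_eqI) (use fn_add[of 0 x] fn_zero in \<open>eventually_elim, simp\<close>)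
  show "- x + x = 0"
    by (rule l2_eqI) (use fn_add[of "-x" x] fn_uminus[of x] fn_zero in \<open>eventually_elim, simp\<close>)
  show "x - y = x + - y" by (simp add: minus_l2_def)
  show "a *\<^sub>R (x + y) = a *\<^sub>R x + a *\<^sub>R y"
    by (rule l2_eqI) (use fn_scaleR[of a "x+y"] fn_add[of x y] fn_add[of "a *\<^sub>R x" "a *\<^sub>R y"]
        fn_scaleR[of a x] fn_scaleR[of a y] in \<open>eventually_elim, simp add: distrib_left\<close>)
  show "(a + b) *\<^sub>R x = a *\<^sub>R x + b *\<^sub>R x"
    by (rule l2_eqI) (use fn_scaleR[of "a+b" x] fn_add[of "a *\<^sub>R x" "b *\<^sub>R x"]
        fn_scaleR[of a x] fn_scaleR[of b x] in \<open>eventually_elim, simp add: distrib_right\<close>)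
  show "a *\<^sub>R b *\<^sub>R x = (a * b) *\<^sub>R x"
    by (rule l2_eqI) (use fn_scaleR[of a "b *\<^sub>R x"] fn_scaleR[of b x] fn_scaleR[of "a*b" x]
        in \<open>eventually_elim, simp\<close>)
  show "1 *\<^sub>R x = x"
    by (rule l2_eqI) (use fn_scaleR[of 1 x] in \<open>eventually_elim, simp\<close>)
  show "dist x y = norm (x - y)" by (simp add: dist_l2_def)
  show "sgn x = scaleR (inverse (norm x)) x" by (simp add: sgn_l2_def)
  show "uniformity = (INF e\<in>{0<..}. principal {(x, y). dist x (y::l2) < e})"
    by (rule uniformity_l2_def)
  show "open U \<longleftrightarrow> (\<forall>x\<in>U. eventually (\<lambda>(x', y). x' = x \<longrightarrow> y \<in> U) uniformity)" for U :: "l2 set"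
    by (rule open_l2_def)
  have "l2_inner_c y x = cnj (l2_inner_c x y)"
    unfolding l2_inner_c_def using Bochner_Integration.integral_cnj[of lebesgue "\<lambda>z. fn x z * cnj (fn y z)"]
    by (simp add: mult.commute)
  then show "inner x y = inner y x" by (simp add: inner_l2_def)
  have "l2_inner_c (x + y) z = (LINT w|lebesgue. fn x w * cnj (fn z w) + fn y w * cnj (fn z w))"
    unfolding l2_inner_c_def
    by (rule integral_cong_AE) (measurable, use fn_add[of x y] in \<open>eventually_elim, simp add: distrib_right\<close>)
  then show "inner (x + y) z = inner x z + inner y z"
    unfolding inner_l2_def l2_inner_c_def by (simp add: l2_inner_integrable)
  have "l2_inner_c (a *\<^sub>R x) y = (LINT w|lebesgue. of_real a * (fn x w * cnj (fn y w)))"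
    unfolding l2_inner_c_def
    by (rule integral_cong_AE) (measurable, use fn_scaleR[of a x] in \<open>eventually_elim, simp\<close>)
  then show "inner (a *\<^sub>R x) y = a * inner x y"
    unfolding inner_l2_def l2_inner_c_def by simp
  show "0 \<le> inner x x" unfolding inner_self by simp
  show "inner x x = 0 \<longleftrightarrow> x = 0"
  proof
    assume "inner x x = 0"
    moreover have "integrable lebesgue (\<lambda>z. (cmod (fn x z))\<^sup>2)"
      using sqint_fn[of x] by (simp add: sqint_def)
    ultimately have "AE z in lebesgue. (cmod (fn x z))\<^sup>2 = 0"
      unfolding inner_self by (subst (asm) integral_nonneg_eq_0_iff_AE) auto
    then have ae: "AE z in lebesgue. fn x z = 0" by simp
    show "x = 0" by (rule l2_eqI) (use ae fn_zero in \<open>eventually_elim, simp\<close>)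
  next
    assume "x = 0"
    moreover have "(LINT z|lebesgue. (cmod (fn 0 z))\<^sup>2) = (LINT z|(lebesgue::(real\<times>real) measure). (0::real))"
      by (rule integral_cong_AE) (measurable, use fn_zero in \<open>eventually_elim, simp\<close>)
    ultimately show "inner x x = 0" unfolding inner_self by simp
  qed
  show "norm x = sqrt (inner x x)" by (rule norm_l2_def)
qed

end

lemma fn_diff: "AE z in lebesgue. fn (x - y) z = fn x z - fn y z"
  using fn_add[of x "-y"] fn_uminus[of y] by eventually_elim simp

lemma norm_square_l2: "(norm x)\<^sup>2 = (LINT z|lebesgue. (cmod (fn x z))\<^sup>2)" for x :: l2
  by (simp add: power2_norm_eq_inner inner_self)

lemma cmod_square_integrable: "integrable lebesgue (\<lambda>z. (cmod (fn x z))\<^sup>2)"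
  using sqint_fn[of x] by (simp add: sqint_def)

lemma nn_norm_square_l2: "(\<integral>\<^sup>+z. ennreal ((cmod (fn x z))\<^sup>2) \<partial>lebesgue) = ennreal ((norm x)\<^sup>2)"
  unfolding norm_square_l2 by (rule nn_integral_eq_integral[OF cmod_square_integrable]) simp

text \<open>The factor \<open>2\<^sup>k\<close> below makes the increments of the subsequence pointwise summable
  without Minkowski's inequality.\<close>

lemma fast_Cauchy_AE_convergent:
  fixes X :: "nat \<Rightarrow> l2"
  assumes fast: "\<And>k. norm (X (Suc k) - X k) \<le> (1/2) ^ k"
  shows "AE z in lebesgue. convergent (\<lambda>k. fn (X k) z)"
proof -
  define d where "d k = X (Suc k) - X k" for k
  have "(\<integral>\<^sup>+z. (\<Sum>k. ennreal (2 ^ k * (cmod (fn (d k) z))\<^sup>2)) \<partial>lebesgue)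
      = (\<Sum>k. \<integral>\<^sup>+z. ennreal (2 ^ k * (cmod (fn (d k) z))\<^sup>2) \<partial>lebesgue)"
    by (rule nn_integral_suminf) measurable
  also have "\<dots> = (\<Sum>k. ennreal (2 ^ k * (norm (d k))\<^sup>2))"
  proof (rule suminf_cong)
    fix k
    have "(\<integral>\<^sup>+z. ennreal (2 ^ k * (cmod (fn (d k) z))\<^sup>2) \<partial>lebesgue)
        = (\<integral>\<^sup>+z. ennreal (2 ^ k) * ennreal ((cmod (fn (d k) z))\<^sup>2) \<partial>lebesgue)"
      by (simp add: ennreal_mult)
    also have "\<dots> = ennreal (2 ^ k) * ennreal ((norm (d k))\<^sup>2)"
      by (subst nn_integral_cmult) (measurable, simp add: nn_norm_square_l2)
    finally show "(\<integral>\<^sup>+z. ennreal (2 ^ k * (cmod (fn (d k) z))\<^sup>2) \<partial>lebesgue)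
        = ennreal (2 ^ k * (norm (d k))\<^sup>2)" by (simp add: ennreal_mult)
  qed
  also have "\<dots> \<le> (\<Sum>k. ennreal ((1/2) ^ k))"
  proof (intro suminf_le ennreal_leI)
    fix k
    have "(norm (d k))\<^sup>2 \<le> ((1/2) ^ k)\<^sup>2" unfolding d_def by (intro power_mono fast) auto
    then have "2 ^ k * (norm (d k))\<^sup>2 \<le> 2 ^ k * ((1/2) ^ k)\<^sup>2" by simp
    also have "\<dots> = (1/2) ^ k" by (simp add: power2_eq_square power_divide)
    finally show "2 ^ k * (norm (d k))\<^sup>2 \<le> (1/2) ^ k" .
  qed auto
  also have "\<dots> = ennreal (\<Sum>k. (1/2) ^ k)"
    by (rule suminf_ennreal2) (auto intro: summable_geometric)
  also have "\<dots> < \<infinity>" by simp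
  finally have "(\<integral>\<^sup>+z. (\<Sum>k. ennreal (2 ^ k * (cmod (fn (d k) z))\<^sup>2)) \<partial>lebesgue) \<noteq> \<infinity>"
    by simp
  then have "AE z in lebesgue. (\<Sum>k. ennreal (2 ^ k * (cmod (fn (d k) z))\<^sup>2)) \<noteq> \<infinity>"
    by (rule nn_integral_PInf_AE[rotated]) measurable
  moreover have "AE z in lebesgue. \<forall>k. fn (d k) z = fn (X (Suc k)) z - fn (X k) z"
    unfolding AE_all_countable d_def by (intro allI fn_diff)
  ultimately show ?thesis
  proof eventually_elim
    fix z
    assume fin: "(\<Sum>k. ennreal (2 ^ k * (cmod (fn (d k) z))\<^sup>2)) \<noteq> \<infinity>"
      and dz: "\<forall>k. fn (d k) z = fn (X (Suc k)) z - fn (X k) z"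
    have "summable (\<lambda>k. 2 ^ k * (cmod (fn (d k) z))\<^sup>2)"
      by (rule summable_suminf_not_top) (use fin in auto)
    \<comment> \<open>Bounded weighted terms give |fn (d k) z| = O(2^(-k/2)), hence absolute
      convergence at z.\<close>
    then have "Bseq (\<lambda>k. 2 ^ k * (cmod (fn (d k) z))\<^sup>2)"
      by (intro convergent_imp_Bseq) (auto simp: convergent_def dest: summable_LIMSEQ_zero)
    then obtain C where C: "\<And>k. 2 ^ k * (cmod (fn (d k) z))\<^sup>2 \<le> C" "C > 0"
      unfolding Bseq_def by auto
    have "cmod (fn (d k) z) \<le> sqrt C * (sqrt (1/2)) ^ k" for k
    proof (rule power2_le_imp_le)
      have e: "((sqrt (1/2)) ^ k)\<^sup>2 = (1/2) ^ k"
        unfolding power2_eq_square power_mult_distrib[symmetric] by simp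
      have "(cmod (fn (d k) z))\<^sup>2 \<le> C * (1/2) ^ k"
        using C(1)[of k] by (simp add: field_simps power_divide)
      also have "\<dots> = (sqrt C * (sqrt (1/2)) ^ k)\<^sup>2"
        using C(2) e by (simp add: power_mult_distrib)
      finally show "(cmod (fn (d k) z))\<^sup>2 \<le> (sqrt C * (sqrt (1/2)) ^ k)\<^sup>2" .
    qed (use C in simp)
    then have "\<exists>N. \<forall>k\<ge>N. norm (fn (d k) z) \<le> sqrt C * (sqrt (1/2)) ^ k" by blast
    moreover have "summable (\<lambda>k. sqrt C * (sqrt (1/2)) ^ k)"
      by (intro summable_mult summable_geometric) (simp add: real_sqrt_divide)
    ultimately have "summable (\<lambda>k. fn (d k) z)" by (rule summable_comparison_test)
    then have "convergent (\<lambda>n. \<Sum>k<n. fn (d k) z)" by (simp add: summable_iff_convergent)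
    moreover have "(\<Sum>k<n. fn (d k) z) = fn (X n) z - fn (X 0) z" for n
      using dz sum_lessThan_telescope[of "\<lambda>k. fn (X k) z" n] by simp
    ultimately have "convergent (\<lambda>n. fn (X n) z - fn (X 0) z)" by simp
    then have "convergent (\<lambda>n. (fn (X n) z - fn (X 0) z) + fn (X 0) z)"
      by (intro convergent_add convergent_const)
    then show "convergent (\<lambda>k. fn (X k) z)" by simp
  qed
qed

instance l2 :: complete_space
proof
  fix X :: "nat \<Rightarrow> l2"
  assume X: "Cauchy X"
  have "\<exists>N. \<forall>m\<ge>N. \<forall>n\<ge>N. norm (X m - X n) < (1/2) ^ k" for k :: nat
    using CauchyD[OF X, of "(1/2) ^ k"] by simp
  then obtain N where N: "\<And>k m n. m \<ge> N k \<Longrightarrow> n \<ge> N k \<Longrightarrow> norm (X m - X n) < (1/2) ^ k"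
    by metis
  \<comment> \<open>The maximum makes \<open>r k\<close> admissible for every tolerance up to k at
    once, so consecutive terms of \<open>Y\<close> differ by at most
    \<open>(1/2) ^ k\<close>.\<close>
  define r where "r k = Max (N ` {..k})" for k
  have rN: "N j \<le> r k" if "j \<le> k" for j k unfolding r_def using that by simp
  define Y where "Y k = X (r k)" for k
  have YX: "norm (Y j - X m) < (1/2) ^ k" if "j \<ge> k" "m \<ge> N k" for j k m
    unfolding Y_def using N[OF rN[OF that(1)] that(2)] .
  have YY: "norm (Y (Suc k) - Y k) \<le> (1/2) ^ k" for k
    unfolding Y_def using N[of k "r (Suc k)" "r k"] rN[of k] by (simp add: less_imp_le)
  define f where "f z = lim (\<lambda>k. fn (Y k) z)" for z
  have fm [measurable]: "f \<in> borel_measurable lebesgue" unfolding f_def by measurable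
  have lim: "AE z in lebesgue. (\<lambda>k. fn (Y k) z) \<longlonglongrightarrow> f z"
    using fast_Cauchy_AE_convergent[OF YY] unfolding f_def
    by eventually_elim (simp add: convergent_LIMSEQ_iff)
  \<comment> \<open>Fatou's lemma along \<open>Y\<close>, which converges to \<open>f\<close> almost
    everywhere.\<close>
  have est: "(\<integral>\<^sup>+z. ennreal ((cmod (fn (X m) z - f z))\<^sup>2) \<partial>lebesgue) \<le> ennreal (((1/2) ^ k)\<^sup>2)"
    if m: "m \<ge> N k" for m k
  proof -
    have "AE z in lebesgue. \<forall>j. fn (X m - Y j) z = fn (X m) z - fn (Y j) z"
      unfolding AE_all_countable by (intro allI fn_diff)
    then have ae: "AE z in lebesgue. ennreal ((cmod (fn (X m) z - f z))\<^sup>2)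
        = liminf (\<lambda>j. ennreal ((cmod (fn (X m - Y j) z))\<^sup>2))"
      using lim
    proof eventually_elim
      fix z assume a: "\<forall>j. fn (X m - Y j) z = fn (X m) z - fn (Y j) z" and l: "(\<lambda>k. fn (Y k) z) \<longlonglongrightarrow> f z"
      have "(\<lambda>j. ennreal ((cmod (fn (X m) z - fn (Y j) z))\<^sup>2)) \<longlonglongrightarrow> ennreal ((cmod (fn (X m) z - f z))\<^sup>2)"
        by (intro tendsto_ennrealI tendsto_intros l)
      from lim_imp_Liminf[OF trivial_limit_sequentially this]
      show "ennreal ((cmod (fn (X m) z - f z))\<^sup>2) = liminf (\<lambda>j. ennreal ((cmod (fn (X m - Y j) z))\<^sup>2))"
        using a by simp
    qed
    have "(\<integral>\<^sup>+z. ennreal ((cmod (fn (X m) z - f z))\<^sup>2) \<partial>lebesgue)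
        = (\<integral>\<^sup>+z. liminf (\<lambda>j. ennreal ((cmod (fn (X m - Y j) z))\<^sup>2)) \<partial>lebesgue)"
      by (rule nn_integral_cong_AE[OF ae])
    also have "\<dots> \<le> liminf (\<lambda>j. \<integral>\<^sup>+z. ennreal ((cmod (fn (X m - Y j) z))\<^sup>2) \<partial>lebesgue)"
      by (rule nn_integral_liminf) measurable
    also have "\<dots> = liminf (\<lambda>j. ennreal ((norm (X m - Y j))\<^sup>2))" by (simp add: nn_norm_square_l2)
    also have "\<dots> \<le> ennreal (((1/2) ^ k)\<^sup>2)"
    proof (rule Liminf_le)
      show "\<forall>\<^sub>F j in sequentially. ennreal ((norm (X m - Y j))\<^sup>2) \<le> ennreal (((1/2) ^ k)\<^sup>2)"
        using eventually_ge_at_top[of k]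
      proof eventually_elim
        fix j assume "k \<le> j"
        then have "norm (X m - Y j) \<le> (1/2) ^ k" using YX[OF _ m] by (simp add: norm_minus_commute less_imp_le)
        then show "ennreal ((norm (X m - Y j))\<^sup>2) \<le> ennreal (((1/2) ^ k)\<^sup>2)"
          by (intro ennreal_leI power_mono) auto
      qed
    qed simp
    finally show ?thesis .
  qed
  have sq: "sqint lebesgue (\<lambda>z. fn (X m) z - f z)" if "m \<ge> N k" for m k
    unfolding sqint_def
  proof
    show "integrable lebesgue (\<lambda>z. (cmod (fn (X m) z - f z))\<^sup>2)"
    proof (rule integrableI_bounded)
      show "(\<integral>\<^sup>+ z. ennreal (norm ((cmod (fn (X m) z - f z))\<^sup>2)) \<partial>lebesgue) < \<infinity>"
        using est[OF that] by (simp add: le_less_trans[OF _ ennreal_less_top])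
    qed measurable
  qed measurable
  have sf: "sqint lebesgue f"
  proof -
    have "sqint lebesgue (\<lambda>z. fn (X (N 0)) z + -1 * (fn (X (N 0)) z - f z))"
      by (intro sqint_add sqint_scale sq[of 0]) auto
    then show ?thesis by simp
  qed
  have "X \<longlonglongrightarrow> mk f"
  proof (rule LIMSEQ_I)
    fix e :: real assume "0 < e"
    then obtain k where k: "(1/2 :: real) ^ k < e" using real_arch_pow_inv[of e "1/2"] by auto
    have "norm (X m - mk f) < e" if m: "m \<ge> N k" for m
    proof -
      have "ennreal ((norm (X m - mk f))\<^sup>2) = (\<integral>\<^sup>+z. ennreal ((cmod (fn (X m) z - f z))\<^sup>2) \<partial>lebesgue)"
        unfolding nn_norm_square_l2[symmetric]
        by (rule nn_integral_cong_AE)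
          (use fn_diff[of "X m" "mk f"] fn_mk[OF sf] in \<open>eventually_elim, simp\<close>)
      also have "\<dots> \<le> ennreal (((1/2) ^ k)\<^sup>2)" by (rule est[OF m])
      finally have "(norm (X m - mk f))\<^sup>2 \<le> ((1/2) ^ k)\<^sup>2" by (simp add: ennreal_le_iff)
      then have "norm (X m - mk f) \<le> (1/2) ^ k" by (rule power2_le_imp_le) simp
      then show ?thesis using k by simp
    qed
    then show "\<exists>no. \<forall>n\<ge>no. norm (X n - mk f) < e" by blast
  qed
  then show "convergent X" by (auto simp: convergent_def)
qed

section \<open>Multiplication, translation and restriction\<close>

lemma l2_inner_mk:
  assumes "sqint lebesgue f" "sqint lebesgue g"
  shows "inner (mk f) (mk g) = Re (LINT z|lebesgue. f z * cnj (g z))"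
proof -
  have [measurable]: "f \<in> borel_measurable lebesgue" "g \<in> borel_measurable lebesgue"
    using assms sqint_measurable by auto
  have "l2_inner_c (mk f) (mk g) = (LINT z|lebesgue. f z * cnj (g z))"
    unfolding l2_inner_c_def
    by (rule integral_cong_AE) (measurable, use fn_mk[OF assms(1)] fn_mk[OF assms(2)] in
        \<open>eventually_elim, simp\<close>)
  then show ?thesis by (simp add: inner_l2_def)
qed

lemma norm_le_of_cmod:
  assumes "AE z in lebesgue. cmod (fn x z) \<le> B * cmod (fn y z)" "0 \<le> B"
  shows "norm x \<le> B * norm y"
proof (rule power2_le_imp_le)
  have "(norm x)\<^sup>2 \<le> (LINT z|lebesgue. B\<^sup>2 * (cmod (fn y z))\<^sup>2)"
    unfolding norm_square_l2
  proof (rule integral_mono_AE[OF cmod_square_integrable])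
    show "integrable lebesgue (\<lambda>z. B\<^sup>2 * (cmod (fn y z))\<^sup>2)" using cmod_square_integrable by simp
    show "AE z in lebesgue. (cmod (fn x z))\<^sup>2 \<le> B\<^sup>2 * (cmod (fn y z))\<^sup>2"
      using assms(1)
    proof eventually_elim
      fix z assume "cmod (fn x z) \<le> B * cmod (fn y z)"
      then have "(cmod (fn x z))\<^sup>2 \<le> (B * cmod (fn y z))\<^sup>2" by (intro power_mono) auto
      then show "(cmod (fn x z))\<^sup>2 \<le> B\<^sup>2 * (cmod (fn y z))\<^sup>2" by (simp add: power_mult_distrib)
    qed
  qed
  also have "\<dots> = (B * norm y)\<^sup>2" by (simp add: norm_square_l2 power_mult_distrib)
  finally show "(norm x)\<^sup>2 \<le> (B * norm y)\<^sup>2" .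
qed (use assms in simp)

text \<open>Multipliers are measurable for the completed measure, so that indicators of arbitrary
  Lebesgue sets are included.\<close>

definition bm :: "(real \<times> real \<Rightarrow> complex) \<Rightarrow> bool" where
  "bm m \<longleftrightarrow> m \<in> borel_measurable lebesgue \<and> (\<exists>B. \<forall>z. cmod (m z) \<le> B)"

definition mul :: "(real \<times> real \<Rightarrow> complex) \<Rightarrow> l2 \<Rightarrow> l2" where
  "mul m x = mk (\<lambda>z. m z * fn x z)"

lemma bm_mult: "bm m \<Longrightarrow> bm n \<Longrightarrow> bm (\<lambda>z. m z * n z)"
proof -
  assume a: "bm m" "bm n"
  then obtain B C where BC: "\<And>z. cmod (m z) \<le> B" "\<And>z. cmod (n z) \<le> C" unfolding bm_def by blast
  have "cmod (m z * n z) \<le> B * C" for z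
    unfolding norm_mult using BC[of z] by (intro mult_mono) (auto intro: order_trans[OF norm_ge_zero])
  then show ?thesis using a unfolding bm_def by auto
qed

lemma bm_add: "bm m \<Longrightarrow> bm n \<Longrightarrow> bm (\<lambda>z. m z + n z)"
proof -
  assume a: "bm m" "bm n"
  then obtain B C where BC: "\<And>z. cmod (m z) \<le> B" "\<And>z. cmod (n z) \<le> C" unfolding bm_def by blast
  have "cmod (m z + n z) \<le> B + C" for z
    using norm_triangle_ineq[of "m z" "n z"] BC[of z] by linarith
  then show ?thesis using a unfolding bm_def by auto
qed

lemma bm_const [simp]: "bm (\<lambda>z. c)" unfolding bm_def by auto
lemma bm_cnj: "bm m \<Longrightarrow> bm (\<lambda>z. cnj (m z))" unfolding bm_def by auto
lemma bm_diff: "bm m \<Longrightarrow> bm n \<Longrightarrow> bm (\<lambda>z. m z - n z)"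
  using bm_add[of m "\<lambda>z. -1 * n z"] bm_mult[OF bm_const[of "-1"], of n] by simp
lemma bm_indicator: "S \<in> sets lebesgue \<Longrightarrow> bm (indicator S)"
  unfolding bm_def by (auto intro!: exI[of _ 1] simp: indicator_def)

lemma sqint_bm: "bm m \<Longrightarrow> sqint lebesgue (\<lambda>z. m z * fn x z)"
  unfolding bm_def using sqint_mult[OF sqint_fn] by blast

lemma fn_mul: "bm m \<Longrightarrow> AE z in lebesgue. fn (mul m x) z = m z * fn x z"
  unfolding mul_def by (rule fn_mk[OF sqint_bm])

lemma mul_add:
  assumes m: "bm m" shows "mul m (x + y) = mul m x + mul m y"
  by (rule l2_eqI) (use fn_mul[OF m, of "x+y"] fn_mul[OF m, of x] fn_mul[OF m, of y] fn_add[of x y]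
      fn_add[of "mul m x" "mul m y"] in \<open>eventually_elim, simp add: distrib_left\<close>)

lemma mul_scaleR:
  assumes m: "bm m" shows "mul m (c *\<^sub>R x) = c *\<^sub>R mul m x"
  by (rule l2_eqI) (use fn_mul[OF m, of "c *\<^sub>R x"] fn_mul[OF m, of x] fn_scaleR[of c x]
      fn_scaleR[of c "mul m x"] in \<open>eventually_elim, simp\<close>)

lemma mul_linear: "bm m \<Longrightarrow> linear (mul m)"
  by (auto intro!: linearI mul_add mul_scaleR)

lemma mul_diff: "bm m \<Longrightarrow> mul m (x - y) = mul m x - mul m y"
  by (rule linear_diff[OF mul_linear])

lemma mul_mul:
  assumes m: "bm m" and n: "bm n" shows "mul m (mul n x) = mul (\<lambda>z. m z * n z) x"
  by (rule l2_eqI) (use fn_mul[OF m, of "mul n x"] fn_mul[OF n, of x] fn_mul[OF bm_mult[OF m n], of x]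
      in \<open>eventually_elim, simp\<close>)

lemma mul_plus:
  assumes m: "bm m" and n: "bm n" shows "mul (\<lambda>z. m z + n z) x = mul m x + mul n x"
  by (rule l2_eqI) (use fn_mul[OF m, of x] fn_mul[OF n, of x] fn_mul[OF bm_add[OF m n], of x]
      fn_add[of "mul m x" "mul n x"] in \<open>eventually_elim, simp add: distrib_right\<close>)

lemma mul_minus:
  assumes m: "bm m" and n: "bm n" shows "mul (\<lambda>z. m z - n z) x = mul m x - mul n x"
  by (rule l2_eqI) (use fn_mul[OF m, of x] fn_mul[OF n, of x] fn_mul[OF bm_diff[OF m n], of x]
      fn_diff[of "mul m x" "mul n x"] in \<open>eventually_elim, simp add: left_diff_distrib\<close>)

lemma mul_commute: "bm m \<Longrightarrow> bm n \<Longrightarrow> mul m (mul n x) = mul n (mul m x)"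
  by (simp add: mul_mul mult.commute)

lemma mul_one [simp]: "mul (\<lambda>z. 1) x = x"
  by (rule l2_eqI) (use fn_mul[of "\<lambda>z. 1" x] in simp)

lemma mul_of_real: "mul (\<lambda>z. of_real c) x = c *\<^sub>R x"
  by (rule l2_eqI) (use fn_mul[OF bm_const[of "of_real c"], of x] fn_scaleR[of c x] in
      \<open>eventually_elim, simp\<close>)

lemma mul_zero [simp]: "mul (\<lambda>z. 0) x = 0"
  using mul_of_real[of 0 x] by simp

lemma inner_mul: "bm m \<Longrightarrow> inner (mul m x) y = inner x (mul (\<lambda>z. cnj (m z)) y)"
proof -
  assume m: "bm m"
  have "inner (mul m x) y = Re (LINT z|lebesgue. m z * fn x z * cnj (fn y z))"
    using l2_inner_mk[OF sqint_bm[OF m] sqint_fn[of y]] by (simp add: mul_def)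
  also have "\<dots> = Re (LINT z|lebesgue. fn x z * cnj (cnj (m z) * fn y z))" by (simp add: mult_ac)
  also have "\<dots> = inner x (mul (\<lambda>z. cnj (m z)) y)"
    using l2_inner_mk[OF sqint_fn[of x] sqint_bm[OF bm_cnj[OF m]], of y] by (simp add: mul_def)
  finally show ?thesis .
qed

lemma norm_mul_le:
  assumes "bm m" "\<And>z. cmod (m z) \<le> B"
  shows "norm (mul m x) \<le> B * norm x"
proof (rule norm_le_of_cmod)
  show "AE z in lebesgue. cmod (fn (mul m x) z) \<le> B * cmod (fn x z)"
    using fn_mul[OF assms(1), of x]
    by eventually_elim (simp add: norm_mult mult_right_mono assms(2))
  show "0 \<le> B" using assms(2)[of undefined] norm_ge_zero order_trans by blast
qed

definition ii :: "l2 \<Rightarrow> l2" where "ii = mul (\<lambda>z. \<i>)"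

lemma ii_linear: "linear ii" unfolding ii_def by (simp add: mul_linear)
lemma ii_isometry: "inner (ii x) (ii y) = inner x y"
  unfolding ii_def by (simp add: inner_mul mul_mul)
lemma ii_square: "ii (ii x) = - x"
  unfolding ii_def using mul_of_real[of "-1" x] by (simp add: mul_mul)
lemma mul_ii: "bm m \<Longrightarrow> mul m (ii x) = ii (mul m x)"
  unfolding ii_def by (rule mul_commute) auto

lemma l2_inner_c_eq: "l2_inner_c x y = Complex (inner x y) (inner x (ii y))"
proof -
  have "inner x (ii y) = Re (LINT z|lebesgue. fn x z * cnj (\<i> * fn y z))"
    using l2_inner_mk[OF sqint_fn[of x] sqint_bm[OF bm_const[of \<i>]], of y]
    by (simp add: ii_def mul_def)
  also have "(\<lambda>z. fn x z * cnj (\<i> * fn y z)) = (\<lambda>z. - \<i> * (fn x z * cnj (fn y z)))"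
    by (simp add: fun_eq_iff)
  finally have "inner x (ii y) = Re (- \<i> * l2_inner_c x y)"
    unfolding l2_inner_c_def by (simp del: mult_minus_left)
  then show ?thesis by (simp add: inner_l2_def complex_eq_iff)
qed

lemma cmod_l2_inner_c: "cmod (l2_inner_c x y) \<le> norm x * norm y"
proof (cases "l2_inner_c x y = 0")
  case False
  \<comment> \<open>A unimodular factor rotates the complex inner product onto the positive reals,
    where the real Cauchy-Schwarz inequality applies.\<close>
  define c where "c = cnj (l2_inner_c x y) / cmod (l2_inner_c x y)"
  have c1: "cmod c = 1" using False by (simp add: c_def norm_divide)
  have "c * l2_inner_c x y = of_real ((cmod (l2_inner_c x y))\<^sup>2) / of_real (cmod (l2_inner_c x y))"
    unfolding complex_norm_square by (simp add: c_def)
  then have "cmod (l2_inner_c x y) = Re (c * l2_inner_c x y)"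
    using False by (simp add: power2_eq_square)
  also have "c * l2_inner_c x y = l2_inner_c (mul (\<lambda>z. c) x) y"
  proof -
    have "l2_inner_c (mul (\<lambda>z. c) x) y = (LINT z|lebesgue. c * (fn x z * cnj (fn y z)))"
      unfolding l2_inner_c_def
      by (rule integral_cong_AE) (measurable, use fn_mul[OF bm_const[of c], of x] in
          \<open>eventually_elim, simp\<close>)
    then show ?thesis by (simp add: l2_inner_c_def)
  qed
  also have "Re \<dots> = inner (mul (\<lambda>z. c) x) y" by (simp add: inner_l2_def)
  also have "\<dots> \<le> norm (mul (\<lambda>z. c) x) * norm y" by (rule norm_cauchy_schwarz)
  also have "\<dots> \<le> norm x * norm y"
    using norm_mul_le[of "\<lambda>z. c" 1 x] c1 by (intro mult_right_mono) auto
  finally show ?thesis .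
qed simp

section \<open>Restriction to measurable sets\<close>

abbreviation cut :: "(real \<times> real) set \<Rightarrow> l2 \<Rightarrow> l2" where
  "cut S \<equiv> mul (indicator S)"

lemma inner_cut:
  assumes "S \<in> sets lebesgue" shows "inner (cut S x) y = inner x (cut S y)"
proof -
  have "(\<lambda>z. cnj (indicator S z)) = indicator S" by (auto simp: fun_eq_iff indicator_def)
  then show ?thesis using assms by (simp add: inner_mul bm_indicator)
qed

lemma cut_cut: "S \<in> sets lebesgue \<Longrightarrow> T \<in> sets lebesgue \<Longrightarrow> cut S (cut T x) = cut (S \<inter> T) x"
  by (simp add: mul_mul bm_indicator indicator_inter_arith[symmetric, abs_def])

lemma norm_cut_le: "S \<in> sets lebesgue \<Longrightarrow> norm (cut S x) \<le> norm x"
  using norm_mul_le[OF bm_indicator, of S 1 x] by (simp add: indicator_def)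

lemma norm_cut_mono:
  assumes "S \<in> sets lebesgue" "T \<in> sets lebesgue" "S \<subseteq> T"
  shows "norm (cut S x) \<le> norm (cut T x)"
  using norm_cut_le[OF assms(1), of "cut T x"] assms by (simp add: cut_cut Int_absorb2)

lemma norm_cut_square: "S \<in> sets lebesgue \<Longrightarrow> (norm (cut S x))\<^sup>2 = inner (cut S x) x"
  using inner_cut[of S "cut S x" x] cut_cut[of S S x] inner_commute
  by (simp add: power2_norm_eq_inner)

text \<open>Pythagoras: restrictions to disjoint sets are orthogonal.\<close>

lemma norm_cut_disjoint:
  fixes S :: "nat \<Rightarrow> (real \<times> real) set"
  assumes S: "\<And>k. S k \<in> sets lebesgue" "disjoint_family S"
  shows "(\<Sum>k<n. (norm (cut (S k) x))\<^sup>2) = (norm (cut (\<Union>k<n. S k) x))\<^sup>2"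
proof (induction n)
  case 0
  have "indicator {} = (\<lambda>z::real\<times>real. 0::complex)" by (intro ext) simp
  then have "cut {} x = 0" by simp
  then show ?case by simp
next
  case (Suc n)
  let ?A = "\<Union>k<n. S k"
  have A: "?A \<in> sets lebesgue" "?A \<union> S n \<in> sets lebesgue" using S(1) by auto
  have d: "z \<notin> S n" if "z \<in> ?A" for z
  proof -
    obtain k where k: "k < n" "z \<in> S k" using \<open>z \<in> ?A\<close> by blast
    then have "S k \<inter> S n = {}" using S(2) by (intro disjoint_family_onD[of S UNIV]) auto
    then show ?thesis using k by blast
  qed
  have "indicator (?A \<union> S n) = (\<lambda>z. indicator ?A z + indicator (S n) z :: complex)"
    using d by (intro ext) (auto simp: indicator_def)
  then have "cut (?A \<union> S n) x = cut ?A x + cut (S n) x"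
    using A S(1) by (simp add: mul_plus bm_indicator)
  then have "inner (cut (?A \<union> S n) x) x = inner (cut ?A x) x + inner (cut (S n) x) x"
    by (simp add: inner_add_left)
  then have "(norm (cut (?A \<union> S n) x))\<^sup>2 = (norm (cut ?A x))\<^sup>2 + (norm (cut (S n) x))\<^sup>2"
    unfolding norm_cut_square[OF A(1)] norm_cut_square[OF A(2)] norm_cut_square[OF S(1)] .
  then show ?case using Suc by (simp add: lessThan_Suc Un_commute)
qed

text \<open>The null set \<open>N\<close> makes room for the points of K, which lie on no line
  missing K. The overlap of S and T is assigned to S.\<close>

lemma norm_cut_Un:
  assumes "S \<in> sets lebesgue" "T \<in> sets lebesgue" "W \<in> sets lebesgue" "N \<in> null_sets lebesgue" "W \<subseteq> S \<union> T \<union> N"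
  shows "norm (cut W x) \<le> norm (cut S x) + norm (cut T x)"
proof -
  have N: "AE z in lebesgue. z \<notin> N" using assms(4) by (rule AE_not_in)
  have WS: "bm (indicator (W \<inter> S))" "bm (indicator (W \<inter> T - S))"
    using assms by (auto intro: bm_indicator)
  have "cut W x = cut (W \<inter> S) x + cut (W \<inter> T - S) x"
    by (rule l2_eqI) (use N fn_mul[OF bm_indicator[OF assms(3)], of x] fn_mul[OF WS(1), of x]
      fn_mul[OF WS(2), of x] fn_add[of "cut (W \<inter> S) x" "cut (W \<inter> T - S) x"] in
      \<open>eventually_elim, use assms(5) in \<open>auto simp: indicator_def\<close>\<close>)
  also have "norm \<dots> \<le> norm (cut (W \<inter> S) x) + norm (cut (W \<inter> T - S) x)" by (rule norm_triangle_ineq)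
  also have "\<dots> \<le> norm (cut S x) + norm (cut T x)"
    using assms by (intro add_mono norm_cut_mono) auto
  finally show ?thesis .
qed

section \<open>Translations\<close>

lemma lebesgue_distr_translation:
  fixes a :: "real \<times> real"
  shows "distr lebesgue lebesgue (\<lambda>z. a + z) = lebesgue" "(\<lambda>z. a + z) \<in> lebesgue \<rightarrow>\<^sub>M lebesgue"
proof -
  \<comment> \<open>A translation is the affine map with all coefficients 1, so the general
    transformation formula of Lebesgue measure applies.\<close>
  have T: "(\<lambda>x. a + (\<Sum>j\<in>Basis. (1 * (x \<bullet> j)) *\<^sub>R j)) = (\<lambda>z. a + z)"
    by (simp add: euclidean_representation)
  show "(\<lambda>z. a + z) \<in> lebesgue \<rightarrow>\<^sub>M lebesgue"
    using lebesgue_affine_measurable[of "\<lambda>_. 1" a] unfolding T by simp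
  have "lebesgue = density (distr lebesgue lebesgue (\<lambda>z. a + z)) (\<lambda>_. 1)"
    using lebesgue_affine_euclidean[of "\<lambda>_. 1" a] unfolding T by simp
  then show "distr lebesgue lebesgue (\<lambda>z. a + z) = lebesgue" by (simp add: density_1)
qed

lemma AE_translate:
  fixes a :: "real \<times> real"
  assumes "AE z in lebesgue. P z" shows "AE z in lebesgue. P (a + z)"
  using assms AE_distrD[OF lebesgue_distr_translation(2)] lebesgue_distr_translation(1) by metis

lemma integral_translate:
  fixes f :: "real \<times> real \<Rightarrow> 'b::{banach, second_countable_topology}"
  assumes "f \<in> borel_measurable lebesgue"
  shows "(LINT z|lebesgue. f (a + z)) = (LINT z|lebesgue. f z)"
  using integral_distr[OF lebesgue_distr_translation(2) assms, of a] lebesgue_distr_translation(1)[of a]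
  by simp

lemma sqint_translate:
  fixes a :: "real \<times> real"
  assumes "sqint lebesgue f" shows "sqint lebesgue (\<lambda>z. f (a + z))"
proof -
  have f: "f \<in> borel_measurable lebesgue" "integrable lebesgue (\<lambda>z. (cmod (f z))\<^sup>2)"
    using assms by (auto simp: sqint_def)
  have "integrable (distr lebesgue lebesgue (\<lambda>z. a + z)) (\<lambda>z. (cmod (f z))\<^sup>2)"
    using f lebesgue_distr_translation(1)[of a] by simp
  then show ?thesis
    unfolding sqint_def using measurable_compose[OF lebesgue_distr_translation(2) f(1)]
    by (auto intro: integrable_distr[OF lebesgue_distr_translation(2)])
qed

definition tr :: "real \<times> real \<Rightarrow> l2 \<Rightarrow> l2" where "tr a x = mk (\<lambda>z. fn x (a + z))"

lemma fn_tr: "AE z in lebesgue. fn (tr a x) z = fn x (a + z)"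
  unfolding tr_def by (rule fn_mk[OF sqint_translate[OF sqint_fn]])

lemma tr_mk:
  assumes f: "sqint lebesgue f" shows "tr a (mk f) = mk (\<lambda>z. f (a + z))"
  by (rule l2_eqI) (use fn_tr[of a "mk f"] AE_translate[OF fn_mk[OF f], of a]
      fn_mk[OF sqint_translate[OF f], of a] in \<open>eventually_elim, simp\<close>)

lemma tr_add: "tr a (x + y) = tr a x + tr a y"
  by (rule l2_eqI) (use fn_tr[of a "x+y"] fn_tr[of a x] fn_tr[of a y] AE_translate[OF fn_add[of x y], of a]
      fn_add[of "tr a x" "tr a y"] in \<open>eventually_elim, simp\<close>)

lemma tr_scaleR: "tr a (c *\<^sub>R x) = c *\<^sub>R tr a x"
  by (rule l2_eqI) (use fn_tr[of a "c *\<^sub>R x"] fn_tr[of a x] AE_translate[OF fn_scaleR[of c x], of a]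
      fn_scaleR[of c "tr a x"] in \<open>eventually_elim, simp\<close>)

lemma tr_linear: "linear (tr a)" by (auto intro!: linearI tr_add tr_scaleR)

lemma tr_diff: "tr a (x - y) = tr a x - tr a y" by (rule linear_diff[OF tr_linear])

lemma tr_tr: "tr a (tr b x) = tr (a + b) x"
  by (rule l2_eqI) (use fn_tr[of a "tr b x"] AE_translate[OF fn_tr[of b x], of a] fn_tr[of "a+b" x]
      in \<open>eventually_elim, simp add: add_ac\<close>)

lemma tr_0 [simp]: "tr 0 x = x"
  unfolding tr_def by simp

lemma tr_isometry: "inner (tr a x) (tr a y) = inner x y"
proof -
  have [measurable]: "(\<lambda>z. fn x (a + z)) \<in> borel_measurable lebesgue" for a x
    using sqint_measurable[OF sqint_translate[OF sqint_fn]] .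
  have "inner (tr a x) (tr a y) = Re (LINT z|lebesgue. fn x (a + z) * cnj (fn y (a + z)))"
    unfolding tr_def by (intro l2_inner_mk sqint_translate sqint_fn)
  also have "\<dots> = inner x y"
    unfolding inner_l2_def l2_inner_c_def
    using integral_translate[of "\<lambda>z. fn x z * cnj (fn y z)" a] by simp
  finally show ?thesis .
qed

lemma norm_tr [simp]: "norm (tr a x) = norm x"
  by (simp add: norm_eq_sqrt_inner tr_isometry)

lemma inner_tr: "inner (tr a x) y = inner x (tr (- a) y)"
  using tr_isometry[of "-a" "tr a x" y] by (simp add: tr_tr)

lemma bm_translate: "bm m \<Longrightarrow> bm (\<lambda>z. m (a + z))"
  unfolding bm_def using measurable_compose[OF lebesgue_distr_translation(2)] by blast

lemma tr_mul:
  assumes m: "bm m" shows "tr a (mul m x) = mul (\<lambda>z. m (a + z)) (tr a x)"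
  by (rule l2_eqI) (use fn_tr[of a "mul m x"] AE_translate[OF fn_mul[OF m, of x], of a] fn_tr[of a x]
      fn_mul[OF bm_translate[OF m], of a "tr a x"] in \<open>eventually_elim, simp\<close>)

section \<open>The subspace of functions vanishing outside a set\<close>

definition VV :: "(real \<times> real) set \<Rightarrow> l2 set" where "VV U = {x. cut U x = x}"

lemma VV_iff:
  assumes "U \<in> sets lebesgue"
  shows "x \<in> VV U \<longleftrightarrow> (AE z in lebesgue. z \<notin> U \<longrightarrow> fn x z = 0)"
proof -
  have "x \<in> VV U \<longleftrightarrow> (AE z in lebesgue. fn (cut U x) z = fn x z)"
    unfolding VV_def by (simp add: l2_eq_iff)
  also have "\<dots> \<longleftrightarrow> (AE z in lebesgue. z \<notin> U \<longrightarrow> fn x z = 0)"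
    using fn_mul[OF bm_indicator[OF assms], of x]
    by (intro iffI; elim AE_mp) (auto elim!: eventually_mono simp: indicator_def split: if_splits)
  finally show ?thesis .
qed

lemma bounded_linear_mul: "bm m \<Longrightarrow> bounded_linear (mul m)"
proof -
  assume m: "bm m"
  then obtain B where B: "\<And>z. cmod (m z) \<le> B" unfolding bm_def by blast
  show ?thesis
    by (rule bounded_linear_intro[where K = B])
      (use norm_mul_le[OF m B] in \<open>auto simp: mul_add mul_scaleR m mult.commute\<close>)
qed

lemma VV_subspace: "U \<in> sets lebesgue \<Longrightarrow> subspace (VV U)"
  unfolding VV_def by (rule subspaceI) (auto simp: bm_indicator mul_add mul_scaleR linear_0[OF mul_linear])

lemma VV_closed: "U \<in> sets lebesgue \<Longrightarrow> closed (VV U)"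
  unfolding VV_def
  by (intro closed_Collect_eq continuous_on_id linear_continuous_on bounded_linear_mul bm_indicator)

text \<open>This is the identification of L^2 on \<Omega> - K with L^2 on \<Omega>: a condition
  almost everywhere does not see a null set.\<close>

lemma VV_null:
  assumes "U \<in> sets lebesgue" "N \<in> null_sets lebesgue"
  shows "VV (U - N) = VV U"
proof -
  have N: "AE z in lebesgue. z \<notin> N" using assms(2) by (rule AE_not_in)
  have "U - N \<in> sets lebesgue" using assms by auto
  then have "x \<in> VV (U - N) \<longleftrightarrow> x \<in> VV U" for x
    unfolding VV_iff[OF assms(1)] VV_iff[OF \<open>U - N \<in> sets lebesgue\<close>]
    by (intro iffI; elim AE_mp) (use N in \<open>auto elim!: eventually_mono\<close>)
  then show ?thesis by blast
qed

lemma mul_VV: "U \<in> sets lebesgue \<Longrightarrow> bm m \<Longrightarrow> x \<in> VV U \<Longrightarrow> mul m x \<in> VV U"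
  unfolding VV_def using mul_commute[of "indicator U" m x] by (simp add: bm_indicator)

text \<open>Extension by zero, which maps the carrier isometrically onto
  \<open>VV U\<close>.\<close>

definition emb :: "(real \<times> real) set \<Rightarrow> (real \<times> real \<Rightarrow> complex) set \<Rightarrow> l2" where
  "emb U F = mk (\<lambda>z. indicator U z *\<^sub>R rep F z)"

context
  fixes U :: "(real \<times> real) set"
  assumes U: "U \<in> sets lebesgue"
begin

lemma scaleR_indicator: "indicator S z *\<^sub>R w = indicator S z * w" for w :: complex
  by (simp add: indicator_def)

lemma U_sets: "U \<inter> space lebesgue \<in> sets lebesgue" using U by simp

lemma sqint_restrict:
  "sqint (lebesgue_on U) f \<longleftrightarrow> sqint lebesgue (\<lambda>z. indicator U z *\<^sub>R f z)"
proof -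
  have "(\<lambda>z. indicator U z *\<^sub>R (cmod (f z))\<^sup>2) = (\<lambda>z. (cmod (indicator U z *\<^sub>R f z))\<^sup>2)"
    by (auto simp: fun_eq_iff indicator_def)
  then show ?thesis
    unfolding sqint_def borel_measurable_restrict_space_iff[OF U_sets] integrable_restrict_space[OF U_sets]
    by simp
qed

lemma fn_emb:
  "F \<in> hcarrier (L2_on U) \<Longrightarrow> AE z in lebesgue. fn (emb U F) z = indicator U z *\<^sub>R rep F z"
  unfolding emb_def using rep_sqint(1) sqint_restrict by (blast intro: fn_mk)

lemma AE_restrict: "(AE z in lebesgue_on U. P z) \<longleftrightarrow> (AE z in lebesgue. z \<in> U \<longrightarrow> P z)"
  using AE_restrict_space_iff[OF U_sets] .

lemma emb_eqI:
  assumes "F \<in> hcarrier (L2_on U)" "AE z in lebesgue. z \<in> U \<longrightarrow> rep F z = fn x z"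
    "AE z in lebesgue. z \<notin> U \<longrightarrow> fn x z = 0"
  shows "emb U F = x"
  by (rule l2_eqI) (use fn_emb[OF assms(1)] assms(2,3) in \<open>eventually_elim, auto simp: indicator_def\<close>)

lemma emb_VV:
  assumes "F \<in> hcarrier (L2_on U)" shows "emb U F \<in> VV U"
  unfolding VV_iff[OF U] using fn_emb[OF assms] by eventually_elim simp

lemma emb_ae_class:
  assumes "sqint (lebesgue_on U) f"
  shows "emb U (ae_class (lebesgue_on U) f) = mk (\<lambda>z. indicator U z *\<^sub>R f z)"
proof (rule emb_eqI[OF ae_class_in[OF assms]])
  have s: "sqint lebesgue (\<lambda>z. indicator U z *\<^sub>R f z)" using assms sqint_restrict by simp
  show "AE z in lebesgue. z \<in> U \<longrightarrow> rep (ae_class (lebesgue_on U) f) z = fn (mk (\<lambda>z. indicator U z *\<^sub>R f z)) z"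
    using rep_AE[OF assms] fn_mk[OF s] unfolding AE_restrict by eventually_elim simp
  show "AE z in lebesgue. z \<notin> U \<longrightarrow> fn (mk (\<lambda>z. indicator U z *\<^sub>R f z)) z = 0"
    using fn_mk[OF s] by eventually_elim simp
qed

lemma emb_surj:
  assumes "x \<in> VV U"
  shows "ae_class (lebesgue_on U) (fn x) \<in> hcarrier (L2_on U)" "emb U (ae_class (lebesgue_on U) (fn x)) = x"
proof -
  have "sqint lebesgue (\<lambda>z. indicator U z * fn x z)" using sqint_bm[OF bm_indicator[OF U]] .
  then have s: "sqint (lebesgue_on U) (fn x)" unfolding sqint_restrict by (simp add: scaleR_indicator)
  then show "ae_class (lebesgue_on U) (fn x) \<in> hcarrier (L2_on U)" by (rule ae_class_in)
  show "emb U (ae_class (lebesgue_on U) (fn x)) = x"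
    unfolding emb_ae_class[OF s] using assms by (simp add: VV_def mul_def scaleR_indicator)
qed

lemma emb_range: "emb U ` hcarrier (L2_on U) = VV U"
  using emb_VV emb_surj by (auto simp: image_iff) metis

lemma emb_inj: "inj_on (emb U) (hcarrier (L2_on U))"
proof (rule inj_onI)
  fix F G assume FG: "F \<in> hcarrier (L2_on U)" "G \<in> hcarrier (L2_on U)" "emb U F = emb U G"
  have "AE z in lebesgue. z \<in> U \<longrightarrow> rep F z = rep G z"
    using fn_emb[OF FG(1)] fn_emb[OF FG(2)] unfolding FG(3) by eventually_elim auto
  then show "F = G" using L2_eqI[OF FG(1,2)] unfolding AE_restrict by blast
qed

lemma hinner_emb:
  assumes "F \<in> hcarrier (L2_on U)" "G \<in> hcarrier (L2_on U)"
  shows "hinner (L2_on U) F G = l2_inner_c (emb U F) (emb U G)"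
proof -
  have m: "(\<lambda>z. indicator U z *\<^sub>R rep F z) \<in> borel_measurable lebesgue"
      "(\<lambda>z. indicator U z *\<^sub>R rep G z) \<in> borel_measurable lebesgue"
    using assms rep_sqint(1) sqint_restrict sqint_measurable by blast+
  have "hinner (L2_on U) F G = (LINT z|lebesgue. indicator U z *\<^sub>R (rep F z * cnj (rep G z)))"
    unfolding L2_inner by (rule integral_restrict_space[OF U_sets])
  also have "\<dots> = (LINT z|lebesgue. (indicator U z *\<^sub>R rep F z) * cnj (indicator U z *\<^sub>R rep G z))"
    by (rule Bochner_Integration.integral_cong) (auto simp: indicator_def)
  also have "\<dots> = l2_inner_c (emb U F) (emb U G)"
    unfolding l2_inner_c_def
  proof (rule integral_cong_AE)
    show "(\<lambda>z. indicator U z *\<^sub>R rep F z * cnj (indicator U z *\<^sub>R rep G z)) \<in> borel_measurable lebesgue"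
      by (intro borel_measurable_times borel_measurable_cnj m)
    show "AE z in lebesgue. indicator U z *\<^sub>R rep F z * cnj (indicator U z *\<^sub>R rep G z)
        = fn (emb U F) z * cnj (fn (emb U G) z)"
      using fn_emb[OF assms(1)] fn_emb[OF assms(2)] by eventually_elim simp
  qed measurable
  finally show ?thesis .
qed

lemma hilbert_rep_L2_on: "hilbert_rep (L2_on U) (emb U) ii"
proof
  show "inj_on (emb U) (hcarrier (L2_on U))" by (rule emb_inj)
  show "closed (emb U ` hcarrier (L2_on U))" unfolding emb_range by (rule VV_closed[OF U])
  show "hcarrier (L2_on U) \<noteq> {}" using ae_class_in[OF sqint_zero] by blast
  fix F G assume FG: "F \<in> hcarrier (L2_on U)" "G \<in> hcarrier (L2_on U)"
  show "hadd (L2_on U) F G \<in> hcarrier (L2_on U)" by (rule L2_add(1)[OF FG])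
  show "emb U (hadd (L2_on U) F G) = emb U F + emb U G"
    by (rule l2_eqI) (use fn_emb[OF L2_add(1)[OF FG]] L2_add(2)[OF FG, unfolded AE_restrict]
      fn_emb[OF FG(1)] fn_emb[OF FG(2)] fn_add[of "emb U F" "emb U G"] in
      \<open>eventually_elim, auto simp: indicator_def\<close>)
  show "hinner (L2_on U) F G = Complex (inner (emb U F) (emb U G)) (inner (emb U F) (ii (emb U G)))"
    using hinner_emb[OF FG] l2_inner_c_eq by simp
next
  fix F c assume F: "F \<in> hcarrier (L2_on U)"
  show "hscale (L2_on U) c F \<in> hcarrier (L2_on U)" by (rule L2_scale(1)[OF F])
  have "emb U (hscale (L2_on U) c F) = mul (\<lambda>z. c) (emb U F)"
    by (rule l2_eqI) (use fn_emb[OF L2_scale(1)[OF F], of c] L2_scale(2)[OF F, of c, unfolded AE_restrict]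
      fn_emb[OF F] fn_mul[OF bm_const[of c], of "emb U F"] in
      \<open>eventually_elim, auto simp: indicator_def\<close>)
  also have "\<dots> = mul (\<lambda>z. of_real (Re c) + of_real (Im c) * \<i>) (emb U F)"
    by (rule arg_cong[where f = "\<lambda>m. mul m (emb U F)"]) (simp add: fun_eq_iff complex_eq_iff)
  also have "\<dots> = mul (\<lambda>z. of_real (Re c)) (emb U F) + mul (\<lambda>z. of_real (Im c)) (mul (\<lambda>z. \<i>) (emb U F))"
    by (subst mul_plus) (auto simp: bm_mult mul_mul)
  also have "\<dots> = Re c *\<^sub>R emb U F + Im c *\<^sub>R ii (emb U F)"
    unfolding ii_def mul_of_real ..
  finally show "emb U (hscale (L2_on U) c F) = Re c *\<^sub>R emb U F + Im c *\<^sub>R ii (emb U F)" .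
qed (auto simp: linear_add[OF ii_linear] linear_scale[OF ii_linear] ii_isometry ii_square)

end

section \<open>Smooth cutoff functions\<close>

text \<open>A derivative determines its coefficients, so the witnesses of the coinductive rule must
  be the directional derivatives.\<close>

lemma smoothE:
  assumes "smooth f"
  shows "(f has_derivative (\<lambda>h. directional_deriv h f z)) (at z)"
    "directional_deriv h f z = fst h * directional_deriv (1, 0) f z + snd h * directional_deriv (0, 1) f z"
    "smooth (directional_deriv (1, 0) f)" "smooth (directional_deriv (0, 1) f)"
proof -
  obtain X Y where d: "\<And>z. (f has_derivative (\<lambda>h. fst h * X z + snd h * Y z)) (at z)"
    and XY: "smooth X" "smooth Y"
  proof (rule smooth.cases[OF assms])
    fix \<phi> \<phi>x \<phi>y
    assume a: "f = \<phi>" "\<And>z. (\<phi> has_derivative (\<lambda>h. fst h * \<phi>x z + snd h * \<phi>y z)) (at z)"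
      "smooth \<phi>x" "smooth \<phi>y"
    show thesis by (rule that[OF _ a(3,4)]) (simp only: a(1), rule a(2))
  qed
  have D: "directional_deriv h f z = fst h * X z + snd h * Y z" for h z
    unfolding directional_deriv_def by (rule fun_cong[OF frechet_derivative_at[OF d], symmetric])
  then have e: "directional_deriv (1, 0) f = X" "directional_deriv (0, 1) f = Y" by (auto simp: fun_eq_iff)
  show "(f has_derivative (\<lambda>h. directional_deriv h f z)) (at z)"
    "directional_deriv h f z = fst h * directional_deriv (1, 0) f z + snd h * directional_deriv (0, 1) f z"
    "smooth (directional_deriv (1, 0) f)" "smooth (directional_deriv (0, 1) f)"
    unfolding e D by (rule d XY refl)+
qed

lemma smooth_has_derivative:
  assumes "smooth f"
  shows "(f has_derivative
     (\<lambda>h. fst h * directional_deriv (1, 0) f z + snd h * directional_deriv (0, 1) f z)) (at z)"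
  by (rule has_derivative_eq_rhs[OF smoothE(1)[OF assms]], rule ext, rule smoothE(2)[OF assms])

lemma directional_deriv_eq:
  "(f has_derivative f') (at z) \<Longrightarrow> directional_deriv h f z = f' h"
  unfolding directional_deriv_def by (rule fun_cong[OF frechet_derivative_at, symmetric])

lemma smooth_continuous: "smooth f \<Longrightarrow> continuous_on S f"
  by (intro continuous_at_imp_continuous_on ballI has_derivative_continuous[OF smoothE(1)])

text \<open>Coinduction needs a class of functions closed under both partial derivatives. By
  Leibniz, single products do not form one, but finite sums of products do; the sum and the product
  of two functions are special lists.\<close>

lemma smooth_sum_list_prod:
  "(\<And>f g. (f, g) \<in> set ps \<Longrightarrow> smooth f \<and> smooth g) \<Longrightarrow> smooth (\<lambda>z. \<Sum>(f, g)\<leftarrow>ps. f z * g z)"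
proof (coinduction arbitrary: ps)
  case (smooth ps)
  define L where "L e = concat (map (\<lambda>(f, g). [(directional_deriv e f, g), (f, directional_deriv e g)]) ps)"
    for e :: "real \<times> real"
  have L: "(\<Sum>(f, g)\<leftarrow>L e. f z * g z) = (\<Sum>(f, g)\<leftarrow>ps. directional_deriv e f z * g z + f z * directional_deriv e g z)"
    for e z
    unfolding L_def by (induction ps) auto
  have Ls: "smooth f \<and> smooth g" if "(f, g) \<in> set (L e)" "e = (1, 0) \<or> e = (0, 1)" for f g e
    using that smooth smoothE(3,4) unfolding L_def by fastforce
  have "((\<lambda>z. \<Sum>(f, g)\<leftarrow>qs. f z * g z) has_derivative
      (\<lambda>h. fst h * (\<Sum>(f, g)\<leftarrow>qs. directional_deriv (1, 0) f z * g z + f z * directional_deriv (1, 0) g z)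
         + snd h * (\<Sum>(f, g)\<leftarrow>qs. directional_deriv (0, 1) f z * g z + f z * directional_deriv (0, 1) g z))) (at z)"
    if "set qs \<subseteq> set ps" for z qs
    using that
  proof (induction qs)
    case (Cons p qs)
    obtain f g where p: "p = (f, g)" by fastforce
    have fg: "smooth f" "smooth g" using Cons.prems smooth p by auto
    have IH: "((\<lambda>z. \<Sum>(f, g)\<leftarrow>qs. f z * g z) has_derivative
      (\<lambda>h. fst h * (\<Sum>(f, g)\<leftarrow>qs. directional_deriv (1, 0) f z * g z + f z * directional_deriv (1, 0) g z)
         + snd h * (\<Sum>(f, g)\<leftarrow>qs. directional_deriv (0, 1) f z * g z + f z * directional_deriv (0, 1) g z))) (at z)"
      using Cons by simp
    show ?case unfolding p
      by (simp, rule has_derivative_eq_rhs[OF has_derivative_add[OF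
            has_derivative_mult[OF smooth_has_derivative[OF fg(1)] smooth_has_derivative[OF fg(2)]] IH]])
         (simp add: algebra_simps)
  qed simp
  from this[OF order_refl] have der: "((\<lambda>z. \<Sum>(f, g)\<leftarrow>ps. f z * g z) has_derivative
      (\<lambda>h. fst h * (\<Sum>(f, g)\<leftarrow>L (1, 0). f z * g z) + snd h * (\<Sum>(f, g)\<leftarrow>L (0, 1). f z * g z))) (at z)" for z
    unfolding L .
  show ?case
  proof (rule exI[of _ "\<lambda>z. \<Sum>(f, g)\<leftarrow>ps. f z * g z"], rule exI[of _ "\<lambda>z. \<Sum>(f, g)\<leftarrow>L (1,0). f z * g z"],
      rule exI[of _ "\<lambda>z. \<Sum>(f, g)\<leftarrow>L (0,1). f z * g z"], intro conjI refl allI der disjI1)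
    show "\<exists>ps. (\<lambda>z. \<Sum>(f, g)\<leftarrow>L (1, 0). f z * g z) = (\<lambda>z. \<Sum>(f, g)\<leftarrow>ps. f z * g z) \<and>
         (\<forall>f g. (f, g) \<in> set ps \<longrightarrow> smooth f \<and> smooth g)"
      using Ls[of _ _ "(1, 0)"] by (intro exI[of _ "L (1,0)"]) simp
    show "\<exists>ps. (\<lambda>z. \<Sum>(f, g)\<leftarrow>L (0, 1). f z * g z) = (\<lambda>z. \<Sum>(f, g)\<leftarrow>ps. f z * g z) \<and>
         (\<forall>f g. (f, g) \<in> set ps \<longrightarrow> smooth f \<and> smooth g)"
      using Ls[of _ _ "(0, 1)"] by (intro exI[of _ "L (0,1)"]) simp
  qed
qed

lemma smooth_const [simp]: "smooth (\<lambda>z. c)"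
proof (coinduction arbitrary: c)
  case smooth
  show ?case
    by (rule exI[of _ "\<lambda>z. c"], rule exI[of _ "\<lambda>z. 0"], rule exI[of _ "\<lambda>z. 0"]) auto
qed

lemma smooth_mult:
  assumes "smooth f" "smooth g" shows "smooth (\<lambda>z. f z * g z)"
proof -
  have "smooth (\<lambda>z. \<Sum>(f, g)\<leftarrow>[(f, g)]. f z * g z)"
    by (rule smooth_sum_list_prod) (use assms in auto)
  then show ?thesis by simp
qed

lemma smooth_add:
  assumes "smooth f" "smooth g" shows "smooth (\<lambda>z. f z + g z)"
proof -
  have "smooth (\<lambda>z. \<Sum>(f, g)\<leftarrow>[(f, \<lambda>z. 1), (g, \<lambda>z. 1)]. f z * g z)"
    by (rule smooth_sum_list_prod) (use assms in auto)
  then show ?thesis by simp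
qed

lemma smooth_cmult: "smooth f \<Longrightarrow> smooth (\<lambda>z. c * f z)"
  by (rule smooth_mult) auto

lemma smooth_diff: "smooth f \<Longrightarrow> smooth g \<Longrightarrow> smooth (\<lambda>z. f z - g z)"
  using smooth_add[OF _ smooth_cmult[of g "-1"], of f] by simp

lemma smooth_directional_deriv: "smooth f \<Longrightarrow> smooth (directional_deriv h f)"
proof -
  assume f: "smooth f"
  have "directional_deriv h f = (\<lambda>z. fst h * directional_deriv (1, 0) f z + snd h * directional_deriv (0, 1) f z)"
    by (intro ext smoothE(2)[OF f])
  then show ?thesis using f by (simp add: smooth_add smooth_cmult smoothE(3,4))
qed

lemma has_derivative_shift: "((\<lambda>z. a + z) has_derivative (\<lambda>h. h)) (at z)"
  by (rule has_derivative_eq_rhs[OF has_derivative_add[OF has_derivative_const has_derivative_ident]]) simp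

lemma directional_deriv_translate:
  assumes "smooth f"
  shows "directional_deriv h (\<lambda>z. f (a + z)) = (\<lambda>z. directional_deriv h f (a + z))"
proof
  fix z
  have "((\<lambda>z. f (a + z)) has_derivative (\<lambda>h. directional_deriv h f (a + z))) (at z)"
    by (rule has_derivative_compose[OF has_derivative_shift smoothE(1)[OF assms]])
  from directional_deriv_eq[OF this]
  show "directional_deriv h (\<lambda>z. f (a + z)) z = directional_deriv h f (a + z)" .
qed

lemma smooth_translate:
  assumes "smooth f" shows "smooth (\<lambda>z. f (a + z))"
  using assms
proof (coinduction arbitrary: f)
  case (smooth f)
  have "((\<lambda>z. f (a + z)) has_derivative (\<lambda>h. directional_deriv h f (a + z))) (at z)" for z
    by (rule has_derivative_compose[OF has_derivative_shift smoothE(1)[OF smooth]])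
  then have "((\<lambda>z. f (a + z)) has_derivative (\<lambda>h. fst h * directional_deriv (1, 0) f (a + z)
      + snd h * directional_deriv (0, 1) f (a + z))) (at z)" for z
    by (rule has_derivative_eq_rhs, intro ext smoothE(2)[OF smooth])
  then show ?case using smoothE(3,4)[OF smooth]
    by - (rule exI[of _ "\<lambda>z. f (a + z)"], rule exI[of _ "\<lambda>z. directional_deriv (1, 0) f (a + z)"],
        rule exI[of _ "\<lambda>z. directional_deriv (0, 1) f (a + z)"], blast)
qed

lemma directional_deriv_mult:
  assumes "smooth f" "smooth g"
  shows "directional_deriv h (\<lambda>z. f z * g z) = (\<lambda>z. directional_deriv h f z * g z + f z * directional_deriv h g z)"
proof
  fix z
  show "directional_deriv h (\<lambda>z. f z * g z) z = directional_deriv h f z * g z + f z * directional_deriv h g z"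
    by (subst directional_deriv_eq[OF has_derivative_mult[OF smoothE(1)[OF assms(1)] smoothE(1)[OF assms(2)]]]) simp
qed

lemma directional_deriv_1_minus:
  assumes "smooth f"
  shows "directional_deriv h (\<lambda>z. 1 - f z) = (\<lambda>z. - directional_deriv h f z)"
proof
  fix z
  show "directional_deriv h (\<lambda>z. 1 - f z) z = - directional_deriv h f z"
    by (subst directional_deriv_eq[OF has_derivative_diff[OF has_derivative_const smoothE(1)[OF assms]]]) simp
qed

text \<open>The polynomial parameter makes the family closed under differentiation, as the
  coinduction for smoothness requires; \<open>p = 1\<close> is the classical flat function
  exp(-1/t).\<close>

definition flat_exp :: "real poly \<Rightarrow> real \<Rightarrow> real" where
  "flat_exp p t = (if t > 0 then poly p (1/t) * exp (- (1/t)) else 0)"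

lemma poly_div_exp_tendsto_0: "((\<lambda>u::real. poly p u * exp (- u)) \<longlongrightarrow> 0) at_top"
proof -
  have "((\<lambda>u. \<Sum>i\<le>degree p. coeff p i * (u ^ i / exp u)) \<longlongrightarrow> (\<Sum>i\<le>degree p. coeff p i * 0)) at_top"
    by (intro tendsto_intros tendsto_power_div_exp_0)
  then show ?thesis by (simp add: poly_altdef exp_minus divide_inverse sum_distrib_right mult.assoc)
qed

text \<open>The derivative of p(1/t) exp(-1/t) is t^(-2) (p - p')(1/t) exp(-1/t); the factor
  \<open>[:0, 0, 1:]\<close> evaluated at 1/t is t^(-2).\<close>

definition flat_deriv :: "real poly \<Rightarrow> real poly" where
  "flat_deriv p = [:0, 0, 1:] * (p - pderiv p)"

lemma DERIV_flat_exp: "(flat_exp p has_real_derivative flat_exp (flat_deriv p) t) (at t)"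
proof -
  consider "t > 0" | "t < 0" | "t = 0" by linarith
  then show ?thesis
  proof cases
    case 1
    have "((\<lambda>t. poly p (1/t) * exp (- (1/t))) has_real_derivative
        poly (flat_deriv p) (1/t) * exp (- (1/t))) (at t)"
      using 1 by (auto intro!: derivative_eq_intros DERIV_chain'[OF _ poly_DERIV]
          simp: flat_deriv_def field_simps power2_eq_square)
    then have "(flat_exp p has_real_derivative poly (flat_deriv p) (1/t) * exp (- (1/t))) (at t)"
      by (rule DERIV_cong_ev[THEN iffD1, rotated -1, OF _ refl _ refl])
        (use 1 eventually_nhds_in_open[of "{0<..}" t] in \<open>auto elim!: eventually_mono simp: flat_exp_def\<close>)
    then show ?thesis using 1 by (simp add: flat_exp_def)
  next
    case 2
    have "((\<lambda>t. 0) has_real_derivative 0) (at t)" by simp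
    then have "(flat_exp p has_real_derivative 0) (at t)"
      by (rule DERIV_cong_ev[THEN iffD1, rotated -1, OF _ refl _ refl])
        (use 2 eventually_nhds_in_open[of "{..<0}" t] in \<open>auto elim!: eventually_mono simp: flat_exp_def\<close>)
    then show ?thesis using 2 by (simp add: flat_exp_def)
  next
    case 3
    \<comment> \<open>The substitution u = 1/h turns the right-hand quotient at 0 into u p(u)
      exp(-u).\<close>
    have "((\<lambda>h. flat_exp p h / h) \<longlongrightarrow> 0) (at_right 0)"
      unfolding filterlim_at_right_to_top
    proof (rule Lim_transform_eventually)
      show "((\<lambda>u. poly ([:0, 1:] * p) u * exp (- u)) \<longlongrightarrow> 0) at_top" by (rule poly_div_exp_tendsto_0)
      show "\<forall>\<^sub>F u in at_top. poly ([:0, 1:] * p) u * exp (- u) = flat_exp p (inverse u) / inverse u"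
        using eventually_gt_at_top[of 0] by eventually_elim (simp add: flat_exp_def field_simps)
    qed
    moreover have "((\<lambda>h. flat_exp p h / h) \<longlongrightarrow> 0) (at_left 0)"
      by (rule Lim_transform_eventually[OF tendsto_const])
        (simp add: eventually_at_filter flat_exp_def)
    ultimately have "((\<lambda>h. flat_exp p h / h) \<longlongrightarrow> 0) (at 0)" by (simp add: filterlim_split_at)
    then show ?thesis using 3 by (simp add: has_field_derivative_iff flat_exp_def)
  qed
qed

lemma smooth_flat_exp: "smooth (\<lambda>z. flat_exp p (\<alpha> * fst z + \<gamma> * snd z + \<delta>))"
proof (coinduction arbitrary: p)
  case smooth
  have sm: "flat_exp (smult c q) t = c * flat_exp q t" for c q t by (simp add: flat_exp_def)
  have "((\<lambda>z. flat_exp p (\<alpha> * fst z + \<gamma> * snd z + \<delta>)) has_derivative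
      (\<lambda>h. fst h * flat_exp (smult \<alpha> (flat_deriv p)) (\<alpha> * fst z + \<gamma> * snd z + \<delta>)
         + snd h * flat_exp (smult \<gamma> (flat_deriv p)) (\<alpha> * fst z + \<gamma> * snd z + \<delta>))) (at z)" for z
    by (rule has_derivative_eq_rhs[OF has_derivative_compose[OF _
          DERIV_flat_exp[unfolded has_field_derivative_def]]])
       (auto intro!: derivative_eq_intros simp: sm algebra_simps)
  then show ?case
    by - (rule exI[of _ "\<lambda>z. flat_exp p (\<alpha> * fst z + \<gamma> * snd z + \<delta>)"],
        rule exI[of _ "\<lambda>z. flat_exp (smult \<alpha> (flat_deriv p)) (\<alpha> * fst z + \<gamma> * snd z + \<delta>)"],
        rule exI[of _ "\<lambda>z. flat_exp (smult \<gamma> (flat_deriv p)) (\<alpha> * fst z + \<gamma> * snd z + \<delta>)"], blast)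
qed

section \<open>Smooth steps, plateaus and rectangular cutoffs\<close>

definition bump :: "real \<Rightarrow> real" where "bump t = flat_exp 1 t * flat_exp 1 (1 - t)"

lemma flat_exp_1: "0 \<le> flat_exp 1 t" "flat_exp 1 t \<le> 1" "0 < t \<Longrightarrow> 0 < flat_exp 1 t"
  by (auto simp: flat_exp_def)

lemma bump_bounds: "0 \<le> bump t" "bump t \<le> 1" "t \<notin> {0<..<1} \<Longrightarrow> bump t = 0" "t \<in> {0<..<1} \<Longrightarrow> 0 < bump t"
proof -
  show "0 \<le> bump t" by (simp add: bump_def flat_exp_1)
  show "bump t \<le> 1" unfolding bump_def by (intro mult_le_one flat_exp_1)
  show "t \<notin> {0<..<1} \<Longrightarrow> bump t = 0" by (auto simp: bump_def flat_exp_def)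
  show "t \<in> {0<..<1} \<Longrightarrow> 0 < bump t" by (simp add: bump_def flat_exp_1)
qed

lemma smooth_bump: "smooth (\<lambda>z. bump (\<alpha> * fst z + \<gamma> * snd z + \<delta>))"
proof -
  have "smooth (\<lambda>z. flat_exp 1 ((- \<alpha>) * fst z + (- \<gamma>) * snd z + (1 - \<delta>)))" by (rule smooth_flat_exp)
  then have "smooth (\<lambda>z. flat_exp 1 (1 - (\<alpha> * fst z + \<gamma> * snd z + \<delta>)))" by (simp add: algebra_simps)
  then show ?thesis unfolding bump_def by (intro smooth_mult smooth_flat_exp)
qed

lemma continuous_bump: "continuous_on S bump"
proof -
  have "continuous_on UNIV (flat_exp 1)"
    by (intro continuous_at_imp_continuous_on ballI DERIV_continuous[OF DERIV_flat_exp])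
  then have "continuous_on UNIV (\<lambda>t. flat_exp 1 t * flat_exp 1 (1 - t))"
    by (intro continuous_on_mult continuous_on_compose2[of UNIV "flat_exp 1" UNIV "\<lambda>t. 1 - t"]
        continuous_on_diff continuous_on_const continuous_on_id) auto
  also have "(\<lambda>t. flat_exp 1 t * flat_exp 1 (1 - t)) = bump" by (simp add: fun_eq_iff bump_def)
  finally have "continuous_on UNIV bump" .
  then show ?thesis by (rule continuous_on_subset) simp
qed

definition bump_total :: real where "bump_total = integral {-1..1} bump"
text \<open>The lower limit -1 instead of 0 keeps t = 0 inside the interval of integration;
  \<open>bump\<close> vanishes on the added part.\<close>

definition smooth_step :: "real \<Rightarrow> real" where "smooth_step t = integral {-1..t} bump / bump_total"

lemma bump_total_pos: "0 < bump_total"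
proof -
  have "integral {-1..1} bump = 0 \<longleftrightarrow> (\<forall>x\<in>{-1..1}. bump x = 0)"
    by (rule integral_eq_0_iff) (auto simp: continuous_bump bump_bounds(1))
  moreover have "bump (1/2) \<noteq> 0" using bump_bounds(4)[of "1/2"] by simp
  moreover have "(1/2 :: real) \<in> {-1..1}" by simp
  ultimately have "integral {-1..1} bump \<noteq> 0" by blast
  moreover have "0 \<le> integral {-1..1} bump"
    by (intro Henstock_Kurzweil_Integration.integral_nonneg integrable_continuous_real continuous_bump)
      (auto simp: bump_bounds)
  ultimately show ?thesis unfolding bump_total_def by simp
qed

lemma smooth_step_0: "t \<le> 0 \<Longrightarrow> smooth_step t = 0"
proof -
  assume "t \<le> 0"
  then have "integral {-1..t} bump = integral {-1..t} (\<lambda>_. 0)"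
    by (intro Henstock_Kurzweil_Integration.integral_cong) (auto simp: bump_bounds)
  then show ?thesis by (simp add: smooth_step_def)
qed

lemma smooth_step_1: "1 \<le> t \<Longrightarrow> smooth_step t = 1"
proof -
  assume t: "1 \<le> t"
  have "integral {-1..1} bump + integral {1..t} bump = integral {-1..t} bump"
    using t by (intro Henstock_Kurzweil_Integration.integral_combine integrable_continuous_real continuous_bump) auto
  moreover have "integral {1..t} bump = integral {1..t} (\<lambda>_. 0)"
    by (intro Henstock_Kurzweil_Integration.integral_cong) (auto simp: bump_bounds)
  ultimately show ?thesis using bump_total_pos by (simp add: smooth_step_def bump_total_def)
qed

lemma DERIV_smooth_step: "(smooth_step has_real_derivative bump t / bump_total) (at t)"
proof (cases "t < 0")
  case True
  have "((\<lambda>t. 0) has_real_derivative 0) (at t)" by simp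
  then have "(smooth_step has_real_derivative 0) (at t)"
    by (rule DERIV_cong_ev[THEN iffD1, rotated -1, OF _ refl _ refl])
      (use True eventually_nhds_in_open[of "{..<0}" t] in
        \<open>auto elim!: eventually_mono simp: smooth_step_0\<close>)
  then show ?thesis using True by (simp add: bump_bounds)
next
  case False
  have "((\<lambda>x. integral {-1..x} bump) has_real_derivative bump t) (at t within {-1..t+1})"
    using False by (intro integral_has_real_derivative continuous_bump) auto
  then have "((\<lambda>x. integral {-1..x} bump) has_real_derivative bump t) (at t)"
    using False at_within_interior[of t "{-1..t+1}"] by simp
  then show ?thesis unfolding smooth_step_def by (rule DERIV_cdivide)
qed

lemma smooth_step_mono: "s \<le> t \<Longrightarrow> smooth_step s \<le> smooth_step t"
proof (erule DERIV_nonneg_imp_nondecreasing)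
  fix x
  have "0 \<le> bump x / bump_total" using bump_bounds(1) bump_total_pos by simp
  then show "\<exists>y. (smooth_step has_real_derivative y) (at x) \<and> 0 \<le> y" using DERIV_smooth_step by blast
qed

lemma smooth_step_bounds: "0 \<le> smooth_step t" "smooth_step t \<le> 1"
proof -
  have "smooth_step (min 0 t) \<le> smooth_step t" "smooth_step t \<le> smooth_step (max 1 t)"
    by (auto intro: smooth_step_mono)
  then show "0 \<le> smooth_step t" "smooth_step t \<le> 1" by (simp_all add: smooth_step_0 smooth_step_1)
qed

text \<open>One unfolding of the coinductive rule suffices, since the partial derivatives are
  multiples of \<open>bump\<close>.\<close>

lemma smooth_smooth_step: "smooth (\<lambda>z. smooth_step (\<alpha> * fst z + \<gamma> * snd z + \<delta>))"
proof (rule smooth.intros)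
  fix z :: "real \<times> real"
  let ?l = "\<lambda>z. \<alpha> * fst z + \<gamma> * snd z + \<delta>"
  show "((\<lambda>z. smooth_step (?l z)) has_derivative
      (\<lambda>h. fst h * (\<alpha> / bump_total * bump (?l z)) + snd h * (\<gamma> / bump_total * bump (?l z)))) (at z)"
    by (rule has_derivative_eq_rhs[OF has_derivative_compose[OF _
          DERIV_smooth_step[unfolded has_field_derivative_def]]])
       (auto intro!: derivative_eq_intros simp: algebra_simps add_divide_distrib)
qed (rule smooth_cmult[OF smooth_bump])+

definition plateau :: "real \<Rightarrow> real \<Rightarrow> real \<Rightarrow> real \<Rightarrow> real" where
  "plateau a b w t = smooth_step ((t - a) / w) * smooth_step ((b - t) / w)"

lemma plateau_bounds: "0 \<le> plateau a b w t" "plateau a b w t \<le> 1"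
  unfolding plateau_def using smooth_step_bounds by (auto intro: mult_le_one)

lemma plateau_0: "0 < w \<Longrightarrow> t \<notin> {a<..<b} \<Longrightarrow> plateau a b w t = 0"
  unfolding plateau_def by (auto simp: smooth_step_0 divide_nonpos_pos not_less)

lemma plateau_1: "0 < w \<Longrightarrow> a + w \<le> t \<Longrightarrow> t \<le> b - w \<Longrightarrow> plateau a b w t = 1"
  unfolding plateau_def by (simp add: smooth_step_1)

text \<open>A step at scale w has slope at most \<open>1 / (bump_total * w)\<close>, and the product
  rule gives two such terms. The gradient bound O(1/w) of the cutoffs originates here.\<close>

lemma DERIV_plateau:
  assumes "0 < w"
  shows "\<exists>d. (plateau a b w has_real_derivative d) (at t) \<and> \<bar>d\<bar> \<le> 2 / (bump_total * w)"
proof -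
  let ?d = "bump ((t - a) / w) / bump_total / w * smooth_step ((b - t) / w)
    - smooth_step ((t - a) / w) * (bump ((b - t) / w) / bump_total / w)"
  have "(plateau a b w has_real_derivative ?d) (at t)"
  proof -
    have "((\<lambda>x. (x - a) / w) has_real_derivative 1 / w) (at t)"
      "((\<lambda>x. (b - x) / w) has_real_derivative - 1 / w) (at t)"
      using assms by (auto intro!: derivative_eq_intros)
    then have "((\<lambda>x. smooth_step ((x - a) / w) * smooth_step ((b - x) / w)) has_real_derivative
        (bump ((t - a) / w) / bump_total * (1 / w)) * smooth_step ((b - t) / w)
        + (bump ((b - t) / w) / bump_total * (- 1 / w)) * smooth_step ((t - a) / w)) (at t)"
      by (intro DERIV_mult DERIV_chain'[OF _ DERIV_smooth_step])
    then show ?thesis unfolding plateau_def by (simp add: mult.commute)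
  qed
  moreover have "\<bar>?d\<bar> \<le> 2 / (bump_total * w)"
  proof -
    have c: "0 \<le> 1 / (bump_total * w)" using assms bump_total_pos by simp
    have *: "0 \<le> bump s / bump_total / w * smooth_step s'" "bump s / bump_total / w * smooth_step s' \<le> 1 / (bump_total * w)" for s s'
    proof -
      have e: "bump s / bump_total / w * smooth_step s' = (bump s * smooth_step s') * (1 / (bump_total * w))" by simp
      have "0 \<le> bump s * smooth_step s'" "bump s * smooth_step s' \<le> 1"
        using bump_bounds smooth_step_bounds by (auto intro: mult_le_one)
      then show "0 \<le> bump s / bump_total / w * smooth_step s'" "bump s / bump_total / w * smooth_step s' \<le> 1 / (bump_total * w)"
        unfolding e using mult_right_mono[OF _ c, of "bump s * smooth_step s'" 1] c by (auto intro: mult_nonneg_nonneg)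
    qed
    have "2 / (bump_total * w) = 1 / (bump_total * w) + 1 / (bump_total * w)" by simp
    then show ?thesis
      using *[of "(t-a)/w" "(b-t)/w"] *[of "(b-t)/w" "(t-a)/w"] c
      by (simp only: mult.commute[of "smooth_step ((t - a) / w)"] abs_le_iff) linarith
  qed
  ultimately show ?thesis by blast
qed

definition rect :: "real \<times> real \<Rightarrow> real \<times> real \<Rightarrow> real \<Rightarrow> real \<times> real \<Rightarrow> real" where
  "rect a b w z = plateau (fst a) (fst b) w (fst z) * plateau (snd a) (snd b) w (snd z)"

lemma smooth_rect: "0 < w \<Longrightarrow> smooth (rect a b w)"
proof -
  have "smooth (\<lambda>z. (smooth_step (inverse w * fst z + 0 * snd z + (- inverse w * fst a))
      * smooth_step ((- inverse w) * fst z + 0 * snd z + (inverse w * fst b)))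
    * (smooth_step (0 * fst z + inverse w * snd z + (- inverse w * snd a))
      * smooth_step (0 * fst z + (- inverse w) * snd z + (inverse w * snd b))))"
    by (intro smooth_mult smooth_smooth_step)
  also have "(\<lambda>z. (smooth_step (inverse w * fst z + 0 * snd z + (- inverse w * fst a))
      * smooth_step ((- inverse w) * fst z + 0 * snd z + (inverse w * fst b)))
    * (smooth_step (0 * fst z + inverse w * snd z + (- inverse w * snd a))
      * smooth_step (0 * fst z + (- inverse w) * snd z + (inverse w * snd b)))) = rect a b w"
    by (intro ext) (simp add: rect_def plateau_def divide_inverse algebra_simps)
  finally show "smooth (rect a b w)" .
qed

lemma rect_bounds: "0 \<le> rect a b w z" "rect a b w z \<le> 1"
  unfolding rect_def using plateau_bounds by (auto intro: mult_le_one)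

lemma in_box_prod: "z \<in> box a b \<longleftrightarrow> fst z \<in> {fst a<..<fst b} \<and> snd z \<in> {snd a<..<snd b}"
  for z :: "real \<times> real"
  by (auto simp: mem_box Basis_prod_def inner_prod_def)

lemma rect_0: "0 < w \<Longrightarrow> z \<notin> box a b \<Longrightarrow> rect a b w z = 0"
  unfolding rect_def in_box_prod by (auto simp: plateau_0)

lemma rect_1:
  assumes "0 < w" "fst a + w \<le> fst z" "fst z \<le> fst b - w" "snd a + w \<le> snd z" "snd z \<le> snd b - w"
  shows "rect a b w z = 1"
  unfolding rect_def using assms by (simp add: plateau_1)

lemma rect_deriv_bound:
  assumes "0 < w"
  shows "\<bar>directional_deriv (1, 0) (rect a b w) z\<bar> \<le> 2 / (bump_total * w)"
    "\<bar>directional_deriv (0, 1) (rect a b w) z\<bar> \<le> 2 / (bump_total * w)"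
proof -
  obtain d e where d: "(plateau (fst a) (fst b) w has_real_derivative d) (at (fst z))" "\<bar>d\<bar> \<le> 2 / (bump_total * w)"
    and e: "(plateau (snd a) (snd b) w has_real_derivative e) (at (snd z))" "\<bar>e\<bar> \<le> 2 / (bump_total * w)"
    using DERIV_plateau[OF assms] by meson
  have c: "0 \<le> 2 / (bump_total * w)" using assms bump_total_pos by simp
  have "(rect a b w has_derivative (\<lambda>h. plateau (fst a) (fst b) w (fst z) * (e * snd h)
      + (d * fst h) * plateau (snd a) (snd b) w (snd z))) (at z)"
    unfolding rect_def
    by (intro has_derivative_mult
        has_derivative_compose[OF has_derivative_fst[OF has_derivative_ident] d(1)[unfolded has_field_derivative_def]]
        has_derivative_compose[OF has_derivative_snd[OF has_derivative_ident] e(1)[unfolded has_field_derivative_def]])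
  from directional_deriv_eq[OF this]
  have D: "directional_deriv h (rect a b w) z = plateau (fst a) (fst b) w (fst z) * (e * snd h)
      + (d * fst h) * plateau (snd a) (snd b) w (snd z)" for h .
  have m: "\<bar>d * plateau a' b' w t\<bar> \<le> C" if "\<bar>d\<bar> \<le> C" for d a' b' t C
    using that mult_mono[of "\<bar>d\<bar>" C "\<bar>plateau a' b' w t\<bar>" 1] plateau_bounds[of a' b' w t]
    by (simp add: abs_mult abs_of_nonneg order_trans[OF abs_ge_zero])
  show "\<bar>directional_deriv (1, 0) (rect a b w) z\<bar> \<le> 2 / (bump_total * w)"
    unfolding D using m[OF d(2)] by simp
  show "\<bar>directional_deriv (0, 1) (rect a b w) z\<bar> \<le> 2 / (bump_total * w)"
    unfolding D using m[OF e(2)] by (simp add: mult.commute)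
qed

lemma rect_support: "0 < w \<Longrightarrow> closure {z. rect a b w z \<noteq> 0} \<subseteq> cbox a b"
  using rect_0[of w _ a b] box_subset_cbox[of a b] by (intro closure_minimal closed_cbox) auto

lemma test_function_rect: "0 < w \<Longrightarrow> cbox a b \<subseteq> U \<Longrightarrow> test_function U (rect a b w)"
  unfolding test_function_def
proof (intro conjI)
  assume w: "0 < w" and U: "cbox a b \<subseteq> U"
  show "smooth (rect a b w)" by (rule smooth_rect[OF w])
  show "closure {z. rect a b w z \<noteq> 0} \<subseteq> U" using rect_support[OF w] U by blast
  show "compact (closure {z. rect a b w z \<noteq> 0})"
    using bounded_subset[OF bounded_cbox rect_support[OF w]] by (simp add: compact_eq_bounded_closed)
qed

section \<open>Test functions\<close>

lemma test_smooth: "test_function U \<phi> \<Longrightarrow> smooth \<phi>"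
  by (simp add: test_function_def)

lemma test_mono: "test_function U \<phi> \<Longrightarrow> U \<subseteq> W \<Longrightarrow> test_function W \<phi>"
  by (auto simp: test_function_def)

lemma test_zero_outside: "test_function U \<phi> \<Longrightarrow> z \<notin> U \<Longrightarrow> \<phi> z = 0"
  using closure_subset[of "{z. \<phi> z \<noteq> 0}"] by (auto simp: test_function_def)

lemma test_functionI:
  assumes "smooth \<psi>" "test_function U \<phi>" "{z. \<psi> z \<noteq> 0} \<subseteq> closure {z. \<phi> z \<noteq> 0}"
  shows "test_function U \<psi>"
proof -
  have s: "closure {z. \<psi> z \<noteq> 0} \<subseteq> closure {z. \<phi> z \<noteq> 0}"
    using assms(3) by (rule closure_minimal) simp
  then have "bounded (closure {z. \<psi> z \<noteq> 0})"
    using assms(2) bounded_subset compact_imp_bounded unfolding test_function_def by blast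
  then show ?thesis using s assms by (auto simp: test_function_def compact_eq_bounded_closed)
qed

lemma test_zero: "test_function U (\<lambda>z. 0)"
  by (simp add: test_function_def)

lemma test_mult: "smooth \<eta> \<Longrightarrow> test_function U \<phi> \<Longrightarrow> test_function U (\<lambda>z. \<eta> z * \<phi> z)"
  by (rule test_functionI) (use closure_subset[of "{z. \<phi> z \<noteq> 0}"] in \<open>auto intro: smooth_mult test_smooth\<close>)

text \<open>Off its closed support the function is locally zero, so the derivative vanishes there as
  well.\<close>

lemma test_directional_deriv:
  assumes "test_function U \<phi>"
  shows "test_function U (directional_deriv b \<phi>)"
proof (rule test_functionI[OF smooth_directional_deriv[OF test_smooth[OF assms]] assms], rule subsetI, rule ccontr)
  fix z assume z: "z \<in> {z. directional_deriv b \<phi> z \<noteq> 0}" "z \<notin> closure {z. \<phi> z \<noteq> 0}"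
  have "((\<lambda>z. 0) has_derivative (\<lambda>h. 0)) (at z)" by simp
  then have "(\<phi> has_derivative (\<lambda>h. 0)) (at z)"
    by (rule has_derivative_transform_within_open[where s = "- closure {z. \<phi> z \<noteq> 0}"])
      (use z closure_subset[of "{z. \<phi> z \<noteq> 0}"] in auto)
  then have "directional_deriv b \<phi> z = 0" by (rule directional_deriv_eq)
  then show False using z by simp
qed

lemma test_translate:
  assumes "test_function U \<phi>" "\<And>z. z \<in> U \<Longrightarrow> z - a \<in> W"
  shows "test_function W (\<lambda>z. \<phi> (a + z))"
proof -
  let ?C = "closure {z. \<phi> z \<noteq> 0}"
  have c: "compact ?C" "?C \<subseteq> U" using assms(1) by (auto simp: test_function_def)
  have comp: "compact ((\<lambda>z. - a + z) ` ?C)" using c(1) by (rule compact_translation)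
  have "closure {z. \<phi> (a + z) \<noteq> 0} \<subseteq> (\<lambda>z. - a + z) ` ?C"
  proof (rule closure_minimal)
    show "{z. \<phi> (a + z) \<noteq> 0} \<subseteq> (\<lambda>z. - a + z) ` ?C"
    proof
      fix z assume "z \<in> {z. \<phi> (a + z) \<noteq> 0}"
      then have "a + z \<in> ?C" using closure_subset[of "{z. \<phi> z \<noteq> 0}"] by auto
      then show "z \<in> (\<lambda>z. - a + z) ` ?C" by (intro image_eqI[of _ _ "a + z"]) auto
    qed
    show "closed ((\<lambda>z. - a + z) ` ?C)" using comp by (rule compact_imp_closed)
  qed
  moreover have "(\<lambda>z. - a + z) ` ?C \<subseteq> W" using c(2) assms(2) by auto
  ultimately show ?thesis
    unfolding test_function_def using smooth_translate[OF test_smooth[OF assms(1)]]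
      bounded_subset[OF compact_imp_bounded[OF comp]] by (auto simp: compact_eq_bounded_closed)
qed

lemma test_bounds:
  assumes "test_function U \<phi>"
  obtains B R where "0 \<le> B" "\<And>z. \<bar>\<phi> z\<bar> \<le> B" "\<And>z. norm z > R \<Longrightarrow> \<phi> z = 0"
proof -
  let ?C = "closure {z. \<phi> z \<noteq> 0}"
  have c: "compact ?C" using assms by (auto simp: test_function_def)
  have "compact (\<phi> ` ?C)"
    by (rule compact_continuous_image[OF smooth_continuous[OF test_smooth[OF assms]] c])
  then obtain B where B: "\<And>y. y \<in> \<phi> ` ?C \<Longrightarrow> \<bar>y\<bar> \<le> B"
    using compact_imp_bounded bounded_iff[of "\<phi> ` ?C"] by (auto simp: real_norm_def)
  obtain R where R: "\<And>z. z \<in> ?C \<Longrightarrow> norm z \<le> R"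
    using compact_imp_bounded[OF c] bounded_iff[of ?C] by auto
  have mem: "\<phi> z \<noteq> 0 \<Longrightarrow> z \<in> ?C" for z using closure_subset[of "{z. \<phi> z \<noteq> 0}"] by auto
  show thesis
  proof
    show "0 \<le> max B 0" by simp
    show "\<bar>\<phi> z\<bar> \<le> max B 0" for z using B[of "\<phi> z"] mem[of z] by (cases "\<phi> z = 0") auto
    show "\<phi> z = 0" if "norm z > R" for z using R[of z] mem[of z] that by force
  qed
qed

lemma continuous_imp_lebesgue_measurable:
  fixes f :: "real \<times> real \<Rightarrow> 'b::topological_space"
  shows "continuous_on UNIV f \<Longrightarrow> f \<in> borel_measurable lebesgue"
  using borel_measurable_continuous_onI[of f] by (intro measurable_completion) simp

lemma smooth_measurable: "smooth \<phi> \<Longrightarrow> \<phi> \<in> borel_measurable lebesgue"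
  by (intro continuous_imp_lebesgue_measurable smooth_continuous)

lemma sqint_cball: "sqint lebesgue (indicator (cball (0 :: real \<times> real) R))"
proof -
  have "integrable lebesgue (indicator (cball (0::real\<times>real) R) :: _ \<Rightarrow> real)"
    using emeasure_bounded_finite[OF bounded_cball, of 0 R] by (intro integrable_real_indicator) auto
  moreover have "(\<lambda>z::real\<times>real. (cmod (indicator (cball 0 R) z))\<^sup>2) = indicator (cball 0 R)"
    by (auto simp: indicator_def fun_eq_iff)
  ultimately show ?thesis unfolding sqint_def by (auto intro!: borel_measurable_indicator)
qed

lemma norm_le_cball:
  assumes "AE z in lebesgue. cmod (fn x z) \<le> (if norm z \<le> R then K else 0)" "0 \<le> K"
  shows "norm x \<le> K * norm (mk (indicator (cball 0 R)))"
  by (rule norm_le_of_cmod)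
    (use assms(1) fn_mk[OF sqint_cball[of R]] assms(2) in
      \<open>auto elim!: eventually_elim2 simp: indicator_def split: if_splits\<close>)

text \<open>The complex test function \<phi> + i \<psi> as an element of \<open>l2\<close>;
  smoothness is defined for real functions, hence the pair.\<close>

definition ctf :: "(real \<times> real \<Rightarrow> real) \<Rightarrow> (real \<times> real \<Rightarrow> real) \<Rightarrow> l2" where
  "ctf \<phi> \<psi> = mk (\<lambda>z. Complex (\<phi> z) (\<psi> z))"

lemma cmod_Complex_le: "cmod (Complex a b) \<le> \<bar>a\<bar> + \<bar>b\<bar>"
  using cmod_le[of "Complex a b"] by simp

lemma Complex_measurable:
  assumes "smooth \<phi>" "smooth \<psi>" shows "(\<lambda>z. Complex (\<phi> z) (\<psi> z)) \<in> borel_measurable lebesgue"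
  unfolding Complex_eq using smooth_measurable[OF assms(1)] smooth_measurable[OF assms(2)] by measurable

lemma sqint_ctf:
  assumes "test_function U \<phi>" "test_function U \<psi>"
  shows "sqint lebesgue (\<lambda>z. Complex (\<phi> z) (\<psi> z))"
proof -
  obtain B R where B: "0 \<le> B" "\<And>z. \<bar>\<phi> z\<bar> \<le> B" "\<And>z. norm z > R \<Longrightarrow> \<phi> z = 0" using test_bounds[OF assms(1)] by blast
  obtain B' R' where B': "0 \<le> B'" "\<And>z. \<bar>\<psi> z\<bar> \<le> B'" "\<And>z. norm z > R' \<Longrightarrow> \<psi> z = 0" using test_bounds[OF assms(2)] by blast
  show ?thesis
  proof (rule sqint_bound)
    show "(\<lambda>z. Complex (\<phi> z) (\<psi> z)) \<in> borel_measurable lebesgue"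
      using assms by (intro Complex_measurable test_smooth)
    show "integrable lebesgue (\<lambda>z::real\<times>real. (B + B')\<^sup>2 * (cmod (indicator (cball 0 (max R R')) z))\<^sup>2)"
      using sqint_cball[of "max R R'"] by (auto simp: sqint_def)
    have "(cmod (Complex (\<phi> z) (\<psi> z)))\<^sup>2 \<le> (B + B')\<^sup>2 * (cmod (indicator (cball 0 (max R R')) z))\<^sup>2" for z
    proof (cases "norm z \<le> max R R'")
      case True
      have "cmod (Complex (\<phi> z) (\<psi> z)) \<le> B + B'"
        using cmod_Complex_le[of "\<phi> z" "\<psi> z"] B(2)[of z] B'(2)[of z] by linarith
      then have "(cmod (Complex (\<phi> z) (\<psi> z)))\<^sup>2 \<le> (B + B')\<^sup>2" by (intro power_mono) auto
      then show ?thesis using True by (simp add: indicator_def)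
    next
      case False
      then have "Complex (\<phi> z) (\<psi> z) = 0" using B(3)[of z] B'(3)[of z] by (simp add: complex_eq_iff)
      then show ?thesis by simp
    qed
    then show "AE z in lebesgue. (cmod (Complex (\<phi> z) (\<psi> z)))\<^sup>2
        \<le> (B + B')\<^sup>2 * (cmod (indicator (cball 0 (max R R')) z))\<^sup>2" by simp
  qed
qed

lemma fn_ctf:
  assumes "test_function U \<phi>" "test_function U \<psi>"
  shows "AE z in lebesgue. fn (ctf \<phi> \<psi>) z = Complex (\<phi> z) (\<psi> z)"
  unfolding ctf_def by (rule fn_mk[OF sqint_ctf[OF assms]])

lemma ctf_VV:
  assumes "test_function U \<phi>" "test_function U \<psi>" "U \<in> sets lebesgue"
  shows "ctf \<phi> \<psi> \<in> VV U"
  unfolding VV_iff[OF assms(3)] using fn_ctf[OF assms(1,2)]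
  by eventually_elim (auto simp: test_zero_outside[OF assms(1)] test_zero_outside[OF assms(2)] complex_eq_iff)

lemma tr_ctf:
  assumes "test_function U \<phi>" "test_function U \<psi>"
  shows "tr a (ctf \<phi> \<psi>) = ctf (\<lambda>z. \<phi> (a + z)) (\<lambda>z. \<psi> (a + z))"
  unfolding ctf_def by (rule tr_mk[OF sqint_ctf[OF assms]])

lemma mul_ctf:
  assumes t: "test_function U \<phi>" "test_function U \<psi>" and m: "bm (\<lambda>z. of_real (\<eta> z))"
  shows "mul (\<lambda>z. of_real (\<eta> z)) (ctf \<phi> \<psi>) = ctf (\<lambda>z. \<eta> z * \<phi> z) (\<lambda>z. \<eta> z * \<psi> z)"
proof -
  have s: "sqint lebesgue (\<lambda>z. of_real (\<eta> z) * Complex (\<phi> z) (\<psi> z))"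
  proof -
    obtain B where "(\<lambda>z. complex_of_real (\<eta> z)) \<in> borel_measurable lebesgue" "\<And>z. cmod (of_real (\<eta> z)) \<le> B"
      using m unfolding bm_def by blast
    then show ?thesis by (rule sqint_mult[OF sqint_ctf[OF t]])
  qed
  have "mul (\<lambda>z. of_real (\<eta> z)) (ctf \<phi> \<psi>) = mk (\<lambda>z. of_real (\<eta> z) * Complex (\<phi> z) (\<psi> z))"
    by (rule l2_eqI) (use fn_mul[OF m, of "ctf \<phi> \<psi>"] fn_ctf[OF t] fn_mk[OF s] in \<open>eventually_elim, simp\<close>)
  also have "(\<lambda>z. of_real (\<eta> z) * Complex (\<phi> z) (\<psi> z)) = (\<lambda>z. Complex (\<eta> z * \<phi> z) (\<eta> z * \<psi> z))"
    by (simp add: fun_eq_iff complex_eq_iff)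
  finally show ?thesis unfolding ctf_def .
qed

lemma ctf_add:
  assumes "test_function U \<phi>" "test_function U \<psi>" "test_function U \<phi>'" "test_function U \<psi>'"
  shows "ctf \<phi> \<psi> + ctf \<phi>' \<psi>' = ctf (\<lambda>z. \<phi> z + \<phi>' z) (\<lambda>z. \<psi> z + \<psi>' z)"
proof -
  have e: "(\<lambda>z. Complex (\<phi> z) (\<psi> z) + Complex (\<phi>' z) (\<psi>' z)) = (\<lambda>z. Complex (\<phi> z + \<phi>' z) (\<psi> z + \<psi>' z))"
    by (simp add: fun_eq_iff complex_eq_iff)
  have s: "sqint lebesgue (\<lambda>z. Complex (\<phi> z) (\<psi> z) + Complex (\<phi>' z) (\<psi>' z))"
    by (intro sqint_add sqint_ctf[of U] assms)
  have "ctf \<phi> \<psi> + ctf \<phi>' \<psi>' = mk (\<lambda>z. Complex (\<phi> z) (\<psi> z) + Complex (\<phi>' z) (\<psi>' z))"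
    by (rule l2_eqI) (use fn_add[of "ctf \<phi> \<psi>" "ctf \<phi>' \<psi>'"] fn_ctf[OF assms(1,2)] fn_ctf[OF assms(3,4)]
        fn_mk[OF s] in \<open>eventually_elim, simp\<close>)
  then show ?thesis unfolding e ctf_def[of "\<lambda>z. \<phi> z + \<phi>' z"] .
qed

lemma DERIV_of_quadratic_bound:
  fixes F :: "real \<Rightarrow> real"
  assumes "\<And>h. \<bar>h\<bar> \<le> 1 \<Longrightarrow> \<bar>F (s + h) - F s - h * D\<bar> \<le> C * h\<^sup>2"
  shows "(F has_real_derivative D) (at s)"
  unfolding DERIV_def
proof (rule LIM_zero_cancel, rule tendsto_rabs_zero_cancel)
  have l: "((\<lambda>h. C * \<bar>h\<bar>) \<longlongrightarrow> 0) (at 0)" by (auto intro!: tendsto_eq_intros)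
  show "((\<lambda>h. \<bar>(F (s + h) - F s) / h - D\<bar>) \<longlongrightarrow> 0) (at 0)"
  proof (rule tendsto_sandwich[OF _ _ tendsto_const l])
    show "\<forall>\<^sub>F h in at 0. \<bar>(F (s + h) - F s) / h - D\<bar> \<le> C * \<bar>h\<bar>"
      unfolding eventually_at
    proof (intro exI[of _ 1] conjI ballI impI)
      fix h :: real assume h: "h \<noteq> 0 \<and> dist h 0 < 1"
      have "\<bar>(F (s + h) - F s) / h - D\<bar> * \<bar>h\<bar> = \<bar>F (s + h) - F s - h * D\<bar>"
      proof -
        have "((F (s + h) - F s) / h - D) * h = F (s + h) - F s - h * D"
          using conjunct1[OF h] by (simp add: left_diff_distrib[of _ D])
        then show ?thesis by (metis abs_mult)
      qed
      also have "\<dots> \<le> C * h\<^sup>2" using assms h by (simp add: dist_norm)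
      also have "\<dots> = C * \<bar>h\<bar> * \<bar>h\<bar>" by (simp add: power2_eq_square)
      finally show "\<bar>(F (s + h) - F s) / h - D\<bar> \<le> C * \<bar>h\<bar>" using h by simp
    qed simp
  qed simp
qed

text \<open>Uniformity in z and a support independent of s turn the pointwise Taylor remainder into
  an O(s^2) bound in L^2. \<open>M\<close> bounds the second derivative along
  \<open>b\<close>.\<close>

lemma test_Taylor:
  assumes "test_function U \<phi>"
  obtains M R where "0 \<le> M"
    "\<And>s z. \<bar>s\<bar> \<le> 1 \<Longrightarrow> \<bar>\<phi> (s *\<^sub>R b + z) - \<phi> z - s * directional_deriv b \<phi> z\<bar> \<le> (if norm z \<le> R then M * s\<^sup>2 else 0)"
proof -
  let ?d = "directional_deriv b \<phi>"
  obtain B R where B: "\<And>z. norm z > R \<Longrightarrow> \<phi> z = 0" using test_bounds[OF assms] by metis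
  obtain R1 where R1: "\<And>z. norm z > R1 \<Longrightarrow> ?d z = 0"
    using test_bounds[OF test_directional_deriv[OF assms]] by metis
  obtain M where M: "0 \<le> M" "\<And>z. \<bar>directional_deriv b ?d z\<bar> \<le> M"
    using test_bounds[OF test_directional_deriv[OF test_directional_deriv[OF assms]]] by metis
  have deriv: "((\<lambda>s. f (s *\<^sub>R b + z)) has_real_derivative directional_deriv b f (s *\<^sub>R b + z)) (at s within S)"
    if "smooth f" for f z s S
  proof -
    have "((\<lambda>s. s *\<^sub>R b + z) has_derivative (\<lambda>h. h *\<^sub>R b)) (at s within S)"
      by (auto intro!: derivative_eq_intros)
    from has_derivative_compose[OF this smoothE(1)[OF that]]
    have "((\<lambda>s. f (s *\<^sub>R b + z)) has_derivative (\<lambda>h. directional_deriv (h *\<^sub>R b) f (s *\<^sub>R b + z))) (at s within S)" .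
    moreover have "directional_deriv (h *\<^sub>R b) f w = directional_deriv b f w * h" for h w
      using smoothE(2)[OF that, of "h *\<^sub>R b" w] smoothE(2)[OF that, of b w] by (simp only: fst_scaleR snd_scaleR)
        (simp add: algebra_simps)
    ultimately show ?thesis by (simp add: has_field_derivative_def mult_commute_abs)
  qed
  have sm: "smooth \<phi>" "smooth ?d" using assms test_smooth smooth_directional_deriv by blast+
  have d1: "\<bar>?d (s *\<^sub>R b + z) - ?d z\<bar> \<le> M * \<bar>s\<bar>" for s z
    using field_differentiable_bound[of UNIV "\<lambda>s. ?d (s *\<^sub>R b + z)" "\<lambda>s. directional_deriv b ?d (s *\<^sub>R b + z)" M s 0]
      deriv[OF sm(2)] M(2) by simp
  have d2: "\<bar>\<phi> (s *\<^sub>R b + z) - \<phi> z - s * ?d z\<bar> \<le> M * s\<^sup>2" for s z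
  proof -
    let ?S = "{- \<bar>s\<bar> .. \<bar>s\<bar>}"
    have "norm ((\<phi> (s *\<^sub>R b + z) - s * ?d z) - (\<phi> (0 *\<^sub>R b + z) - 0 * ?d z)) \<le> (M * \<bar>s\<bar>) * norm (s - 0)"
    proof (rule field_differentiable_bound[of ?S "\<lambda>s. \<phi> (s *\<^sub>R b + z) - s * ?d z" "\<lambda>s. ?d (s *\<^sub>R b + z) - ?d z"])
      fix r assume r: "r \<in> ?S"
      show "((\<lambda>s. \<phi> (s *\<^sub>R b + z) - s * ?d z) has_real_derivative ?d (r *\<^sub>R b + z) - ?d z) (at r within ?S)"
        by (rule DERIV_diff[OF deriv[OF sm(1)]]) (auto intro!: derivative_eq_intros)
      have "M * \<bar>r\<bar> \<le> M * \<bar>s\<bar>" using r M(1) by (intro mult_left_mono) auto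
      then show "norm (?d (r *\<^sub>R b + z) - ?d z) \<le> M * \<bar>s\<bar>" using d1[of r z] by simp
    qed auto
    then show ?thesis by (simp add: power2_eq_square algebra_simps)
  qed
  show thesis
  \<comment> \<open>Adding \<open>norm b\<close> to the radius ensures that both z and the shifted
    point \<open>s *\<^sub>R b + z\<close> have left the supports when z is outside the
    ball.\<close>
  proof (rule that[of M "max R R1 + norm b"])
    show "0 \<le> M" by (rule M)
    fix s :: real and z assume s: "\<bar>s\<bar> \<le> 1"
    show "\<bar>\<phi> (s *\<^sub>R b + z) - \<phi> z - s * ?d z\<bar> \<le> (if norm z \<le> max R R1 + norm b then M * s\<^sup>2 else 0)"
    proof (cases "norm z \<le> max R R1 + norm b")
      case True then show ?thesis using d2 by simp
    next
      case False
      have "norm (s *\<^sub>R b) \<le> norm b" using s mult_right_mono[of "\<bar>s\<bar>" 1 "norm b"] by simp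
      then have "norm (s *\<^sub>R b + z) > R" using False norm_triangle_ineq2[of z "- (s *\<^sub>R b)"] by (simp add: add.commute)
      moreover have "norm z > R" "norm z > R1" 
        using False norm_ge_zero[of b] max.cobounded1[of R R1] max.cobounded2[of R1 R] by linarith+
      ultimately show ?thesis using B[of z] B[of "s *\<^sub>R b + z"] R1[of z] False by simp
    qed
  qed
qed

text \<open>By \<open>test_Taylor\<close> translation acts differentiably on test functions in L^2,
  so pairing with an arbitrary u is differentiable too. Integration by parts and the difference
  quotient bounds both rest on this derivative.\<close>

lemma DERIV_inner_tr_ctf:
  assumes "test_function U \<phi>" "test_function U \<psi>"
  shows "((\<lambda>s. inner u (tr (s *\<^sub>R b) (ctf \<phi> \<psi>))) has_real_derivative
    inner u (tr (s *\<^sub>R b) (ctf (directional_deriv b \<phi>) (directional_deriv b \<psi>)))) (at s)"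
proof -
  let ?d = "ctf (directional_deriv b \<phi>) (directional_deriv b \<psi>)"
  obtain M R where M: "0 \<le> M" "\<And>s z. \<bar>s\<bar> \<le> 1 \<Longrightarrow>
      \<bar>\<phi> (s *\<^sub>R b + z) - \<phi> z - s * directional_deriv b \<phi> z\<bar> \<le> (if norm z \<le> R then M * s\<^sup>2 else 0)"
    using test_Taylor[OF assms(1)] by blast
  obtain M' R' where M': "0 \<le> M'" "\<And>s z. \<bar>s\<bar> \<le> 1 \<Longrightarrow>
      \<bar>\<psi> (s *\<^sub>R b + z) - \<psi> z - s * directional_deriv b \<psi> z\<bar> \<le> (if norm z \<le> R' then M' * s\<^sup>2 else 0)"
    using test_Taylor[OF assms(2)] by blast
  define K where "K = norm (mk (indicator (cball 0 (max R R'))))"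
  have rem: "norm (tr (h *\<^sub>R b) (ctf \<phi> \<psi>) - ctf \<phi> \<psi> - h *\<^sub>R ?d) \<le> ((M + M') * h\<^sup>2) * K" if h: "\<bar>h\<bar> \<le> 1" for h
    unfolding K_def
  proof (rule norm_le_cball)
    let ?x = "tr (h *\<^sub>R b) (ctf \<phi> \<psi>) - ctf \<phi> \<psi> - h *\<^sub>R ?d"
    have "AE z in lebesgue. fn ?x z = Complex (\<phi> (h *\<^sub>R b + z) - \<phi> z - h * directional_deriv b \<phi> z)
        (\<psi> (h *\<^sub>R b + z) - \<psi> z - h * directional_deriv b \<psi> z)"
      using fn_diff[of "tr (h *\<^sub>R b) (ctf \<phi> \<psi>) - ctf \<phi> \<psi>" "h *\<^sub>R ?d"] fn_diff[of "tr (h *\<^sub>R b) (ctf \<phi> \<psi>)" "ctf \<phi> \<psi>"]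
        fn_scaleR[of h ?d] fn_ctf[OF test_directional_deriv[OF assms(1)] test_directional_deriv[OF assms(2)], of b b]
        fn_ctf[OF assms] AE_translate[OF fn_ctf[OF assms], of "h *\<^sub>R b"] fn_tr[of "h *\<^sub>R b" "ctf \<phi> \<psi>"]
      by eventually_elim (simp add: complex_eq_iff)
    then show "AE z in lebesgue. cmod (fn ?x z) \<le> (if norm z \<le> max R R' then (M + M') * h\<^sup>2 else 0)"
    proof eventually_elim
      fix z assume e: "fn ?x z = Complex (\<phi> (h *\<^sub>R b + z) - \<phi> z - h * directional_deriv b \<phi> z)
        (\<psi> (h *\<^sub>R b + z) - \<psi> z - h * directional_deriv b \<psi> z)"
      have "0 \<le> M * h\<^sup>2" "0 \<le> M' * h\<^sup>2" using M(1) M'(1) by auto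
      then show "cmod (fn ?x z) \<le> (if norm z \<le> max R R' then (M + M') * h\<^sup>2 else 0)"
        unfolding e using M(2)[OF h, of z] M'(2)[OF h, of z]
        by (intro order_trans[OF cmod_Complex_le]) (auto simp: distrib_right split: if_splits)
    qed
    show "0 \<le> (M + M') * h\<^sup>2" using M(1) M'(1) by simp
  qed
  show ?thesis
  proof (rule DERIV_of_quadratic_bound)
    fix h :: real assume h: "\<bar>h\<bar> \<le> 1"
    let ?x = "tr (h *\<^sub>R b) (ctf \<phi> \<psi>) - ctf \<phi> \<psi> - h *\<^sub>R ?d"
    have "inner u (tr ((s + h) *\<^sub>R b) (ctf \<phi> \<psi>)) - inner u (tr (s *\<^sub>R b) (ctf \<phi> \<psi>)) - h * inner u (tr (s *\<^sub>R b) ?d)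
        = inner u (tr (s *\<^sub>R b) ?x)"
      by (simp add: scaleR_left_distrib tr_diff tr_scaleR inner_diff_right flip: tr_tr)
    also have "\<bar>\<dots>\<bar> \<le> norm u * norm (tr (s *\<^sub>R b) ?x)" by (rule Cauchy_Schwarz_ineq2)
    also have "\<dots> \<le> norm u * (((M + M') * h\<^sup>2) * K)" unfolding norm_tr using rem[OF h] by (intro mult_left_mono) auto
    finally show "\<bar>inner u (tr ((s + h) *\<^sub>R b) (ctf \<phi> \<psi>)) - inner u (tr (s *\<^sub>R b) (ctf \<phi> \<psi>)) - h * inner u (tr (s *\<^sub>R b) ?d)\<bar>
      \<le> (norm u * (M + M') * K) * h\<^sup>2" by (simp add: mult_ac)
  qed
qed

section \<open>Fundamental lemma of the calculus of variations\<close>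

lemma integrable_lborel_zero_on_boxes:
  fixes f :: "real \<times> real \<Rightarrow> real"
  assumes f: "integrable lborel f" and boxes: "\<And>a b. set_lebesgue_integral lborel (box a b) f = 0"
    and total: "integral\<^sup>L lborel f = 0"
  shows "AE z in lborel. f z = 0"
proof (rule sigma_finite_measure.density_zero[OF sigma_finite_lborel f])
  fix A :: "(real \<times> real) set" assume "A \<in> sets lborel"
  then have A: "A \<in> sigma_sets UNIV (range (\<lambda>(a, b). box a b))"
    unfolding sets_lborel borel_eq_box by simp
  \<comment> \<open>Boxes form an intersection-stable generator, and the sets with vanishing
    integral form a Dynkin system; complements use \<open>total\<close>.\<close>
  have "Int_stable (range (\<lambda>(a, b). box a b :: (real \<times> real) set))"
    by (auto simp: Int_stable_def box_Int_box)
  moreover have "range (\<lambda>(a, b). box a b :: (real \<times> real) set) \<subseteq> Pow UNIV" by simp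
  ultimately show "set_lebesgue_integral lborel A f = 0"
    using A
  proof (induction rule: sigma_sets_induct_disjoint)
    case (basic A) then show ?case using boxes by auto
  next
    case empty show ?case by (simp add: set_lebesgue_integral_def)
  next
    case (compl A)
    then have A: "A \<in> sets lborel" by (simp add: borel_eq_box)
    have i: "set_integrable lborel A f" "set_integrable lborel (UNIV - A) f"
      unfolding set_integrable_def by (rule integrable_mult_indicator[OF _ f], use A in simp)+
    have "set_lebesgue_integral lborel (A \<union> (UNIV - A)) f
        = set_lebesgue_integral lborel A f + set_lebesgue_integral lborel (UNIV - A) f"
      by (rule set_integral_Un[OF _ i]) auto
    moreover have "A \<union> (UNIV - A) = UNIV" by auto
    ultimately show ?case using compl total by (simp add: set_lebesgue_integral_def)
  next
    case (union A)
    then have A: "A i \<in> sets lborel" for i by (auto simp: borel_eq_box)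
    have "set_lebesgue_integral lborel (\<Union>i. A i) f = (\<Sum>i. set_lebesgue_integral lborel (A i) f)"
    proof (rule lebesgue_integral_countable_add)
      show "set_integrable lborel (\<Union>i. A i) f"
        unfolding set_integrable_def by (rule integrable_mult_indicator[OF _ f]) (use A in auto)
    qed (use A union(1) in \<open>auto simp: disjoint_family_on_def\<close>)
    then show ?case using union by simp
  qed
qed

text \<open>Smooth plateaus converge to the indicator of a box, so the integrals over all boxes
  inside \<open>U\<close> vanish. Boxes determine an integrable function, and \<open>U\<close> is a
  countable union of them.\<close>

lemma AE_zero_of_rect_integrals:
  fixes h :: "real \<times> real \<Rightarrow> real"
  assumes hm: "h \<in> borel_measurable lebesgue" and U: "open U"
    and int: "\<And>R. integrable lebesgue (\<lambda>z. indicator (cball 0 R) z * h z)"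
    and zero: "\<And>\<phi>. test_function U \<phi> \<Longrightarrow> (LINT z|lebesgue. \<phi> z * h z) = 0"
  shows "AE z in lebesgue. z \<in> U \<longrightarrow> h z = 0"
proof -
  \<comment> \<open>The argument with generators runs on Borel sets, so \<open>h\<close> is replaced
    by a Borel representative.\<close>
  obtain g where gm: "g \<in> borel_measurable lborel" and gh: "AE z in lborel. h z = g z"
    using completion_ex_borel_measurable_real[OF hm] by blast
  have gh': "AE z in lebesgue. h z = g z" using gh AE_completion by blast
  have box0: "(LINT z|lebesgue. indicator (box a b) z * h z) = 0" if bU: "box a b \<subseteq> U" for a b
  proof -
    obtain R where "\<forall>z\<in>box a b. norm z \<le> R" using bounded_box[of a b] unfolding bounded_iff by blast
    then have R: "box a b \<subseteq> cball 0 R" by auto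
    define w where "w n = 1 / real (Suc n)" for n
    have w: "w n > 0" for n by (simp add: w_def)
    \<comment> \<open>The box is shrunk by \<open>w n\<close> and the transition layer also has
      width \<open>w n\<close>: the closed support stays inside the box, and points at distance at
      least \<open>2 * w n\<close> from all sides get the value 1.\<close>
    define \<phi> where "\<phi> n = rect (fst a + w n, snd a + w n) (fst b - w n, snd b - w n) (w n)" for n
    have tU: "test_function U (\<phi> n)" for n unfolding \<phi>_def
    proof (rule test_function_rect[OF w])
      show "cbox (fst a + w n, snd a + w n) (fst b - w n, snd b - w n) \<subseteq> U"
      proof
        fix z assume "z \<in> cbox (fst a + w n, snd a + w n) (fst b - w n, snd b - w n)"
        then have "z \<in> box a b" using w[of n] by (auto simp: in_box_prod mem_box Basis_prod_def inner_prod_def)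
        then show "z \<in> U" using bU by blast
      qed
    qed
    have "(\<lambda>n. LINT z|lebesgue. \<phi> n z * h z) \<longlonglongrightarrow> (LINT z|lebesgue. indicator (box a b) z * h z)"
    proof (rule integral_dominated_convergence[where w = "\<lambda>z. \<bar>indicator (cball 0 R) z * h z\<bar>"])
      show "(\<lambda>z. indicator (box a b) z * h z) \<in> borel_measurable lebesgue"
        by (intro borel_measurable_times borel_measurable_indicator hm) auto
      show "(\<lambda>z. \<phi> n z * h z) \<in> borel_measurable lebesgue" for n
        by (intro borel_measurable_times smooth_measurable[OF test_smooth[OF tU]] hm)
      show "integrable lebesgue (\<lambda>z. \<bar>indicator (cball 0 R) z * h z\<bar>)" using int by (rule integrable_abs)
      have "\<phi> n z = 0" if "z \<notin> box a b" for n z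
      proof -
        have "z \<notin> box (fst a + w n, snd a + w n) (fst b - w n, snd b - w n)"
          using that w[of n] by (auto simp: in_box_prod)
        then show ?thesis unfolding \<phi>_def by (rule rect_0[OF w])
      qed
      note out = this
      show "AE z in lebesgue. norm (\<phi> n z * h z) \<le> \<bar>indicator (cball 0 R) z * h z\<bar>" for n
      proof (rule AE_I2)
        fix z show "norm (\<phi> n z * h z) \<le> \<bar>indicator (cball 0 R) z * h z\<bar>"
        proof (cases "z \<in> box a b")
          case True
          then have "indicator (cball 0 R) z = (1::real)" using R by auto
          then show ?thesis using rect_bounds[of "(fst a + w n, snd a + w n)" "(fst b - w n, snd b - w n)" "w n" z]
            mult_right_mono[of "\<bar>\<phi> n z\<bar>" 1 "\<bar>h z\<bar>"] by (simp add: abs_mult \<phi>_def)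
        qed (simp add: out)
      qed
      show "AE z in lebesgue. (\<lambda>n. \<phi> n z * h z) \<longlonglongrightarrow> indicator (box a b) z * h z"
      proof (rule AE_I2)
        fix z show "(\<lambda>n. \<phi> n z * h z) \<longlonglongrightarrow> indicator (box a b) z * h z"
        proof (cases "z \<in> box a b")
          case True
          define \<delta> where "\<delta> = Min {fst z - fst a, fst b - fst z, snd z - snd a, snd b - snd z}"
          have "\<delta> > 0" using True unfolding \<delta>_def in_box_prod by simp
          then obtain N where N: "w N < \<delta> / 2" unfolding w_def using nat_approx_posE[of "\<delta>/2"] by auto
          have "\<phi> n z = 1" if "n \<ge> N" for n
          proof -
            have "w n \<le> w N" unfolding w_def using that by (simp add: field_simps)
            then have "2 * w n < \<delta>" using N by simp
            then show ?thesis unfolding \<phi>_def \<delta>_def by (intro rect_1[OF w]) auto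
          qed
          then have "\<forall>\<^sub>F n in sequentially. \<phi> n z * h z = indicator (box a b) z * h z"
            using True by (intro eventually_sequentiallyI[of N]) auto
          then show ?thesis by (rule tendsto_eventually)
        qed (simp add: out)
      qed
    qed
    then show ?thesis using zero[OF tU] by (simp add: LIMSEQ_const_iff)
  qed
  have on_box: "AE z in lebesgue. z \<in> box a b \<longrightarrow> h z = 0" if bU: "box a b \<subseteq> U" for a b
  proof -
    obtain R where "\<forall>z\<in>box a b. norm z \<le> R" using bounded_box[of a b] unfolding bounded_iff by blast
    then have R: "box a b \<subseteq> cball 0 R" by auto
    \<comment> \<open>Cutting \<open>g\<close> to the box turns the integral over any other box into
      one over the intersection, which is again a box inside \<open>U\<close>.\<close>
    let ?f = "\<lambda>z. indicator (box a b) z * g z"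
    have fm: "?f \<in> borel_measurable lborel"
      by (intro borel_measurable_times borel_measurable_indicator gm) auto
    have val: "integral\<^sup>L lborel (\<lambda>z. indicator (box c d) z * ?f z) = 0" for c d
    proof -
      have m: "(\<lambda>z. indicator (box c d) z * ?f z) \<in> borel_measurable lborel"
        by (intro borel_measurable_times borel_measurable_indicator fm) auto
      obtain c' d' where cd: "box c d \<inter> box a b = box c' d'" unfolding box_Int_box by blast
      have "integral\<^sup>L lborel (\<lambda>z. indicator (box c d) z * ?f z) = (LINT z|lebesgue. indicator (box c d) z * ?f z)"
        by (rule integral_completion[OF m, symmetric])
      also have "\<dots> = (LINT z|lebesgue. indicator (box c' d') z * h z)"
      proof (rule integral_cong_AE)
        show "(\<lambda>z. indicator (box c d) z * ?f z) \<in> borel_measurable lebesgue" using m by (rule measurable_completion)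
        show "(\<lambda>z. indicator (box c' d') z * h z) \<in> borel_measurable lebesgue"
          by (intro borel_measurable_times borel_measurable_indicator hm) auto
        show "AE z in lebesgue. indicator (box c d) z * ?f z = indicator (box c' d') z * h z"
          using gh' unfolding cd[symmetric] by eventually_elim (simp add: indicator_def)
      qed
      also have "\<dots> = 0" using box0[of c' d'] bU cd by blast
      finally show ?thesis .
    qed
    have val': "integral\<^sup>L lborel ?f = 0"
    proof -
      have "(\<lambda>z. indicator (box a b) z * ?f z) = ?f" by (auto simp: fun_eq_iff indicator_def)
      then show ?thesis using val[of a b] by simp
    qed
    have fi: "integrable lborel ?f"
    proof -
      have "integrable lebesgue (\<lambda>z. indicator (box a b) z * (indicator (cball 0 R) z * h z))"
        using integrable_mult_indicator[OF _ int[of R], of "box a b"] by simp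
      then have "integrable lebesgue ?f"
      proof (rule integrable_cong_AE_imp)
        show "?f \<in> borel_measurable lebesgue" using fm by (rule measurable_completion)
        show "AE z in lebesgue. indicator (box a b) z * (indicator (cball 0 R) z * h z) = ?f z"
          using gh' by eventually_elim (use R in \<open>auto simp: indicator_def\<close>)
      qed
      then show ?thesis using integrable_completion[OF fm] by simp
    qed
    have "AE z in lborel. ?f z = 0"
      by (rule integrable_lborel_zero_on_boxes[OF fi _ val']) (simp add: set_lebesgue_integral_def val)
    then have "AE z in lebesgue. ?f z = 0" by (rule AE_completion)
    then show ?thesis using gh' by eventually_elim (auto simp: indicator_def)
  qed
  obtain \<D> where D: "countable \<D>" "\<And>X. X \<in> \<D> \<Longrightarrow> \<exists>a b. X = box a b" "\<Union>\<D> = U"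
    using open_countable_Union_open_box[OF U] by metis
  have "AE z in lebesgue. \<forall>X\<in>\<D>. z \<in> X \<longrightarrow> h z = 0"
    unfolding AE_ball_countable[OF D(1)] using D on_box by (metis Union_upper)
  then show ?thesis by eventually_elim (use D(3) in blast)
qed

text \<open>Purely real test functions detect the real part of \<open>g\<close>, purely imaginary
  ones the imaginary part.\<close>

theorem test_functions_separate:
  assumes U: "open U" and g: "g \<in> VV U"
    and zero: "\<And>\<phi> \<psi>. test_function U \<phi> \<Longrightarrow> test_function U \<psi> \<Longrightarrow> inner g (ctf \<phi> \<psi>) = 0"
  shows "g = 0"
proof -
  have UL: "U \<in> sets lebesgue" using U by (simp add: borel_open)
  have inn: "inner g (ctf \<phi> \<psi>) = (LINT z|lebesgue. \<phi> z * Re (fn g z)) + (LINT z|lebesgue. \<psi> z * Im (fn g z))"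
    if t: "test_function U \<phi>" "test_function U \<psi>" for \<phi> \<psi>
  proof -
    have i: "integrable lebesgue (\<lambda>z. fn g z * cnj (Complex (\<phi> z) 0))" "integrable lebesgue (\<lambda>z. fn g z * cnj (Complex 0 (\<psi> z)))"
      by (intro sqint_product sqint_fn sqint_ctf[OF t(1) test_zero] sqint_ctf[OF test_zero t(2)])+
    have "inner g (ctf \<phi> \<psi>) = Re (LINT z|lebesgue. fn g z * cnj (Complex (\<phi> z) (\<psi> z)))"
      using l2_inner_mk[OF sqint_fn[of g] sqint_ctf[OF t]] by (simp add: ctf_def)
    also have "(\<lambda>z. fn g z * cnj (Complex (\<phi> z) (\<psi> z))) = (\<lambda>z. fn g z * cnj (Complex (\<phi> z) 0) + fn g z * cnj (Complex 0 (\<psi> z)))"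
      by (simp add: fun_eq_iff complex_eq_iff)
    also have "Re (LINT z|lebesgue. fn g z * cnj (Complex (\<phi> z) 0) + fn g z * cnj (Complex 0 (\<psi> z)))
        = Re (LINT z|lebesgue. fn g z * cnj (Complex (\<phi> z) 0)) + Re (LINT z|lebesgue. fn g z * cnj (Complex 0 (\<psi> z)))"
      using i by simp
    also have "Re (LINT z|lebesgue. fn g z * cnj (Complex (\<phi> z) 0)) = (LINT z|lebesgue. Re (fn g z * cnj (Complex (\<phi> z) 0)))"
      by (rule integral_Re[OF i(1), symmetric])
    also have "Re (LINT z|lebesgue. fn g z * cnj (Complex 0 (\<psi> z))) = (LINT z|lebesgue. Re (fn g z * cnj (Complex 0 (\<psi> z))))"
      by (rule integral_Re[OF i(2), symmetric])
    finally show ?thesis by (simp add: mult.commute)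
  qed
  have int: "integrable lebesgue (\<lambda>z. indicator (cball 0 R) z * Re (fn g z))"
    "integrable lebesgue (\<lambda>z. indicator (cball 0 R) z * Im (fn g z))" for R
  proof -
    have i: "integrable lebesgue (\<lambda>z. fn g z * cnj (indicator (cball 0 R) z))"
      by (intro sqint_product sqint_fn sqint_cball)
    have "(\<lambda>z. Re (fn g z * cnj (indicator (cball 0 R) z))) = (\<lambda>z. indicator (cball 0 R) z * Re (fn g z))"
      "(\<lambda>z. Im (fn g z * cnj (indicator (cball 0 R) z))) = (\<lambda>z. indicator (cball 0 R) z * Im (fn g z))"
      by (auto simp: fun_eq_iff indicator_def)
    then show "integrable lebesgue (\<lambda>z. indicator (cball 0 R) z * Re (fn g z))"
      "integrable lebesgue (\<lambda>z. indicator (cball 0 R) z * Im (fn g z))"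
      using integrable_Re[OF i] integrable_Im[OF i] by auto
  qed
  have "AE z in lebesgue. z \<in> U \<longrightarrow> Re (fn g z) = 0"
  proof (rule AE_zero_of_rect_integrals[OF _ U int(1)])
    show "(LINT z|lebesgue. \<phi> z * Re (fn g z)) = 0" if "test_function U \<phi>" for \<phi>
      using inn[OF that test_zero] zero[OF that test_zero] by simp
  qed measurable
  moreover have "AE z in lebesgue. z \<in> U \<longrightarrow> Im (fn g z) = 0"
  proof (rule AE_zero_of_rect_integrals[OF _ U int(2)])
    show "(LINT z|lebesgue. \<psi> z * Im (fn g z)) = 0" if "test_function U \<psi>" for \<psi>
      using inn[OF test_zero that] zero[OF test_zero that] by simp
  qed measurable
  moreover have "AE z in lebesgue. z \<notin> U \<longrightarrow> fn g z = 0" using g VV_iff[OF UL] by blast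
  ultimately have ae: "AE z in lebesgue. fn g z = 0"
    by eventually_elim (auto simp: complex_eq_iff)
  show ?thesis by (rule l2_eqI) (use ae fn_zero in \<open>eventually_elim, simp\<close>)
qed

section \<open>Weak derivatives and translates\<close>

text \<open>The inner product of \<open>l2\<close> is only the real part of the complex one, so the defining identity is
  required for complex test functions \<open>\<phi> + \<i> \<psi>\<close>.\<close>

definition wd :: "(real \<times> real) set \<Rightarrow> real \<times> real \<Rightarrow> l2 \<Rightarrow> l2 \<Rightarrow> bool" where
  "wd U b f g \<longleftrightarrow> f \<in> VV U \<and> g \<in> VV U \<and> (\<forall>\<phi> \<psi>. test_function U \<phi> \<longrightarrow> test_function U \<psi> \<longrightarrow>
     inner f (ctf (directional_deriv b \<phi>) (directional_deriv b \<psi>)) = - inner g (ctf \<phi> \<psi>))"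

lemma wdD:
  assumes "wd U b f g"
  shows "f \<in> VV U" "g \<in> VV U"
    "test_function U \<phi> \<Longrightarrow> test_function U \<psi> \<Longrightarrow>
      inner f (ctf (directional_deriv b \<phi>) (directional_deriv b \<psi>)) = - inner g (ctf \<phi> \<psi>)"
  using assms unfolding wd_def by blast+

lemma open_lebesgue: "open U \<Longrightarrow> U \<in> sets lebesgue" for U :: "(real \<times> real) set"
  by (simp add: borel_open)

lemma wd_unique:
  assumes U: "open U" and "wd U b f g" "wd U b f g'"
  shows "g = g'"
proof -
  have "g - g' = 0"
  proof (rule test_functions_separate[OF U])
    show "g - g' \<in> VV U"
      using wdD(2)[OF assms(2)] wdD(2)[OF assms(3)] VV_subspace[OF open_lebesgue[OF U]]
      by (rule subspace_diff[rotated])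
    show "inner (g - g') (ctf \<phi> \<psi>) = 0" if "test_function U \<phi>" "test_function U \<psi>" for \<phi> \<psi>
      using wdD(3)[OF assms(2) that] wdD(3)[OF assms(3) that] by (simp add: inner_diff_left)
  qed
  then show ?thesis by simp
qed

context
  fixes U :: "(real \<times> real) set"
  assumes U: "open U"
begin

lemmas VVc = subspace_add[OF VV_subspace[OF open_lebesgue[OF U]]]
  subspace_diff[OF VV_subspace[OF open_lebesgue[OF U]]] subspace_scale[OF VV_subspace[OF open_lebesgue[OF U]]]

lemma wd_add: "wd U b f g \<Longrightarrow> wd U b f' g' \<Longrightarrow> wd U b (f + f') (g + g')"
  unfolding wd_def by (simp add: VVc(1) inner_add_left)

lemma wd_scaleR: "wd U b f g \<Longrightarrow> wd U b (c *\<^sub>R f) (c *\<^sub>R g)"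
  unfolding wd_def by (simp add: VVc(3))

lemma wd_diff: "wd U b f g \<Longrightarrow> wd U b f' g' \<Longrightarrow> wd U b (f - f') (g - g')"
  unfolding wd_def by (simp add: VVc(2) inner_diff_left)

text \<open>The defining identity is continuous in both entries. Closedness of the Dirichlet form
  reduces to this.\<close>

lemma wd_limit:
  assumes "\<And>n. wd U b (f n) (g n)" "f \<longlonglongrightarrow> f'" "g \<longlonglongrightarrow> g'"
  shows "wd U b f' g'"
  unfolding wd_def
proof (intro conjI allI impI)
  have c: "closed (VV U)" by (rule VV_closed[OF open_lebesgue[OF U]])
  show "f' \<in> VV U" using closed_sequentially[OF c _ assms(2)] wdD(1)[OF assms(1)] by blast
  show "g' \<in> VV U" using closed_sequentially[OF c _ assms(3)] wdD(2)[OF assms(1)] by blast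
  fix \<phi> \<psi> assume t: "test_function U \<phi>" "test_function U \<psi>"
  have "(\<lambda>n. inner (f n) (ctf (directional_deriv b \<phi>) (directional_deriv b \<psi>)))
      \<longlonglongrightarrow> inner f' (ctf (directional_deriv b \<phi>) (directional_deriv b \<psi>))"
    by (intro tendsto_intros assms)
  moreover have "(\<lambda>n. - inner (g n) (ctf \<phi> \<psi>)) \<longlonglongrightarrow> - inner g' (ctf \<phi> \<psi>)"
    by (intro tendsto_intros assms)
  ultimately show "inner f' (ctf (directional_deriv b \<phi>) (directional_deriv b \<psi>)) = - inner g' (ctf \<phi> \<psi>)"
    using wdD(3)[OF assms(1) t] LIMSEQ_unique by simp
qed

lemma ctf_scale:
  assumes "test_function U \<phi>" "test_function U \<psi>"
  shows "ctf (\<lambda>z. c * \<phi> z) (\<lambda>z. c * \<psi> z) = c *\<^sub>R ctf \<phi> \<psi>"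
  using mul_ctf[OF assms, of "\<lambda>z. c"] mul_of_real[of c "ctf \<phi> \<psi>"] by simp

lemma test_cmult: "test_function U \<phi> \<Longrightarrow> test_function U (\<lambda>z. c * \<phi> z)"
  by (rule test_mult) auto

lemma test_add: 
  assumes "test_function U \<phi>" "test_function U \<psi>" shows "test_function U (\<lambda>z. \<phi> z + \<psi> z)"
proof -
  let ?A = "closure {z. \<phi> z \<noteq> 0} \<union> closure {z. \<psi> z \<noteq> 0}"
  have sub: "closure {z. \<phi> z + \<psi> z \<noteq> 0} \<subseteq> ?A"
  proof (rule closure_minimal)
    have "{z. \<phi> z + \<psi> z \<noteq> 0} \<subseteq> {z. \<phi> z \<noteq> 0} \<union> {z. \<psi> z \<noteq> 0}" by auto
    also have "\<dots> \<subseteq> ?A" by (intro Un_mono closure_subset)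
    finally show "{z. \<phi> z + \<psi> z \<noteq> 0} \<subseteq> ?A" .
  qed auto
  have A: "compact ?A" "?A \<subseteq> U" using assms by (auto simp: test_function_def)
  have "bounded (closure {z. \<phi> z + \<psi> z \<noteq> 0})"
    by (rule bounded_subset[OF compact_imp_bounded[OF A(1)] sub])
  then show ?thesis
    unfolding test_function_def compact_eq_bounded_closed
    using smooth_add[OF test_smooth[OF assms(1)] test_smooth[OF assms(2)]] order_trans[OF sub A(2)]
    by (intro conjI) simp_all
qed

lemma ii_ctf:
  assumes "test_function U \<phi>" "test_function U \<psi>"
  shows "ii (ctf \<phi> \<psi>) = ctf (\<lambda>z. -1 * \<psi> z) \<phi>"
  by (rule l2_eqI) (use fn_mul[OF bm_const[of \<i>], of "ctf \<phi> \<psi>"] fn_ctf[OF assms]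
      fn_ctf[OF test_cmult[OF assms(2), of "-1"] assms(1)] in
      \<open>unfold ii_def, eventually_elim, simp add: complex_eq_iff\<close>)

lemma directional_deriv_cmult:
  assumes "smooth \<phi>" shows "directional_deriv b (\<lambda>z. c * \<phi> z) = (\<lambda>z. c * directional_deriv b \<phi> z)"
proof -
  have "directional_deriv b (\<lambda>z. c :: real) = (\<lambda>z. 0)"
    by (rule ext, rule directional_deriv_eq) simp
  then show ?thesis using directional_deriv_mult[OF smooth_const[of c] assms, of b] by simp
qed

text \<open>Multiplication by i moves to the test side and rotates the pair (\<phi>, \<psi>) into
  (-\<psi>, \<phi>), which is again admissible.\<close>

lemma wd_ii:
  assumes "wd U b f g" shows "wd U b (ii f) (ii g)"
  unfolding wd_def
proof (intro conjI allI impI)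
  show "ii f \<in> VV U" "ii g \<in> VV U"
    unfolding ii_def using mul_VV[OF open_lebesgue[OF U]] wdD(1,2)[OF assms] by auto
  have skew: "inner (ii x) y = - inner x (ii y)" for x y
    using ii_isometry[of x "ii y"] by (simp add: ii_square)
  fix \<phi> \<psi> assume t: "test_function U \<phi>" "test_function U \<psi>"
  note d = test_directional_deriv[OF t(1), of b] test_directional_deriv[OF t(2), of b]
  have "inner f (ctf (directional_deriv b (\<lambda>z. -1 * \<psi> z)) (directional_deriv b \<phi>)) = - inner g (ctf (\<lambda>z. -1 * \<psi> z) \<phi>)"
    by (rule wdD(3)[OF assms test_cmult[OF t(2)] t(1)])
  then show "inner (ii f) (ctf (directional_deriv b \<phi>) (directional_deriv b \<psi>)) = - inner (ii g) (ctf \<phi> \<psi>)"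
    unfolding skew ii_ctf[OF t] ii_ctf[OF d] directional_deriv_cmult[OF test_smooth[OF t(2)]] by simp
qed

text \<open>Integration by parts without integrals: translation may be moved to the other factor
  with the opposite sign, and the derivative at s = 0 is computed on either side.\<close>

lemma wd_test:
  assumes t: "test_function U \<phi>" "test_function U \<psi>"
  shows "wd U b (ctf \<phi> \<psi>) (ctf (directional_deriv b \<phi>) (directional_deriv b \<psi>))"
  unfolding wd_def
proof (intro conjI allI impI ctf_VV[OF t] ctf_VV test_directional_deriv t open_lebesgue[OF U])
  fix \<phi>' \<psi>' assume t': "test_function U \<phi>'" "test_function U \<psi>'"
  let ?x = "ctf \<phi> \<psi>" and ?y = "ctf \<phi>' \<psi>'"
  let ?dx = "ctf (directional_deriv b \<phi>) (directional_deriv b \<psi>)"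
  let ?dy = "ctf (directional_deriv b \<phi>') (directional_deriv b \<psi>')"
  have 1: "((\<lambda>s. inner ?x (tr (s *\<^sub>R b) ?y)) has_real_derivative inner ?x ?dy) (at 0)"
    using DERIV_inner_tr_ctf[OF t', of ?x b 0] by simp
  have "((\<lambda>s. inner ?y (tr (s *\<^sub>R b) ?x)) has_real_derivative inner ?y ?dx) (at (- 0))"
    using DERIV_inner_tr_ctf[OF t, of ?y b 0] by simp
  then have "((\<lambda>s. inner ?y (tr ((- s) *\<^sub>R b) ?x)) has_real_derivative inner ?y ?dx * -1) (at 0)"
    by (intro DERIV_chain2[where g = uminus]) (auto intro!: derivative_eq_intros)
  moreover have "inner ?y (tr ((- s) *\<^sub>R b) ?x) = inner ?x (tr (s *\<^sub>R b) ?y)" for s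
    using inner_tr[of "(- s) *\<^sub>R b" ?x ?y] by (simp add: inner_commute)
  ultimately have 2: "((\<lambda>s. inner ?x (tr (s *\<^sub>R b) ?y)) has_real_derivative - inner ?dx ?y) (at 0)"
    by (simp add: inner_commute)
  show "inner ?x ?dy = - inner ?dx ?y" by (rule DERIV_unique[OF 1 2])
qed

text \<open>An element of \<open>VV U\<close> orthogonal to all test functions is zero by
  \<open>test_functions_separate\<close>.\<close>

lemma tests_dense: "closure {ctf \<phi> \<psi> | \<phi> \<psi>. test_function U \<phi> \<and> test_function U \<psi>} = VV U"
proof (rule dense_subspace_if_orthogonal_trivial)
  let ?S = "{ctf \<phi> \<psi> | \<phi> \<psi>. test_function U \<phi> \<and> test_function U \<psi>}"
  show "subspace ?S"
  proof (rule subspaceI)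
    have "ctf (\<lambda>z. 0) (\<lambda>z. 0) = 0"
      using ctf_scale[OF test_zero test_zero, of 0] by simp
    then show "0 \<in> ?S"
      by (intro CollectI exI[of _ "\<lambda>z. 0"] conjI test_zero) simp
    show "x + y \<in> ?S" if xy: "x \<in> ?S" "y \<in> ?S" for x y
    proof -
      obtain \<phi> \<psi> \<phi>' \<psi>' where t: "test_function U \<phi>" "test_function U \<psi>" "test_function U \<phi>'" "test_function U \<psi>'"
        "x = ctf \<phi> \<psi>" "y = ctf \<phi>' \<psi>'" using xy by auto
      then show ?thesis using ctf_add[OF t(1-4)] test_add by blast
    qed
    show "c *\<^sub>R x \<in> ?S" if x: "x \<in> ?S" for c x
    proof -
      obtain \<phi> \<psi> where t: "test_function U \<phi>" "test_function U \<psi>" "x = ctf \<phi> \<psi>" using x by auto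
      have "c *\<^sub>R x = ctf (\<lambda>z. c * \<phi> z) (\<lambda>z. c * \<psi> z)" using ctf_scale[OF t(1,2)] t(3) by simp
      then show ?thesis using test_cmult[OF t(1)] test_cmult[OF t(2)] by blast
    qed
  qed
  show "?S \<subseteq> VV U" using ctf_VV open_lebesgue[OF U] by blast
  show "subspace (VV U)" "closed (VV U)" by (intro VV_subspace VV_closed open_lebesgue U)+
  fix x assume "x \<in> VV U" "\<forall>y\<in>?S. inner x y = 0"
  then show "x = 0" by (intro test_functions_separate[OF U]) blast+
qed

text \<open>By density \<open>d\<close> itself is a limit of test functions, and in the limit the
  bound reads <d, d> <= C |d|.\<close>

lemma norm_le_by_tests:
  assumes "d \<in> VV U" "0 \<le> C"
    and le: "\<And>\<phi> \<psi>. test_function U \<phi> \<Longrightarrow> test_function U \<psi> \<Longrightarrow> \<bar>inner d (ctf \<phi> \<psi>)\<bar> \<le> C * norm (ctf \<phi> \<psi>)"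
  shows "norm d \<le> C"
proof -
  let ?S = "{ctf \<phi> \<psi> | \<phi> \<psi>. test_function U \<phi> \<and> test_function U \<psi>}"
  have "d \<in> closure ?S" using assms(1) by (simp only: tests_dense)
  from iffD1[OF closure_sequential this]
  obtain X where X: "(\<forall>n. X n \<in> ?S) \<and> X \<longlonglongrightarrow> d" by (rule exE)
  have "inner d (X n) \<le> C * norm (X n)" for n
  proof -
    obtain \<phi> \<psi> where t: "test_function U \<phi>" "test_function U \<psi>" "X n = ctf \<phi> \<psi>" using conjunct1[OF X] by blast
    show ?thesis using le[OF t(1,2)] unfolding t(3) by simp
  qed
  moreover have "(\<lambda>n. inner d (X n)) \<longlonglongrightarrow> inner d d" "(\<lambda>n. C * norm (X n)) \<longlonglongrightarrow> C * norm d"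
    by (intro tendsto_intros conjunct2[OF X])+
  ultimately have "inner d d \<le> C * norm d" by (intro LIMSEQ_le) auto
  then have "norm d * norm d \<le> C * norm d" by (simp add: power2_norm_eq_inner[symmetric] power2_eq_square)
  then show ?thesis using assms(2) by (cases "norm d = 0") (auto simp: mult_le_cancel_right)
qed

end

lemma wd_mono:
  assumes "wd U b f g" "W \<subseteq> U" "f \<in> VV W" "g \<in> VV W"
  shows "wd W b f g"
  using assms test_mono[OF _ assms(2)] unfolding wd_def by blast

text \<open>Two open sets occur because the product rule also changes the domain: from U to the
  plane and back with a compactly supported factor, and from \<Omega> - K to \<Omega> with a factor
  vanishing near K. The last hypothesis is what permits each change.\<close>

lemma wd_mul:
  assumes w: "wd U b f g" and s: "smooth \<eta>"
    and m: "bm (\<lambda>z. of_real (\<eta> z))" "bm (\<lambda>z. of_real (directional_deriv b \<eta> z))"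
    and W: "open W" and V: "mul (\<lambda>z. of_real (\<eta> z)) f \<in> VV W" "mul (\<lambda>z. of_real (\<eta> z)) g \<in> VV W"
      "mul (\<lambda>z. of_real (directional_deriv b \<eta> z)) f \<in> VV W"
    and t: "\<And>\<phi>. test_function W \<phi> \<Longrightarrow> test_function U (\<lambda>z. \<eta> z * \<phi> z)"
  shows "wd W b (mul (\<lambda>z. of_real (\<eta> z)) f)
    (mul (\<lambda>z. of_real (\<eta> z)) g + mul (\<lambda>z. of_real (directional_deriv b \<eta> z)) f)"
  unfolding wd_def
proof (intro conjI allI impI)
  show "mul (\<lambda>z. of_real (\<eta> z)) f \<in> VV W" by (rule V)
  show "mul (\<lambda>z. of_real (\<eta> z)) g + mul (\<lambda>z. of_real (directional_deriv b \<eta> z)) f \<in> VV W"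
    by (intro VVc(1) W V)
  fix \<phi> \<psi> assume tW: "test_function W \<phi>" "test_function W \<psi>"
  note sm = test_smooth[OF tW(1)] test_smooth[OF tW(2)]
  let ?m = "mul (\<lambda>z. of_real (\<eta> z))" and ?d = "mul (\<lambda>z. of_real (directional_deriv b \<eta> z))"
  let ?c = "ctf (directional_deriv b \<phi>) (directional_deriv b \<psi>)"
  have sa: "inner (mul (\<lambda>z. of_real (r z)) x) y = inner x (mul (\<lambda>z. of_real (r z)) y)"
    if "bm (\<lambda>z. of_real (r z))" for r x y using inner_mul[OF that] by simp
  have D: "test_function W (\<lambda>z. directional_deriv b \<eta> z * \<phi> z)" "test_function W (\<lambda>z. directional_deriv b \<eta> z * \<psi> z)"
    "test_function W (\<lambda>z. \<eta> z * directional_deriv b \<phi> z)" "test_function W (\<lambda>z. \<eta> z * directional_deriv b \<psi> z)"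
    using tW s by (auto intro!: test_mult test_directional_deriv smooth_directional_deriv)
  have "?d (ctf \<phi> \<psi>) + ?m ?c = ctf (\<lambda>z. directional_deriv b \<eta> z * \<phi> z + \<eta> z * directional_deriv b \<phi> z)
      (\<lambda>z. directional_deriv b \<eta> z * \<psi> z + \<eta> z * directional_deriv b \<psi> z)"
    unfolding mul_ctf[OF tW m(2)] mul_ctf[OF test_directional_deriv[OF tW(1)] test_directional_deriv[OF tW(2)] m(1)]
    by (rule ctf_add[OF D])
  also have "\<dots> = ctf (directional_deriv b (\<lambda>z. \<eta> z * \<phi> z)) (directional_deriv b (\<lambda>z. \<eta> z * \<psi> z))"
    by (simp add: directional_deriv_mult s sm)
  finally have "inner f (?d (ctf \<phi> \<psi>)) + inner f (?m ?c) = - inner g (ctf (\<lambda>z. \<eta> z * \<phi> z) (\<lambda>z. \<eta> z * \<psi> z))"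
    using wdD(3)[OF w t[OF tW(1)] t[OF tW(2)]] by (metis inner_add_right)
  also have "ctf (\<lambda>z. \<eta> z * \<phi> z) (\<lambda>z. \<eta> z * \<psi> z) = ?m (ctf \<phi> \<psi>)"
    by (rule mul_ctf[OF tW m(1), symmetric])
  finally show "inner (?m f) ?c = - inner (?m g + ?d f) (ctf \<phi> \<psi>)"
    by (simp add: sa[OF m(1)] sa[OF m(2)] inner_add_left)
qed

lemma VV_UNIV [simp]: "VV UNIV = UNIV"
  using VV_iff[of UNIV] by auto

section \<open>Comparison with translates\<close>

lemma wd_tr:
  assumes "wd UNIV b f g" shows "wd UNIV b (tr a f) (tr a g)"
  unfolding wd_def
proof (intro conjI allI impI)
  fix \<phi> \<psi> assume t: "test_function UNIV \<phi>" "test_function UNIV \<psi>"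
  have t': "test_function UNIV (\<lambda>z. \<phi> (- a + z))" "test_function UNIV (\<lambda>z. \<psi> (- a + z))"
    by (rule test_translate[OF t(1)], simp, rule test_translate[OF t(2)], simp)
  show "inner (tr a f) (ctf (directional_deriv b \<phi>) (directional_deriv b \<psi>)) = - inner (tr a g) (ctf \<phi> \<psi>)"
    using wdD(3)[OF assms t']
    unfolding inner_tr tr_ctf[OF t] tr_ctf[OF test_directional_deriv[OF t(1)] test_directional_deriv[OF t(2)]]
      directional_deriv_translate[OF test_smooth[OF t(1)]] directional_deriv_translate[OF test_smooth[OF t(2)]] .
qed auto

text \<open>While the test function is moved by s from 0 to t it stays supported in
  \<open>U\<close>, so its pairing with \<open>u\<close> has a derivative expressed by
  \<open>g\<close>. The mean value inequality and duality with test functions give the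
  bound.\<close>

lemma difference_quotient:
  assumes W: "open W" and w: "wd U e u g" and t: "0 \<le> t"
    and sub: "\<And>z s. z \<in> W \<Longrightarrow> 0 \<le> s \<Longrightarrow> s \<le> t \<Longrightarrow> z + s *\<^sub>R e \<in> U"
  shows "norm (cut W (tr (t *\<^sub>R e) u - u)) \<le> t * norm g"
proof (rule norm_le_by_tests[OF W])
  let ?d = "cut W (tr (t *\<^sub>R e) u - u)"
  have WL: "W \<in> sets lebesgue" by (rule open_lebesgue[OF W])
  show "?d \<in> VV W" unfolding VV_def using cut_cut[OF WL WL] by simp
  show "0 \<le> t * norm g" using t by simp
  fix \<phi> \<psi> assume tf: "test_function W \<phi>" "test_function W \<psi>"
  let ?F = "\<lambda>s. inner u (tr (s *\<^sub>R (- e)) (ctf \<phi> \<psi>))"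
  have der: "(?F has_real_derivative inner g (tr (s *\<^sub>R (- e)) (ctf \<phi> \<psi>))) (at s)" if s: "0 \<le> s" "s \<le> t" for s
  proof -
    let ?a = "s *\<^sub>R (- e)"
    have tU: "test_function U (\<lambda>z. \<phi> (?a + z))" "test_function U (\<lambda>z. \<psi> (?a + z))"
      by (rule test_translate[OF tf(1)], use sub s in simp, rule test_translate[OF tf(2)], use sub s in simp)
    have neg: "directional_deriv (- e) f = (\<lambda>z. -1 * directional_deriv e f z)" if "smooth f" for f
      using smoothE(2)[OF that, of "- e"] smoothE(2)[OF that, of e] by (auto simp: fun_eq_iff)
    have "tr ?a (ctf (directional_deriv (- e) \<phi>) (directional_deriv (- e) \<psi>))
        = ctf (\<lambda>z. directional_deriv (- e) \<phi> (?a + z)) (\<lambda>z. directional_deriv (- e) \<psi> (?a + z))"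
      by (rule tr_ctf[OF test_directional_deriv[OF tf(1)] test_directional_deriv[OF tf(2)]])
    also have "\<dots> = ctf (\<lambda>z. -1 * directional_deriv e (\<lambda>z. \<phi> (?a + z)) z) (\<lambda>z. -1 * directional_deriv e (\<lambda>z. \<psi> (?a + z)) z)"
      unfolding neg[OF test_smooth[OF tf(1)]] neg[OF test_smooth[OF tf(2)]]
        directional_deriv_translate[OF test_smooth[OF tf(1)]] directional_deriv_translate[OF test_smooth[OF tf(2)]] ..
    also have "\<dots> = (-1) *\<^sub>R ctf (directional_deriv e (\<lambda>z. \<phi> (?a + z))) (directional_deriv e (\<lambda>z. \<psi> (?a + z)))"
      by (rule ctf_scale[OF open_UNIV test_mono[OF test_directional_deriv[OF tU(1)] subset_UNIV]
          test_mono[OF test_directional_deriv[OF tU(2)] subset_UNIV]])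
    finally have "inner u (tr ?a (ctf (directional_deriv (- e) \<phi>) (directional_deriv (- e) \<psi>)))
        = inner g (ctf (\<lambda>z. \<phi> (?a + z)) (\<lambda>z. \<psi> (?a + z)))"
      using wdD(3)[OF w tU] by simp
    then show ?thesis using DERIV_inner_tr_ctf[OF tf, of u "- e" s] tr_ctf[OF tf, of ?a] by simp
  qed
  have "norm (?F t - ?F 0) \<le> (norm g * norm (ctf \<phi> \<psi>)) * norm (t - 0)"
  proof (rule field_differentiable_bound[where S = "{0..t}"])
    fix s assume s: "s \<in> {0..t}"
    show "(?F has_real_derivative inner g (tr (s *\<^sub>R (- e)) (ctf \<phi> \<psi>))) (at s within {0..t})"
      by (rule has_field_derivative_at_within[OF der]) (use s in auto)
    show "norm (inner g (tr (s *\<^sub>R (- e)) (ctf \<phi> \<psi>))) \<le> norm g * norm (ctf \<phi> \<psi>)"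
      using Cauchy_Schwarz_ineq2[of g "tr (s *\<^sub>R (- e)) (ctf \<phi> \<psi>)"] by (simp only: norm_tr real_norm_def)
  qed (use t in auto)
  moreover have "?F t - ?F 0 = inner ?d (ctf \<phi> \<psi>)"
  proof -
    have "cut W (ctf \<phi> \<psi>) = ctf \<phi> \<psi>" using ctf_VV[OF tf WL] by (simp add: VV_def)
    then have "inner ?d (ctf \<phi> \<psi>) = inner (tr (t *\<^sub>R e) u - u) (ctf \<phi> \<psi>)"
      by (simp only: inner_cut[OF WL])
    also have "\<dots> = ?F t - ?F 0" by (simp add: inner_diff_left inner_tr)
    finally show ?thesis by simp
  qed
  ultimately show "\<bar>inner ?d (ctf \<phi> \<psi>)\<bar> \<le> t * norm g * norm (ctf \<phi> \<psi>)" using t by (simp add: mult_ac)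
qed

text \<open>The backward estimate follows from the forward one, as translations are
  isometries.\<close>

lemma difference_quotient_UNIV:
  assumes "wd UNIV e u g" "0 \<le> t"
  shows "norm (tr (t *\<^sub>R e) u - u) \<le> t * norm g" "norm (tr (- (t *\<^sub>R e)) u - u) \<le> t * norm g"
proof -
  have e: "cut UNIV x = x" for x using VV_UNIV unfolding VV_def by auto
  show 1: "norm (tr (t *\<^sub>R e) u - u) \<le> t * norm g"
    using difference_quotient[OF open_UNIV assms] unfolding e by simp
  have "tr (t *\<^sub>R e) (tr (- (t *\<^sub>R e)) u - u) = - (tr (t *\<^sub>R e) u - u)" by (simp add: tr_diff tr_tr)
  then have "norm (tr (- (t *\<^sub>R e)) u - u) = norm (tr (t *\<^sub>R e) u - u)" by (metis norm_minus_cancel norm_tr)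
  then show "norm (tr (- (t *\<^sub>R e)) u - u) \<le> t * norm g" using 1 by simp
qed

text \<open>Chaining the differences between consecutive translates of \<open>S\<close> and averaging over the starting
  point replaces a trace theorem.\<close>

lemma translates_bound:
  fixes v :: l2 and a :: "real \<times> real"
  assumes S: "open S" and N: "N \<ge> 1" and disj: "disjoint_family (\<lambda>k::nat. {z. z - real k *\<^sub>R a \<in> S})"
    and D: "norm (cut (\<Union>k<N. {z. z - real k *\<^sub>R a \<in> S}) (tr a v - v)) \<le> D"
  shows "norm (cut S v) \<le> norm (cut (\<Union>k<N. {z. z - real k *\<^sub>R a \<in> S}) v) / sqrt N + sqrt N * D"
proof -
  define T where "T k = {z. z - real k *\<^sub>R a \<in> S}" for k :: nat
  have To: "open (T k)" for k
  proof -
    have "T k = (\<lambda>z. z - real k *\<^sub>R a) -` S" by (auto simp: T_def)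
    then show ?thesis using S by (auto intro!: open_vimage continuous_intros)
  qed
  then have TL: "T k \<in> sets lebesgue" for k by (intro open_lebesgue)
  have dT: "disjoint_family T" using disj unfolding T_def .
  define \<alpha> where "\<alpha> k = norm (cut (T k) v)" for k
  define d where "d k = norm (cut (T k) (tr a v - v))" for k
  \<comment> \<open>Translation identifies \<open>v\<close> on \<open>T (Suc k)\<close> with
    \<open>tr a v\<close> on \<open>T k\<close>, so the two norms differ by at most that of
    \<open>tr a v - v\<close> on \<open>T k\<close>.\<close>
  have step: "\<alpha> k \<le> \<alpha> (Suc k) + d k" for k
  proof -
    have "tr a (cut (T (Suc k)) v) = mul (\<lambda>z. indicator (T (Suc k)) (a + z)) (tr a v)"
      by (rule tr_mul[OF bm_indicator[OF TL]])
    also have "(\<lambda>z. indicator (T (Suc k)) (a + z)) = (indicator (T k) :: _ \<Rightarrow> complex)"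
      by (auto simp: fun_eq_iff indicator_def T_def algebra_simps)
    finally have "\<alpha> (Suc k) = norm (cut (T k) (tr a v))" unfolding \<alpha>_def by (metis norm_tr)
    moreover have "cut (T k) v = cut (T k) (tr a v) - cut (T k) (tr a v - v)"
      by (simp add: mul_diff bm_indicator TL)
    ultimately show ?thesis unfolding \<alpha>_def d_def using norm_triangle_ineq4 by metis
  qed
  have chain: "\<alpha> 0 \<le> \<alpha> k + (\<Sum>j<k. d j)" for k
  proof (induction k)
    case (Suc k)
    then show ?case using step[of k] by simp
  qed simp
  have cs: "(\<Sum>k<N. x k) \<le> sqrt N * sqrt (\<Sum>k<N. (x k)\<^sup>2)" for x :: "nat \<Rightarrow> real"
  proof -
    have "(\<Sum>k<N. 1 * x k)\<^sup>2 \<le> (\<Sum>k<N. 1\<^sup>2) * (\<Sum>k<N. (x k)\<^sup>2)" by (rule Cauchy_Schwarz_ineq_sum)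
    then have "(\<Sum>k<N. x k) \<le> sqrt (N * (\<Sum>k<N. (x k)\<^sup>2))" by (intro real_le_rsqrt) simp
    then show ?thesis by (simp add: real_sqrt_mult)
  qed
  have sq: "sqrt (\<Sum>k<N. (norm (cut (T k) x))\<^sup>2) = norm (cut (\<Union>k<N. T k) x)" for x
    using norm_cut_disjoint[OF TL dT, of x N] by simp
  have d0: "0 \<le> d j" for j by (simp add: d_def)
  \<comment> \<open>\<open>chain\<close> is summed over all end points k < N. Below, Cauchy-Schwarz
    for sums is combined with disjointness, which lets the squared norms add up to a single norm
    over the union.\<close>
  have "N * \<alpha> 0 \<le> (\<Sum>k<N. \<alpha> k + (\<Sum>j<N. d j))"
  proof -
    have "\<alpha> 0 \<le> \<alpha> k + (\<Sum>j<N. d j)" if "k < N" for k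
    proof -
      have "(\<Sum>j<k. d j) \<le> (\<Sum>j<N. d j)" using that d0 by (intro sum_mono2) auto
      then show ?thesis using chain[of k] by linarith
    qed
    then have "(\<Sum>k<N. \<alpha> 0) \<le> (\<Sum>k<N. \<alpha> k + (\<Sum>j<N. d j))" by (intro sum_mono) auto
    then show ?thesis by simp
  qed
  also have "\<dots> = (\<Sum>k<N. \<alpha> k) + N * (\<Sum>j<N. d j)" by (simp add: sum.distrib)
  also have "\<dots> \<le> sqrt N * norm (cut (\<Union>k<N. T k) v) + N * (sqrt N * D)"
  proof (intro add_mono mult_left_mono)
    show "(\<Sum>k<N. \<alpha> k) \<le> sqrt N * norm (cut (\<Union>k<N. T k) v)" using cs[of \<alpha>] unfolding \<alpha>_def sq .
    have "(\<Sum>j<N. d j) \<le> sqrt N * norm (cut (\<Union>k<N. T k) (tr a v - v))" using cs[of d] unfolding d_def sq .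
    also have "\<dots> \<le> sqrt N * D" using D unfolding T_def by (intro mult_left_mono) auto
    finally show "(\<Sum>j<N. d j) \<le> sqrt N * D" .
  qed simp
  also have "sqrt N * norm (cut (\<Union>k<N. T k) v) = N * (norm (cut (\<Union>k<N. T k) v) / sqrt N)"
  proof -
    have "real N = sqrt N * sqrt N" "sqrt N \<noteq> 0" using N by simp_all
    then show ?thesis by (metis nonzero_mult_div_cancel_left times_divide_eq_right mult.assoc)
  qed
  finally have "N * \<alpha> 0 \<le> N * (norm (cut (\<Union>k<N. T k) v) / sqrt N + sqrt N * D)"
    by (simp only: distrib_left)
  then have "\<alpha> 0 \<le> norm (cut (\<Union>k<N. T k) v) / sqrt N + sqrt N * D" using N by simp
  moreover have "T 0 = S" by (simp add: T_def)
  ultimately show ?thesis unfolding \<alpha>_def T_def by simp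
qed

lemma strip_bound:
  fixes N :: nat and w :: real
  assumes S: "open S" and N: "N \<ge> 1" and w: "0 \<le> w" and u: "wd U e u g"
    and disj: "disjoint_family (\<lambda>k::nat. {z. z - real k *\<^sub>R (w *\<^sub>R e) \<in> S})"
    and sub: "\<And>z s. z \<in> S \<Longrightarrow> 0 \<le> s \<Longrightarrow> s \<le> N * w \<Longrightarrow> z + s *\<^sub>R e \<in> U"
  shows "norm (cut S u) \<le> norm u / sqrt N + sqrt N * (w * norm g)"
proof -
  let ?W = "\<Union>k<N. {z. z - real k *\<^sub>R (w *\<^sub>R e) \<in> S}"
  have Wo: "open ?W"
  proof (intro open_UN ballI)
    fix k
    have "{z. z - real k *\<^sub>R (w *\<^sub>R e) \<in> S} = (\<lambda>z. z - real k *\<^sub>R (w *\<^sub>R e)) -` S" by auto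
    then show "open {z. z - real k *\<^sub>R (w *\<^sub>R e) \<in> S}" using S by (auto intro!: open_vimage continuous_intros)
  qed
  have "norm (cut ?W (tr (w *\<^sub>R e) u - u)) \<le> w * norm g"
  proof (rule difference_quotient[OF Wo u w])
    fix z s assume z: "z \<in> ?W" and s: "0 \<le> s" "s \<le> w"
    obtain k where k: "k < N" "z - real k *\<^sub>R (w *\<^sub>R e) \<in> S" using z by blast
    \<comment> \<open>As k is at most N - 1, even one further step of length w leaves the total
      displacement within \<open>N * w\<close>.\<close>
    have "s + k * w \<le> w + (real N - 1) * w" using k s w by (intro add_mono mult_right_mono) auto
    then have "(z - real k *\<^sub>R (w *\<^sub>R e)) + (s + k * w) *\<^sub>R e \<in> U"
      using s w by (intro sub[OF k(2)]) (auto simp: algebra_simps)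
    then show "z + s *\<^sub>R e \<in> U" by (simp add: algebra_simps)
  qed
  from translates_bound[OF S N disj this]
  have "norm (cut S u) \<le> norm (cut ?W u) / sqrt N + sqrt N * (w * norm g)" .
  also have "norm (cut ?W u) / sqrt N \<le> norm u / sqrt N"
    using norm_cut_le[OF open_lebesgue[OF Wo]] by (intro divide_right_mono) auto
  finally show ?thesis by simp
qed

section \<open>The Dirichlet form\<close>

definition H1 :: "(real \<times> real) set \<Rightarrow> l2 set" where
  "H1 U = {f. (\<exists>g. wd U (1, 0) f g) \<and> (\<exists>g. wd U (0, 1) f g)}"

definition DD :: "(real \<times> real) set \<Rightarrow> real \<times> real \<Rightarrow> l2 \<Rightarrow> l2" where
  "DD U b f = (THE g. wd U b f g)"

definition grad_form :: "(real \<times> real) set \<Rightarrow> l2 \<Rightarrow> l2 \<Rightarrow> complex" where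
  "grad_form U f g = l2_inner_c (DD U (1, 0) f) (DD U (1, 0) g) + l2_inner_c (DD U (0, 1) f) (DD U (0, 1) g)"

lemma l2_inner_c_add: "l2_inner_c (x + y) z = l2_inner_c x z + l2_inner_c y z"
  by (simp add: l2_inner_c_eq inner_add_left complex_eq_iff)

lemma l2_inner_c_diff_right: "l2_inner_c z (x - y) = l2_inner_c z x - l2_inner_c z y"
  by (simp add: l2_inner_c_eq inner_diff_right linear_diff[OF ii_linear] complex_eq_iff)

lemma l2_inner_c_sym: "l2_inner_c y x = cnj (l2_inner_c x y)"
proof -
  have "inner y (ii x) = - inner x (ii y)"
    using ii_isometry[of y "ii x"] by (simp add: ii_square inner_commute)
  then show ?thesis by (simp add: l2_inner_c_eq complex_eq_iff inner_commute)
qed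

lemma l2_inner_c_self: "Re (l2_inner_c x x) = (norm x)\<^sup>2"
  by (simp add: l2_inner_c_eq power2_norm_eq_inner)

lemma l2_inner_c_scale: "l2_inner_c (Re c *\<^sub>R x + Im c *\<^sub>R ii x) y = c * l2_inner_c x y"
proof -
  have "inner (ii x) y = - inner x (ii y)" using ii_isometry[of x "ii y"] by (simp add: ii_square)
  then show ?thesis
    by (simp add: l2_inner_c_eq inner_add_left ii_isometry complex_eq_iff)
qed

context
  fixes U :: "(real \<times> real) set"
  assumes U: "open U"
begin

lemma DD_eq: "wd U b f g \<Longrightarrow> DD U b f = g"
  unfolding DD_def using wd_unique[OF U] by (intro the_equality) auto

lemma H1_wd: "f \<in> H1 U \<Longrightarrow> b = (1, 0) \<or> b = (0, 1) \<Longrightarrow> wd U b f (DD U b f)"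
  unfolding H1_def using DD_eq by auto

lemma H1_VV: "f \<in> H1 U \<Longrightarrow> f \<in> VV U"
  unfolding H1_def using wdD(1) by blast

lemma H1I: "wd U (1, 0) f g1 \<Longrightarrow> wd U (0, 1) f g2 \<Longrightarrow> f \<in> H1 U"
  unfolding H1_def by blast

lemma H1_add:
  assumes "f \<in> H1 U" "g \<in> H1 U"
  shows "f + g \<in> H1 U" "b = (1, 0) \<or> b = (0, 1) \<Longrightarrow> DD U b (f + g) = DD U b f + DD U b g"
  using H1I wd_add[OF U H1_wd[OF assms(1)] H1_wd[OF assms(2)]] DD_eq by (blast, blast)

lemma H1_diff:
  assumes "f \<in> H1 U" "g \<in> H1 U"
  shows "f - g \<in> H1 U" "b = (1, 0) \<or> b = (0, 1) \<Longrightarrow> DD U b (f - g) = DD U b f - DD U b g"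
  using H1I wd_diff[OF U H1_wd[OF assms(1)] H1_wd[OF assms(2)]] DD_eq by (blast, blast)

lemma H1_scale:
  assumes "f \<in> H1 U"
  shows "r *\<^sub>R f + s *\<^sub>R ii f \<in> H1 U"
    "b = (1, 0) \<or> b = (0, 1) \<Longrightarrow> DD U b (r *\<^sub>R f + s *\<^sub>R ii f) = r *\<^sub>R DD U b f + s *\<^sub>R ii (DD U b f)"
proof -
  have w: "b = (1, 0) \<or> b = (0, 1) \<Longrightarrow> wd U b (r *\<^sub>R f + s *\<^sub>R ii f) (r *\<^sub>R DD U b f + s *\<^sub>R ii (DD U b f))" for b
    by (intro wd_add wd_scaleR wd_ii U H1_wd assms)
  show "r *\<^sub>R f + s *\<^sub>R ii f \<in> H1 U" using H1I w by blast
  show "b = (1, 0) \<or> b = (0, 1) \<Longrightarrow> DD U b (r *\<^sub>R f + s *\<^sub>R ii f) = r *\<^sub>R DD U b f + s *\<^sub>R ii (DD U b f)"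
    using DD_eq[OF w] .
qed

lemma grad_form_self: "Re (grad_form U f f) = (norm (DD U (1, 0) f))\<^sup>2 + (norm (DD U (0, 1) f))\<^sup>2"
  by (simp add: grad_form_def l2_inner_c_self)

section \<open>Agreement with the record-based Sobolev space and Dirichlet form\<close>

interpretation hr: hilbert_rep "L2_on U" "emb U" ii
  by (rule hilbert_rep_L2_on[OF open_lebesgue[OF U]])

lemma V_eq: "hr.V = VV U"
  unfolding hr.V_def by (rule emb_range[OF open_lebesgue[OF U]])

lemma weak_pairing:
  assumes F: "F \<in> hcarrier (L2_on U)" and t: "test_function U \<phi>"
  shows "(LINT z|lebesgue_on U. \<phi> z *\<^sub>R rep F z) = (LINT z|lebesgue. fn (emb U F) z * cnj (Complex (\<phi> z) 0))"
proof -
  note UL = open_lebesgue[OF U]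
  have m: "(\<lambda>z. indicator U z *\<^sub>R rep F z) \<in> borel_measurable lebesgue"
    using rep_sqint(1)[OF F] sqint_restrict[OF UL] sqint_measurable by blast
  have pm: "\<phi> \<in> borel_measurable lebesgue" using t by (intro smooth_measurable test_smooth)
  have e: "indicator U z *\<^sub>R (\<phi> z *\<^sub>R rep F z) = \<phi> z *\<^sub>R (indicator U z *\<^sub>R rep F z)" for z
    by (simp add: indicator_def)
  have "(LINT z|lebesgue_on U. \<phi> z *\<^sub>R rep F z) = (LINT z|lebesgue. indicator U z *\<^sub>R (\<phi> z *\<^sub>R rep F z))"
    by (rule integral_restrict_space) (use UL in simp)
  also have "\<dots> = (LINT z|lebesgue. fn (emb U F) z * cnj (Complex (\<phi> z) 0))"
  proof (rule integral_cong_AE)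
    show "(\<lambda>z. indicator U z *\<^sub>R (\<phi> z *\<^sub>R rep F z)) \<in> borel_measurable lebesgue"
      unfolding e by (intro borel_measurable_scaleR pm m)
    show "(\<lambda>z. fn (emb U F) z * cnj (Complex (\<phi> z) 0)) \<in> borel_measurable lebesgue"
      using sqint_measurable[OF sqint_ctf[OF t test_zero]]
      by (intro borel_measurable_times borel_measurable_cnj) auto
    show "AE z in lebesgue. indicator U z *\<^sub>R (\<phi> z *\<^sub>R rep F z) = fn (emb U F) z * cnj (Complex (\<phi> z) 0)"
      using fn_emb[OF UL F] by eventually_elim (simp add: e complex_eq_iff)
  qed
  finally show ?thesis .
qed

lemma inner_ctf:
  assumes "test_function U \<phi>" "test_function U \<psi>"
  shows "inner f (ctf \<phi> \<psi>) = Re (LINT z|lebesgue. fn f z * cnj (Complex (\<phi> z) 0))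
    + Im (LINT z|lebesgue. fn f z * cnj (Complex (\<psi> z) 0))"
proof -
  have i: "integrable lebesgue (\<lambda>z. fn f z * cnj (Complex (\<phi> z) 0))" "integrable lebesgue (\<lambda>z. fn f z * cnj (Complex (\<psi> z) 0))"
    by (intro sqint_product sqint_fn sqint_ctf[OF assms(1) test_zero] sqint_ctf[OF assms(2) test_zero])+
  have "inner f (ctf \<phi> \<psi>) = Re (LINT z|lebesgue. fn f z * cnj (Complex (\<phi> z) (\<psi> z)))"
    using l2_inner_mk[OF sqint_fn[of f] sqint_ctf[OF assms]] by (simp add: ctf_def)
  also have "(\<lambda>z. fn f z * cnj (Complex (\<phi> z) (\<psi> z)))
      = (\<lambda>z. fn f z * cnj (Complex (\<phi> z) 0) + (- \<i>) * (fn f z * cnj (Complex (\<psi> z) 0)))"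
    by (simp add: fun_eq_iff complex_eq_iff)
  also have "(LINT z|lebesgue. fn f z * cnj (Complex (\<phi> z) 0) + (- \<i>) * (fn f z * cnj (Complex (\<psi> z) 0)))
      = (LINT z|lebesgue. fn f z * cnj (Complex (\<phi> z) 0)) + (- \<i>) * (LINT z|lebesgue. fn f z * cnj (Complex (\<psi> z) 0))"
    by (subst Bochner_Integration.integral_add[OF i(1) integrable_mult_right[OF i(2)]])
      (simp only: Bochner_Integration.integral_mult_right[OF i(2)])
  finally show ?thesis by simp
qed

text \<open>One side pairs complex values with real test functions, the other takes real parts
  against complex ones. The test pair (\<phi>, 0) yields the real part of the identity and (0,
  \<phi>) the imaginary part.\<close>

lemma is_weak_deriv_iff:
  assumes F: "F \<in> hcarrier (L2_on U)" and G: "G \<in> hcarrier (L2_on U)"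
  shows "is_weak_deriv U b F G \<longleftrightarrow> wd U b (emb U F) (emb U G)"
proof -
  define p where "p f \<phi> = (LINT z|lebesgue. fn f z * cnj (Complex (\<phi> z) 0))" for f \<phi>
  have V: "emb U F \<in> VV U" "emb U G \<in> VV U" using emb_VV[OF open_lebesgue[OF U]] F G by auto
  have "is_weak_deriv U b F G \<longleftrightarrow>
      (\<forall>\<phi>. test_function U \<phi> \<longrightarrow> p (emb U F) (directional_deriv b \<phi>) = - p (emb U G) \<phi>)"
    unfolding is_weak_deriv_def p_def using F G by (simp add: weak_pairing test_directional_deriv)
  also have "\<dots> \<longleftrightarrow> wd U b (emb U F) (emb U G)"
  proof
    assume a: "\<forall>\<phi>. test_function U \<phi> \<longrightarrow> p (emb U F) (directional_deriv b \<phi>) = - p (emb U G) \<phi>"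
    show "wd U b (emb U F) (emb U G)"
      unfolding wd_def
      by (intro conjI allI impI V) (use a in \<open>simp add: inner_ctf test_directional_deriv flip: p_def\<close>)
  next
    assume w: "wd U b (emb U F) (emb U G)"
    show "\<forall>\<phi>. test_function U \<phi> \<longrightarrow> p (emb U F) (directional_deriv b \<phi>) = - p (emb U G) \<phi>"
    proof (intro allI impI)
      fix \<phi> assume t: "test_function U \<phi>"
      have d0: "directional_deriv b (\<lambda>z. 0 :: real) = (\<lambda>z. 0)"
        by (rule ext, rule directional_deriv_eq) simp
      have p0: "p f (\<lambda>z. 0) = 0" for f
      proof -
        have "(\<lambda>z. fn f z * cnj (Complex 0 0)) = (\<lambda>z. 0)" by (simp add: fun_eq_iff complex_eq_iff)
        then show ?thesis by (simp add: p_def)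
      qed
      have "Re (p (emb U F) (directional_deriv b \<phi>)) = - Re (p (emb U G) \<phi>)"
        using wdD(3)[OF w t test_zero] inner_ctf[OF test_directional_deriv[OF t] test_zero]
          inner_ctf[OF t test_zero] unfolding d0 p_def[symmetric] p0 by simp
      moreover have "Im (p (emb U F) (directional_deriv b \<phi>)) = - Im (p (emb U G) \<phi>)"
        using wdD(3)[OF w test_zero t] inner_ctf[OF test_zero test_directional_deriv[OF t]]
          inner_ctf[OF test_zero t] unfolding d0 p_def[symmetric] p0 by simp
      ultimately show "p (emb U F) (directional_deriv b \<phi>) = - p (emb U G) \<phi>" by (simp add: complex_eq_iff)
    qed
  qed
  finally show ?thesis .
qed

lemma is_weak_deriv_carrier: "is_weak_deriv U b F G \<Longrightarrow> F \<in> hcarrier (L2_on U) \<and> G \<in> hcarrier (L2_on U)"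
  unfolding is_weak_deriv_def by blast

lemma ex_weak_deriv_iff:
  assumes F: "F \<in> hcarrier (L2_on U)"
  shows "(\<exists>G. is_weak_deriv U b F G) \<longleftrightarrow> (\<exists>g. wd U b (emb U F) g)"
proof
  assume "\<exists>g. wd U b (emb U F) g"
  then obtain g where g: "wd U b (emb U F) g" by blast
  note s = emb_surj[OF open_lebesgue[OF U] wdD(2)[OF g]]
  have "is_weak_deriv U b F (ae_class (lebesgue_on U) (fn g))"
    unfolding is_weak_deriv_iff[OF F s(1)] s(2) by (rule g)
  then show "\<exists>G. is_weak_deriv U b F G" by (rule exI)
next
  assume "\<exists>G. is_weak_deriv U b F G"
  then obtain G where G: "is_weak_deriv U b F G" by blast
  have "G \<in> hcarrier (L2_on U)" using is_weak_deriv_carrier[OF G] by blast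
  from iffD1[OF is_weak_deriv_iff[OF F this] G] show "\<exists>g. wd U b (emb U F) g" by (rule exI)
qed

lemma sobolev_iff: "F \<in> sobolev_H1 U \<longleftrightarrow> F \<in> hcarrier (L2_on U) \<and> emb U F \<in> H1 U"
  unfolding sobolev_H1_def H1_def mem_Collect_eq
  using ex_weak_deriv_iff[of F "(1, 0)"] ex_weak_deriv_iff[of F "(0, 1)"] by blast

lemma emb_sobolev: "emb U ` sobolev_H1 U = H1 U"
proof
  show "emb U ` sobolev_H1 U \<subseteq> H1 U" using sobolev_iff by auto
  show "H1 U \<subseteq> emb U ` sobolev_H1 U"
  proof
    fix f assume f: "f \<in> H1 U"
    note s = emb_surj[OF open_lebesgue[OF U] H1_VV[OF f]]
    show "f \<in> emb U ` sobolev_H1 U"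
      by (rule image_eqI[where x = "ae_class (lebesgue_on U) (fn f)"]) (use f s in \<open>simp_all add: sobolev_iff\<close>)
  qed
qed

lemma weak_deriv_emb:
  assumes F: "F \<in> sobolev_H1 U" and b: "b = (1, 0) \<or> b = (0, 1)"
  shows "weak_deriv U b F \<in> hcarrier (L2_on U)" "emb U (weak_deriv U b F) = DD U b (emb U F)"
proof -
  have c: "F \<in> hcarrier (L2_on U)" and H: "emb U F \<in> H1 U" using F sobolev_iff by auto
  note w = H1_wd[OF H b]
  note s = emb_surj[OF open_lebesgue[OF U] wdD(2)[OF w]]
  let ?G = "ae_class (lebesgue_on U) (fn (DD U b (emb U F)))"
  have G: "is_weak_deriv U b F ?G" using is_weak_deriv_iff[OF c s(1)] w s(2) by simp
  have "weak_deriv U b F = ?G"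
    unfolding weak_deriv_def
  proof (rule the_equality)
    show "is_weak_deriv U b F ?G" by (rule G)
    fix G' assume G': "is_weak_deriv U b F G'"
    have c': "G' \<in> hcarrier (L2_on U)" using is_weak_deriv_carrier[OF G'] by blast
    have "emb U G' = emb U ?G" using is_weak_deriv_iff[OF c c'] G' wd_unique[OF U _ w] s(2) by auto
    then show "G' = ?G" using inj_onD[OF emb_inj[OF open_lebesgue[OF U]] _ c' s(1)] by blast
  qed
  then show "weak_deriv U b F \<in> hcarrier (L2_on U)" "emb U (weak_deriv U b F) = DD U b (emb U F)"
    using s by auto
qed

lemma dirichlet_form_eq:
  assumes F: "F \<in> sobolev_H1 U" and G: "G \<in> sobolev_H1 U"
  shows "dirichlet_form U F G = grad_form U (emb U F) (emb U G)"
proof -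
  have b: "(1::real, 0::real) = (1, 0) \<or> (1::real, 0::real) = (0, 1)" "(0::real, 1::real) = (1, 0) \<or> (0::real, 1::real) = (0, 1)" by auto
  note w = weak_deriv_emb[OF F b(1)] weak_deriv_emb[OF F b(2)] weak_deriv_emb[OF G b(1)] weak_deriv_emb[OF G b(2)]
  have i: "integrable (lebesgue_on U) (\<lambda>z. rep (weak_deriv U (1, 0) F) z * cnj (rep (weak_deriv U (1, 0) G) z))"
    "integrable (lebesgue_on U) (\<lambda>z. rep (weak_deriv U (0, 1) F) z * cnj (rep (weak_deriv U (0, 1) G) z))"
    by (intro sqint_product rep_sqint(1) w)+
  have "dirichlet_form U F G = hinner (L2_on U) (weak_deriv U (1, 0) F) (weak_deriv U (1, 0) G)
      + hinner (L2_on U) (weak_deriv U (0, 1) F) (weak_deriv U (0, 1) G)"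
    unfolding dirichlet_form_def L2_inner by (rule Bochner_Integration.integral_add[OF i])
  then show ?thesis
    unfolding grad_form_def using hinner_emb[OF open_lebesgue[OF U]] w by simp
qed

lemma emb_hscale: "F \<in> hcarrier (L2_on U) \<Longrightarrow> emb U (hscale (L2_on U) c F) = Re c *\<^sub>R emb U F + Im c *\<^sub>R ii (emb U F)"
  by (rule hr.\<iota>_scale)

lemma test_H1: "test_function U \<phi> \<Longrightarrow> test_function U \<psi> \<Longrightarrow> ctf \<phi> \<psi> \<in> H1 U"
  using H1I wd_test[OF U] by blast

text \<open>Density comes from the test functions. For closedness, the Cauchy condition on the form
  makes both weak derivatives converge, and \<open>wd_limit\<close> identifies their limits.\<close>

lemma sobolev_closed_form: "closed_nonneg_form (L2_on U) (sobolev_H1 U) (dirichlet_form U)"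
  unfolding closed_nonneg_form_def
proof (intro conjI ballI allI impI)
  let ?H = "L2_on U" and ?D = "sobolev_H1 U"
  have car: "F \<in> ?D \<Longrightarrow> F \<in> hcarrier ?H" and H: "F \<in> ?D \<Longrightarrow> emb U F \<in> H1 U" for F using sobolev_iff by auto
  have add: "hadd ?H F G \<in> ?D" "emb U (hadd ?H F G) = emb U F + emb U G" if "F \<in> ?D" "G \<in> ?D" for F G
    using that by (auto simp: sobolev_iff hr.add_closed hr.\<iota>_add H1_add)
  have scale: "hscale ?H c F \<in> ?D" if "F \<in> ?D" for F c
    using that by (auto simp: sobolev_iff hr.scale_closed emb_hscale H1_scale)
  show "lin_subspace ?H ?D"
    unfolding lin_subspace_def
  proof (intro conjI ballI allI)
    show "?D \<subseteq> hcarrier ?H" using car by blast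
    have "ctf (\<lambda>z. 0) (\<lambda>z. 0) \<in> emb U ` ?D" unfolding emb_sobolev by (rule test_H1[OF test_zero test_zero])
    then show "?D \<noteq> {}" by blast
  qed (use add scale in auto)
  show "dense_in ?H ?D"
  proof -
    have "closure (emb U ` ?D) = VV U"
    proof
      show "closure (emb U ` ?D) \<subseteq> VV U"
        unfolding emb_sobolev using H1_VV by (intro closure_minimal VV_closed open_lebesgue U) blast
      have "closure {ctf \<phi> \<psi> | \<phi> \<psi>. test_function U \<phi> \<and> test_function U \<psi>} \<subseteq> closure (H1 U)"
        using test_H1 by (intro closure_mono) blast
      then show "VV U \<subseteq> closure (emb U ` ?D)" unfolding emb_sobolev tests_dense[OF U] .
    qed
    then show ?thesis using hr.dense_in_iff[of ?D] car V_eq by blast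
  qed
  fix F G assume F: "F \<in> ?D" and G: "G \<in> ?D"
  show "dirichlet_form U G F = cnj (dirichlet_form U F G)"
    unfolding dirichlet_form_eq[OF F G] dirichlet_form_eq[OF G F] grad_form_def
    using l2_inner_c_sym[of "DD U (1, 0) (emb U G)" "DD U (1, 0) (emb U F)"]
      l2_inner_c_sym[of "DD U (0, 1) (emb U G)" "DD U (0, 1) (emb U F)"] by simp
  show "dirichlet_form U (hscale ?H c F) G = c * dirichlet_form U F G" for c
    using F G scale[OF F] H[OF F] car[OF F]
    by (simp add: dirichlet_form_eq grad_form_def emb_hscale H1_scale l2_inner_c_scale distrib_left)
  show "dirichlet_form U (hadd ?H F G) K = dirichlet_form U F K + dirichlet_form U G K" if K: "K \<in> ?D" for K
    using F G K add[OF F G] H[OF F] H[OF G]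
    by (simp add: dirichlet_form_eq grad_form_def H1_add l2_inner_c_add)
  show "0 \<le> Re (dirichlet_form U F F)"
    unfolding dirichlet_form_eq[OF F F] grad_form_self by simp
next
  let ?H = "L2_on U" and ?D = "sobolev_H1 U"
  fix X F assume F: "F \<in> hcarrier ?H"
    and a: "(\<forall>n. X n \<in> ?D) \<and> (\<lambda>n. hnorm ?H (hdiff ?H (X n) F)) \<longlonglongrightarrow> 0 \<and>
      (\<forall>e>0. \<exists>N. \<forall>m\<ge>N. \<forall>n\<ge>N. Re (dirichlet_form U (hdiff ?H (X m) (X n)) (hdiff ?H (X m) (X n))) < e)"
  define f where "f n = emb U (X n)" for n
  have X: "X n \<in> ?D" "X n \<in> hcarrier ?H" "f n \<in> H1 U" for n using a sobolev_iff f_def by auto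
  have dX: "emb U (hdiff ?H (X m) (X n)) = f m - f n" "hdiff ?H (X m) (X n) \<in> ?D" for m n
    using X H1_diff(1)[OF X(3)[of m] X(3)[of n]] by (auto simp: hr.\<iota>_diff f_def sobolev_iff hr.hdiff_closed)
  have "(\<lambda>n. norm (f n - emb U F)) \<longlonglongrightarrow> 0"
    using a X F by (simp add: hr.hnorm_eq hr.hdiff_closed hr.\<iota>_diff f_def)
  then have "(\<lambda>n. f n - emb U F) \<longlonglongrightarrow> 0" by (rule tendsto_norm_zero_cancel)
  then have lim: "f \<longlonglongrightarrow> emb U F" by (rule LIM_zero_cancel)
  have conv: "\<exists>g. (\<lambda>n. DD U b (f n)) \<longlonglongrightarrow> g" if b: "b = (1, 0) \<or> b = (0, 1)" for b
  proof -
    have "Cauchy (\<lambda>n. DD U b (f n))"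
    proof (rule CauchyI)
      fix e :: real assume e: "0 < e"
      from mp[OF spec[OF conjunct2[OF conjunct2[OF a]]] zero_less_power[OF e, of 2]]
      obtain N where N: "\<forall>m\<ge>N. \<forall>n\<ge>N. Re (dirichlet_form U (hdiff ?H (X m) (X n)) (hdiff ?H (X m) (X n))) < e\<^sup>2"
        by (rule exE)
      have "norm (DD U b (f m) - DD U b (f n)) < e" if "m \<ge> N" "n \<ge> N" for m n
      proof (rule power2_less_imp_less)
        have "(norm (DD U b (f m) - DD U b (f n)))\<^sup>2 = (norm (DD U b (f m - f n)))\<^sup>2"
          by (simp add: H1_diff(2)[OF X(3) X(3) b])
        also have "\<dots> \<le> Re (grad_form U (f m - f n) (f m - f n))" using b unfolding grad_form_self by auto
        also have "\<dots> < e\<^sup>2" using N that dirichlet_form_eq[OF dX(2) dX(2)] dX(1) by simp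
        finally show "(norm (DD U b (f m) - DD U b (f n)))\<^sup>2 < e\<^sup>2" .
      qed (use e in simp)
      then show "\<exists>M. \<forall>m\<ge>M. \<forall>n\<ge>M. norm (DD U b (f m) - DD U b (f n)) < e" by blast
    qed
    then show ?thesis using Cauchy_convergent convergent_def by blast
  qed
  obtain g1 where g1: "(\<lambda>n. DD U (1, 0) (f n)) \<longlonglongrightarrow> g1" using conv by blast
  obtain g2 where g2: "(\<lambda>n. DD U (0, 1) (f n)) \<longlonglongrightarrow> g2" using conv by blast
  have w1: "wd U (1, 0) (emb U F) g1" by (rule wd_limit[OF U H1_wd[OF X(3)] lim g1]) simp
  have w2: "wd U (0, 1) (emb U F) g2" by (rule wd_limit[OF U H1_wd[OF X(3)] lim g2]) simp
  have FH: "emb U F \<in> H1 U" by (rule H1I[OF w1 w2])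
  show FD: "F \<in> ?D" using F FH sobolev_iff by blast
  have dF: "emb U (hdiff ?H (X n) F) = f n - emb U F" "hdiff ?H (X n) F \<in> ?D" for n
    using X F H1_diff(1)[OF X(3)[of n] FH] by (auto simp: hr.\<iota>_diff f_def sobolev_iff hr.hdiff_closed)
  have "Re (dirichlet_form U (hdiff ?H (X n) F) (hdiff ?H (X n) F))
      = (norm (DD U (1, 0) (f n) - g1))\<^sup>2 + (norm (DD U (0, 1) (f n) - g2))\<^sup>2" for n
    unfolding dirichlet_form_eq[OF dF(2) dF(2)] dF(1) grad_form_self
    using H1_diff(2)[OF X(3) FH, of "(1, 0)" n] H1_diff(2)[OF X(3) FH, of "(0, 1)" n] DD_eq[OF w1] DD_eq[OF w2] by simp
  moreover have "(\<lambda>n. (norm (DD U (1, 0) (f n) - g1))\<^sup>2 + (norm (DD U (0, 1) (f n) - g2))\<^sup>2)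
      \<longlonglongrightarrow> (norm (g1 - g1))\<^sup>2 + (norm (g2 - g2))\<^sup>2"
    by (intro tendsto_intros g1 g2)
  ultimately show "(\<lambda>n. Re (dirichlet_form U (hdiff ?H (X n) F) (hdiff ?H (X n) F))) \<longlonglongrightarrow> 0" by simp
qed

lemma form_rep_sobolev: "form_rep (L2_on U) (emb U) ii (sobolev_H1 U) (dirichlet_form U)"
  using hr.hilbert_rep_axioms sobolev_closed_form by (simp add: form_rep_def form_rep_axioms_def)

end

section \<open>Elliptic regularity and estimates on small squares\<close>

lemma test_bm: "test_function U \<phi> \<Longrightarrow> bm (\<lambda>z. of_real (\<phi> z))"
proof -
  assume t: "test_function U \<phi>"
  obtain B R where B: "0 \<le> B" "\<And>z. \<bar>\<phi> z\<bar> \<le> B" "\<And>z. norm z > R \<Longrightarrow> \<phi> z = 0"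
    using test_bounds[OF t] by blast
  have "(\<lambda>z. complex_of_real (\<phi> z)) \<in> borel_measurable lebesgue"
    using smooth_measurable[OF test_smooth[OF t]] by measurable
  then show ?thesis unfolding bm_def using B(2) by auto
qed

lemma norm_mul_real_le:
  assumes "bm (\<lambda>z. of_real (\<phi> z))" "\<And>z. \<bar>\<phi> z\<bar> \<le> B"
  shows "norm (mul (\<lambda>z. of_real (\<phi> z)) x) \<le> B * norm x"
  by (rule norm_mul_le[OF assms(1)]) (simp add: assms(2))

lemma inner_mul_real:
  "bm (\<lambda>z. of_real (\<phi> z)) \<Longrightarrow> inner (mul (\<lambda>z. of_real (\<phi> z)) x) y = inner x (mul (\<lambda>z. of_real (\<phi> z)) y)"
  by (simp add: inner_mul)

lemma mul_in_VV:
  assumes "U \<in> sets lebesgue" "bm m" "\<And>z. z \<notin> U \<Longrightarrow> m z = 0"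
  shows "mul m x \<in> VV U"
  unfolding VV_iff[OF assms(1)] using fn_mul[OF assms(2), of x] by eventually_elim (simp add: assms(3))

lemma test_mult_test:
  assumes "test_function U \<eta>" "smooth \<phi>" shows "test_function U (\<lambda>z. \<eta> z * \<phi> z)"
  using test_mult[OF assms(2,1)] by (simp add: mult.commute)

text \<open>Cutting off moves a function from U to the whole plane, where translations act
  freely.\<close>

lemma wd_mul_test_UNIV:
  assumes w: "wd U b f g" and t: "test_function U \<eta>"
  shows "wd UNIV b (mul (\<lambda>z. of_real (\<eta> z)) f)
    (mul (\<lambda>z. of_real (\<eta> z)) g + mul (\<lambda>z. of_real (directional_deriv b \<eta> z)) f)"
  by (rule wd_mul[OF w test_smooth[OF t] test_bm[OF t] test_bm[OF test_directional_deriv[OF t]]])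
    (auto intro: test_mult_test[OF t] test_smooth)

text \<open>The way back: it turns a function built from translates on the plane into an admissible
  test element on \<open>U\<close>.\<close>

lemma wd_mul_test_restrict:
  assumes U: "open U" and w: "wd UNIV b f g" and t: "test_function U \<eta>"
  shows "wd U b (mul (\<lambda>z. of_real (\<eta> z)) f)
    (mul (\<lambda>z. of_real (\<eta> z)) g + mul (\<lambda>z. of_real (directional_deriv b \<eta> z)) f)"
proof (rule wd_mul[OF w test_smooth[OF t] test_bm[OF t] test_bm[OF test_directional_deriv[OF t]] U])
  note UL = open_lebesgue[OF U]
  have V: "mul (\<lambda>z. of_real (\<eta> z)) x \<in> VV U" for x
    by (rule mul_in_VV[OF UL test_bm[OF t]]) (simp add: test_zero_outside[OF t])
  show "mul (\<lambda>z. of_real (\<eta> z)) f \<in> VV U" by (rule V)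
  show "mul (\<lambda>z. of_real (\<eta> z)) g \<in> VV U" by (rule V)
  show "mul (\<lambda>z. of_real (directional_deriv b \<eta> z)) f \<in> VV U"
    by (rule mul_in_VV[OF UL test_bm[OF test_directional_deriv[OF t]]])
      (simp add: test_zero_outside[OF test_directional_deriv[OF t]])
  show "test_function UNIV (\<lambda>z. \<eta> z * \<phi> z)" if "test_function U \<phi>" for \<phi>
    using test_mult[OF test_smooth[OF t] that] by (rule test_mono) simp
qed

text \<open>Summation by parts: the adjoint of the forward difference is the backward one.\<close>

lemma inner_tr_diff: "inner (tr a x - x) y = inner x (tr (- a) y - y)"
  by (simp add: inner_diff_left inner_diff_right inner_tr)

text \<open>Interior \<open>H\<^sup>2\<close> regularity by difference quotients. The Neumann equation is tested with
  \<open>\<eta> (\<tau>\<^sub>-\<^sub>t w - w)\<close>, where \<open>w = \<tau>\<^sub>t (\<eta> f) - \<eta> f\<close>.\<close>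

lemma elliptic_difference:
  fixes e :: "real \<times> real"
  assumes U: "open U" and t\<eta>: "test_function U \<eta>" and B: "1 \<le> B" "\<And>z. \<bar>\<eta> z\<bar> \<le> B"
    "\<And>z i. i \<in> {(1, 0), (0, 1)} \<Longrightarrow> \<bar>directional_deriv i \<eta> z\<bar> \<le> B"
    "\<And>z i j. i \<in> {(1, 0), (0, 1)} \<Longrightarrow> j \<in> {(1, 0), (0, 1)} \<Longrightarrow> \<bar>directional_deriv j (directional_deriv i \<eta>) z\<bar> \<le> B"
    and f: "wd U (1, 0) f f1" "wd U (0, 1) f f2"
    and eqn: "\<And>v v1 v2. wd U (1, 0) v v1 \<Longrightarrow> wd U (0, 1) v v2 \<Longrightarrow> inner f1 v1 + inner f2 v2 = inner w0 v"
    and M: "norm f \<le> M" "norm f1 \<le> M" "norm f2 \<le> M" "norm w0 \<le> M"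
    and e: "e \<in> {(1, 0), (0, 1)}" and t: "0 \<le> t"
    and h1: "h1 = mul (\<lambda>z. of_real (\<eta> z)) f1 + mul (\<lambda>z. of_real (directional_deriv (1, 0) \<eta> z)) f"
    and h2: "h2 = mul (\<lambda>z. of_real (\<eta> z)) f2 + mul (\<lambda>z. of_real (directional_deriv (0, 1) \<eta> z)) f"
  shows "norm (tr (t *\<^sub>R e) h1 - h1) \<le> t * (7 * B * M)" "norm (tr (t *\<^sub>R e) h2 - h2) \<le> t * (7 * B * M)"
proof -
  let ?e1 = "(1, 0) :: real \<times> real" and ?e2 = "(0, 1) :: real \<times> real"
  let ?m = "mul (\<lambda>z. of_real (\<eta> z))"
  let ?d1 = "mul (\<lambda>z. of_real (directional_deriv ?e1 \<eta> z))"
  let ?d2 = "mul (\<lambda>z. of_real (directional_deriv ?e2 \<eta> z))"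
  let ?a = "t *\<^sub>R e"
  note td = test_directional_deriv[OF t\<eta>]
  have M0: "0 \<le> M" using M(1) norm_ge_zero order_trans by blast
  have B0: "0 \<le> B" using B(1) by simp
  define h where "h = ?m f"
  have wh: "wd UNIV ?e1 h h1" "wd UNIV ?e2 h h2"
    unfolding h_def h1 h2 by (rule wd_mul_test_UNIV[OF f(1) t\<eta>], rule wd_mul_test_UNIV[OF f(2) t\<eta>])
  define w where "w = tr ?a h - h"
  define w1 where "w1 = tr ?a h1 - h1"
  define w2 where "w2 = tr ?a h2 - h2"
  have ww: "wd UNIV ?e1 w w1" "wd UNIV ?e2 w w2"
    unfolding w_def w1_def w2_def by (intro wd_diff[OF open_UNIV] wd_tr wh)+
  define v where "v = tr (- ?a) w - w"
  define v1 where "v1 = tr (- ?a) w1 - w1"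
  define v2 where "v2 = tr (- ?a) w2 - w2"
  have wv: "wd UNIV ?e1 v v1" "wd UNIV ?e2 v v2"
    unfolding v_def v1_def v2_def by (intro wd_diff[OF open_UNIV] wd_tr ww)+
  \<comment> \<open>The norm of the gradient of w. The aim is an inequality W^2 <= const t W, from
    which one factor W cancels.\<close>
  define W where "W = sqrt ((norm w1)\<^sup>2 + (norm w2)\<^sup>2)"
  have W0: "0 \<le> W" and wW: "norm w1 \<le> W" "norm w2 \<le> W"
    unfolding W_def by (auto intro: real_le_rsqrt)
  \<comment> \<open>\<open>e\<close> is a coordinate direction, so one of \<open>w1\<close>,
    \<open>w2\<close> is the derivative of w along \<open>e\<close>, and the second difference gains
    a factor t.\<close>
  have vW: "norm v \<le> t * W"
  proof -
    obtain we where we: "wd UNIV e w we" "norm we \<le> W" using e ww wW by auto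
    have "norm v \<le> t * norm we" unfolding v_def by (rule difference_quotient_UNIV(2)[OF we(1) t])
    also have "\<dots> \<le> t * W" using we t by (intro mult_left_mono) auto
    finally show ?thesis .
  qed
  \<comment> \<open>Translating the term (derivative of \<eta>) times f costs one more derivative of
    each factor; this explains the bound on second derivatives of \<eta>.\<close>
  have F: "norm (tr ?a (mul (\<lambda>z. of_real (directional_deriv i \<eta> z)) f) - mul (\<lambda>z. of_real (directional_deriv i \<eta> z)) f)
      \<le> t * (2 * B * M)" if i: "i \<in> {(1, 0), (0, 1)}" for i
  proof -
    obtain fe where fe: "wd U e f fe" "norm fe \<le> M" using e f M by auto
    let ?G = "mul (\<lambda>z. of_real (directional_deriv i \<eta> z)) fe
      + mul (\<lambda>z. of_real (directional_deriv e (directional_deriv i \<eta>) z)) f"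
    have "norm ?G \<le> B * norm fe + B * norm f"
      by (intro order_trans[OF norm_triangle_ineq] add_mono norm_mul_real_le test_bm[OF td]
          test_bm[OF test_directional_deriv[OF td]] B i e)
    also have "\<dots> \<le> B * M + B * M" using fe M B0 by (intro add_mono mult_left_mono) auto
    finally have G: "norm ?G \<le> 2 * B * M" by simp
    show ?thesis
      by (rule order_trans[OF difference_quotient_UNIV(1)[OF wd_mul_test_UNIV[OF fe(1) td] t] mult_left_mono[OF G t]])
  qed
  \<comment> \<open>Summation by parts turns <w1, w1> into <h1, v1>. The terms are then regrouped so
    that the full derivative of \<eta> v appears next to \<open>f1\<close>, ready for the
    equation.\<close>
  have split1: "inner w1 w1 = (inner f1 (?m v1 + ?d1 v) - inner f1 (?d1 v)) + inner (tr ?a (?d1 f) - ?d1 f) w1"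
  proof -
    have "inner w1 w1 = inner h1 v1" unfolding v1_def by (subst (1) w1_def) (rule inner_tr_diff)
    also have "\<dots> = inner (?m f1) v1 + inner (?d1 f) v1" unfolding h1 by (rule inner_add_left)
    also have "inner (?d1 f) v1 = inner (tr ?a (?d1 f) - ?d1 f) w1" unfolding v1_def by (rule inner_tr_diff[symmetric])
    also have "inner (?m f1) v1 = inner f1 (?m v1 + ?d1 v) - inner f1 (?d1 v)"
      by (simp add: inner_mul_real[OF test_bm[OF t\<eta>]] inner_add_right)
    finally show ?thesis .
  qed
  have split2: "inner w2 w2 = (inner f2 (?m v2 + ?d2 v) - inner f2 (?d2 v)) + inner (tr ?a (?d2 f) - ?d2 f) w2"
  proof -
    have "inner w2 w2 = inner h2 v2" unfolding v2_def by (subst (1) w2_def) (rule inner_tr_diff)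
    also have "\<dots> = inner (?m f2) v2 + inner (?d2 f) v2" unfolding h2 by (rule inner_add_left)
    also have "inner (?d2 f) v2 = inner (tr ?a (?d2 f) - ?d2 f) w2" unfolding v2_def by (rule inner_tr_diff[symmetric])
    also have "inner (?m f2) v2 = inner f2 (?m v2 + ?d2 v) - inner f2 (?d2 v)"
      by (simp add: inner_mul_real[OF test_bm[OF t\<eta>]] inner_add_right)
    finally show ?thesis .
  qed
  have "inner f1 (?m v1 + ?d1 v) + inner f2 (?m v2 + ?d2 v) = inner w0 (?m v)"
    by (rule eqn[OF wd_mul_test_restrict[OF U wv(1) t\<eta>] wd_mul_test_restrict[OF U wv(2) t\<eta>]])
  moreover have "W\<^sup>2 = inner w1 w1 + inner w2 w2" unfolding W_def by (simp add: power2_norm_eq_inner)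
  ultimately have "W\<^sup>2 = inner w0 (?m v) + - inner f1 (?d1 v) + - inner f2 (?d2 v)
      + inner (tr ?a (?d1 f) - ?d1 f) w1 + inner (tr ?a (?d2 f) - ?d2 f) w2"
    using split1 split2 by linarith
  \<comment> \<open>Three terms contain v, estimated by \<open>vW\<close>, and two contain
    differences estimated by \<open>F\<close> with constant 2; together 3 + 2 + 2 = 7.\<close>
  also have "\<dots> \<le> B * M * (t * W) + B * M * (t * W) + B * M * (t * W) + t * (2 * B * M) * W + t * (2 * B * M) * W"
  proof (intro add_mono)
    have *: "\<bar>inner x (mul (\<lambda>z. of_real (r z)) v)\<bar> \<le> B * M * (t * W)"
      if "norm x \<le> M" "bm (\<lambda>z. of_real (r z))" "\<And>z. \<bar>r z\<bar> \<le> B" for x r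
    proof -
      have "norm (mul (\<lambda>z. of_real (r z)) v) \<le> B * (t * W)"
        by (rule order_trans[OF norm_mul_real_le[OF that(2,3)] mult_left_mono[OF vW B0]])
      then have "norm x * norm (mul (\<lambda>z. of_real (r z)) v) \<le> M * (B * (t * W))"
        using that(1) M0 by (intro mult_mono) auto
      then show ?thesis using Cauchy_Schwarz_ineq2[of x "mul (\<lambda>z. of_real (r z)) v"] by (simp add: mult_ac)
    qed
    show "inner w0 (?m v) \<le> B * M * (t * W)"
      using *[OF M(4) test_bm[OF t\<eta>] B(2)] by (rule order_trans[OF abs_ge_self])
    show "- inner f1 (?d1 v) \<le> B * M * (t * W)"
      using *[OF M(2) test_bm[OF td] B(3), of ?e1] by (intro order_trans[OF abs_ge_minus_self]) simp
    show "- inner f2 (?d2 v) \<le> B * M * (t * W)"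
      using *[OF M(3) test_bm[OF td] B(3), of ?e2] by (intro order_trans[OF abs_ge_minus_self]) simp
    have tBM: "0 \<le> t * (2 * B * M)" using t B0 M0 by simp
    show "inner (tr ?a (?d1 f) - ?d1 f) w1 \<le> t * (2 * B * M) * W"
      by (rule order_trans[OF norm_cauchy_schwarz mult_mono[OF F wW(1) tBM norm_ge_zero]]) simp
    show "inner (tr ?a (?d2 f) - ?d2 f) w2 \<le> t * (2 * B * M) * W"
      by (rule order_trans[OF norm_cauchy_schwarz mult_mono[OF F wW(2) tBM norm_ge_zero]]) simp
  qed
  also have "\<dots> = (t * (7 * B * M)) * W" by (simp add: algebra_simps)
  finally have "W * W \<le> (t * (7 * B * M)) * W" by (simp add: power2_eq_square)
  moreover have "0 \<le> t * (7 * B * M)" using t B0 M0 by simp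
  ultimately have "W \<le> t * (7 * B * M)" using W0 by (cases "W = 0") (auto simp: mult_le_cancel_right)
  then show "norm (tr ?a h1 - h1) \<le> t * (7 * B * M)" "norm (tr ?a h2 - h2) \<le> t * (7 * B * M)"
    using wW unfolding w1_def w2_def by linarith+
qed

section \<open>Decay on small squares\<close>

definition square :: "real \<times> real \<Rightarrow> real \<Rightarrow> (real \<times> real) set" where
  "square p r = {z. \<bar>fst z - fst p\<bar> < r \<and> \<bar>snd z - snd p\<bar> < r}"

lemma open_square: "open (square p r)"
  unfolding square_def by (intro open_Collect_conj open_Collect_less continuous_intros)

text \<open>The step \<open>2 * \<rho>\<close> is at least the full width of \<open>S\<close> in the
  coordinate \<open>l\<close>.\<close>

lemma disjoint_translates:
  assumes "0 < \<rho>" and "\<And>z. z \<in> S \<Longrightarrow> \<bar>l z - c\<bar> < \<rho>" and l: "\<And>z k. l (z - real k *\<^sub>R a) = l z - 2 * \<rho> * real k"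
  shows "disjoint_family (\<lambda>k::nat. {z. z - real k *\<^sub>R a \<in> S})"
  unfolding disjoint_family_on_def
proof (intro ballI impI equals0I, elim IntE CollectE)
  fix j k :: nat and z assume jk: "j \<noteq> k" and "z - real j *\<^sub>R a \<in> S" "z - real k *\<^sub>R a \<in> S"
  then have "\<bar>l z - 2 * \<rho> * real j - c\<bar> < \<rho>" "\<bar>l z - 2 * \<rho> * real k - c\<bar> < \<rho>" using assms(2) l by metis+
  then have "\<bar>2 * \<rho> * real j - 2 * \<rho> * real k\<bar> < 2 * \<rho>" by linarith
  then have "2 * \<rho> * \<bar>real j - real k\<bar> < 2 * \<rho> * 1"
    using assms(1) by (simp add: abs_mult flip: right_diff_distrib)
  then have "\<bar>real j - real k\<bar> < 1" using assms(1) by (subst (asm) mult_less_cancel_left_pos) auto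
  then show False using jk by linarith
qed

lemma nat_between:
  fixes x :: real assumes "1 \<le> x"
  obtains N :: nat where "N \<ge> 1" "x \<le> N" "N \<le> 2 * x"
proof
  show "1 \<le> nat \<lceil>x\<rceil>" using assms by linarith
  show "x \<le> nat \<lceil>x\<rceil>" using assms by linarith
  show "nat \<lceil>x\<rceil> \<le> 2 * x" using assms by linarith
qed

text \<open>The constant 3/2 is a rational upper bound for the square root of 2.\<close>

lemma sqrt_between:
  assumes r: "0 < r" and N: "1 / r\<^sup>2 \<le> N" "N \<le> 2 * (1 / r\<^sup>2)"
  shows "1 / sqrt N \<le> r" "sqrt N \<le> 3 / 2 / r"
proof -
  have "1 / r \<le> sqrt N" using N(1) r by (intro real_le_rsqrt) (simp add: power_divide)
  moreover have "0 < sqrt N" using less_le_trans[of 0 "1 / r" "sqrt N"] calculation r by simp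
  ultimately show "1 / sqrt N \<le> r" using r by (simp add: field_simps)
  have "N \<le> (3 / 2 / r)\<^sup>2"
  proof -
    have "2 * (1 / r\<^sup>2) \<le> 9 / 4 * (1 / r\<^sup>2)" by (intro mult_right_mono) auto
    then show ?thesis using N(2) by (simp add: power_divide)
  qed
  then show "sqrt N \<le> 3 / 2 / r" using r by (intro real_le_lsqrt) auto
qed

text \<open>Two successive strip estimates, first over \<open>\<approx> r\<^sup>-\<^sup>4\<close> vertical strips and then over \<open>\<approx> r\<^sup>-\<^sup>2\<close>
  squares inside one strip, give the exponent \<open>3/4\<close> for squares of side \<open>\<rho> = r\<^sup>4\<close>.\<close>

lemma square_estimate:
  fixes g :: l2
  assumes r: "0 < r" "r \<le> 1" and G: "norm g \<le> G"
    and tr: "\<And>e t. e \<in> {(1, 0), (0, 1)} \<Longrightarrow> 0 \<le> t \<Longrightarrow> norm (tr (t *\<^sub>R e) g - g) \<le> t * G"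
  shows "norm (cut (square p (r ^ 4)) g) \<le> 7 * r ^ 3 * G"
proof -
  let ?\<rho> = "r ^ 4"
  have \<rho>: "0 < ?\<rho>" using r by simp
  have G0: "0 \<le> G" using G norm_ge_zero order_trans by blast
  define S where "S = {z :: real \<times> real. \<bar>fst z - fst p\<bar> < ?\<rho>}"
  have So: "open S" unfolding S_def by (intro open_Collect_less continuous_intros)
  have r2: "1 \<le> 1 / r\<^sup>2" "1 \<le> 1 / (r\<^sup>2)\<^sup>2" using r by (auto simp: power_le_one)
  \<comment> \<open>About r^(-4) strips of width 2 r^4 cover a width of order one: averaging gains
    r^2, and the accumulated translation error sqrt N1 times r^4 is of order r^2 too.\<close>
  obtain N1 :: nat where N1: "N1 \<ge> 1" "1 / (r\<^sup>2)\<^sup>2 \<le> N1" "N1 \<le> 2 * (1 / (r\<^sup>2)\<^sup>2)" using nat_between[OF r2(2)] by blast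
  \<comment> \<open>Inside the strip the norm is already O(r^2). The two errors r^2 / sqrt N2 and
    sqrt N2 times r^4 balance for N2 of order r^(-2), and both are then of order r^3.\<close>
  obtain N2 :: nat where N2: "N2 \<ge> 1" "1 / r\<^sup>2 \<le> N2" "N2 \<le> 2 * (1 / r\<^sup>2)" using nat_between[OF r2(1)] by blast
  have s1: "1 / sqrt N1 \<le> r\<^sup>2" "sqrt N1 \<le> 3 / 2 / r\<^sup>2" using sqrt_between[of "r\<^sup>2" N1] N1 r by auto
  have s2: "1 / sqrt N2 \<le> r" "sqrt N2 \<le> 3 / 2 / r" using sqrt_between[of r N2] N2 r by auto
  have strip: "norm (cut S g) \<le> 4 * r\<^sup>2 * G"
  proof -
    let ?a = "(2 * ?\<rho>) *\<^sub>R (1, 0) :: real \<times> real"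
    let ?T = "\<Union>k<N1. {z. z - real k *\<^sub>R ?a \<in> S}"
    have To: "open ?T"
    proof (intro open_UN ballI)
      fix k
      have "{z. z - real k *\<^sub>R ?a \<in> S} = (\<lambda>z. z - real k *\<^sub>R ?a) -` S" by auto
      then show "open {z. z - real k *\<^sub>R ?a \<in> S}" using So by (auto intro!: open_vimage continuous_intros)
    qed
    have le: "norm (cut ?T x) \<le> norm x" for x by (rule norm_cut_le[OF open_lebesgue[OF To]])
    have "norm (cut S g) \<le> norm (cut ?T g) / sqrt N1 + sqrt N1 * (2 * ?\<rho> * G)"
    proof (rule translates_bound[OF So N1(1)])
      show "disjoint_family (\<lambda>k::nat. {z. z - real k *\<^sub>R ?a \<in> S})"
        by (rule disjoint_translates[OF \<rho>, where l = fst and c = "fst p"]) (auto simp: S_def)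
      show "norm (cut ?T (tr ?a g - g)) \<le> 2 * ?\<rho> * G"
        using le[of "tr ?a g - g"] tr[of "(1, 0)" "2 * ?\<rho>"] \<rho> by simp
    qed
    also have "norm (cut ?T g) / sqrt N1 \<le> r\<^sup>2 * G"
    proof -
      have "norm (cut ?T g) / sqrt N1 = (1 / sqrt N1) * norm (cut ?T g)" by simp
      also have "\<dots> \<le> r\<^sup>2 * G" by (rule mult_mono[OF s1(1) order_trans[OF le G]]) auto
      finally show ?thesis .
    qed
    also have "sqrt N1 * (2 * ?\<rho> * G) \<le> 3 / 2 / r\<^sup>2 * (2 * ?\<rho> * G)"
      using s1(2) \<rho> G0 by (intro mult_right_mono) auto
    also have "3 / 2 / r\<^sup>2 * (2 * ?\<rho> * G) = 3 * r\<^sup>2 * G" using r by (simp add: field_simps power2_eq_square eval_nat_numeral)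
    finally show ?thesis by (simp add: mult_ac)
  qed
  let ?Q = "square p ?\<rho>"
  let ?a = "(2 * ?\<rho>) *\<^sub>R (0, 1) :: real \<times> real"
  let ?T = "\<Union>k<N2. {z. z - real k *\<^sub>R ?a \<in> ?Q}"
  have To: "open ?T"
  proof (intro open_UN ballI)
    fix k
    have "open ((\<lambda>z. z - real k *\<^sub>R ?a) -` ?Q)" by (intro open_vimage open_square continuous_intros)
    then show "open {z. z - real k *\<^sub>R ?a \<in> ?Q}" unfolding vimage_def .
  qed
  have TS: "?T \<subseteq> S" by (auto simp: square_def S_def)
  have "norm (cut ?Q g) \<le> norm (cut ?T g) / sqrt N2 + sqrt N2 * (2 * ?\<rho> * G)"
  proof (rule translates_bound[OF open_square N2(1)])
    show "disjoint_family (\<lambda>k::nat. {z. z - real k *\<^sub>R ?a \<in> ?Q})"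
      by (rule disjoint_translates[OF \<rho>, where l = snd and c = "snd p"]) (auto simp: square_def)
    show "norm (cut ?T (tr ?a g - g)) \<le> 2 * ?\<rho> * G"
      using norm_cut_le[OF open_lebesgue[OF To], of "tr ?a g - g"] tr[of "(0, 1)" "2 * ?\<rho>"] \<rho> by simp
  qed
  also have "norm (cut ?T g) / sqrt N2 \<le> r * (4 * r\<^sup>2 * G)"
  proof -
    have "norm (cut ?T g) \<le> norm (cut S g)" by (intro norm_cut_mono open_lebesgue To So TS)
    then have c: "norm (cut ?T g) \<le> 4 * r\<^sup>2 * G" using strip by simp
    have "norm (cut ?T g) / sqrt N2 = (1 / sqrt N2) * norm (cut ?T g)" by simp
    also have "\<dots> \<le> r * (4 * r\<^sup>2 * G)" by (rule mult_mono[OF s2(1) c]) (use r in auto)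
    finally show ?thesis .
  qed
  also have "sqrt N2 * (2 * ?\<rho> * G) \<le> 3 / 2 / r * (2 * ?\<rho> * G)"
    using s2(2) \<rho> G0 by (intro mult_right_mono) auto
  also have "3 / 2 / r * (2 * ?\<rho> * G) = 3 * r ^ 3 * G" using r by (simp add: field_simps eval_nat_numeral)
  also have "r * (4 * r\<^sup>2 * G) + 3 * r ^ 3 * G = 7 * r ^ 3 * G" by (simp add: eval_nat_numeral algebra_simps)
  finally show ?thesis by simp
qed

text \<open>One half of the estimate of \<open>u\<close> near \<open>K\<close>: \<open>S\<close> collects the points whose line in direction \<open>e\<close>
  avoids \<open>K\<close>, so \<open>u\<close> may be compared with its translates along that line.\<close>

lemma free_line_estimate:
  fixes l :: "real \<times> real \<Rightarrow> real" and e p :: "real \<times> real"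
  assumes S: "open S" "S \<subseteq> square p \<rho>" and \<rho>: "0 < \<rho>" "8 * \<rho> \<le> R" and R: "R \<le> 1"
    and e: "e = (1, 0) \<and> l = fst \<or> e = (0, 1) \<and> l = snd"
    and line: "\<And>z s. z \<in> S \<Longrightarrow> z + s *\<^sub>R e \<in> square p R \<Longrightarrow> z + s *\<^sub>R e \<in> U"
    and u: "wd U e u g"
  shows "norm (cut S u) \<le> sqrt \<rho> * (sqrt (8 / R) * (norm u + norm g))"
proof -
  have R0: "0 < R" using \<rho> by linarith
  \<comment> \<open>N steps of length 2 \<rho> cover at most R / 2, so with \<rho> <= R / 8 the
    translates remain in \<open>square p R\<close>. The floor loses at most a factor 2, whence the 8
    in R / (8 \<rho>).\<close>
  define N where "N = nat \<lfloor>R / (4 * \<rho>)\<rfloor>"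
  have x2: "2 \<le> R / (4 * \<rho>)" using \<rho> by (simp add: field_simps)
  have half: "x / 2 \<le> real (nat \<lfloor>x\<rfloor>)" if "2 \<le> x" for x :: real using that by linarith
  have N: "N \<ge> 1" "R / (8 * \<rho>) \<le> N" "N \<le> R / (4 * \<rho>)"
  proof -
    show "N \<ge> 1" "N \<le> R / (4 * \<rho>)" unfolding N_def using x2 by linarith+
    have "R / (4 * \<rho>) / 2 \<le> N" unfolding N_def by (rule half[OF x2])
    then show "R / (8 * \<rho>) \<le> N" by simp
  qed
  have "norm (cut S u) \<le> norm u / sqrt N + sqrt N * (2 * \<rho> * norm g)"
  proof (rule strip_bound[OF S(1) N(1) _ u])
    show "0 \<le> 2 * \<rho>" using \<rho> by simp
    show "disjoint_family (\<lambda>k::nat. {z. z - real k *\<^sub>R ((2 * \<rho>) *\<^sub>R e) \<in> S})"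
      by (rule disjoint_translates[OF \<rho>(1), where l = l and c = "l p"])
        (use S(2) e in \<open>auto simp: square_def\<close>)
    fix z s assume z: "z \<in> S" and s: "0 \<le> s" "s \<le> N * (2 * \<rho>)"
    have "N * (2 * \<rho>) \<le> R / (4 * \<rho>) * (2 * \<rho>)" using N(3) \<rho> by (intro mult_right_mono) auto
    then have sR: "s \<le> R / 2" using s \<rho> by simp
    show "z + s *\<^sub>R e \<in> U"
      by (rule line[OF z]) (use z S(2) e s sR \<rho> in \<open>auto simp: square_def\<close>)
  qed
  also have "norm u / sqrt N \<le> sqrt \<rho> * sqrt (8 / R) * norm u"
  proof -
    have "1 / sqrt N \<le> sqrt (8 * \<rho> / R)"
    proof -
      have "1 / N \<le> 8 * \<rho> / R" using N R0 \<rho> by (simp add: field_simps)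
      then have "sqrt (1 / N) \<le> sqrt (8 * \<rho> / R)" by (rule real_sqrt_le_mono)
      then show ?thesis by (simp add: real_sqrt_divide)
    qed
    also have "\<dots> = sqrt \<rho> * sqrt (8 / R)" by (simp add: real_sqrt_mult[symmetric] mult.commute)
    finally have "(1 / sqrt N) * norm u \<le> (sqrt \<rho> * sqrt (8 / R)) * norm u" by (rule mult_right_mono) simp
    then show ?thesis by simp
  qed
  also have "sqrt N * (2 * \<rho> * norm g) \<le> sqrt \<rho> * sqrt (8 / R) * norm g"
  proof -
    have "sqrt N * (2 * \<rho>) \<le> sqrt (R / (4 * \<rho>)) * (2 * \<rho>)"
      using N(3) \<rho> by (intro mult_right_mono real_sqrt_le_mono) auto
    also have "\<dots> = sqrt (R / (4 * \<rho>) * (2 * \<rho>)\<^sup>2)"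
      using \<rho> by (simp only: real_sqrt_mult[of "R / (4 * \<rho>)" "(2 * \<rho>)\<^sup>2"] real_sqrt_abs)
    also have "R / (4 * \<rho>) * (2 * \<rho>)\<^sup>2 = \<rho> * R" using \<rho> by (simp add: field_simps power2_eq_square)
    \<comment> \<open>Since R <= 1, the factor R may be enlarged to 8 / R, the one arising from the
      other summand.\<close>
    also have "sqrt (\<rho> * R) \<le> sqrt (\<rho> * (8 / R))"
    proof (intro real_sqrt_le_mono mult_left_mono)
      have "R * R \<le> 1 * 1" using R R0 by (intro mult_mono) auto
      then show "R \<le> 8 / R" using R0 by (simp add: field_simps)
    qed (use \<rho> in simp)
    also have "\<dots> = sqrt \<rho> * sqrt (8 / R)" by (rule real_sqrt_mult)
    finally have "sqrt N * (2 * \<rho>) * norm g \<le> sqrt \<rho> * sqrt (8 / R) * norm g" by (rule mult_right_mono) simp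
    then show ?thesis by (simp add: mult.assoc)
  qed
  finally show ?thesis by (simp add: algebra_simps)
qed

section \<open>Closeness of the Neumann Laplacians\<close>

lemma cbox_subset_cball: "cbox (p - (s, s)) (p + (s, s)) \<subseteq> cball p (2 * s)" for p :: "real \<times> real"
proof
  fix z assume "z \<in> cbox (p - (s, s)) (p + (s, s))"
  then have "\<bar>fst z - fst p\<bar> \<le> s" "\<bar>snd z - snd p\<bar> \<le> s"
    by (auto simp: mem_box Basis_prod_def inner_prod_def abs_le_iff)
  moreover have "norm (z - p) \<le> norm (fst (z - p)) + norm (snd (z - p))"
    using norm_Pair_le[of "fst (z - p)" "snd (z - p)"] unfolding prod.collapse .
  ultimately show "z \<in> cball p (2 * s)" by (simp add: dist_norm norm_minus_commute)
qed

lemma ball_subset_square: "ball p r \<subseteq> square p r"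
proof
  fix z assume "z \<in> ball p r"
  then have "norm (z - p) < r" by (simp add: dist_norm norm_minus_commute)
  moreover have "norm (fst (z - p)) \<le> norm (z - p)" 
    using norm_fst_le[of "fst (z - p)" "snd (z - p)"] unfolding prod.collapse .
  moreover have "norm (snd (z - p)) \<le> norm (z - p)" 
    using norm_snd_le[of "snd (z - p)" "fst (z - p)"] unfolding prod.collapse .
  ultimately show "z \<in> square p r" unfolding square_def by simp
qed

lemma box_eq_square: "box (p - (r, r)) (p + (r, r)) = square p r"
proof (intro set_eqI)
  fix z show "z \<in> box (p - (r, r)) (p + (r, r)) \<longleftrightarrow> z \<in> square p r"
    unfolding in_box_prod square_def by (simp add: abs_less_iff) linarith
qed

lemma directional_deriv_locally_const:
  assumes "open S" "z \<in> S" "\<And>z. z \<in> S \<Longrightarrow> \<phi> z = c"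
  shows "directional_deriv b \<phi> z = 0"
proof -
  have "((\<lambda>z. c) has_derivative (\<lambda>h. 0)) (at z)" by simp
  then have "(\<phi> has_derivative (\<lambda>h. 0)) (at z)"
    by (rule has_derivative_transform_within_open[OF _ assms(1,2)]) (simp add: assms(3))
  then show ?thesis by (rule directional_deriv_eq)
qed

lemma test_derivatives_bounded:
  assumes "test_function U \<eta>"
  obtains B where "1 \<le> B" "\<And>z. \<bar>\<eta> z\<bar> \<le> B"
    "\<And>z i. i \<in> {(1, 0), (0, 1)} \<Longrightarrow> \<bar>directional_deriv i \<eta> z\<bar> \<le> B"
    "\<And>z i j. i \<in> {(1, 0), (0, 1)} \<Longrightarrow> j \<in> {(1, 0), (0, 1)} \<Longrightarrow> \<bar>directional_deriv j (directional_deriv i \<eta>) z\<bar> \<le> B"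
proof -
  have ex: "\<exists>B\<ge>0. \<forall>z. \<bar>\<phi> z\<bar> \<le> B" if "test_function U \<phi>" for \<phi> using test_bounds[OF that] by metis
  define b where "b \<phi> = (SOME B. 0 \<le> B \<and> (\<forall>z. \<bar>\<phi> z\<bar> \<le> B))" for \<phi> :: "real \<times> real \<Rightarrow> real"
  have b: "0 \<le> b \<phi>" "\<bar>\<phi> z\<bar> \<le> b \<phi>" if "test_function U \<phi>" for \<phi> z
    using someI_ex[OF ex[OF that]] unfolding b_def by blast+
  let ?D = "\<lambda>i. directional_deriv i \<eta>"
  let ?I = "{(1, 0), (0, 1)} :: (real \<times> real) set"
  note t1 = test_directional_deriv[OF assms] and t2 = test_directional_deriv[OF test_directional_deriv[OF assms]]
  define B where "B = 1 + b \<eta> + (\<Sum>i\<in>?I. b (?D i)) + (\<Sum>i\<in>?I. \<Sum>j\<in>?I. b (directional_deriv j (?D i)))"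
  have s1: "0 \<le> (\<Sum>i\<in>?I. b (?D i))" by (intro sum_nonneg b t1)
  have s2: "0 \<le> (\<Sum>j\<in>?I. b (directional_deriv j (?D i)))" for i by (intro sum_nonneg b t2)
  have s3: "0 \<le> (\<Sum>i\<in>?I. \<Sum>j\<in>?I. b (directional_deriv j (?D i)))" by (intro sum_nonneg s2)
  note b0 = b[OF assms]
  show thesis
  proof
    show "1 \<le> B" unfolding B_def using b0(1) s1 s3 by linarith
    show "\<bar>\<eta> z\<bar> \<le> B" for z unfolding B_def using b0(1) b0(2)[of z] s1 s3 by linarith
    fix i :: "real \<times> real" assume i: "i \<in> ?I"
    have "b (?D i) \<le> (\<Sum>i\<in>?I. b (?D i))" by (rule member_le_sum[OF i]) (use b(1)[OF t1] in auto)
    then show "\<bar>?D i z\<bar> \<le> B" for z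
      unfolding B_def using b0(1) b(2)[OF t1, of i z] s3 by linarith
    fix j :: "real \<times> real" assume j: "j \<in> ?I"
    have "b (directional_deriv j (?D i)) \<le> (\<Sum>j\<in>?I. b (directional_deriv j (?D i)))"
      by (rule member_le_sum[OF j]) (use b(1)[OF t2] in auto)
    moreover have "(\<Sum>j\<in>?I. b (directional_deriv j (?D i))) \<le> (\<Sum>i\<in>?I. \<Sum>j\<in>?I. b (directional_deriv j (?D i)))"
      by (rule member_le_sum[OF i]) (use s2 in auto)
    ultimately show "\<bar>directional_deriv j (?D i) z\<bar> \<le> B" for z
      unfolding B_def using b0(1) b(2)[OF t2, of j i z] s1 by linarith
  qed
qed

text \<open>A fixed cutoff \<eta> equals 1 near p, so on small squares the gradient of \<eta> f
  agrees with that of f. The former lives on the whole plane and has difference quotients controlled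
  by \<open>elliptic_difference\<close>, so \<open>square_estimate\<close> applies.\<close>

lemma gradient_decay:
  fixes p :: "real \<times> real"
  assumes U: "open U" and p: "p \<in> U"
  obtains R C where "0 < R" "0 < C"
    "\<And>r M f f1 f2 w0. \<lbrakk>0 < r; r \<le> 1; r ^ 4 \<le> R; wd U (1, 0) f f1; wd U (0, 1) f f2;
      \<And>v v1 v2. wd U (1, 0) v v1 \<Longrightarrow> wd U (0, 1) v v2 \<Longrightarrow> inner f1 v1 + inner f2 v2 = inner w0 v;
      norm f \<le> M; norm f1 \<le> M; norm f2 \<le> M; norm w0 \<le> M\<rbrakk>
      \<Longrightarrow> norm (cut (square p (r ^ 4)) f1) \<le> C * r ^ 3 * M \<and> norm (cut (square p (r ^ 4)) f2) \<le> C * r ^ 3 * M"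
proof -
  obtain e where e: "0 < e" "ball p e \<subseteq> U" using U p open_contains_ball by blast
  define s where "s = e / 4"
  have s: "0 < s" "0 < s / 2" using e by (auto simp: s_def)
  define \<eta> where "\<eta> = rect (p - (s, s)) (p + (s, s)) (s / 2)"
  have "cball p (2 * s) \<subseteq> ball p e" using e by (auto simp: s_def)
  then have "cbox (p - (s, s)) (p + (s, s)) \<subseteq> U" using cbox_subset_cball[of p s] e(2) by blast
  then have t: "test_function U \<eta>" unfolding \<eta>_def by (rule test_function_rect[OF s(2)])
  obtain B where B: "1 \<le> B" "\<And>z. \<bar>\<eta> z\<bar> \<le> B"
    "\<And>z i. i \<in> {(1, 0), (0, 1)} \<Longrightarrow> \<bar>directional_deriv i \<eta> z\<bar> \<le> B"
    "\<And>z i j. i \<in> {(1, 0), (0, 1)} \<Longrightarrow> j \<in> {(1, 0), (0, 1)} \<Longrightarrow> \<bar>directional_deriv j (directional_deriv i \<eta>) z\<bar> \<le> B"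
    using test_derivatives_bounded[OF t] by blast
  have one: "\<eta> z = 1" if "z \<in> square p (s / 2)" for z
  proof -
    have z: "\<bar>fst z - fst p\<bar> < s / 2" "\<bar>snd z - snd p\<bar> < s / 2" using that unfolding square_def by blast+
    show ?thesis
      unfolding \<eta>_def
      by (rule rect_1[OF s(2)]; simp only: fst_diff snd_diff fst_add snd_add fst_conv snd_conv; insert z; linarith)
  qed
  have zero: "directional_deriv b \<eta> z = 0" if "z \<in> square p (s / 2)" for z b
    by (rule directional_deriv_locally_const[OF open_square that one])
  show thesis
  proof
    show "0 < s / 2" by (rule s(2))
    show "0 < 49 * B" using B(1) by simp
    fix r M :: real and f f1 f2 w0 :: l2
    assume r: "0 < r" "r \<le> 1" "r ^ 4 \<le> s / 2" and f: "wd U (1, 0) f f1" "wd U (0, 1) f f2"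
      and eqn: "\<And>v v1 v2. wd U (1, 0) v v1 \<Longrightarrow> wd U (0, 1) v v2 \<Longrightarrow> inner f1 v1 + inner f2 v2 = inner w0 v"
      and M: "norm f \<le> M" "norm f1 \<le> M" "norm f2 \<le> M" "norm w0 \<le> M"
    let ?Q = "square p (r ^ 4)"
    have Q: "?Q \<subseteq> square p (s / 2)" using r(3) by (auto simp: square_def)
    define h where "h i g = mul (\<lambda>z. of_real (\<eta> z)) g + mul (\<lambda>z. of_real (directional_deriv i \<eta> z)) f" for i g
    have M0: "0 \<le> M" using M(1) norm_ge_zero order_trans by blast
    have B0: "0 \<le> B" using B(1) by simp
    have bm: "bm (\<lambda>z. of_real (\<eta> z))" "bm (\<lambda>z. of_real (directional_deriv i \<eta> z))" for i
      by (intro test_bm[OF t] test_bm[OF test_directional_deriv[OF t]])+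
    have hcut: "cut ?Q (h i g) = cut ?Q g" for i g
    proof -
      have Qb: "bm (indicator ?Q)" by (intro bm_indicator open_lebesgue open_square)
      have e1: "(\<lambda>z. indicator ?Q z * complex_of_real (\<eta> z)) = indicator ?Q"
        using one Q by (auto simp: fun_eq_iff indicator_def)
      have e2: "(\<lambda>z. indicator ?Q z * complex_of_real (directional_deriv i \<eta> z)) = (\<lambda>z. 0)"
      proof (rule ext)
        fix z show "indicator ?Q z * complex_of_real (directional_deriv i \<eta> z) = 0"
          using zero[of z i] Q by (cases "z \<in> ?Q") auto
      qed
      show ?thesis
        unfolding h_def mul_add[OF Qb] mul_mul[OF Qb bm(1)] mul_mul[OF Qb bm(2)] e1 e2 by simp
    qed
    have main: "norm (cut ?Q g) \<le> 49 * B * r ^ 3 * M"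
      if i: "i \<in> {(1, 0), (0, 1)}" and g: "norm g \<le> M"
        and d: "\<And>e t. e \<in> {(1, 0), (0, 1)} \<Longrightarrow> 0 \<le> t \<Longrightarrow> norm (tr (t *\<^sub>R e) (h i g) - h i g) \<le> t * (7 * B * M)" for i g
    proof -
      have "norm (h i g) \<le> B * norm g + B * norm f"
        unfolding h_def by (intro order_trans[OF norm_triangle_ineq] add_mono norm_mul_real_le bm B i)
      also have "\<dots> \<le> B * M + B * M" using g M(1) B0 by (intro add_mono mult_left_mono) auto
      \<comment> \<open>The norm bound 2 B M is relaxed to the constant of the difference bound,
        since \<open>square_estimate\<close> takes a single \<open>G\<close>; its own factor 7 then
        produces 49.\<close>
      also have "\<dots> \<le> 7 * B * M" using mult_nonneg_nonneg[OF B0 M0] by linarith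
      finally have "norm (cut ?Q (h i g)) \<le> 7 * r ^ 3 * (7 * B * M)" by (rule square_estimate[OF r(1,2) _ d])
      then show ?thesis unfolding hcut by (simp add: mult_ac)
    qed
    note el = elliptic_difference[OF U t B f eqn M]
    show "norm (cut ?Q f1) \<le> 49 * B * r ^ 3 * M \<and> norm (cut ?Q f2) \<le> 49 * B * r ^ 3 * M"
      by (intro conjI main[of "(1, 0)"] main[of "(0, 1)"] M) (auto simp only: h_def insert_iff intro: el)
  qed
qed

text \<open>Points are sorted by which of the lines through them misses K. Expressed through the
  projections of K, which are compact, both families are open; by property* they cover the square up
  to the null set K.\<close>

lemma H1_decay:
  assumes \<Omega>: "open \<Omega>" and K: "compact K" "K \<in> null_sets lebesgue" "K \<subseteq> \<Omega>" "property_star \<Omega> K"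
    and \<rho>: "0 < \<rho>" "8 * \<rho> \<le> R" and R: "R \<le> 1" "square p R \<subseteq> \<Omega>"
    and u: "wd (\<Omega> - K) (1, 0) u u1" "wd (\<Omega> - K) (0, 1) u u2"
  shows "norm (cut (square p \<rho>) u) \<le> sqrt \<rho> * (sqrt (8 / R) * (2 * norm u + norm u1 + norm u2))"
proof -
  define Sx where "Sx = square p \<rho> \<inter> snd -` (- (snd ` K))"
  define Sy where "Sy = square p \<rho> \<inter> fst -` (- (fst ` K))"
  have op: "open Sx" "open Sy"
    unfolding Sx_def Sy_def
    by (intro open_Int open_square open_vimage open_Compl compact_imp_closed compact_continuous_image continuous_intros K(1))+
  have x: "norm (cut Sx u) \<le> sqrt \<rho> * (sqrt (8 / R) * (norm u + norm u1))"
  proof (rule free_line_estimate[OF op(1) _ \<rho> R(1) _ _ u(1)])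
    show "Sx \<subseteq> square p \<rho>" unfolding Sx_def by blast
    show "(1, 0) = (1::real, 0::real) \<and> fst = (fst :: real \<times> real \<Rightarrow> real) \<or> (1, 0) = (0::real, 1::real) \<and> fst = (snd :: real \<times> real \<Rightarrow> real)" by simp
    fix z s assume z: "z \<in> Sx" "z + s *\<^sub>R (1, 0) \<in> square p R"
    have "snd (z + s *\<^sub>R (1, 0)) \<notin> snd ` K" using z(1) by (simp add: Sx_def)
    then show "z + s *\<^sub>R (1, 0) \<in> \<Omega> - K" using z(2) R(2) by blast
  qed
  have y: "norm (cut Sy u) \<le> sqrt \<rho> * (sqrt (8 / R) * (norm u + norm u2))"
  proof (rule free_line_estimate[OF op(2) _ \<rho> R(1) _ _ u(2)])
    show "Sy \<subseteq> square p \<rho>" unfolding Sy_def by blast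
    show "(0, 1) = (1::real, 0::real) \<and> snd = (fst :: real \<times> real \<Rightarrow> real) \<or> (0, 1) = (0::real, 1::real) \<and> snd = (snd :: real \<times> real \<Rightarrow> real)" by simp
    fix z s assume z: "z \<in> Sy" "z + s *\<^sub>R (0, 1) \<in> square p R"
    have "fst (z + s *\<^sub>R (0, 1)) \<notin> fst ` K" using z(1) by (simp add: Sy_def)
    then show "z + s *\<^sub>R (0, 1) \<in> \<Omega> - K" using z(2) R(2) by blast
  qed
  have sub: "square p \<rho> \<subseteq> Sx \<union> Sy \<union> K"
  proof
    fix z assume z: "z \<in> square p \<rho>"
    show "z \<in> Sx \<union> Sy \<union> K"
    proof (cases "z \<in> K")
      case False
      have "\<rho> \<le> R" using \<rho> by linarith
      then have "z \<in> square p R" using z by (auto simp: square_def)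
      then have "(fst z, snd z) \<in> \<Omega> - K" using R(2) False by auto
      then have "{(x, y). (x, y) \<in> \<Omega> \<and> x = fst z} \<inter> K = {} \<or> {(x, y). (x, y) \<in> \<Omega> \<and> y = snd z} \<inter> K = {}"
        using K(4) unfolding property_star_def by blast
      then show ?thesis
      proof
        \<comment> \<open>The condition concerns only the part of the line inside \<Omega>; since K
          lies in \<Omega>, it excludes the coordinate from the whole projection of K.\<close>
        assume e: "{(x, y). (x, y) \<in> \<Omega> \<and> x = fst z} \<inter> K = {}"
        have "fst z \<notin> fst ` K"
        proof
          assume "fst z \<in> fst ` K"
          then obtain k where k: "k \<in> K" "fst k = fst z" by auto
          then have "k \<in> {(x, y). (x, y) \<in> \<Omega> \<and> x = fst z} \<inter> K" using K(3) by (cases k) auto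
          then show False using e by simp
        qed
        then show ?thesis using z by (simp add: Sy_def)
      next
        assume e: "{(x, y). (x, y) \<in> \<Omega> \<and> y = snd z} \<inter> K = {}"
        have "snd z \<notin> snd ` K"
        proof
          assume "snd z \<in> snd ` K"
          then obtain k where k: "k \<in> K" "snd k = snd z" by auto
          then have "k \<in> {(x, y). (x, y) \<in> \<Omega> \<and> y = snd z} \<inter> K" using K(3) by (cases k) auto
          then show False using e by simp
        qed
        then show ?thesis using z by (simp add: Sx_def)
      qed
    qed simp
  qed
  have "norm (cut (square p \<rho>) u) \<le> norm (cut Sx u) + norm (cut Sy u)"
    by (rule norm_cut_Un[OF open_lebesgue[OF op(1)] open_lebesgue[OF op(2)] open_lebesgue[OF open_square] K(2) sub])
  then show ?thesis using x y by (simp add: algebra_simps)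
qed

text \<open>A multiplier vanishing off \<open>Q\<close> absorbs the indicator of \<open>Q\<close> on
  either side, so both factors of the inner product get restricted to \<open>Q\<close>.\<close>

lemma cmod_inner_localized:
  assumes Q: "Q \<in> sets lebesgue" and m: "bm (\<lambda>z. of_real (\<phi> z))"
    and B: "\<And>z. \<bar>\<phi> z\<bar> \<le> B" "0 \<le> B" and off: "\<And>z. z \<notin> Q \<Longrightarrow> \<phi> z = 0"
  shows "mul (\<lambda>z. of_real (\<phi> z)) x = mul (\<lambda>z. of_real (\<phi> z)) (cut Q x)"
    "cmod (l2_inner_c f (mul (\<lambda>z. of_real (\<phi> z)) x)) \<le> norm (cut Q f) * (B * norm (cut Q x))"
proof -
  let ?m = "mul (\<lambda>z. of_real (\<phi> z))"
  have Qb: "bm (indicator Q)" by (rule bm_indicator[OF Q])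
  have e: "(\<lambda>z. complex_of_real (\<phi> z) * indicator Q z) = (\<lambda>z. of_real (\<phi> z))"
    using off by (auto simp: fun_eq_iff indicator_def)
  have e': "(\<lambda>z. indicator Q z * complex_of_real (\<phi> z)) = (\<lambda>z. of_real (\<phi> z))"
    using off by (auto simp: fun_eq_iff indicator_def)
  show 1: "?m x = ?m (cut Q x)" unfolding mul_mul[OF m Qb] e ..
  have 2: "?m y = cut Q (?m y)" for y unfolding mul_mul[OF Qb m] e' ..
  have sw: "l2_inner_c f (cut Q y) = l2_inner_c (cut Q f) y" for y
    unfolding l2_inner_c_eq mul_ii[OF Qb, symmetric] inner_cut[OF Q] ..
  have "l2_inner_c f (?m x) = l2_inner_c (cut Q f) (?m (cut Q x))"
    by (subst 2) (simp only: sw 1[symmetric])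
  then have "cmod (l2_inner_c f (?m x)) \<le> norm (cut Q f) * norm (?m (cut Q x))"
    using cmod_l2_inner_c by simp
  also have "\<dots> \<le> norm (cut Q f) * (B * norm (cut Q x))"
    by (intro mult_left_mono norm_mul_real_le[OF m B(1)]) simp
  finally show "cmod (l2_inner_c f (?m x)) \<le> norm (cut Q f) * (B * norm (cut Q x))" .
qed

text \<open>A test function on \<Omega> multiplied by 1 - \<eta> vanishes near K and becomes
  admissible on \<Omega> - K. The weak derivative of (1 - \<eta>) u therefore extends across
  K.\<close>

lemma wd_cutoff:
  assumes \<Omega>: "open \<Omega>" and K: "K \<in> null_sets lebesgue" "K \<subseteq> S" and S: "open S"
    and t: "test_function \<Omega> \<eta>" and one: "\<And>z. z \<in> S \<Longrightarrow> \<eta> z = 1" and w: "wd (\<Omega> - K) b u g"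
  shows "wd \<Omega> b (mul (\<lambda>z. of_real (1 - \<eta> z)) u)
    (mul (\<lambda>z. of_real (1 - \<eta> z)) g - mul (\<lambda>z. of_real (directional_deriv b \<eta> z)) u)"
proof -
  have s: "smooth (\<lambda>z. 1 - \<eta> z)" by (intro smooth_diff smooth_const test_smooth[OF t])
  have m1: "bm (\<lambda>z. of_real (1 - \<eta> z))"
    unfolding of_real_diff by (intro bm_diff bm_const test_bm[OF t])
  have d: "directional_deriv b (\<lambda>z. 1 - \<eta> z) = (\<lambda>z. - directional_deriv b \<eta> z)"
    by (rule directional_deriv_1_minus[OF test_smooth[OF t]])
  have m: "bm (\<lambda>z. of_real (directional_deriv b \<eta> z))" by (rule test_bm[OF test_directional_deriv[OF t]])
  have m2: "bm (\<lambda>z. of_real (directional_deriv b (\<lambda>z. 1 - \<eta> z) z))"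
    using bm_diff[OF bm_const[of 0] m] unfolding d by simp
  have e: "mul (\<lambda>z. of_real (directional_deriv b (\<lambda>z. 1 - \<eta> z) z)) u = - mul (\<lambda>z. of_real (directional_deriv b \<eta> z)) u"
    using mul_minus[OF bm_const[of 0] m, of u] unfolding d by simp
  note UL = open_lebesgue[OF \<Omega>]
  have V: "u \<in> VV \<Omega>" "g \<in> VV \<Omega>" using wdD(1,2)[OF w] unfolding VV_null[OF UL K(1)] .
  have "wd \<Omega> b (mul (\<lambda>z. of_real (1 - \<eta> z)) u)
    (mul (\<lambda>z. of_real (1 - \<eta> z)) g + mul (\<lambda>z. of_real (directional_deriv b (\<lambda>z. 1 - \<eta> z) z)) u)"
  proof (rule wd_mul[OF w s m1 m2 \<Omega>])
    fix \<phi> assume \<phi>: "test_function \<Omega> \<phi>"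
    let ?A = "{z. (1 - \<eta> z) * \<phi> z \<noteq> 0}"
    have t': "test_function \<Omega> (\<lambda>z. (1 - \<eta> z) * \<phi> z)" by (rule test_mult[OF s \<phi>])
    \<comment> \<open>\<open>S\<close> is open, so even the closed support avoids it, and K is
      contained in \<open>S\<close>.\<close>
    have "closure ?A \<subseteq> - S" by (rule closure_minimal) (use one S in auto)
    then show "test_function (\<Omega> - K) (\<lambda>z. (1 - \<eta> z) * \<phi> z)"
      using t' K(2) unfolding test_function_def by blast
  qed (intro mul_VV[OF UL] m1 m2 V)+
  then show ?thesis unfolding e by simp
qed


text \<open>The square of half side r^4 = 2 \<epsilon> carries \<eta>; the transition layer of width
  \<epsilon> leaves \<eta> = 1 on the square of half side \<epsilon>, which contains K. All errors
  are thus confined to the larger square.\<close>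

lemma cutoff_estimates:
  assumes \<Omega>: "open \<Omega>" and K: "compact K" "K \<in> null_sets lebesgue" "K \<subseteq> ball p \<epsilon>" "property_star \<Omega> K"
    and \<epsilon>: "0 < \<epsilon>" "16 * \<epsilon> \<le> R" and R: "R \<le> 1" "square p R \<subseteq> \<Omega>"
    and supp: "cbox (p - (2 * \<epsilon>, 2 * \<epsilon>)) (p + (2 * \<epsilon>, 2 * \<epsilon>)) \<subseteq> \<Omega>"
    and r: "0 < r" "r ^ 4 = 2 * \<epsilon>"
    and \<eta>: "\<eta> = rect (p - (2 * \<epsilon>, 2 * \<epsilon>)) (p + (2 * \<epsilon>, 2 * \<epsilon>)) \<epsilon>"
    and u: "u \<in> H1 (\<Omega> - K)" "norm u \<le> S" "norm (DD (\<Omega> - K) (1, 0) u) \<le> S" "norm (DD (\<Omega> - K) (0, 1) u) \<le> S"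
  shows "mul (\<lambda>z. of_real (1 - \<eta> z)) u \<in> H1 \<Omega>"
    and "norm (u - mul (\<lambda>z. of_real (1 - \<eta> z)) u) \<le> 4 * sqrt (8 / R) * r\<^sup>2 * S"
    and "\<lbrakk>f \<in> H1 \<Omega>; norm (cut (square p (r ^ 4)) (DD \<Omega> (1, 0) f)) \<le> E; norm (cut (square p (r ^ 4)) (DD \<Omega> (0, 1) f)) \<le> E\<rbrakk>
      \<Longrightarrow> cmod (grad_form \<Omega> f (mul (\<lambda>z. of_real (1 - \<eta> z)) u) - grad_form (\<Omega> - K) f u)
        \<le> 2 * E * (S + 4 / (bump_total * r ^ 4) * (4 * sqrt (8 / R) * r\<^sup>2 * S))"
proof -
  let ?Q = "square p (r ^ 4)" and ?T = "mul (\<lambda>z. of_real (1 - \<eta> z))"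
  let ?a = "4 * sqrt (8 / R) * r\<^sup>2 * S" and ?c = "4 / (bump_total * r ^ 4)"
  let ?D = "DD (\<Omega> - K)"
  have \<Omega>': "open (\<Omega> - K)" using \<Omega> K(1) compact_imp_closed open_Diff by blast
  have KS: "K \<subseteq> square p \<epsilon>" using K(3) ball_subset_square by blast
  have K\<Omega>: "K \<subseteq> \<Omega>"
  proof -
    have "\<epsilon> \<le> R" using \<epsilon> by linarith
    then have "square p \<epsilon> \<subseteq> square p R" by (auto simp: square_def)
    then show ?thesis using KS R(2) by blast
  qed
  have t: "test_function \<Omega> \<eta>" unfolding \<eta> by (rule test_function_rect[OF \<epsilon>(1) supp])
  note td = test_directional_deriv[OF t]
  have one: "\<eta> z = 1" if "z \<in> square p \<epsilon>" for z
  proof -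
    have z: "\<bar>fst z - fst p\<bar> < \<epsilon>" "\<bar>snd z - snd p\<bar> < \<epsilon>" using that unfolding square_def by blast+
    show ?thesis
      unfolding \<eta>
      by (rule rect_1[OF \<epsilon>(1)]; simp only: fst_diff snd_diff fst_add snd_add fst_conv snd_conv; insert z; linarith)
  qed
  have off: "\<eta> z = 0" if "z \<notin> ?Q" for z
    unfolding \<eta> by (rule rect_0[OF \<epsilon>(1)]) (use that in \<open>simp only: box_eq_square r(2) not_False_eq_True\<close>)
  \<comment> \<open>On the boundary of the square \<eta> need not be locally constant, but it
    attains its minimum 0 there, so its derivative vanishes.\<close>
  have doff: "directional_deriv b \<eta> z = 0" if "z \<notin> ?Q" for b z
  proof -
    have "\<forall>y\<in>UNIV. \<eta> z \<le> \<eta> y" using off[OF that] rect_bounds(1) unfolding \<eta> by simp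
    then have "(\<lambda>h. directional_deriv h \<eta> z) = (\<lambda>h. 0)"
      using differential_zero_maxmin[OF UNIV_I open_UNIV smoothE(1)[OF test_smooth[OF t], of z]] by blast
    then show ?thesis by (rule fun_cong)
  qed
  have bm: "bm (\<lambda>z. of_real (\<eta> z))" "bm (\<lambda>z. of_real (directional_deriv b \<eta> z))" for b
    by (rule test_bm[OF t], rule test_bm[OF td])
  have T: "?T x = x - mul (\<lambda>z. of_real (\<eta> z)) x" for x
    using mul_minus[OF bm_const[of 1] bm(1), of x] by simp
  have b1: "\<bar>\<eta> z\<bar> \<le> 1" for z unfolding \<eta> using rect_bounds by (simp add: abs_le_iff order_trans[of _ 0])
  have c0: "0 \<le> ?c"
    using bump_total_pos r(1) by (intro divide_nonneg_nonneg mult_nonneg_nonneg zero_le_power) auto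
  have b2: "\<bar>directional_deriv b \<eta> z\<bar> \<le> ?c" if "b \<in> {(1, 0), (0, 1)}" for b z
  proof -
    \<comment> \<open>As r^4 = 2 \<epsilon>, this is the bound for a transition layer of width
      \<epsilon>.\<close>
    have c: "?c = 2 / (bump_total * \<epsilon>)" unfolding r(2) using \<epsilon>(1) bump_total_pos by (simp add: field_simps)
    have "b = (1, 0) \<or> b = (0, 1)" using that by simp
    then show ?thesis unfolding \<eta> c by (elim disjE) (simp_all only: rect_deriv_bound[OF \<epsilon>(1)])
  qed
  note QL = open_lebesgue[OF open_square[of p "r ^ 4"]]
  have e12: "(1::real, 0::real) = (1, 0) \<or> (1::real, 0::real) = (0, 1)" "(0::real, 1::real) = (1, 0) \<or> (0::real, 1::real) = (0, 1)" by auto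
  have w: "wd \<Omega> b (?T u) (?T (?D b u) - mul (\<lambda>z. of_real (directional_deriv b \<eta> z)) u)"
    if "b = (1, 0) \<or> b = (0, 1)" for b
    by (rule wd_cutoff[OF \<Omega> K(2) KS open_square t one H1_wd[OF \<Omega>' u(1) that]])
  show "?T u \<in> H1 \<Omega>" by (rule H1I[OF \<Omega> w[OF e12(1)] w[OF e12(2)]])
  \<comment> \<open>The factor 4 is 2 + 1 + 1 from the sum in \<open>H1_decay\<close>, and sqrt
    (r^4) = r^2.\<close>
  have cu: "norm (cut ?Q u) \<le> ?a"
  proof -
    have "norm (cut ?Q u) \<le> sqrt (r ^ 4) * (sqrt (8 / R) * (2 * norm u + norm (?D (1, 0) u) + norm (?D (0, 1) u)))"
      by (rule H1_decay[OF \<Omega> K(1,2) K\<Omega> K(4) _ _ R H1_wd[OF \<Omega>' u(1) e12(1)] H1_wd[OF \<Omega>' u(1) e12(2)]])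
        (use \<epsilon> r in simp_all)
    also have "\<dots> \<le> sqrt (r ^ 4) * (sqrt (8 / R) * (4 * S))"
      using u \<epsilon> by (intro mult_left_mono) auto
    also have "sqrt (r ^ 4) = r\<^sup>2"
      using r(1) by (intro real_sqrt_unique) (simp_all flip: power_mult)
    finally show ?thesis by (simp add: mult_ac)
  qed
  show "norm (u - ?T u) \<le> ?a"
  proof -
    have "norm (u - ?T u) = norm (mul (\<lambda>z. of_real (\<eta> z)) (cut ?Q u))"
      unfolding T using cmod_inner_localized(1)[OF QL bm(1) b1 _ off] by simp
    also have "\<dots> \<le> 1 * norm (cut ?Q u)" by (rule norm_mul_real_le[OF bm(1) b1])
    finally show ?thesis using cu by simp
  qed
  assume f: "f \<in> H1 \<Omega>" "norm (cut ?Q (DD \<Omega> (1, 0) f)) \<le> E" "norm (cut ?Q (DD \<Omega> (0, 1) f)) \<le> E"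
  have E0: "0 \<le> E" using f(2) norm_ge_zero order_trans by blast
  define X where "X b = l2_inner_c (DD \<Omega> b f) (DD \<Omega> b (?T u)) - l2_inner_c (DD \<Omega> b f) (?D b u)" for b
  have X: "cmod (X b) \<le> E * (S + ?c * ?a)" if b: "b = (1, 0) \<or> b = (0, 1)" for b
  proof -
    let ?m = "mul (\<lambda>z. of_real (\<eta> z)) (?D b u)" and ?d = "mul (\<lambda>z. of_real (directional_deriv b \<eta> z)) u"
    have fb: "norm (cut ?Q (DD \<Omega> b f)) \<le> E" and ub: "norm (?D b u) \<le> S" using b f u by auto
    have bI: "b \<in> {(1, 0), (0, 1)}" using b by simp
    \<comment> \<open>By the product rule the derivative of (1 - \<eta>) u differs from that of u by
      two terms, one with \<eta> and one with its derivative, both supported in the square.\<close>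
    have "X b = - (l2_inner_c (DD \<Omega> b f) ?m + l2_inner_c (DD \<Omega> b f) ?d)"
      unfolding X_def DD_eq[OF \<Omega> w[OF b]] unfolding T by (simp add: l2_inner_c_diff_right)
    then have "cmod (X b) \<le> cmod (l2_inner_c (DD \<Omega> b f) ?m) + cmod (l2_inner_c (DD \<Omega> b f) ?d)"
      using norm_triangle_ineq by (simp only: norm_minus_cancel)
    also have "cmod (l2_inner_c (DD \<Omega> b f) ?m) \<le> norm (cut ?Q (DD \<Omega> b f)) * (1 * norm (cut ?Q (?D b u)))"
      by (rule cmod_inner_localized(2)[OF QL bm(1) b1 _ off]) simp
    also have "\<dots> \<le> E * S"
      using order_trans[OF norm_cut_le[OF QL] ub] by (intro mult_mono fb E0) simp_all
    also have "cmod (l2_inner_c (DD \<Omega> b f) ?d) \<le> norm (cut ?Q (DD \<Omega> b f)) * (?c * norm (cut ?Q u))"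
      by (rule cmod_inner_localized(2)[OF QL bm(2) b2[OF bI] c0 doff])
    also have "\<dots> \<le> E * (?c * ?a)"
      using c0 by (intro mult_mono fb E0 mult_left_mono cu mult_nonneg_nonneg) simp_all
    finally show ?thesis by (simp only: distrib_left)
  qed
  have "grad_form \<Omega> f (?T u) - grad_form (\<Omega> - K) f u = X (1, 0) + X (0, 1)"
  proof -
    \<comment> \<open>Passing to \<Omega> - K leaves fewer test functions and, K being null, the
      same subspace; so the weak derivative of f stays the same.\<close>
    have "DD (\<Omega> - K) b f = DD \<Omega> b f" if "b = (1, 0) \<or> b = (0, 1)" for b
    proof (rule DD_eq[OF \<Omega>' wd_mono[OF H1_wd[OF \<Omega> f(1) that]]])
      show "f \<in> VV (\<Omega> - K)" "DD \<Omega> b f \<in> VV (\<Omega> - K)"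
        using wdD(1,2)[OF H1_wd[OF \<Omega> f(1) that]] unfolding VV_null[OF open_lebesgue[OF \<Omega>] K(2)] .
    qed blast
    then show ?thesis unfolding grad_form_def X_def by simp
  qed
  then have "cmod (grad_form \<Omega> f (?T u) - grad_form (\<Omega> - K) f u) \<le> cmod (X (1, 0)) + cmod (X (0, 1))"
    using norm_triangle_ineq by (simp only:)
  also have "\<dots> \<le> E * (S + ?c * ?a) + E * (S + ?c * ?a)" by (intro add_mono X e12)
  finally show "cmod (grad_form \<Omega> f (?T u) - grad_form (\<Omega> - K) f u) \<le> 2 * E * (S + ?c * ?a)" by simp
qed

section \<open>Assembling the closeness conditions\<close>

lemma linear_between_rep:
  assumes "hilbert_rep H \<iota> ii" "hilbert_rep H' \<iota>' ii" and T: "linear T" "\<And>x. T (ii x) = ii (T x)"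
    and D: "D \<subseteq> hcarrier H" "D' \<subseteq> hcarrier H'" "\<And>x. x \<in> D \<Longrightarrow> T (\<iota> x) \<in> \<iota>' ` D'"
  shows "linear_between H D H' D' (\<lambda>x. hilbert_rep.\<kappa> H' \<iota>' (T (\<iota> x)))"
proof -
  interpret h: hilbert_rep H \<iota> ii by fact
  interpret h': hilbert_rep H' \<iota>' ii by fact
  have ex: "\<exists>y\<in>D'. T (\<iota> x) = \<iota>' y \<and> h'.\<kappa> (T (\<iota> x)) = y" if x: "x \<in> D" for x
  proof -
    from D(3)[OF x] obtain y where "T (\<iota> x) = \<iota>' y" "y \<in> D'" by (rule imageE)
    then show ?thesis using D(2) by auto
  qed
  show ?thesis
    unfolding linear_between_def
  proof (intro conjI ballI allI)
    fix x assume x: "x \<in> D"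
    obtain a where a: "a \<in> D'" "T (\<iota> x) = \<iota>' a" "h'.\<kappa> (T (\<iota> x)) = a" using ex[OF x] by blast
    have ca: "a \<in> hcarrier H'" and cx: "x \<in> hcarrier H" using a(1) x D by auto
    show "h'.\<kappa> (T (\<iota> x)) \<in> D'" using a by simp
    show "h'.\<kappa> (T (\<iota> (hscale H c x))) = hscale H' c (h'.\<kappa> (T (\<iota> x)))" for c
    proof -
      have "T (\<iota> (hscale H c x)) = \<iota>' (hscale H' c a)"
        using ca cx a(2) T(2) by (simp add: h.\<iota>_scale h'.\<iota>_scale linear_add[OF T(1)] linear_cmul[OF T(1)])
      then show ?thesis using a(3) ca by (simp add: h'.scale_closed)
    qed
    fix y assume y: "y \<in> D"
    obtain b where b: "b \<in> D'" "T (\<iota> y) = \<iota>' b" "h'.\<kappa> (T (\<iota> y)) = b" using ex[OF y] by blast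
    have cb: "b \<in> hcarrier H'" and cy: "y \<in> hcarrier H" using b(1) y D by auto
    have "T (\<iota> (hadd H x y)) = \<iota>' (hadd H' a b)"
      using ca cx cb cy a(2) b(2) by (simp add: h.\<iota>_add h'.\<iota>_add linear_add[OF T(1)])
    then show "h'.\<kappa> (T (\<iota> (hadd H x y))) = hadd H' (h'.\<kappa> (T (\<iota> x))) (h'.\<kappa> (T (\<iota> y)))"
      using a(3) b(3) ca cb by (simp add: h'.add_closed)
  qed
qed

text \<open>\<open>emb\<close> maps both carriers onto the same subspace, on which J and J' act as
  the identity, so every condition on J and J' alone holds exactly. Only \<open>small\<close> and
  \<open>form\<close> carry content. In \<open>form\<close>, w is the image of f under the operator,
  and \<open>norm (w + f)\<close> is the norm of order 2.\<close>

lemma delta_close_transfer: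
  fixes T :: "l2 \<Rightarrow> l2"
  assumes \<Omega>: "open \<Omega>" and K: "compact K" "K \<in> null_sets lebesgue" and \<delta>: "0 < \<delta>"
    and T: "linear T" "\<And>x. T (ii x) = ii (T x)" "\<And>u. u \<in> H1 (\<Omega> - K) \<Longrightarrow> T u \<in> H1 \<Omega>"
    and small: "\<And>u S. \<lbrakk>u \<in> H1 (\<Omega> - K); norm u \<le> S; norm (DD (\<Omega> - K) (1, 0) u) \<le> S; norm (DD (\<Omega> - K) (0, 1) u) \<le> S\<rbrakk>
      \<Longrightarrow> norm (u - T u) \<le> \<delta> * S"
    and form: "\<And>f w u S. \<lbrakk>f \<in> H1 \<Omega>; \<And>v. v \<in> H1 \<Omega> \<Longrightarrow> grad_form \<Omega> f v = l2_inner_c w v;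
      u \<in> H1 (\<Omega> - K); norm u \<le> S; norm (DD (\<Omega> - K) (1, 0) u) \<le> S; norm (DD (\<Omega> - K) (0, 1) u) \<le> S\<rbrakk>
      \<Longrightarrow> cmod (grad_form \<Omega> f (T u) - grad_form (\<Omega> - K) f u) \<le> \<delta> * norm (w + f) * S"
  shows "delta_close \<delta> 2 (L2_on \<Omega>) (neumann_laplacian \<Omega>) (L2_on (\<Omega> - K)) (neumann_laplacian (\<Omega> - K))"
proof -
  let ?\<Omega>' = "\<Omega> - K"
  let ?H = "L2_on \<Omega>" and ?H' = "L2_on ?\<Omega>'" and ?D = "sobolev_H1 \<Omega>" and ?D' = "sobolev_H1 ?\<Omega>'"
  have \<Omega>': "open ?\<Omega>'" using \<Omega> K(1) compact_imp_closed open_Diff by blast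
  interpret fr: form_rep ?H "emb \<Omega>" ii ?D "dirichlet_form \<Omega>" by (rule form_rep_sobolev[OF \<Omega>])
  interpret fr': form_rep ?H' "emb ?\<Omega>'" ii ?D' "dirichlet_form ?\<Omega>'" by (rule form_rep_sobolev[OF \<Omega>'])
  note UL = open_lebesgue[OF \<Omega>] and UL' = open_lebesgue[OF \<Omega>']
  have VV: "VV ?\<Omega>' = VV \<Omega>" by (rule VV_null[OF UL K(2)])
  have A: "neumann_laplacian \<Omega> = fr.A" "neumann_laplacian ?\<Omega>' = fr'.A"
    unfolding neumann_laplacian_def fr.A_def fr'.A_def by simp_all
  have ran: "emb \<Omega> ` hcarrier ?H = VV \<Omega>" "emb ?\<Omega>' ` hcarrier ?H' = VV \<Omega>"
    using emb_range[OF UL] emb_range[OF UL'] unfolding VV .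
  have ranD: "emb \<Omega> ` ?D = H1 \<Omega>" "emb ?\<Omega>' ` ?D' = H1 ?\<Omega>'"
    by (rule emb_sobolev[OF \<Omega>], rule emb_sobolev[OF \<Omega>'])
  have V: "fr.V = VV \<Omega>" "fr'.V = VV \<Omega>" unfolding fr.V_def fr'.V_def by (rule ran)+
  have wd': "wd ?\<Omega>' b f g" if "wd \<Omega> b f g" for b f g
    by (rule wd_mono[OF that]) (use wdD(1,2)[OF that] VV in auto)
  have e12: "(1::real, 0::real) = (1, 0) \<or> (1::real, 0::real) = (0, 1)" "(0::real, 1::real) = (1, 0) \<or> (0::real, 1::real) = (0, 1)" by auto
  \<comment> \<open>Removing K enlarges the Sobolev space; therefore J itself can serve as the
    operator between the spaces of order 1.\<close>
  have H1': "f \<in> H1 ?\<Omega>'" if "f \<in> H1 \<Omega>" for f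
    by (rule H1I[OF \<Omega>' wd'[OF H1_wd[OF \<Omega> that e12(1)]] wd'[OF H1_wd[OF \<Omega> that e12(2)]]])
  define J where "J F = fr'.\<kappa> (emb \<Omega> F)" for F
  define J' where "J' u = fr.\<kappa> (emb ?\<Omega>' u)" for u
  define J1' where "J1' u = fr.\<kappa> (T (emb ?\<Omega>' u))" for u
  have inVV: "emb \<Omega> F \<in> VV \<Omega>" if "F \<in> hcarrier ?H" for F using that ran by blast
  have inVV': "emb ?\<Omega>' u \<in> VV \<Omega>" if "u \<in> hcarrier ?H'" for u using that ran by blast
  have inH: "emb ?\<Omega>' u \<in> H1 ?\<Omega>'" if "u \<in> ?D'" for u using that ranD by blast
  have J: "J F \<in> hcarrier ?H'" "emb ?\<Omega>' (J F) = emb \<Omega> F" if "F \<in> hcarrier ?H" for F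
    unfolding J_def using inVV[OF that] V by auto
  have J': "J' u \<in> hcarrier ?H" "emb \<Omega> (J' u) = emb ?\<Omega>' u" if "u \<in> hcarrier ?H'" for u
    unfolding J'_def using inVV'[OF that] V by auto
  have JD: "J F \<in> ?D'" if "F \<in> ?D" for F
    using J[OF fr.D_in[OF that]] H1' ranD(1) that unfolding sobolev_iff[OF \<Omega>'] by auto
  have J1': "J1' u \<in> ?D" "emb \<Omega> (J1' u) = T (emb ?\<Omega>' u)" if "u \<in> ?D'" for u
  proof -
    have "T (emb ?\<Omega>' u) \<in> fr.V" unfolding V(1) by (rule H1_VV[OF \<Omega> T(3)[OF inH[OF that]]])
    then show e: "emb \<Omega> (J1' u) = T (emb ?\<Omega>' u)" and "J1' u \<in> ?D"
      unfolding sobolev_iff[OF \<Omega>] J1'_def using T(3)[OF inH[OF that]] by auto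
  qed
  \<comment> \<open>The squared norm of order 1 is |u|^2 + |grad u|^2, so this norm serves as the
    common bound \<open>S\<close> in the hypotheses.\<close>
  have S: "norm (emb ?\<Omega>' u) \<le> scale_norm ?H' fr'.A 1 u"
    "norm (DD ?\<Omega>' (1, 0) (emb ?\<Omega>' u)) \<le> scale_norm ?H' fr'.A 1 u"
    "norm (DD ?\<Omega>' (0, 1) (emb ?\<Omega>' u)) \<le> scale_norm ?H' fr'.A 1 u" if u: "u \<in> ?D'" for u
  proof -
    have e: "(scale_norm ?H' fr'.A 1 u)\<^sup>2 = (norm (emb ?\<Omega>' u))\<^sup>2
        + ((norm (DD ?\<Omega>' (1, 0) (emb ?\<Omega>' u)))\<^sup>2 + (norm (DD ?\<Omega>' (0, 1) (emb ?\<Omega>' u)))\<^sup>2)"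
      unfolding fr'.scale_norm_1(1)[OF u] fr'.hnorm_eq[OF fr'.D_in[OF u]] dirichlet_form_eq[OF \<Omega>' u u] grad_form_self[OF \<Omega>'] ..
    show "norm (emb ?\<Omega>' u) \<le> scale_norm ?H' fr'.A 1 u"
      "norm (DD ?\<Omega>' (1, 0) (emb ?\<Omega>' u)) \<le> scale_norm ?H' fr'.A 1 u"
      "norm (DD ?\<Omega>' (0, 1) (emb ?\<Omega>' u)) \<le> scale_norm ?H' fr'.A 1 u"
      by (rule power2_le_imp_le[OF _ fr'.scale_norm_1(2)[OF u]], unfold e, simp)+
  qed
  have S1: "0 \<le> \<delta> * scale_norm ?H fr.A 1 f" if "f \<in> ?D" for f
    using fr.scale_norm_1(2)[OF that] \<delta> by simp
  have S1': "0 \<le> \<delta> * scale_norm ?H' fr'.A 1 u" if "u \<in> ?D'" for u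
    using fr'.scale_norm_1(2)[OF that] \<delta> by simp
  have lin: "linear_between ?H (hcarrier ?H) ?H' (hcarrier ?H') J" "linear_between ?H ?D ?H' ?D' J"
    "linear_between ?H' (hcarrier ?H') ?H (hcarrier ?H) J'" "linear_between ?H' ?D' ?H ?D J1'"
  proof -
    note h = fr.hilbert_rep_axioms and h' = fr'.hilbert_rep_axioms
    note id = linear_ident
    show "linear_between ?H (hcarrier ?H) ?H' (hcarrier ?H') J"
      unfolding J_def by (rule linear_between_rep[OF h h' id]) (use inVV ran in auto)
    show "linear_between ?H ?D ?H' ?D' J"
      unfolding J_def by (rule linear_between_rep[OF h h' id]) (use H1' ranD fr.D_in fr'.D_in in auto)
    show "linear_between ?H' (hcarrier ?H') ?H (hcarrier ?H) J'"
      unfolding J'_def by (rule linear_between_rep[OF h' h id]) (use inVV' ran in auto)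
    show "linear_between ?H' ?D' ?H ?D J1'"
      unfolding J1'_def by (rule linear_between_rep[OF h' h T(1,2)]) (use inH T(3) ranD fr.D_in fr'.D_in in auto)
  qed
  show ?thesis
    unfolding delta_close_def A fr.scale_space_1 fr'.scale_space_1 fr.scale_space_2
  proof (intro conjI, rule \<delta>, simp, rule exI[of _ J], rule exI[of _ J], rule exI[of _ J'], rule exI[of _ J1'],
      intro conjI ballI)
    fix f assume f: "f \<in> ?D"
    note c = fr.D_in[OF f]
    show "hnorm ?H' (hdiff ?H' (J f) (J f)) \<le> \<delta> * scale_norm ?H fr.A 1 f"
      using J[OF c] S1[OF f] by (simp add: fr'.hnorm_eq fr'.hdiff_closed fr'.\<iota>_diff del: One_nat_def)
    show "hnorm ?H (hdiff ?H f (J' (J f))) \<le> \<delta> * scale_norm ?H fr.A 1 f"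
      using J[OF c] J'[OF J(1)[OF c]] c S1[OF f] by (simp add: fr.hnorm_eq fr.hdiff_closed fr.\<iota>_diff del: One_nat_def)
  next
    fix f u assume f: "f \<in> hcarrier ?H" and u: "u \<in> hcarrier ?H'"
    show "cmod (hinner ?H' (J f) u - hinner ?H f (J' u)) \<le> \<delta> * hnorm ?H f * hnorm ?H' u"
      using J[OF f] J'[OF u] f u \<delta> by (simp add: fr.hinner_eq fr'.hinner_eq fr.hnorm_eq fr'.hnorm_eq)
  next
    fix u assume u: "u \<in> ?D'"
    note c = fr'.D_in[OF u]
    show "hnorm ?H' (hdiff ?H' u (J (J' u))) \<le> \<delta> * scale_norm ?H' fr'.A 1 u"
      using J'[OF c] J[OF J'(1)[OF c]] c S1'[OF u] by (simp add: fr'.hnorm_eq fr'.hdiff_closed fr'.\<iota>_diff del: One_nat_def)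
    show "hnorm ?H (hdiff ?H (J' u) (J1' u)) \<le> \<delta> * scale_norm ?H' fr'.A 1 u"
      using J'[OF c] J1'[OF u] fr.D_in[OF J1'(1)[OF u]] small[OF inH[OF u] S[OF u]]
      by (simp add: fr.hnorm_eq fr.hdiff_closed fr.\<iota>_diff del: One_nat_def)
  next
    fix f assume f: "f \<in> hcarrier ?H"
    show "hnorm ?H' (J f) \<le> 2 * hnorm ?H f" using J[OF f] f by (simp add: fr.hnorm_eq fr'.hnorm_eq)
  next
    fix u assume u: "u \<in> hcarrier ?H'"
    show "hnorm ?H (J' u) \<le> 2 * hnorm ?H' u" using J'[OF u] u by (simp add: fr.hnorm_eq fr'.hnorm_eq)
  next
    fix f u assume f: "f \<in> Domain fr.A" and u: "u \<in> ?D'"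
    from f obtain w where w: "(f, w) \<in> fr.A" by blast
    then have fD: "f \<in> ?D" and wc: "w \<in> hcarrier ?H"
      and eq: "\<And>v. v \<in> ?D \<Longrightarrow> dirichlet_form \<Omega> f v = hinner ?H w v"
      unfolding fr.A_def form_operator_def by auto
    have fH: "emb \<Omega> f \<in> H1 \<Omega>" using fD ranD(1) by blast
    have eqn: "grad_form \<Omega> (emb \<Omega> f) v = l2_inner_c (emb \<Omega> w) v" if "v \<in> H1 \<Omega>" for v
    proof -
      from that obtain G where G: "G \<in> ?D" "v = emb \<Omega> G" using ranD(1) by blast
      show ?thesis
        using eq[OF G(1)] dirichlet_form_eq[OF \<Omega> fD G(1)] hinner_emb[OF UL wc fr.D_in[OF G(1)]] G(2) by simp
    qed
    have "operator_form ?H fr.A f (J1' u) = grad_form \<Omega> (emb \<Omega> f) (T (emb ?\<Omega>' u))"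
      unfolding fr.operator_form_eq[OF fD J1'(1)[OF u]] dirichlet_form_eq[OF \<Omega> fD J1'(1)[OF u]] J1'(2)[OF u] ..
    moreover have "operator_form ?H' fr'.A (J f) u = grad_form ?\<Omega>' (emb \<Omega> f) (emb ?\<Omega>' u)"
      unfolding fr'.operator_form_eq[OF JD[OF fD] u] dirichlet_form_eq[OF \<Omega>' JD[OF fD] u] J(2)[OF fr.D_in[OF fD]] ..
    moreover have "scale_norm ?H fr.A 2 f = norm (emb \<Omega> w + emb \<Omega> f)"
      using fr.scale_norm_2[OF w] wc fr.D_in[OF fD] by (simp add: fr.hnorm_eq fr.add_closed fr.\<iota>_add)
    ultimately show "cmod (operator_form ?H fr.A f (J1' u) - operator_form ?H' fr'.A (J f) u)
        \<le> \<delta> * scale_norm ?H fr.A 2 f * scale_norm ?H' fr'.A 1 u"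
      using form[OF fH eqn inH[OF u] S[OF u]] by simp
  qed (rule lin)+
qed

theorem theorem3p1:
  fixes \<Omega> :: "(real \<times> real) set" and p :: "real \<times> real" and K :: "real \<Rightarrow> (real \<times> real) set"
  assumes "open \<Omega>" and "connected \<Omega>" and "bounded \<Omega>" and "p \<in> \<Omega>"
    and "\<And>\<epsilon>. \<epsilon> > 0 \<Longrightarrow> ball p \<epsilon> \<subseteq> \<Omega> \<Longrightarrow>
           K \<epsilon> \<subseteq> ball p \<epsilon> \<and> compact (K \<epsilon>) \<and> K \<epsilon> \<in> null_sets lebesgue \<and> property_star \<Omega> (K \<epsilon>)"
  shows "\<exists>C>0. \<exists>\<epsilon>0>0. \<forall>\<epsilon>. 0 < \<epsilon> \<and> \<epsilon> < \<epsilon>0 \<longrightarrow>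
           delta_close (C * \<epsilon> powr (1/6)) 2
             (L2_on \<Omega>) (neumann_laplacian \<Omega>)
             (L2_on (\<Omega> - K \<epsilon>)) (neumann_laplacian (\<Omega> - K \<epsilon>))"
proof -
  obtain R0 C0 where R0: "0 < R0" and C0: "0 < C0"
    and grad: "\<And>r M f f1 f2 w0. \<lbrakk>0 < r; r \<le> 1; r ^ 4 \<le> R0; wd \<Omega> (1, 0) f f1; wd \<Omega> (0, 1) f f2;
      \<And>v v1 v2. wd \<Omega> (1, 0) v v1 \<Longrightarrow> wd \<Omega> (0, 1) v v2 \<Longrightarrow> inner f1 v1 + inner f2 v2 = inner w0 v;
      norm f \<le> M; norm f1 \<le> M; norm f2 \<le> M; norm w0 \<le> M\<rbrakk>
      \<Longrightarrow> norm (cut (square p (r ^ 4)) f1) \<le> C0 * r ^ 3 * M \<and> norm (cut (square p (r ^ 4)) f2) \<le> C0 * r ^ 3 * M"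
    using gradient_decay[OF assms(1,4)] by blast
  obtain e where e: "0 < e" "ball p e \<subseteq> \<Omega>" using assms(1,4) open_contains_ball by blast
  \<comment> \<open>R <= 1 is demanded by the free line estimate; the bound e / 4 keeps the squares
    inside the given ball.\<close>
  define R where "R = min 1 (e / 4)"
  have R: "0 < R" "R \<le> 1" "R \<le> e / 4" using e(1) by (auto simp: R_def)
  have sq: "square p s \<subseteq> \<Omega>" "cbox (p - (s, s)) (p + (s, s)) \<subseteq> \<Omega>" if "s \<le> e / 4" for s
  proof -
    have "cball p (2 * s) \<subseteq> ball p e" using that e(1) by auto
    then show b: "cbox (p - (s, s)) (p + (s, s)) \<subseteq> \<Omega>" using cbox_subset_cball[of p s] e(2) by blast
    then show "square p s \<subseteq> \<Omega>" using box_subset_cbox unfolding box_eq_square[symmetric] by blast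
  qed
  \<comment> \<open>\<open>c1\<close> is the constant in the bound c1 r^2 S for \<eta> u, and
    \<open>c2 / r^4\<close> bounds the partial derivatives of \<eta>.\<close>
  define c1 where "c1 = 4 * sqrt (8 / R)"
  define c2 where "c2 = 4 / bump_total"
  have c: "0 < c1" "0 < c2" unfolding c1_def c2_def using R bump_total_pos by simp_all
  \<comment> \<open>The two summands serve the two hypotheses of the transfer lemma; the outer
    factor 2 pays for r <= 2 \<epsilon>^(1/6).\<close>
  define C where "C = 2 * (c1 + 2 * C0 * (1 + c1 * c2))"
  have "0 < 2 * C0 * (1 + c1 * c2)" using C0 c by (intro mult_pos_pos add_pos_pos) auto
  then have C: "0 < C" "2 * c1 \<le> C" "2 * (2 * C0 * (1 + c1 * c2)) \<le> C" unfolding C_def using c by auto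
  define \<epsilon>0 where "\<epsilon>0 = min (R / 16) (R0 / 2)"
  have e12: "(1::real, 0::real) = (1, 0) \<or> (1::real, 0::real) = (0, 1)" "(0::real, 1::real) = (1, 0) \<or> (0::real, 1::real) = (0, 1)" by auto
  show ?thesis
  proof (rule exI[of _ C], rule conjI[OF C(1)], rule exI[of _ \<epsilon>0], intro conjI allI impI)
    show "0 < \<epsilon>0" unfolding \<epsilon>0_def using R R0 by simp
    fix \<epsilon> assume "0 < \<epsilon> \<and> \<epsilon> < \<epsilon>0"
    then have \<epsilon>: "0 < \<epsilon>" "16 * \<epsilon> \<le> R" "2 * \<epsilon> \<le> R0" unfolding \<epsilon>0_def by auto
    have "\<epsilon> \<le> e" using \<epsilon> R e by linarith
    then have "ball p \<epsilon> \<subseteq> \<Omega>" using e(2) by (meson order_trans subset_ball)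
    from assms(5)[OF \<epsilon>(1) this] have K: "compact (K \<epsilon>)" "K \<epsilon> \<in> null_sets lebesgue" "K \<epsilon> \<subseteq> ball p \<epsilon>"
      "property_star \<Omega> (K \<epsilon>)" by auto
    have supp: "cbox (p - (2 * \<epsilon>, 2 * \<epsilon>)) (p + (2 * \<epsilon>, 2 * \<epsilon>)) \<subseteq> \<Omega>" by (rule sq(2)) (use \<epsilon> R in linarith)
    \<comment> \<open>All small quantities become integer powers of r, and r^4 is the half side of
      the support of the cutoff.\<close>
    define r where "r = root 4 (2 * \<epsilon>)"
    have r: "0 < r" "r ^ 4 = 2 * \<epsilon>" unfolding r_def using \<epsilon>(1) by simp_all
    have r1: "r \<le> 1" unfolding r_def using \<epsilon> R by (intro real_root_le_1_iff[THEN iffD2]) auto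
    have r2: "r\<^sup>2 \<le> r" using r r1 by (simp add: power2_eq_square mult_left_le)
    define d where "d = \<epsilon> powr (1 / 6)"
    have d0: "0 < d" unfolding d_def using \<epsilon>(1) by simp
    \<comment> \<open>The errors are O(r), that is of order \<epsilon>^(1/4), and are weakened here
      to \<epsilon>^(1/6): as \<epsilon> <= 1, (2 d)^4 = 16 \<epsilon>^(2/3) >= 2
      \<epsilon>.\<close>
    have rd: "r \<le> 2 * d"
    proof (rule power_le_imp_le_base[of _ 3])
      have "d ^ 4 = \<epsilon> powr (2 / 3)" unfolding d_def using \<epsilon>(1) by (simp add: powr_power)
      moreover have "\<epsilon> powr 1 \<le> \<epsilon> powr (2 / 3)" by (rule powr_mono') (use \<epsilon> R in auto)
      ultimately show "r ^ Suc 3 \<le> (2 * d) ^ Suc 3" using r(2) \<epsilon>(1) by (simp add: power_mult_distrib)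
    qed (use d0 in simp)
    define \<eta> where "\<eta> = rect (p - (2 * \<epsilon>, 2 * \<epsilon>)) (p + (2 * \<epsilon>, 2 * \<epsilon>)) \<epsilon>"
    have bm: "bm (\<lambda>z. of_real (1 - \<eta> z))"
      unfolding of_real_diff \<eta>_def
      by (intro bm_diff bm_const test_bm[OF test_function_rect[OF \<epsilon>(1) supp]])
    note est = cutoff_estimates[OF assms(1) K(1,2,3,4) \<epsilon>(1,2) R(2) sq(1)[OF R(3)] supp r \<eta>_def]
    show "delta_close (C * \<epsilon> powr (1/6)) 2 (L2_on \<Omega>) (neumann_laplacian \<Omega>) (L2_on (\<Omega> - K \<epsilon>)) (neumann_laplacian (\<Omega> - K \<epsilon>))"
      unfolding d_def[symmetric]
    proof (rule delta_close_transfer[OF assms(1) K(1,2), where T = "mul (\<lambda>z. of_real (1 - \<eta> z))"])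
      show "0 < C * d" using C d0 by simp
      show "linear (mul (\<lambda>z. of_real (1 - \<eta> z)))" by (rule mul_linear[OF bm])
      show "mul (\<lambda>z. of_real (1 - \<eta> z)) (ii x) = ii (mul (\<lambda>z. of_real (1 - \<eta> z)) x)" for x by (rule mul_ii[OF bm])
    next
      fix u assume "u \<in> H1 (\<Omega> - K \<epsilon>)"
      then show "mul (\<lambda>z. of_real (1 - \<eta> z)) u \<in> H1 \<Omega>"
        by (rule est(1)[where S = "norm u + norm (DD (\<Omega> - K \<epsilon>) (1, 0) u) + norm (DD (\<Omega> - K \<epsilon>) (0, 1) u)"]) simp_all
    next
      fix u S assume u: "u \<in> H1 (\<Omega> - K \<epsilon>)" "norm u \<le> S" "norm (DD (\<Omega> - K \<epsilon>) (1, 0) u) \<le> S" "norm (DD (\<Omega> - K \<epsilon>) (0, 1) u) \<le> S"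
      have S0: "0 \<le> S" using u(2) norm_ge_zero order_trans by blast
      have "c1 * r\<^sup>2 \<le> c1 * (2 * d)" using r2 rd c by (intro mult_left_mono) auto
      also have "\<dots> \<le> C * d" using mult_right_mono[OF C(2), of d] d0 by simp
      finally have k1: "c1 * r\<^sup>2 * S \<le> C * d * S" using S0 by (rule mult_right_mono)
      show "norm (u - mul (\<lambda>z. of_real (1 - \<eta> z)) u) \<le> C * d * S"
        using est(2)[OF u] k1 unfolding c1_def by linarith
      fix f w assume f: "f \<in> H1 \<Omega>" and eqn: "\<And>v. v \<in> H1 \<Omega> \<Longrightarrow> grad_form \<Omega> f v = l2_inner_c w v"
      let ?f1 = "DD \<Omega> (1, 0) f" and ?f2 = "DD \<Omega> (0, 1) f" and ?G = "norm (w + f)"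
      have eqn': "inner ?f1 v1 + inner ?f2 v2 = inner w v" if v: "wd \<Omega> (1, 0) v v1" "wd \<Omega> (0, 1) v v2" for v v1 v2
      proof -
        have "grad_form \<Omega> f v = l2_inner_c w v" by (rule eqn[OF H1I[OF assms(1) v]])
        then have "Re (l2_inner_c ?f1 v1 + l2_inner_c ?f2 v2) = Re (l2_inner_c w v)"
          unfolding grad_form_def DD_eq[OF assms(1) v(1)] DD_eq[OF assms(1) v(2)] by simp
        then show ?thesis by (simp add: l2_inner_c_eq)
      qed
      note wf = H1_wd[OF assms(1) f e12(1)] H1_wd[OF assms(1) f e12(2)]
      \<comment> \<open>The equation tested with f itself. The mixed term of |w + f|^2 is then 2
        |grad f|^2 >= 0, so the norm of order 2 dominates f, grad f and w at once.\<close>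
      have wf0: "inner w f = (norm ?f1)\<^sup>2 + (norm ?f2)\<^sup>2" using eqn'[OF wf] by (simp add: power2_norm_eq_inner)
      have G2: "?G\<^sup>2 = (norm w)\<^sup>2 + (norm f)\<^sup>2 + 2 * ((norm ?f1)\<^sup>2 + (norm ?f2)\<^sup>2)"
        unfolding wf0[symmetric] by (simp add: power2_norm_eq_inner inner_add_left inner_add_right inner_commute)
      have G: "norm f \<le> ?G" "norm ?f1 \<le> ?G" "norm ?f2 \<le> ?G" "norm w \<le> ?G"
        by (rule power2_le_imp_le[OF _ norm_ge_zero], unfold G2, simp)+
      have r4: "r ^ 4 \<le> R0" unfolding r(2) by (rule \<epsilon>(3))
      note E = grad[OF r(1) r1 r4 wf eqn' G]
      have r0: "r \<noteq> 0" using r(1) by simp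
      have GS: "0 \<le> ?G * S" using S0 by simp
      \<comment> \<open>Count of powers: r^3 from grad f, times r^2 from u and r^(-4) from the
        gradient of \<eta>, leaves r; the term with \<eta> itself is O(r^3).\<close>
      have "cmod (grad_form \<Omega> f (mul (\<lambda>z. of_real (1 - \<eta> z)) u) - grad_form (\<Omega> - K \<epsilon>) f u)
          \<le> 2 * (C0 * r ^ 3 * ?G) * (S + 4 / (bump_total * r ^ 4) * (4 * sqrt (8 / R) * r\<^sup>2 * S))"
        by (rule est(3)[OF u f conjunct1[OF E] conjunct2[OF E]])
      also have "4 / (bump_total * r ^ 4) * (4 * sqrt (8 / R) * r\<^sup>2 * S) = c1 * c2 / r\<^sup>2 * S"
        unfolding c1_def[symmetric] c2_def using r0 bump_total_pos by (simp add: field_simps eval_nat_numeral)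
      also have "2 * (C0 * r ^ 3 * ?G) * (S + c1 * c2 / r\<^sup>2 * S) = (2 * C0 * (r ^ 3 + c1 * c2 * r)) * (?G * S)"
        using r0 by (simp add: field_simps eval_nat_numeral)
      also have "\<dots> \<le> (C * d) * (?G * S)"
      proof (rule mult_right_mono[OF _ GS])
        have "r ^ 3 = r\<^sup>2 * r" by (simp add: eval_nat_numeral)
        also have "\<dots> \<le> 1 * r" using r2 r1 r by (intro mult_right_mono) auto
        finally have "r ^ 3 + c1 * c2 * r \<le> (1 + c1 * c2) * r" by (simp add: algebra_simps)
        then have "2 * C0 * (r ^ 3 + c1 * c2 * r) \<le> 2 * C0 * ((1 + c1 * c2) * r)" using C0 by (intro mult_left_mono) auto
        also have "\<dots> = 2 * C0 * (1 + c1 * c2) * r" by simp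
        also have "\<dots> \<le> 2 * C0 * (1 + c1 * c2) * (2 * d)" using rd C0 c by (intro mult_left_mono mult_nonneg_nonneg add_nonneg_nonneg) auto
        also have "\<dots> = 2 * (2 * C0 * (1 + c1 * c2)) * d" by simp
        also have "\<dots> \<le> C * d" using C(3) d0 by (intro mult_right_mono) auto
        finally show "2 * C0 * (r ^ 3 + c1 * c2 * r) \<le> C * d" .
      qed
      finally show "cmod (grad_form \<Omega> f (mul (\<lambda>z. of_real (1 - \<eta> z)) u) - grad_form (\<Omega> - K \<epsilon>) f u) \<le> C * d * ?G * S"
        by (simp only: mult.assoc)
    qed
  qed
qed

end
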